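(* Let $\phi$ be a finite Blaschke product of order $n=2$ or $n=3$. Then the multiplication operator $M_\phi$ is reducible on the Dirichlet space $D$ if and only if there exist $\lambda\in\mathbb{D}$ and $a\in\mathbb{C}$ with $|a|=1$ such that $\phi(z)=a\,\varphi_\lambda(z^n)$ for all $z\in\mathbb{D}$ (i.e. $\phi$ is equivalent to $z^n$).
   Context: $\mathbb{D}=\{z\in\mathbb{C}:|z|<1\}$ and $dA$ is normalized Lebesgue area measure on $\mathbb{D}$. The Dirichlet space $D$ is the Hilbert space of holomorphic $f$ on $\mathbb{D}$ with $\int_{\mathbb{D}}|f'|^2dA<\infty$, with norm $\|f\|_D^2=\|f\|_{H^2}^2+\int_{\mathbb{D}}|f'|^2dA=\sum_{n\ge 0}(n+1)|\hat f(n)|^2$, where $\hat f(n)$ is the $n$-th Taylor coefficient and $H^2$ is the Hardy space. For $\lambda\in\mathbb{D}$, $\varphi_\lambda(z)=\frac{\lambda-z}{1-\overline{\lambda}z}$. A finite Blaschke product of order $n\ge1$ is a function $c\,\varphi_{\lambda_1}\cdots\varphi_{\lambda_n}$ with $\lambda_1,\dots,\lambda_n\in\mathbb{D}$ (not necessarily distinct) and $|c|=1$. $M_\phi f=\phi f$ is then a bounded operator on $D$. A closed subspace $\mathcal{M}$ of a Hilbert space is a reducing subspace of an operator $T$ if it is invariant under both $T$ and $T^*$; it is nontrivial if it is neither $\{0\}$ nor the whole space. $T$ is reducible if it has a nontrivial reducing subspace. Two Blaschke products $\phi_1,\phi_2$ are equivalent if $\phi_2=a\,\varphi_\lambda\circ\phi_1$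 for some $\lambda\in\mathbb{D}$, $|a|=1$. *)

theory Defs
  imports "HOL-Complex_Analysis.Complex_Analysis"
begin

abbreviation unit_disc :: "complex set" where
  "unit_disc \<equiv> ball 0 1"

definition taylor_coeff :: "(complex \<Rightarrow> complex) \<Rightarrow> nat \<Rightarrow> complex" where
  "taylor_coeff f n = (deriv ^^ n) f 0 / fact n"

text \<open>
  A holomorphic function on the disc is represented by its extension by zero to the whole plane, so
  that equality of elements of the Dirichlet space is HOL equality.
\<close>

definition dirichlet_space :: "(complex \<Rightarrow> complex) set" where
  "dirichlet_space = {f. f holomorphic_on unit_disc \<and> (\<forall>z. z \<notin> unit_disc \<longrightarrow> f z = 0) \<and>
     set_integrable lborel unit_disc (\<lambda>z. (cmod (deriv f z))\<^sup>2)}"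

text \<open>
  The polarization of the squared norm, i.e. the sum of the inner product of the Hardy space
  (written in Taylor coefficients) and of the Dirichlet integral. The factor \<open>1 / pi\<close> normalizes
  the area measure of the disc.
\<close>

definition dirichlet_inner :: "(complex \<Rightarrow> complex) \<Rightarrow> (complex \<Rightarrow> complex) \<Rightarrow> complex" where
  "dirichlet_inner f g =
     (\<Sum>n. taylor_coeff f n * cnj (taylor_coeff g n)) +
     (LINT z:unit_disc|lborel. deriv f z * cnj (deriv g z)) / complex_of_real pi"

definition dirichlet_norm :: "(complex \<Rightarrow> complex) \<Rightarrow> real" where
  "dirichlet_norm f = sqrt (Re (dirichlet_inner f f))"

definition closed_subspace :: "(complex \<Rightarrow> complex) set \<Rightarrow> bool" where
  "closed_subspace M \<longleftrightarrow>
     M \<subseteq> dirichlet_space \<and> (\<lambda>z. 0) \<in> M \<and>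
     (\<forall>f\<in>M. \<forall>g\<in>M. (\<lambda>z. f z + g z) \<in> M) \<and>
     (\<forall>c. \<forall>f\<in>M. (\<lambda>z. c * f z) \<in> M) \<and>
     (\<forall>F. \<forall>f\<in>dirichlet_space. (\<forall>k::nat. F k \<in> M) \<longrightarrow>
        (\<lambda>k. dirichlet_norm (\<lambda>z. F k z - f z)) \<longlonglongrightarrow> 0 \<longrightarrow> f \<in> M)"

text \<open>
  For a bounded operator on the Dirichlet space the description below has exactly one solution for
  each \<open>g\<close> in the space, by the Riesz representation theorem.
\<close>

definition dirichlet_adjoint ::
  "((complex \<Rightarrow> complex) \<Rightarrow> (complex \<Rightarrow> complex)) \<Rightarrow> (complex \<Rightarrow> complex) \<Rightarrow> (complex \<Rightarrow> complex)" where
  "dirichlet_adjoint T g =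
     (THE h. h \<in> dirichlet_space \<and>
        (\<forall>f\<in>dirichlet_space. dirichlet_inner (T f) g = dirichlet_inner f h))"

definition reducing_subspace ::
  "((complex \<Rightarrow> complex) \<Rightarrow> (complex \<Rightarrow> complex)) \<Rightarrow> (complex \<Rightarrow> complex) set \<Rightarrow> bool" where
  "reducing_subspace T M \<longleftrightarrow>
     closed_subspace M \<and> (\<forall>f\<in>M. T f \<in> M) \<and> (\<forall>f\<in>M. dirichlet_adjoint T f \<in> M)"

definition reducible :: "((complex \<Rightarrow> complex) \<Rightarrow> (complex \<Rightarrow> complex)) \<Rightarrow> bool" where
  "reducible T \<longleftrightarrow>
     (\<exists>M. reducing_subspace T M \<and> M \<noteq> {\<lambda>z. 0} \<and> M \<noteq> dirichlet_space)"

definition mult_op :: "(complex \<Rightarrow> complex) \<Rightarrow> (complex \<Rightarrow> complex) \<Rightarrow> (complex \<Rightarrow> complex)" where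
  "mult_op \<phi> f = (\<lambda>z. \<phi> z * f z)"

definition disc_aut :: "complex \<Rightarrow> complex \<Rightarrow> complex" where
  "disc_aut w z = (w - z) / (1 - cnj w * z)"

text \<open>Only the values on the disc matter; \<open>\<phi>\<close> is arbitrary elsewhere.\<close>

definition finite_blaschke :: "nat \<Rightarrow> (complex \<Rightarrow> complex) \<Rightarrow> bool" where
  "finite_blaschke n \<phi> \<longleftrightarrow> n \<ge> 1 \<and>
     (\<exists>c w. cmod c = 1 \<and> (\<forall>i<n. w i \<in> unit_disc) \<and>
        (\<forall>z\<in>unit_disc. \<phi> z = c * (\<Prod>i<n. disc_aut (w i) z)))"

end

theory Submission
  imports Defs "HOL-Real_Asymp.Real_Asymp" "HOL-Computational_Algebra.Fundamental_Theorem_Algebra"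
begin

text \<open>In Taylor coefficients the inner product is \<open>\<Sum>n. (n + 1) * a n * cnj (b n)\<close>, and
  multiplication by a function holomorphic across the closed disc is bounded. A closed subspace \<open>M\<close>
  is therefore reducing exactly if \<open>M\<close> and its orthogonal complement are both invariant under
  multiplication (\<open>reducing_subspace_iff\<close>).

  If \<open>\<phi>\<close> is a function of \<open>z ^ n\<close>, the functions whose coefficients are supported
  on the multiples of \<open>n\<close> form a nontrivial reducing subspace
  (\<open>reducible_of_lacunary\<close>).

  For the converse, composing \<open>\<phi>\<close> with an automorphism of the disc changes neither its order
  nor its reducing subspaces (\<open>disc_aut_comp_blaschke\<close>, \<open>invariant_disc_aut\<close>), so that
  \<open>\<phi> 0 = 0\<close> may be assumed; it remains to show that all zeros are \<open>0\<close>. The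
  wandering space, the orthogonal complement of \<open>\<phi> D\<close>, has dimension \<open>n\<close>: it is
  spanned by the functions that represent the divided differences at the zeros. It consists of functions
  holomorphic across the closed disc, and it interpolates arbitrary values on each fibre of
  \<open>\<phi>\<close> over the unit circle and at the distinct zeros. A reducing subspace and its complement
  split it into two nonzero parts (\<open>reducing_meets_wander\<close>), and since \<open>n \<le> 3\<close> one
  of the parts is a line (\<open>one_wandering_line\<close>). Let it be spanned by \<open>f0\<close>, and put
  \<open>F z = z * f0 z\<close>.

  On the unit circle the inner product is the integral of \<open>(z f)' * cnj (z g)\<close>
  (\<open>dirichlet_inner_circle\<close>). For \<open>g\<close> in the other part, the relations \<open>\<phi> ^
  k * f0 \<bottom> \<phi> ^ l * g\<close> for all \<open>k\<close> and \<open>l\<close> amount to the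
  orthogonality of both \<open>F\<close> and \<open>dF / d\<phi>\<close> to \<open>z * g\<close> on every fibre
  over the circle (\<open>fibre_orthogonality\<close>). By interpolation \<open>dF / d\<phi>\<close> is then a
  multiple of \<open>F\<close> on each fibre, which forces a power of \<open>F\<close> to be a function of
  \<open>\<phi>\<close> (\<open>power_is_function_of_phi\<close>). With this, the orthogonality of
  \<open>F\<close> and \<open>z * g\<close> on the fibres continues holomorphically from the circle to the fibre
  over \<open>0\<close>, where it contradicts the interpolation property as soon as some zero of
  \<open>\<phi>\<close> is not \<open>0\<close> (\<open>phi_root_zero\<close>).\<close>

section \<open>Square integrals over discs\<close>

text \<open>Identifies the Cartesian plane, where rotations are orthogonal transformations, with the complex one.\<close>

definition r2c :: "real ^ 2 \<Rightarrow> complex" where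
  "r2c x = Complex (x $ 1) (x $ 2)"

lemma r2c_measurable [measurable]: "r2c \<in> borel \<rightarrow>\<^sub>M borel"
proof -
  have "continuous_on UNIV r2c"
    unfolding r2c_def Complex_eq by (intro continuous_intros)
  then show ?thesis by (rule borel_measurable_continuous_onI)
qed

lemma distr_lborel_r2c: "distr lborel borel r2c = lborel"
proof (rule lborel_eqI[symmetric])
  fix l u :: complex
  assume le: "\<And>b. b \<in> Basis \<Longrightarrow> l \<bullet> b \<le> u \<bullet> b"
  define l' u' where "l' = (vector [Re l, Im l] :: real^2)" and "u' = (vector [Re u, Im u] :: real^2)"
  have B2: "(Basis :: (real^2) set) = {axis 1 1, axis 2 1}"
    by (auto simp: Basis_vec_def UNIV_2)
  have ax: "axis (1::2) (1::real) \<noteq> axis 2 1"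
    by (simp add: axis_eq_axis)
  have pre: "r2c -` box l u = box l' u'"
    by (auto simp: r2c_def box_def Basis_complex_def B2 inner_axis l'_def u'_def)
  have Re: "Re l \<le> Re u" and Im: "Im l \<le> Im u"
    using le[of 1] le[of \<i>] by (auto simp: Basis_complex_def)
  have "emeasure (distr lborel borel r2c) (box l u) = emeasure lborel (box l' u')"
    by (simp add: emeasure_distr pre)
  also have "\<dots> = ennreal (\<Prod>b\<in>Basis. (u' - l') \<bullet> b)"
    using Re Im by (subst emeasure_lborel_box) (auto simp: B2 inner_axis l'_def u'_def)
  also have "(\<Prod>b\<in>Basis. (u' - l') \<bullet> b) = (\<Prod>b\<in>Basis. (u - l) \<bullet> b)"
    by (simp add: B2 ax inner_axis l'_def u'_def Basis_complex_def)
  finally show "emeasure (distr lborel borel r2c) (box l u) = (\<Prod>b\<in>Basis. (u - l) \<bullet> b)" .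
qed simp

lemma bij_r2c: "bij r2c"
  by (rule bijI') (auto simp: r2c_def vec_eq_iff forall_2 intro: exI[of _ "vector [Re y, Im y]" for y])

text \<open>In Cartesian coordinates a rotation is an orthogonal transformation, so it does not change the measure of a box.\<close>

lemma distr_lborel_rotation:
  assumes c: "cmod c = 1"
  shows "distr lborel borel (\<lambda>z. c * z) = lborel"
proof (rule lborel_eqI[symmetric])
  fix l u :: complex
  assume le: "\<And>b. b \<in> Basis \<Longrightarrow> l \<bullet> b \<le> u \<bullet> b"
  define T where "T x = inv r2c (cnj c * r2c x)" for x
  have r2cT: "r2c (T x) = cnj c * r2c x" for x
    unfolding T_def by (simp add: bij_is_surj[OF bij_r2c] surj_f_inv_f)
  have T: "T x = vector [Re c * x $ 1 + Im c * x $ 2, Re c * x $ 2 - Im c * x $ 1]" for x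
    using r2cT[of x] by (simp add: r2c_def vec_eq_iff forall_2 complex_eq_iff)
  have cc: "c * cnj c = 1"
    using c by (simp add: complex_norm_square[symmetric])
  have n: "(Re c)\<^sup>2 + (Im c)\<^sup>2 = 1"
    using c by (simp add: cmod_def)
  have linT: "linear T"
    by (rule linearI) (auto simp: T vec_eq_iff forall_2 algebra_simps)
  have orthT: "orthogonal_transformation T"
    unfolding orthogonal_transformation
  proof (intro conjI allI linT)
    fix v
    have "(norm (T v))\<^sup>2 = (norm v)\<^sup>2"
      unfolding power2_norm_eq_inner inner_vec_def
      using n by (simp add: sum_2 T power2_eq_square[symmetric]) algebra
    then show "norm (T v) = norm v"
      by (metis norm_ge_zero power2_eq_iff_nonneg)
  qed
  let ?S = "r2c -` (box l u)"
  have Sb: "?S \<in> sets borel" by (metis borel_open measurable_sets_borel open_box r2c_measurable)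
  have emS: "emeasure lborel ?S = (\<Prod>b\<in>Basis. (u - l) \<bullet> b)"
  proof -
    have "emeasure lborel ?S = emeasure (distr lborel borel r2c) (box l u)"
      by (simp add: emeasure_distr)
    then show ?thesis using le by (simp add: distr_lborel_r2c emeasure_lborel_box)
  qed
  have Slm: "?S \<in> lmeasurable"
    using Sb emS by (intro fmeasurableI) auto
  have pre: "r2c -` ((\<lambda>z. c * z) -` box l u) = T ` ?S"
  proof (intro equalityI subsetI)
    fix x assume x: "x \<in> r2c -` ((\<lambda>z. c * z) -` box l u)"
    define y where "y = inv r2c (c * r2c x)"
    have ry: "r2c y = c * r2c x"
      unfolding y_def by (simp add: bij_is_surj[OF bij_r2c] surj_f_inv_f)
    have "r2c (T y) = r2c x"
      using cc by (simp add: r2cT ry mult.assoc[symmetric] mult.commute)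
    then have "x = T y" using bij_r2c by (metis bij_def injD)
    moreover have "y \<in> ?S" using x ry by simp
    ultimately show "x \<in> T ` ?S" by blast
  next
    fix x assume "x \<in> T ` ?S"
    then show "x \<in> r2c -` ((\<lambda>z. c * z) -` box l u)"
      using cc by (auto simp: r2cT mult.assoc[symmetric])
  qed
  have rot_meas [measurable]: "(\<lambda>z. c * z) \<in> borel \<rightarrow>\<^sub>M borel" by measurable
  have mb: "(\<lambda>z. c * z) -` box l u \<in> sets borel"
    using measurable_sets_borel[OF rot_meas, of "box l u"] by simp
  have pb: "r2c -` ((\<lambda>z. c * z) -` box l u) \<in> sets borel"
    using measurable_sets_borel[OF r2c_measurable mb] by simp
  have "emeasure (distr lborel borel (\<lambda>z. c * z)) (box l u) = emeasure lborel ((\<lambda>z. c * z) -` box l u)"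
    by (simp add: emeasure_distr)
  also have "\<dots> = emeasure (distr lborel borel r2c) ((\<lambda>z. c * z) -` box l u)"
    by (simp add: distr_lborel_r2c)
  also have "\<dots> = emeasure lborel (T ` ?S)"
    using mb by (simp add: emeasure_distr pre)
  also have "\<dots> = emeasure lebesgue (T ` ?S)"
    using pb pre by simp
  also have "\<dots> = ennreal (measure lebesgue (T ` ?S))"
    using measurable_orthogonal_image[OF orthT Slm] by (simp add: emeasure_eq_measure2 fmeasurableD2)
  also have "\<dots> = ennreal (measure lebesgue ?S)"
    by (simp add: measure_orthogonal_image[OF orthT Slm])
  also have "\<dots> = emeasure lebesgue ?S"
    using Slm by (simp add: emeasure_eq_measure2 fmeasurableD2)
  also have "\<dots> = (\<Prod>b\<in>Basis. (u - l) \<bullet> b)"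
    using Sb emS by simp
  finally show "emeasure (distr lborel borel (\<lambda>z. c * z)) (box l u) = (\<Prod>b\<in>Basis. (u - l) \<bullet> b)" .
qed simp

lemma disc_integral_rotation:
  fixes f :: "complex \<Rightarrow> complex"
  assumes c: "cmod c = 1" and [measurable]: "f \<in> borel_measurable borel"
  shows "(LINT z:ball 0 r|lborel. f (c * z)) = (LINT z:ball 0 r|lborel. f z)"
proof -
  have "(LINT z:ball 0 r|lborel. f z) = integral\<^sup>L (distr lborel borel (\<lambda>z. c * z)) (\<lambda>z. indicator (ball 0 r) z *\<^sub>R f z)"
    by (simp add: distr_lborel_rotation[OF c] set_lebesgue_integral_def)
  also have "\<dots> = (LINT z|lborel. indicator (ball 0 r) (c * z) *\<^sub>R f (c * z))"
    by (subst integral_distr) (auto intro!: borel_measurable_scaleR borel_measurable_indicator)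
  also have "\<dots> = (LINT z:ball 0 r|lborel. f (c * z))"
    unfolding set_lebesgue_integral_def using c
    by (intro Bochner_Integration.integral_cong) (auto simp: indicator_def norm_mult)
  finally show ?thesis by simp
qed

text \<open>Rotate by an angle that turns \<open>z ^ j * cnj (z ^ k)\<close> into its negative.\<close>

lemma disc_integral_monomials_orthogonal:
  assumes "j \<noteq> k"
  shows "(LINT z:ball 0 r|lborel. z ^ j * cnj (z ^ k)) = 0"
proof -
  define c where "c = cis (pi / (real j - real k))"
  have c: "cmod c = 1" by (simp add: c_def)
  have "c ^ j * cnj (c ^ k) = cis (pi * real j / (real j - real k) - pi * real k / (real j - real k))"
  proof -
    define t where "t = pi / (real j - real k)"
    have "c ^ j = cis (real j * t)" "cnj (c ^ k) = cis (- (real k * t))"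
      by (simp_all only: c_def t_def[symmetric] Complex.DeMoivre cis_cnj)
    then show ?thesis by (simp only: cis_mult) (simp add: t_def mult.commute)
  qed
  also have "pi * real j / (real j - real k) - pi * real k / (real j - real k) = pi"
    using assms by (simp add: diff_divide_distrib[symmetric] right_diff_distrib[symmetric])
  finally have cjk: "c ^ j * cnj (c ^ k) = -1" by simp
  have "(LINT z:ball 0 r|lborel. z ^ j * cnj (z ^ k)) = (LINT z:ball 0 r|lborel. (c * z) ^ j * cnj ((c * z) ^ k))"
    by (rule disc_integral_rotation[OF c, symmetric])
       (auto intro!: borel_measurable_continuous_onI continuous_intros)
  also have "\<dots> = (LINT z:ball 0 r|lborel. (-1) * (z ^ j * cnj (z ^ k)))"
    unfolding cjk[symmetric] by (simp add: power_mult_distrib mult_ac)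
  also have "\<dots> = - (LINT z:ball 0 r|lborel. z ^ j * cnj (z ^ k))"
    by (subst set_integral_mult_right) simp
  finally show ?thesis by simp
qed

text \<open>This replaces polar coordinates: the disc of radius \<open>t\<close> has area \<open>pi * t\<^sup>2\<close>, so
  under area measure the squared modulus is uniformly distributed.\<close>

lemma distr_disc_norm_square:
  assumes "r > 0"
  shows "distr (density lborel (indicator (ball (0::complex) r))) borel (\<lambda>z. (cmod z)\<^sup>2) =
         density lborel (\<lambda>s. ennreal pi * indicator {0..r\<^sup>2} s)"
proof (rule measure_eqI_lessThan)
  fix x :: real
  have eb: "emeasure lborel (ball (0::complex) t) = ennreal (pi * t\<^sup>2)"
    and ecb: "emeasure lborel (cball (0::complex) t) = ennreal (pi * t\<^sup>2)" if "0 \<le> t" for t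
    using that by (simp_all add: emeasure_ball emeasure_cball unit_ball_vol_2)
  have area: "emeasure lborel {z. cmod z < r \<and> x < (cmod z)\<^sup>2} = ennreal (pi * (max 0 (r\<^sup>2 - max 0 x)))"
  proof (cases "x < 0")
    case True
    then have "{z. cmod z < r \<and> x < (cmod z)\<^sup>2} = ball 0 r"
      by (auto intro: less_le_trans[of x 0])
    then show ?thesis using True assms by (simp add: eb)
  next
    case False
    define q where "q = min r (sqrt x)"
    have q: "0 \<le> q" "q \<le> r" using False assms by (auto simp: q_def)
    have eq: "{z::complex. cmod z < r \<and> x < (cmod z)\<^sup>2} = ball 0 r - cball 0 q"
    proof -
      have iff: "x < (cmod z)\<^sup>2 \<longleftrightarrow> sqrt x < cmod z" for z
        using False by (metis abs_norm_cancel real_sqrt_abs real_sqrt_less_iff)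
      show ?thesis
        unfolding iff by (rule set_eqI) (simp add: q_def not_le min_less_iff_disj, linarith)
    qed
    have "emeasure lborel (ball (0::complex) r - cball 0 q) = emeasure lborel (ball (0::complex) r) - emeasure lborel (cball (0::complex) q)"
    proof (cases "q = r")
      case True
      then have "ball (0::complex) r - cball 0 q = {}" by auto
      then show ?thesis using True assms by (simp only: eb ecb less_imp_le) simp
    next
      case F: False
      show ?thesis
      proof (rule emeasure_Diff)
        show "emeasure lborel (cball (0::complex) q) \<noteq> \<infinity>" using q by (simp only: ecb) simp
        show "cball (0::complex) q \<subseteq> ball 0 r" using F q by (simp add: cball_subset_ball_iff)
      qed auto
    qed
    also have "\<dots> = ennreal (pi * r\<^sup>2 - pi * q\<^sup>2)"
      using q assms by (simp only: eb ecb less_imp_le) (simp add: ennreal_minus)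
    also have "pi * r\<^sup>2 - pi * q\<^sup>2 = pi * (max 0 (r\<^sup>2 - max 0 x))"
    proof (cases "sqrt x \<le> r")
      case True
      then have "q\<^sup>2 = x" using False by (simp add: q_def)
      moreover have "x \<le> r\<^sup>2" using True by (simp add: sqrt_le_D)
      ultimately show ?thesis using False by (simp add: algebra_simps)
    next
      case F: False
      then have "r\<^sup>2 \<le> x" using assms power_strict_mono[of r "sqrt x" 2] False by simp
      then show ?thesis using F False by (simp add: q_def)
    qed
    finally show ?thesis by (simp add: eq)
  qed
  have ibm: "indicator (ball (0::complex) r) \<in> borel_measurable lborel"
    by (intro borel_measurable_indicator) simp
  have sb: "ball (0::complex) r \<inter> {z. x < (cmod z)\<^sup>2} \<in> sets borel" "{z::complex. x < (cmod z)\<^sup>2} \<in> sets lborel"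
    "{z::complex. x < (cmod z)\<^sup>2} \<in> sets borel"
    by (auto intro!: sets.Int borel_open open_Collect_less continuous_intros)
  have "emeasure (distr (density lborel (indicator (ball (0::complex) r))) borel (\<lambda>z. (cmod z)\<^sup>2)) {x<..}
     = emeasure (density lborel (indicator (ball (0::complex) r))) {z. x < (cmod z)\<^sup>2}"
    by (subst emeasure_distr) (simp_all add: vimage_def)
  also have "\<dots> = emeasure lborel (ball 0 r \<inter> {z::complex. x < (cmod z)\<^sup>2})"
    by (subst emeasure_density) (simp_all only: indicator_inter_arith[symmetric] nn_integral_indicator' ibm sb, simp_all add: sb nn_integral_indicator)
  also have "ball 0 r \<inter> {z::complex. x < (cmod z)\<^sup>2} = {z. cmod z < r \<and> x < (cmod z)\<^sup>2}" by auto
  also note area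
  finally have 1: "emeasure (distr (density lborel (indicator (ball (0::complex) r))) borel (\<lambda>z. (cmod z)\<^sup>2)) {x<..}
    = ennreal (pi * (max 0 (r\<^sup>2 - max 0 x)))" .
  then show "emeasure (distr (density lborel (indicator (ball (0::complex) r))) borel (\<lambda>z. (cmod z)\<^sup>2)) {x<..} < \<infinity>"
    by simp
  have "emeasure (density lborel (\<lambda>s. ennreal pi * indicator {0..r\<^sup>2} s)) {x<..} = 
     ennreal pi * emeasure lborel ({0..r\<^sup>2} \<inter> {x<..})"
  proof -
    have "emeasure (density lborel (\<lambda>s. ennreal pi * indicator {0..r\<^sup>2} s)) {x<..} =
      (\<integral>\<^sup>+s. ennreal pi * indicator ({0..r\<^sup>2} \<inter> {x<..}) s \<partial>lborel)"
      by (subst emeasure_density) (simp_all add: mult.assoc indicator_inter_arith)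
    then show ?thesis by (subst (asm) nn_integral_cmult) simp_all
  qed
  also have "emeasure lborel ({0..r\<^sup>2} \<inter> {x<..}) = ennreal (max 0 (r\<^sup>2 - max 0 x))"
  proof (cases "x < 0")
    case True
    then have "{0..r\<^sup>2} \<inter> {x<..} = {0..r\<^sup>2}" by auto
    then show ?thesis using True by simp
  next
    case False
    then have "{0..r\<^sup>2} \<inter> {x<..} = {x<..r\<^sup>2}" by auto
    then show ?thesis using False by (cases "x \<le> r\<^sup>2") auto
  qed
  finally show "emeasure (distr (density lborel (indicator (ball (0::complex) r))) borel (\<lambda>z. (cmod z)\<^sup>2)) {x<..} 
    = emeasure (density lborel (\<lambda>s. ennreal pi * indicator {0..r\<^sup>2} s)) {x<..}"
    unfolding 1 by (simp add: ennreal_mult')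
qed auto

lemma nn_integral_disc_monomial:
  assumes "r > 0"
  shows "(\<integral>\<^sup>+z\<in>ball (0::complex) r. ennreal ((cmod z) ^ (2 * k)) \<partial>lborel) = ennreal (pi * r ^ (2 * k + 2) / (real k + 1))"
proof -
  have "(\<integral>\<^sup>+z\<in>ball (0::complex) r. ennreal ((cmod z) ^ (2 * k)) \<partial>lborel) =
    (\<integral>\<^sup>+z. ennreal (((cmod z)\<^sup>2) ^ k) \<partial>density lborel (indicator (ball (0::complex) r)))"
    by (subst nn_integral_density)
       (auto simp: mult.commute power_mult[symmetric] simp del: power_mult intro!: borel_measurable_indicator)
  also have "\<dots> = (\<integral>\<^sup>+s. ennreal (s ^ k) \<partial>distr (density lborel (indicator (ball (0::complex) r))) borel (\<lambda>z. (cmod z)\<^sup>2))"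
    by (subst nn_integral_distr) auto
  also have "\<dots> = (\<integral>\<^sup>+s. ennreal pi * (ennreal (s ^ k) * indicator {0..r\<^sup>2} s) \<partial>lborel)"
    unfolding distr_disc_norm_square[OF assms] by (subst nn_integral_density) (auto simp: mult_ac)
  also have "\<dots> = ennreal pi * (\<integral>\<^sup>+s. ennreal (s ^ k) * indicator {0..r\<^sup>2} s \<partial>lborel)"
    by (subst nn_integral_cmult) auto
  also have "(\<integral>\<^sup>+s. ennreal (s ^ k) * indicator {0..r\<^sup>2} s \<partial>lborel) = ennreal ((r\<^sup>2) ^ Suc k / (real k + 1) - 0 ^ Suc k / (real k + 1))"
    by (rule nn_integral_FTC_Icc)
       (auto intro!: derivative_eq_intros simp: add.commute simp del: power_Suc)
  finally show ?thesis
    by (simp add: ennreal_mult'[symmetric] power_mult[symmetric] power_add field_simps power2_eq_square mult_2 mult_2_right)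
qed

lemma set_integrable_disc_continuous:
  fixes f :: "complex \<Rightarrow> 'b::{banach, second_countable_topology}"
  assumes "continuous_on (cball 0 r) f"
  shows "set_integrable lborel (ball 0 r) f"
proof (rule set_integrable_subset)
  show "set_integrable lborel (cball 0 r) f"
    unfolding set_integrable_def using borel_integrable_compact[OF compact_cball assms] by simp
qed auto

lemma disc_continuous_measurable:
  fixes f :: "complex \<Rightarrow> 'b::{banach, second_countable_topology}"
  assumes "continuous_on (cball 0 r) f"
  shows "(\<lambda>z. indicat_real (ball 0 r) z *\<^sub>R f z) \<in> borel_measurable lborel"
  using set_integrable_disc_continuous[OF assms] unfolding set_integrable_def
  by (rule borel_measurable_integrable)

lemma disc_integral_monomial_square:
  assumes "r > 0"
  shows "(LINT z:ball (0::complex) r|lborel. (cmod z) ^ (2 * k)) = pi * r ^ (2 * k + 2) / (real k + 1)"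
proof -
  have "(LINT z:ball (0::complex) r|lborel. (cmod z) ^ (2 * k)) =
     enn2real (\<integral>\<^sup>+z\<in>ball (0::complex) r. ennreal ((cmod z) ^ (2 * k)) \<partial>lborel)"
    unfolding set_lebesgue_integral_def
  proof (subst integral_eq_nn_integral)
    show "(\<lambda>z::complex. indicator (ball 0 r) z *\<^sub>R cmod z ^ (2 * k)) \<in> borel_measurable lborel"
      by (intro disc_continuous_measurable continuous_intros)
    show "enn2real (\<integral>\<^sup>+ x. ennreal (indicat_real (ball 0 r) x *\<^sub>R cmod x ^ (2 * k)) \<partial>lborel) =
      enn2real (\<integral>\<^sup>+z\<in>ball (0::complex) r. ennreal ((cmod z) ^ (2 * k)) \<partial>lborel)"
      by (intro arg_cong[of _ _ enn2real] nn_integral_cong) (simp add: indicator_def)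
  qed auto
  then show ?thesis
    using assms by (simp only: nn_integral_disc_monomial) (simp add: enn2real_ennreal)
qed

lemma disc_integral_polynomial_square:
  assumes "r > 0"
  shows "(LINT z:ball (0::complex) r|lborel. (cmod (\<Sum>k<N. b k * z ^ k))\<^sup>2) =
    (\<Sum>k<N. pi * (cmod (b k))\<^sup>2 * r ^ (2 * k + 2) / (real k + 1))"
proof -
  have int: "set_integrable lborel (ball 0 r) (\<lambda>z. z ^ j * cnj (z ^ k))" for j k
    by (intro set_integrable_disc_continuous continuous_intros)
  have diag: "(LINT z:ball (0::complex) r|lborel. z ^ k * cnj (z ^ k)) = complex_of_real (pi * r ^ (2 * k + 2) / (real k + 1))" for k
  proof -
    have "z ^ k * cnj (z ^ k) = complex_of_real (cmod z ^ (2 * k))" for z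
      by (simp only: complex_norm_square[symmetric] norm_power power_mult[symmetric] mult.commute[of k])
    then show ?thesis
      using disc_integral_monomial_square[OF assms, of k] by (simp only: set_integral_complex_of_real)
  qed
  have "complex_of_real (LINT z:ball (0::complex) r|lborel. (cmod (\<Sum>k<N. b k * z ^ k))\<^sup>2) =
    (LINT z:ball (0::complex) r|lborel. (\<Sum>k<N. b k * z ^ k) * cnj (\<Sum>k<N. b k * z ^ k))"
    by (simp only: complex_norm_square[symmetric] set_integral_complex_of_real)
  also have "\<dots> = (LINT z:ball (0::complex) r|lborel. (\<Sum>j<N. \<Sum>k<N. (b j * cnj (b k)) * (z ^ j * cnj (z ^ k))))"
    by (intro set_lebesgue_integral_cong) (auto simp: sum_product mult_ac)
  also have "\<dots> = (\<Sum>j<N. \<Sum>k<N. (b j * cnj (b k)) * (LINT z:ball (0::complex) r|lborel. z ^ j * cnj (z ^ k)))"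
    using int by (simp add: set_lebesgue_integral_def scaleR_sum_right set_integrable_def Bochner_Integration.integral_sum
       mult_scaleR_right[symmetric] del: mult_scaleR_right complex_cnj_power)
  also have "\<dots> = (\<Sum>j<N. \<Sum>k<N. if k = j then (b j * cnj (b j)) * complex_of_real (pi * r ^ (2 * j + 2) / (real j + 1)) else 0)"
    by (intro sum.cong refl) (simp add: diag disc_integral_monomials_orthogonal del: complex_cnj_power)
  also have "\<dots> = (\<Sum>j<N. complex_of_real (pi * (cmod (b j))\<^sup>2 * r ^ (2 * j + 2) / (real j + 1)))"
  proof (rule sum.cong[OF refl])
    fix j
    have "b j * cnj (b j) = complex_of_real ((cmod (b j))\<^sup>2)" by (simp only: complex_norm_square)
    then show "(\<Sum>k<N. if k = j then (b j * cnj (b j)) * complex_of_real (pi * r ^ (2 * j + 2) / (real j + 1)) else 0) =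
       complex_of_real (pi * (cmod (b j))\<^sup>2 * r ^ (2 * j + 2) / (real j + 1))" if "j \<in> {..<N}"
      using that by (simp only: sum.delta finite_lessThan if_True of_real_mult[symmetric]) (simp add: mult_ac)
  qed
  finally show ?thesis
    unfolding of_real_sum[symmetric] of_real_eq_iff .
qed

text \<open>On a smaller disc the Taylor polynomials are uniformly bounded, so the identity for polynomials passes to the
  limit by dominated convergence.\<close>

lemma disc_integral_holomorphic_square_inner:
  assumes h: "h holomorphic_on ball 0 1" and r: "0 < r" "r < 1"
  defines "b \<equiv> \<lambda>k. (deriv ^^ k) h 0 / fact k"
  shows "(\<lambda>k. pi * (cmod (b k))\<^sup>2 * r ^ (2 * k + 2) / (real k + 1)) sums
     (LINT z:ball 0 r|lborel. (cmod (h z))\<^sup>2)"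
proof -
  have ser: "(\<lambda>k. b k * z ^ k) sums h z" if "cmod z < 1" for z
    using holomorphic_power_series[OF h, of z] that by (simp add: b_def)
  have "summable (\<lambda>k. b k * of_real r ^ k)"
    using ser[of "of_real r"] r by (auto simp: sums_iff)
  have abssum: "summable (\<lambda>k. cmod (b k) * r ^ k)"
  proof -
    obtain r' where r': "r < r'" "r' < 1" using r dense by blast
    have "summable (\<lambda>k. b k * of_real r' ^ k)"
      using ser[of "of_real r'"] r r' by (auto simp: sums_iff)
    from powser_insidea[OF this, of "of_real r"] r r' show ?thesis
      by (simp add: norm_mult norm_power)
  qed
  define C where "C = (\<Sum>k. cmod (b k) * r ^ k)"
  have bound: "cmod (\<Sum>k<N. b k * z ^ k) \<le> C" if "cmod z < r" for N z
  proof -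
    have "cmod (\<Sum>k<N. b k * z ^ k) \<le> (\<Sum>k<N. cmod (b k) * r ^ k)"
      using that by (intro sum_norm_le) (auto simp: norm_mult norm_power intro!: mult_left_mono power_mono)
    also have "\<dots> \<le> C" unfolding C_def using r by (intro sum_le_suminf abssum) auto
    finally show ?thesis .
  qed
  have hm: "(\<lambda>z. indicat_real (ball 0 r) z *\<^sub>R (cmod (h z))\<^sup>2) \<in> borel_measurable lborel"
  proof -
    have "continuous_on (cball 0 r) (\<lambda>z. (cmod (h z))\<^sup>2)"
      using r by (intro continuous_intros holomorphic_on_imp_continuous_on holomorphic_on_subset[OF h]) auto
    then show ?thesis by (rule disc_continuous_measurable)
  qed
  have "(\<lambda>N. LINT z:ball 0 r|lborel. (cmod (\<Sum>k<N. b k * z ^ k))\<^sup>2) \<longlonglongrightarrow> (LINT z:ball 0 r|lborel. (cmod (h z))\<^sup>2)"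
    unfolding set_lebesgue_integral_def
  proof (rule integral_dominated_convergence[where w = "\<lambda>z. indicat_real (ball 0 r) z *\<^sub>R C\<^sup>2"])
    show "integrable lborel (\<lambda>z::complex. indicat_real (ball 0 r) z *\<^sub>R C\<^sup>2)"
      using set_integrable_disc_continuous[of r "\<lambda>_. C\<^sup>2"] by (simp add: set_integrable_def)
    show "(\<lambda>z. indicat_real (ball 0 r) z *\<^sub>R (cmod (\<Sum>k<N. b k * z ^ k))\<^sup>2) \<in> borel_measurable lborel" for N
      by (intro disc_continuous_measurable continuous_intros)
    show "AE z in lborel. (\<lambda>N. indicat_real (ball 0 r) z *\<^sub>R (cmod (\<Sum>k<N. b k * z ^ k))\<^sup>2)
        \<longlonglongrightarrow> indicat_real (ball 0 r) z *\<^sub>R (cmod (h z))\<^sup>2"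
    proof (rule AE_I2)
      fix z :: complex
      show "(\<lambda>N. indicat_real (ball 0 r) z *\<^sub>R (cmod (\<Sum>k<N. b k * z ^ k))\<^sup>2)
        \<longlonglongrightarrow> indicat_real (ball 0 r) z *\<^sub>R (cmod (h z))\<^sup>2"
        using ser[of z] r by (cases "z \<in> ball 0 r") (auto simp: sums_def intro!: tendsto_intros)
    qed
    show "AE z in lborel. norm (indicat_real (ball 0 r) z *\<^sub>R (cmod (\<Sum>k<N. b k * z ^ k))\<^sup>2)
        \<le> indicat_real (ball 0 r) z *\<^sub>R C\<^sup>2" for N
      by (rule AE_I2) (auto simp: indicator_def intro!: power_mono bound)
  qed (rule hm)
  then show ?thesis
    unfolding sums_def disc_integral_polynomial_square[OF r(1)] .
qed

text \<open>Exhaust the disc by smaller ones. Both sides increase with the radius, so monotone convergence needs no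
  integrability.\<close>

lemma nn_integral_disc_holomorphic_square:
  assumes h: "h holomorphic_on ball 0 1"
  defines "b \<equiv> \<lambda>k. (deriv ^^ k) h 0 / fact k"
  shows "(\<integral>\<^sup>+z\<in>ball 0 1. ennreal ((cmod (h z))\<^sup>2) \<partial>lborel) = (\<Sum>k. ennreal (pi * (cmod (b k))\<^sup>2 / (real k + 1)))"
    (is "?X = _")
proof -
  define r where "r m = 1 - 1 / (real m + 2)" for m
  have r: "0 < r m" "r m < 1" for m by (auto simp: r_def field_simps)
  have rlim: "r \<longlonglongrightarrow> 1" unfolding r_def by real_asymp
  have rmono: "r m \<le> r m'" if "m \<le> m'" for m m' using that by (auto simp: r_def field_simps)
  let ?I = "\<lambda>m. \<integral>\<^sup>+z\<in>ball 0 (r m). ennreal ((cmod (h z))\<^sup>2) \<partial>lborel"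
  let ?c = "\<lambda>k. pi * (cmod (b k))\<^sup>2 / (real k + 1)"
  have cont: "continuous_on (cball 0 (r m)) (\<lambda>z. (cmod (h z))\<^sup>2)" for m
    using r[of m] by (intro continuous_intros holomorphic_on_imp_continuous_on holomorphic_on_subset[OF h]) auto
  have I: "?I m = (\<Sum>k. ennreal (?c k * r m ^ (2 * k + 2)))" for m
  proof -
    have "(\<lambda>k. ?c k * r m ^ (2 * k + 2)) sums (LINT z:ball 0 (r m)|lborel. (cmod (h z))\<^sup>2)"
      using disc_integral_holomorphic_square_inner[OF h r[of m]] by (simp add: b_def)
    moreover have "?I m = ennreal (LINT z:ball 0 (r m)|lborel. (cmod (h z))\<^sup>2)"
    proof -
      have "?I m = (\<integral>\<^sup>+z. ennreal (indicat_real (ball 0 (r m)) z *\<^sub>R (cmod (h z))\<^sup>2) \<partial>lborel)"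
        by (intro nn_integral_cong) (simp add: indicator_def)
      also have "\<dots> = ennreal (LINT z:ball 0 (r m)|lborel. (cmod (h z))\<^sup>2)"
        unfolding set_lebesgue_integral_def
        using set_integrable_disc_continuous[OF cont, of m]
        by (intro nn_integral_eq_integral) (auto simp: set_integrable_def)
      finally show ?thesis .
    qed
    ultimately show ?thesis
      using r[of m] by (subst suminf_ennreal2) (auto simp: sums_iff less_imp_le)
  qed
  have X: "?X = (SUP m. ?I m)"
  proof -
    have "?X = (\<integral>\<^sup>+z. (SUP m. ennreal (indicat_real (ball 0 (r m)) z *\<^sub>R (cmod (h z))\<^sup>2)) \<partial>lborel)"
    proof (rule nn_integral_cong)
      fix z :: complex
      show "ennreal ((cmod (h z))\<^sup>2) * indicator (ball 0 1) z = (SUP m. ennreal (indicat_real (ball 0 (r m)) z *\<^sub>R (cmod (h z))\<^sup>2))"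
      proof (cases "cmod z < 1")
        case True
        then have "eventually (\<lambda>m. cmod z < r m) sequentially"
          using rlim order_tendstoD(1) by blast
        then obtain m where m: "cmod z < r m" by (auto simp: eventually_sequentially)
        show ?thesis
        proof (rule antisym)
          show "ennreal ((cmod (h z))\<^sup>2) * indicator (ball 0 1) z \<le> (SUP m. ennreal (indicat_real (ball 0 (r m)) z *\<^sub>R (cmod (h z))\<^sup>2))"
            using True m by (intro SUP_upper2[of m]) auto
          show "(SUP m. ennreal (indicat_real (ball 0 (r m)) z *\<^sub>R (cmod (h z))\<^sup>2)) \<le> ennreal ((cmod (h z))\<^sup>2) * indicator (ball 0 1) z"
            using True by (intro SUP_least) (auto simp: indicator_def)
        qed
      next
        case False
        then have "\<not> cmod z < r m" for m using r[of m] by linarith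
        then show ?thesis using False by simp
      qed
    qed
    also have "\<dots> = (SUP m. \<integral>\<^sup>+z. ennreal (indicat_real (ball 0 (r m)) z *\<^sub>R (cmod (h z))\<^sup>2) \<partial>lborel)"
    proof (rule nn_integral_monotone_convergence_SUP)
      show "incseq (\<lambda>m z. ennreal (indicat_real (ball 0 (r m)) z *\<^sub>R (cmod (h z))\<^sup>2))"
      proof (intro incseq_SucI le_funI ennreal_leI)
        fix m and z :: complex
        have "r m \<le> r (Suc m)" by (rule rmono) simp
        then show "indicat_real (ball 0 (r m)) z *\<^sub>R (cmod (h z))\<^sup>2 \<le> indicat_real (ball 0 (r (Suc m))) z *\<^sub>R (cmod (h z))\<^sup>2"
          by (simp add: indicator_def)
      qed
      show "(\<lambda>z. ennreal (indicat_real (ball 0 (r m)) z *\<^sub>R (cmod (h z))\<^sup>2)) \<in> borel_measurable lborel" for m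
        by (intro measurable_compose[OF disc_continuous_measurable[OF cont]] measurable_ennreal)
    qed
    also have "\<dots> = (SUP m. ?I m)"
      by (intro SUP_cong refl nn_integral_cong) (simp add: indicator_def)
    finally show ?thesis .
  qed
  show ?thesis
  proof (rule antisym)
    show "?X \<le> (\<Sum>k. ennreal (?c k))"
      unfolding X I
    proof (intro SUP_least suminf_le)
      fix m k
      have "r m ^ (2 * k + 2) \<le> 1" using r[of m] by (intro power_le_one) auto
      then show "ennreal (?c k * r m ^ (2 * k + 2)) \<le> ennreal (?c k)"
        by (intro ennreal_leI mult_left_le) auto
    qed auto
    show "(\<Sum>k. ennreal (?c k)) \<le> ?X"
    proof (rule suminf_le_const)
      fix N
      have L: "(\<lambda>m. \<Sum>k<N. ennreal (?c k * r m ^ (2 * k + 2))) \<longlonglongrightarrow> (\<Sum>k<N. ennreal (?c k * 1 ^ (2 * k + 2)))"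
        by (intro tendsto_intros tendsto_ennrealI rlim)
      have B: "(\<Sum>k<N. ennreal (?c k * r m ^ (2 * k + 2))) \<le> ?X" for m
      proof -
        have "(\<Sum>k<N. ennreal (?c k * r m ^ (2 * k + 2))) \<le> ?I m" unfolding I by (intro sum_le_suminf) auto
        also have "\<dots> \<le> ?X" unfolding X by (rule SUP_upper) simp
        finally show ?thesis .
      qed
      have "(\<Sum>k<N. ennreal (?c k * 1 ^ (2 * k + 2))) \<le> ?X"
        by (rule LIMSEQ_le_const2[OF L]) (use B in blast)
      then show "(\<Sum>k<N. ennreal (?c k)) \<le> ?X" by (simp only: power_one mult_1_right)
    qed auto
  qed
qed

lemma disc_square_integrable_iff:
  assumes h: "h holomorphic_on ball 0 1"
  defines "b \<equiv> \<lambda>k. (deriv ^^ k) h 0 / fact k"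
  shows "set_integrable lborel (ball 0 1) (\<lambda>z. (cmod (h z))\<^sup>2) \<longleftrightarrow> summable (\<lambda>k. (cmod (b k))\<^sup>2 / (real k + 1))" (is ?A)
    and "summable (\<lambda>k. (cmod (b k))\<^sup>2 / (real k + 1)) \<Longrightarrow>
      (LINT z:ball 0 1|lborel. (cmod (h z))\<^sup>2) / pi = (\<Sum>k. (cmod (b k))\<^sup>2 / (real k + 1))" (is "?S \<Longrightarrow> ?B")
proof -
  let ?c = "\<lambda>k. (cmod (b k))\<^sup>2 / (real k + 1)"
  have meas: "(\<lambda>z. indicat_real (ball 0 1) z *\<^sub>R (cmod (h z))\<^sup>2) \<in> borel_measurable lborel"
  proof -
    have "continuous_on (ball 0 1) (\<lambda>z. (cmod (h z))\<^sup>2)"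
      by (intro continuous_intros holomorphic_on_imp_continuous_on h)
    from borel_measurable_continuous_on_indicator[OF _ this] show ?thesis by simp
  qed
  have X: "(\<integral>\<^sup>+z. ennreal (indicat_real (ball 0 1) z *\<^sub>R (cmod (h z))\<^sup>2) \<partial>lborel) = (\<Sum>k. ennreal (pi * ?c k))"
  proof -
    have "(\<integral>\<^sup>+z. ennreal (indicat_real (ball 0 1) z *\<^sub>R (cmod (h z))\<^sup>2) \<partial>lborel) =
      (\<integral>\<^sup>+z\<in>ball 0 1. ennreal ((cmod (h z))\<^sup>2) \<partial>lborel)"
      by (intro nn_integral_cong) (simp add: indicator_def)
    then show ?thesis
      by (simp only: nn_integral_disc_holomorphic_square[OF h] b_def times_divide_eq_right)
  qed
  show ?A
  proof
    assume "set_integrable lborel (ball 0 1) (\<lambda>z. (cmod (h z))\<^sup>2)"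
    then have "(\<integral>\<^sup>+z. ennreal (indicat_real (ball 0 1) z *\<^sub>R (cmod (h z))\<^sup>2) \<partial>lborel) < \<infinity>"
      unfolding set_integrable_def by (subst nn_integral_eq_integral) auto
    then have "summable (\<lambda>k. pi * ?c k)"
      unfolding X by (intro summable_suminf_not_top) auto
    then show ?S using summable_mult[of "\<lambda>k. pi * ?c k" "1 / pi"] by simp
  next
    assume S: ?S
    have "(\<integral>\<^sup>+z. ennreal (indicat_real (ball 0 1) z *\<^sub>R (cmod (h z))\<^sup>2) \<partial>lborel) < \<infinity>"
      unfolding X using summable_mult[OF S, of pi] by (subst suminf_ennreal2) auto
    then show "set_integrable lborel (ball 0 1) (\<lambda>z. (cmod (h z))\<^sup>2)"
      unfolding set_integrable_def using meas by (intro integrableI_bounded) (auto simp: indicator_def)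
  qed
  assume S: ?S
  have "(LINT z:ball 0 1|lborel. (cmod (h z))\<^sup>2) = enn2real (\<Sum>k. ennreal (pi * ?c k))"
    unfolding set_lebesgue_integral_def X[symmetric] using meas
    by (intro integral_eq_nn_integral) auto
  also have "\<dots> = (\<Sum>k. pi * ?c k)"
  proof -
    have "0 \<le> (\<Sum>k. pi * ?c k)"
      using summable_mult[OF S, of pi] by (intro suminf_nonneg) auto
    then show ?thesis
      using summable_mult[OF S, of pi] by (subst suminf_ennreal2) auto
  qed
  also have "\<dots> = pi * (\<Sum>k. ?c k)" by (rule suminf_mult[OF S])
  finally show ?B by simp
qed

section \<open>The Dirichlet space in Taylor coefficients\<close>

lemma power_series_taylor_coeff:
  assumes R: "R > 0" and ser: "\<And>z. cmod z < R \<Longrightarrow> (\<lambda>n. a n * z ^ n) sums f z"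
  shows "f holomorphic_on ball 0 R" "taylor_coeff f n = a n"
proof -
  show "f holomorphic_on ball 0 R"
    by (rule power_series_holomorphic[of 0 R a]) (use ser in auto)
  have "conv_radius a \<ge> norm (complex_of_real (R / 2))"
    by (rule conv_radius_geI) (use ser[of "of_real (R / 2)"] R in \<open>auto simp: sums_iff\<close>)
  then have "fps_conv_radius (Abs_fps a) > 0"
    unfolding fps_conv_radius_def using R by (auto simp: Abs_fps_inverse intro: less_le_trans[of _ "ereal (R / 2)"])
  moreover have "eventually (\<lambda>z. eval_fps (Abs_fps a) z = f z) (nhds 0)"
  proof -
    have "eventually (\<lambda>z. z \<in> ball (0::complex) R) (nhds 0)"
      using R by (intro eventually_nhds_in_open) auto
    then show ?thesis
      by eventually_elim (use ser in \<open>auto simp: eval_fps_def sums_iff\<close>)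
  qed
  ultimately have "f has_fps_expansion Abs_fps a"
    by (simp add: has_fps_expansion_def)
  from fps_nth_fps_expansion[OF this, of n] show "taylor_coeff f n = a n"
    by (simp add: taylor_coeff_def)
qed

lemma taylor_series:
  assumes "f holomorphic_on ball 0 R" "cmod z < R"
  shows "(\<lambda>n. taylor_coeff f n * z ^ n) sums f z"
  using holomorphic_power_series[OF assms(1), of z] assms(2) by (simp add: taylor_coeff_def)

lemma taylor_coeff_add:
  assumes "f holomorphic_on ball 0 R" "g holomorphic_on ball 0 R" "R > 0"
  shows "taylor_coeff (\<lambda>z. f z + g z) n = taylor_coeff f n + taylor_coeff g n"
  using higher_deriv_add[OF assms(1,2), of 0 n] assms(3) by (simp add: taylor_coeff_def add_divide_distrib)

lemma taylor_coeff_cmult: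
  assumes "f holomorphic_on ball 0 R" "R > 0"
  shows "taylor_coeff (\<lambda>z. c * f z) n = c * taylor_coeff f n"
  using higher_deriv_cmult[OF assms(1), of 0 n c] assms(2) by (simp add: taylor_coeff_def)

lemma taylor_coeff_deriv: "(deriv ^^ k) (deriv f) 0 / fact k = (of_nat k + 1) * taylor_coeff f (Suc k)"
proof -
  have 1: "fact (Suc k) = (of_nat k + 1) * (fact k :: complex)" by (simp add: algebra_simps)
  have 2: "(of_nat k + 1 :: complex) \<noteq> 0"
    using of_nat_neq_0[where ?'a = complex, of k] by (simp add: add.commute)
  show ?thesis
    using 2 by (simp only: taylor_coeff_def funpow_Suc_right o_apply 1) simp
qed

lemma taylor_coeff_0: "taylor_coeff f 0 = f 0"
  by (simp add: taylor_coeff_def)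

lemma taylor_coeff_cong:
  assumes "R > 0" "f holomorphic_on ball 0 R" "\<And>z. cmod z < R \<Longrightarrow> f z = g z"
  shows "taylor_coeff f n = taylor_coeff g n"
proof -
  have "(\<lambda>n. taylor_coeff f n * z ^ n) sums g z" if "cmod z < R" for z
    using taylor_series[OF assms(2) that] assms(3)[OF that] by simp
  from power_series_taylor_coeff(2)[OF assms(1) this] show ?thesis by simp
qed

text \<open>The coefficients of \<open>f'\<close> are \<open>(k + 1) * a (k + 1)\<close>, and the area integral divides
  their squares by \<open>k + 1\<close>.\<close>

lemma dirichlet_integral_summable_iff:
  assumes f: "f holomorphic_on ball 0 1"
  shows "set_integrable lborel (ball 0 1) (\<lambda>z. (cmod (deriv f z))\<^sup>2) \<longleftrightarrow>
      summable (\<lambda>n. real n * (cmod (taylor_coeff f n))\<^sup>2)"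
    and "summable (\<lambda>n. real n * (cmod (taylor_coeff f n))\<^sup>2) \<Longrightarrow>
      (\<lambda>n. real n * (cmod (taylor_coeff f n))\<^sup>2) sums ((LINT z:ball 0 1|lborel. (cmod (deriv f z))\<^sup>2) / pi)"
proof -
  have d: "deriv f holomorphic_on ball 0 1" using f by (intro holomorphic_intros) auto
  have e: "(cmod ((deriv ^^ k) (deriv f) 0 / fact k))\<^sup>2 / (real k + 1) = real (Suc k) * (cmod (taylor_coeff f (Suc k)))\<^sup>2" for k
  proof -
    have "(cmod ((deriv ^^ k) (deriv f) 0 / fact k))\<^sup>2 = (real k + 1)\<^sup>2 * (cmod (taylor_coeff f (Suc k)))\<^sup>2"
      unfolding taylor_coeff_deriv norm_mult power_mult_distrib
      by (metis norm_of_nat of_nat_Suc add.commute of_nat_1 of_nat_add)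
    then show ?thesis by (simp add: power2_eq_square field_simps)
  qed
  note * = disc_square_integrable_iff[OF d, unfolded e]
  show "set_integrable lborel (ball 0 1) (\<lambda>z. (cmod (deriv f z))\<^sup>2) \<longleftrightarrow>
      summable (\<lambda>n. real n * (cmod (taylor_coeff f n))\<^sup>2)"
    using *(1) summable_Suc_iff[of "\<lambda>n. real n * (cmod (taylor_coeff f n))\<^sup>2"] by simp
  assume S: "summable (\<lambda>n. real n * (cmod (taylor_coeff f n))\<^sup>2)"
  then have S': "summable (\<lambda>k. real (Suc k) * (cmod (taylor_coeff f (Suc k)))\<^sup>2)"
    using summable_Suc_iff[of "\<lambda>n. real n * (cmod (taylor_coeff f n))\<^sup>2"] by simp
  have "(\<lambda>k. real (Suc k) * (cmod (taylor_coeff f (Suc k)))\<^sup>2) sums ((LINT z:ball 0 1|lborel. (cmod (deriv f z))\<^sup>2) / pi)"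
    unfolding *(2)[OF S'] by (rule summable_sums[OF S'])
  then show "(\<lambda>n. real n * (cmod (taylor_coeff f n))\<^sup>2) sums ((LINT z:ball 0 1|lborel. (cmod (deriv f z))\<^sup>2) / pi)"
    by (subst (asm) sums_Suc_iff) simp
qed

lemma dirichlet_spaceD:
  assumes "f \<in> dirichlet_space"
  shows "f holomorphic_on ball 0 1" "\<And>z. \<not> cmod z < 1 \<Longrightarrow> f z = 0"
    "set_integrable lborel (ball 0 1) (\<lambda>z. (cmod (deriv f z))\<^sup>2)"
    "summable (\<lambda>n. real n * (cmod (taylor_coeff f n))\<^sup>2)"
    "summable (\<lambda>n. (real n + 1) * (cmod (taylor_coeff f n))\<^sup>2)"
    "summable (\<lambda>n. (cmod (taylor_coeff f n))\<^sup>2)"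
proof -
  show 1: "f holomorphic_on ball 0 1" "\<And>z. \<not> cmod z < 1 \<Longrightarrow> f z = 0"
    "set_integrable lborel (ball 0 1) (\<lambda>z. (cmod (deriv f z))\<^sup>2)"
    using assms by (auto simp: dirichlet_space_def)
  show 2: "summable (\<lambda>n. real n * (cmod (taylor_coeff f n))\<^sup>2)"
    using dirichlet_integral_summable_iff(1)[OF 1(1)] 1(3) by simp
  have "summable (\<lambda>n. (cmod (taylor_coeff f (Suc n)))\<^sup>2)"
  proof (rule summable_comparison_test_ev[OF _ 2[THEN summable_Suc_iff[THEN iffD2]]])
    show "\<forall>\<^sub>F n in sequentially. norm ((cmod (taylor_coeff f (Suc n)))\<^sup>2) \<le> real (Suc n) * (cmod (taylor_coeff f (Suc n)))\<^sup>2"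
      by (auto intro!: always_eventually mult_le_cancel_right1[THEN iffD2])
  qed
  then show 3: "summable (\<lambda>n. (cmod (taylor_coeff f n))\<^sup>2)" by (simp add: summable_Suc_iff[of "\<lambda>n. (cmod (taylor_coeff f n))\<^sup>2"])
  show "summable (\<lambda>n. (real n + 1) * (cmod (taylor_coeff f n))\<^sup>2)"
    using summable_add[OF 2 3] by (simp add: algebra_simps)
qed

lemma dirichlet_spaceI:
  assumes "f holomorphic_on ball 0 1" "\<And>z. \<not> cmod z < 1 \<Longrightarrow> f z = 0"
    "summable (\<lambda>n. (real n + 1) * (cmod (taylor_coeff f n))\<^sup>2)"
  shows "f \<in> dirichlet_space"
proof -
  have "summable (\<lambda>n. real n * (cmod (taylor_coeff f n))\<^sup>2)"
    by (rule summable_comparison_test[OF _ assms(3)]) (auto intro!: exI[of _ 0] mult_right_mono)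
  then show ?thesis
    using dirichlet_integral_summable_iff(1)[OF assms(1)] assms(1,2) by (auto simp: dirichlet_space_def)
qed

lemma norm_add_square_le: "(cmod (x + y))\<^sup>2 \<le> 2 * (cmod x)\<^sup>2 + 2 * (cmod y)\<^sup>2"
proof -
  have "(cmod (x + y))\<^sup>2 \<le> (cmod x + cmod y)\<^sup>2" by (intro power_mono norm_triangle_ineq) auto
  also have "\<dots> \<le> 2 * (cmod x)\<^sup>2 + 2 * (cmod y)\<^sup>2"
    using zero_le_power2[of "cmod x - cmod y"] by (simp add: power2_eq_square algebra_simps)
  finally show ?thesis .
qed

lemma dirichlet_space_add:
  assumes f: "f \<in> dirichlet_space" and g: "g \<in> dirichlet_space"
  shows "(\<lambda>z. f z + g z) \<in> dirichlet_space"
proof (rule dirichlet_spaceI)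
  note F = dirichlet_spaceD[OF f] and G = dirichlet_spaceD[OF g]
  show "(\<lambda>z. f z + g z) holomorphic_on ball 0 1" by (intro holomorphic_intros F G)
  show "f z + g z = 0" if "\<not> cmod z < 1" for z using F(2)[OF that] G(2)[OF that] by simp
  have "summable (\<lambda>n. 2 * ((real n + 1) * (cmod (taylor_coeff f n))\<^sup>2) + 2 * ((real n + 1) * (cmod (taylor_coeff g n))\<^sup>2))"
    by (intro summable_add summable_mult F G)
  then show "summable (\<lambda>n. (real n + 1) * (cmod (taylor_coeff (\<lambda>z. f z + g z) n))\<^sup>2)"
  proof (rule summable_comparison_test_ev[rotated], intro always_eventually allI)
    fix n
    have "(real n + 1) * (cmod (taylor_coeff f n + taylor_coeff g n))\<^sup>2 \<le> (real n + 1) * (2 * (cmod (taylor_coeff f n))\<^sup>2 + 2 * (cmod (taylor_coeff g n))\<^sup>2)"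
      by (intro mult_left_mono norm_add_square_le) auto
    then show "norm ((real n + 1) * (cmod (taylor_coeff (\<lambda>z. f z + g z) n))\<^sup>2)
      \<le> 2 * ((real n + 1) * (cmod (taylor_coeff f n))\<^sup>2) + 2 * ((real n + 1) * (cmod (taylor_coeff g n))\<^sup>2)"
      by (simp add: taylor_coeff_add[OF F(1) G(1)] algebra_simps)
  qed
qed

lemma dirichlet_space_cmult:
  assumes f: "f \<in> dirichlet_space"
  shows "(\<lambda>z. c * f z) \<in> dirichlet_space"
proof (rule dirichlet_spaceI)
  note F = dirichlet_spaceD[OF f]
  show "(\<lambda>z. c * f z) holomorphic_on ball 0 1" by (intro holomorphic_intros F)
  show "c * f z = 0" if "\<not> cmod z < 1" for z using F(2)[OF that] by simp
  show "summable (\<lambda>n. (real n + 1) * (cmod (taylor_coeff (\<lambda>z. c * f z) n))\<^sup>2)"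
    using summable_mult[OF F(5), of "(cmod c)\<^sup>2"]
    by (simp add: taylor_coeff_cmult[OF F(1)] norm_mult power_mult_distrib mult_ac)
qed

lemma dirichlet_space_diff:
  assumes "f \<in> dirichlet_space" "g \<in> dirichlet_space"
  shows "(\<lambda>z. f z - g z) \<in> dirichlet_space"
  using dirichlet_space_add[OF assms(1) dirichlet_space_cmult[OF assms(2), of "-1"]] by simp

lemma taylor_coeff_diff:
  assumes "f holomorphic_on ball 0 R" "g holomorphic_on ball 0 R" "R > 0"
  shows "taylor_coeff (\<lambda>z. f z - g z) n = taylor_coeff f n - taylor_coeff g n"
  using higher_deriv_diff[OF assms(1,2), of 0 n] assms(3) by (simp add: taylor_coeff_def diff_divide_distrib)

lemma dirichlet_space_zero [simp]: "(\<lambda>z. 0) \<in> dirichlet_space"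
proof (rule dirichlet_spaceI)
  have "taylor_coeff (\<lambda>z. 0) n = 0" for n
    by (rule power_series_taylor_coeff(2)[of 1]) auto
  then show "summable (\<lambda>n. (real n + 1) * (cmod (taylor_coeff (\<lambda>z. 0) n))\<^sup>2)" by simp
qed auto

lemma complex_polarization:
  "x * cnj y = (\<Sum>u\<in>{1, -1, \<i>, -\<i>}. u * of_real ((cmod (x + u * y))\<^sup>2)) / 4"
proof -
  have "{1, -1, \<i>, -\<i>} = (set [1, -1, \<i>, -\<i>] :: complex set)" by simp
  have d: "1 \<noteq> \<i>" "1 \<noteq> - \<i>" "-1 \<noteq> \<i>" "-1 \<noteq> - \<i>" "(1::complex) \<noteq> -1" "\<i> \<noteq> - \<i>"
    by (auto simp: complex_eq_iff)
  have "(\<Sum>u\<in>{1, -1, \<i>, -\<i>}. u * of_real ((cmod (x + u * y))\<^sup>2)) =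
     of_real ((cmod (x + y))\<^sup>2) - of_real ((cmod (x - y))\<^sup>2) + \<i> * of_real ((cmod (x + \<i> * y))\<^sup>2) - \<i> * of_real ((cmod (x - \<i> * y))\<^sup>2)"
    using d by simp
  also have "\<dots> = 4 * (x * cnj y)"
    by (simp only: complex_norm_square) (simp add: algebra_simps)
  finally show ?thesis by simp
qed

text \<open>The Dirichlet integral is known in coefficients for squares only; polarization carries it over to the
  sesquilinear form.\<close>

lemma dirichlet_inner_sums:
  assumes f: "f \<in> dirichlet_space" and g: "g \<in> dirichlet_space"
  shows "(\<lambda>n. (of_nat n + 1) * taylor_coeff f n * cnj (taylor_coeff g n)) sums dirichlet_inner f g"
proof -
  note F = dirichlet_spaceD[OF f] and G = dirichlet_spaceD[OF g]
  define U where "U = {1, -1, \<i>, -\<i>}"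
  define h where "h u = (\<lambda>z. f z + u * g z)" for u
  have h: "h u \<in> dirichlet_space" for u
    unfolding h_def by (intro dirichlet_space_add dirichlet_space_cmult f g)
  note H = dirichlet_spaceD[OF h]
  have tc: "taylor_coeff (h u) n = taylor_coeff f n + u * taylor_coeff g n" for u n
    unfolding h_def using F(1) G(1) by (subst taylor_coeff_add) (auto intro!: holomorphic_intros simp: taylor_coeff_cmult)
  have dh: "deriv (h u) z = deriv f z + u * deriv g z" if "cmod z < 1" for u z
  proof -
    have "(f has_field_derivative deriv f z) (at z)" "(g has_field_derivative deriv g z) (at z)"
      using that F(1) G(1) by (auto intro: holomorphic_derivI)
    then have "(h u has_field_derivative (deriv f z + u * deriv g z)) (at z)"
      unfolding h_def by (auto intro!: derivative_eq_intros)
    then show ?thesis by (rule DERIV_imp_deriv)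
  qed
  have 1: "(LINT z:ball 0 1|lborel. deriv f z * cnj (deriv g z)) = 
      (\<Sum>u\<in>U. u * of_real (LINT z:ball 0 1|lborel. (cmod (deriv (h u) z))\<^sup>2)) / 4"
  proof -
    have "(LINT z:ball 0 1|lborel. deriv f z * cnj (deriv g z)) =
      (LINT z:ball 0 1|lborel. (\<Sum>u\<in>U. (u / 4) * of_real ((cmod (deriv (h u) z))\<^sup>2)))"
      by (intro set_lebesgue_integral_cong) 
         (simp_all add: dh complex_polarization[of "deriv f _"] U_def[symmetric] sum_divide_distrib)
    also have "\<dots> = (\<Sum>u\<in>U. LINT z:ball 0 1|lborel. (u / 4) * of_real ((cmod (deriv (h u) z))\<^sup>2))"
      unfolding set_lebesgue_integral_def scaleR_sum_right
    proof (rule Bochner_Integration.integral_sum)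
      fix u
      have "complex_integrable lborel (\<lambda>z. (u / 4) * complex_of_real (indicat_real (ball 0 1) z *\<^sub>R (cmod (deriv (h u) z))\<^sup>2))"
        using H(3)[of u] by (intro integrable_mult_right integrable_of_real) (simp add: set_integrable_def)
      then show "complex_integrable lborel (\<lambda>z. indicat_real (ball 0 1) z *\<^sub>R (u / 4 * complex_of_real ((cmod (deriv (h u) z))\<^sup>2)))"
        by (simp add: scaleR_conv_of_real mult_ac)
    qed
    also have "\<dots> = (\<Sum>u\<in>U. (u / 4) * of_real (LINT z:ball 0 1|lborel. (cmod (deriv (h u) z))\<^sup>2))"
      by (simp add: set_integral_complex_of_real del: of_real_power)
    finally show ?thesis by (simp add: sum_divide_distrib)
  qed
  have "(\<lambda>n. (\<Sum>u\<in>U. u * complex_of_real (real n * (cmod (taylor_coeff (h u) n))\<^sup>2)) / 4) sums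
     ((\<Sum>u\<in>U. u * of_real ((LINT z:ball 0 1|lborel. (cmod (deriv (h u) z))\<^sup>2) / pi)) / 4)"
    by (intro sums_divide sums_sum sums_mult sums_of_real dirichlet_integral_summable_iff(2) H)
  moreover have "(\<Sum>u\<in>U. u * complex_of_real (real n * (cmod (taylor_coeff (h u) n))\<^sup>2)) / 4 = of_nat n * taylor_coeff f n * cnj (taylor_coeff g n)" for n
    unfolding tc mult.assoc complex_polarization[of "taylor_coeff f n"] U_def[symmetric]
    by (simp add: sum_distrib_left mult_ac sum_divide_distrib)
  moreover have "(\<Sum>u\<in>U. u * of_real ((LINT z:ball 0 1|lborel. (cmod (deriv (h u) z))\<^sup>2) / pi)) / 4 =
     (LINT z:ball 0 1|lborel. deriv f z * cnj (deriv g z)) / complex_of_real pi"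
    unfolding 1 by (simp add: sum_divide_distrib mult.commute)
  ultimately have A: "(\<lambda>n. of_nat n * taylor_coeff f n * cnj (taylor_coeff g n)) sums
     ((LINT z:ball 0 1|lborel. deriv f z * cnj (deriv g z)) / complex_of_real pi)" by simp
  have "summable (\<lambda>n. taylor_coeff f n * cnj (taylor_coeff g n))"
  proof (rule summable_comparison_test_ev[OF _ summable_add[OF F(6) G(6)]], intro always_eventually allI)
    fix n
    show "norm (taylor_coeff f n * cnj (taylor_coeff g n)) \<le> (cmod (taylor_coeff f n))\<^sup>2 + (cmod (taylor_coeff g n))\<^sup>2"
      using sum_squares_bound[of "cmod (taylor_coeff f n)" "cmod (taylor_coeff g n)"]
        mult_nonneg_nonneg[OF norm_ge_zero[of "taylor_coeff f n"] norm_ge_zero[of "taylor_coeff g n"]]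
      unfolding norm_mult complex_mod_cnj by linarith
  qed
  from sums_add[OF summable_sums[OF this] A] show ?thesis
    unfolding dirichlet_inner_def by (simp add: algebra_simps)
qed

abbreviation ip :: "(complex \<Rightarrow> complex) \<Rightarrow> (complex \<Rightarrow> complex) \<Rightarrow> complex" where
  "ip \<equiv> dirichlet_inner"

lemma dirichlet_inner_add_left:
  assumes "f \<in> dirichlet_space" "g \<in> dirichlet_space" "h \<in> dirichlet_space"
  shows "ip (\<lambda>z. f z + g z) h = ip f h + ip g h"
  using dirichlet_inner_sums[OF dirichlet_space_add[OF assms(1,2)] assms(3)]
    sums_add[OF dirichlet_inner_sums[OF assms(1,3)] dirichlet_inner_sums[OF assms(2,3)]]
    taylor_coeff_add[OF dirichlet_spaceD(1)[OF assms(1)] dirichlet_spaceD(1)[OF assms(2)]]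
  by (simp add: ring_distribs sums_unique2)

lemma dirichlet_inner_cmult_left:
  assumes "f \<in> dirichlet_space" "h \<in> dirichlet_space"
  shows "ip (\<lambda>z. c * f z) h = c * ip f h"
  using dirichlet_inner_sums[OF dirichlet_space_cmult[OF assms(1)] assms(2), of c]
    sums_mult[OF dirichlet_inner_sums[OF assms(1,2)], of c]
    taylor_coeff_cmult[OF dirichlet_spaceD(1)[OF assms(1)], of c]
  by (simp add: mult_ac sums_unique2)

lemma dirichlet_inner_cnj:
  assumes "f \<in> dirichlet_space" "h \<in> dirichlet_space"
  shows "ip h f = cnj (ip f h)"
  using dirichlet_inner_sums[OF assms(2,1)]
    sums_cnj[THEN iffD2, OF dirichlet_inner_sums[OF assms(1,2)]]
  by (simp add: mult_ac sums_unique2)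

lemma dirichlet_inner_diff_left:
  assumes "f \<in> dirichlet_space" "g \<in> dirichlet_space" "h \<in> dirichlet_space"
  shows "ip (\<lambda>z. f z - g z) h = ip f h - ip g h"
  using dirichlet_inner_add_left[OF assms(1) dirichlet_space_cmult[OF assms(2), of "-1"] assms(3)]
    dirichlet_inner_cmult_left[OF assms(2,3), of "-1"] by simp

lemma dirichlet_inner_add_right:
  assumes "f \<in> dirichlet_space" "g \<in> dirichlet_space" "h \<in> dirichlet_space"
  shows "ip h (\<lambda>z. f z + g z) = ip h f + ip h g"
  using assms by (simp add: dirichlet_inner_cnj[of _ h] dirichlet_inner_add_left dirichlet_space_add)

lemma dirichlet_inner_cmult_right:
  assumes "f \<in> dirichlet_space" "h \<in> dirichlet_space"
  shows "ip h (\<lambda>z. c * f z) = cnj c * ip h f"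
  using assms by (simp add: dirichlet_inner_cnj[of _ h] dirichlet_inner_cmult_left dirichlet_space_cmult)

lemma dirichlet_inner_diff_right:
  assumes "f \<in> dirichlet_space" "g \<in> dirichlet_space" "h \<in> dirichlet_space"
  shows "ip h (\<lambda>z. f z - g z) = ip h f - ip h g"
  using assms by (simp add: dirichlet_inner_cnj[of _ h] dirichlet_inner_diff_left dirichlet_space_diff)

lemma dirichlet_norm_sums:
  assumes "f \<in> dirichlet_space"
  shows "(\<lambda>n. (real n + 1) * (cmod (taylor_coeff f n))\<^sup>2) sums (dirichlet_norm f)\<^sup>2"
    and dirichlet_inner_self: "ip f f = complex_of_real ((dirichlet_norm f)\<^sup>2)"
proof -
  define s where "s = (\<Sum>n. (real n + 1) * (cmod (taylor_coeff f n))\<^sup>2)"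
  note S = summable_sums[OF dirichlet_spaceD(5)[OF assms], folded s_def]
  have 1: "(\<lambda>n. complex_of_real ((real n + 1) * (cmod (taylor_coeff f n))\<^sup>2)) sums of_real s"
    by (intro sums_of_real S)
  have 2: "complex_of_real ((real n + 1) * (cmod (taylor_coeff f n))\<^sup>2) = (of_nat n + 1) * taylor_coeff f n * cnj (taylor_coeff f n)" for n
    by (simp only: of_real_mult complex_norm_square of_real_add of_real_of_nat_eq of_real_1 mult.assoc)
  have "ip f f = of_real s"
    using dirichlet_inner_sums[OF assms assms] 1[unfolded 2] by (rule sums_unique2)
  moreover have "s \<ge> 0" unfolding s_def by (intro suminf_nonneg dirichlet_spaceD(5)[OF assms]) auto
  ultimately have "(dirichlet_norm f)\<^sup>2 = s" "ip f f = of_real s" by (simp_all add: dirichlet_norm_def)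
  then show "(\<lambda>n. (real n + 1) * (cmod (taylor_coeff f n))\<^sup>2) sums (dirichlet_norm f)\<^sup>2"
    "ip f f = complex_of_real ((dirichlet_norm f)\<^sup>2)" using S by simp_all
qed

lemma dirichlet_norm_nonneg [simp]:
  assumes "f \<in> dirichlet_space" shows "dirichlet_norm f \<ge> 0"
proof -
  have "Re (ip f f) \<ge> 0" by (simp add: dirichlet_inner_self[OF assms])
  then show ?thesis by (simp add: dirichlet_norm_def)
qed

lemma taylor_coeff_norm_le:
  assumes "f \<in> dirichlet_space"
  shows "(real n + 1) * (cmod (taylor_coeff f n))\<^sup>2 \<le> (dirichlet_norm f)\<^sup>2"
    "cmod (taylor_coeff f n) \<le> dirichlet_norm f"
proof -
  have "(\<Sum>k\<in>{n}. (real k + 1) * (cmod (taylor_coeff f k))\<^sup>2) \<le> (\<Sum>k. (real k + 1) * (cmod (taylor_coeff f k))\<^sup>2)"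
    by (intro sum_le_suminf dirichlet_spaceD(5)[OF assms]) auto
  then show 1: "(real n + 1) * (cmod (taylor_coeff f n))\<^sup>2 \<le> (dirichlet_norm f)\<^sup>2"
    using dirichlet_norm_sums(1)[OF assms] by (simp add: sums_iff)
  have "1 * (cmod (taylor_coeff f n))\<^sup>2 \<le> (real n + 1) * (cmod (taylor_coeff f n))\<^sup>2"
    by (intro mult_right_mono) auto
  with 1 have "(cmod (taylor_coeff f n))\<^sup>2 \<le> (dirichlet_norm f)\<^sup>2" by simp
  then show "cmod (taylor_coeff f n) \<le> dirichlet_norm f" 
    using assms by (meson dirichlet_norm_nonneg power2_le_imp_le)
qed

lemma dirichlet_space_eqI:
  assumes "f \<in> dirichlet_space" "g \<in> dirichlet_space" "\<And>n. taylor_coeff f n = taylor_coeff g n"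
  shows "f = g"
proof
  fix z
  show "f z = g z"
  proof (cases "cmod z < 1")
    case True
    then show ?thesis
      using taylor_series[OF dirichlet_spaceD(1)[OF assms(1)] True]
        taylor_series[OF dirichlet_spaceD(1)[OF assms(2)] True] assms(3) by (simp add: sums_unique2)
  next
    case False
    then show ?thesis using dirichlet_spaceD(2)[OF assms(1)] dirichlet_spaceD(2)[OF assms(2)] by simp
  qed
qed

lemma taylor_coeff_zero [simp]: "taylor_coeff (\<lambda>z. 0) n = 0"
  by (rule power_series_taylor_coeff(2)[of 1]) auto

lemma dirichlet_norm_eq_0:
  assumes "f \<in> dirichlet_space" "dirichlet_norm f = 0"
  shows "f = (\<lambda>z. 0)"
  using taylor_coeff_norm_le(2)[OF assms(1)] assms by (intro dirichlet_space_eqI) auto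

lemma dirichlet_inner_eq_0D:
  assumes "f \<in> dirichlet_space" "ip f f = 0"
  shows "f = (\<lambda>z. 0)"
  using dirichlet_inner_self[OF assms(1)] assms by (intro dirichlet_norm_eq_0) auto

lemma dirichlet_norm_cmult:
  assumes "f \<in> dirichlet_space"
  shows "dirichlet_norm (\<lambda>z. c * f z) = cmod c * dirichlet_norm f"
proof -
  have D: "(\<lambda>z. c * f z) \<in> dirichlet_space" by (rule dirichlet_space_cmult[OF assms])
  have "complex_of_real ((dirichlet_norm (\<lambda>z. c * f z))\<^sup>2) = ip (\<lambda>z. c * f z) (\<lambda>z. c * f z)"
    by (rule dirichlet_inner_self[OF D, symmetric])
  also have "\<dots> = (c * cnj c) * ip f f"
    by (simp only: dirichlet_inner_cmult_left[OF assms D] dirichlet_inner_cmult_right[OF assms assms] mult.assoc)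
  also have "\<dots> = complex_of_real ((cmod c * dirichlet_norm f)\<^sup>2)"
    by (simp only: dirichlet_inner_self[OF assms] complex_norm_square[symmetric] power_mult_distrib of_real_mult)
  finally have "(dirichlet_norm (\<lambda>z. c * f z))\<^sup>2 = (cmod c * dirichlet_norm f)\<^sup>2"
    by (simp only: of_real_eq_iff)
  then show ?thesis
    by (rule power2_eq_imp_eq) (simp_all add: assms D)
qed

lemma dirichlet_Cauchy_Schwarz:
  assumes f: "f \<in> dirichlet_space" and g: "g \<in> dirichlet_space"
  shows "cmod (ip f g) \<le> dirichlet_norm f * dirichlet_norm g"
proof (cases "dirichlet_norm g = 0")
  case True
  then have "g = (\<lambda>z. 0)" using g by (rule dirichlet_norm_eq_0[rotated])
  then have "ip f g = 0" using dirichlet_inner_cmult_right[OF g f, of 0] by simp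
  then show ?thesis using True by simp
next
  case False
  then have pos: "(dirichlet_norm g)\<^sup>2 > 0" by simp
  define t where "t = ip f g / complex_of_real ((dirichlet_norm g)\<^sup>2)"
  define h where "h = (\<lambda>z. f z - t * g z)"
  have tg: "(\<lambda>z. t * g z) \<in> dirichlet_space" by (rule dirichlet_space_cmult[OF g])
  have h: "h \<in> dirichlet_space" unfolding h_def by (rule dirichlet_space_diff[OF f tg])
  have hg: "ip h g = 0"
  proof -
    have "ip h g = ip f g - t * ip g g"
      unfolding h_def using f g tg by (simp add: dirichlet_inner_diff_left dirichlet_inner_cmult_left)
    then show ?thesis using False by (simp add: t_def dirichlet_inner_self[OF g])
  qed
  have "ip h h = ip h f"
    using dirichlet_inner_diff_right[OF f tg h] dirichlet_inner_cmult_right[OF g h, of t] hg by (simp add: h_def)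
  also have "\<dots> = ip f f - t * cnj (ip f g)"
    unfolding h_def using f g tg by (simp add: dirichlet_inner_diff_left dirichlet_inner_cmult_left dirichlet_inner_cnj[of f g])
  also have "t * cnj (ip f g) = complex_of_real ((cmod (ip f g))\<^sup>2 / (dirichlet_norm g)\<^sup>2)"
    unfolding t_def by (simp add: complex_norm_square del: of_real_power)
  finally have "complex_of_real ((dirichlet_norm h)\<^sup>2) = complex_of_real ((dirichlet_norm f)\<^sup>2 - (cmod (ip f g))\<^sup>2 / (dirichlet_norm g)\<^sup>2)"
    using f h by (simp add: dirichlet_inner_self)
  then have "(dirichlet_norm h)\<^sup>2 = (dirichlet_norm f)\<^sup>2 - (cmod (ip f g))\<^sup>2 / (dirichlet_norm g)\<^sup>2"
    unfolding of_real_eq_iff .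
  then have "(cmod (ip f g))\<^sup>2 / (dirichlet_norm g)\<^sup>2 \<le> (dirichlet_norm f)\<^sup>2" by (metis diff_ge_0_iff_ge zero_le_power2)
  then have "(cmod (ip f g))\<^sup>2 \<le> (dirichlet_norm f * dirichlet_norm g)\<^sup>2"
    using pos by (simp add: divide_le_eq power_mult_distrib)
  then show ?thesis by (rule power2_le_imp_le) (use f g in simp)
qed

lemma dirichlet_norm_parallelogram:
  assumes f: "f \<in> dirichlet_space" and g: "g \<in> dirichlet_space"
  shows "(dirichlet_norm (\<lambda>z. f z + g z))\<^sup>2 + (dirichlet_norm (\<lambda>z. f z - g z))\<^sup>2 = 2 * (dirichlet_norm f)\<^sup>2 + 2 * (dirichlet_norm g)\<^sup>2"
proof -
  have "complex_of_real ((dirichlet_norm (\<lambda>z. f z + g z))\<^sup>2 + (dirichlet_norm (\<lambda>z. f z - g z))\<^sup>2) =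
    complex_of_real (2 * (dirichlet_norm f)\<^sup>2 + 2 * (dirichlet_norm g)\<^sup>2)"
    unfolding of_real_add of_real_mult
    using f g by (simp add: dirichlet_inner_self[symmetric] dirichlet_space_add dirichlet_space_diff dirichlet_inner_add_left
       dirichlet_inner_add_right dirichlet_inner_diff_left dirichlet_inner_diff_right del: of_real_power)
  then show ?thesis unfolding of_real_eq_iff .
qed

lemma dirichlet_norm_triangle:
  assumes f: "f \<in> dirichlet_space" and g: "g \<in> dirichlet_space"
  shows "dirichlet_norm (\<lambda>z. f z + g z) \<le> dirichlet_norm f + dirichlet_norm g"
proof (rule power2_le_imp_le)
  have "complex_of_real ((dirichlet_norm (\<lambda>z. f z + g z))\<^sup>2) = 
    complex_of_real ((dirichlet_norm f)\<^sup>2 + (dirichlet_norm g)\<^sup>2) + (ip f g + cnj (ip f g))"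
    unfolding of_real_add
    using f g by (simp add: dirichlet_inner_self[symmetric] dirichlet_space_add dirichlet_inner_add_left
       dirichlet_inner_add_right dirichlet_inner_cnj[of f g] del: of_real_power)
  then have "(dirichlet_norm (\<lambda>z. f z + g z))\<^sup>2 = (dirichlet_norm f)\<^sup>2 + (dirichlet_norm g)\<^sup>2 + 2 * Re (ip f g)"
    by (metis (mono_tags, lifting) Re_complex_of_real complex_add_cnj of_real_add)
  also have "Re (ip f g) \<le> dirichlet_norm f * dirichlet_norm g"
    using dirichlet_Cauchy_Schwarz[OF f g] complex_Re_le_cmod[of "ip f g"] by linarith
  finally show "(dirichlet_norm (\<lambda>z. f z + g z))\<^sup>2 \<le> (dirichlet_norm f + dirichlet_norm g)\<^sup>2"
    by (simp add: power2_eq_square algebra_simps)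
qed (use f g in simp)

text \<open>The inverse of the map from functions to coefficient sequences, with the value zero outside the disc that
  membership in the Dirichlet space demands.\<close>

definition dfun :: "(nat \<Rightarrow> complex) \<Rightarrow> complex \<Rightarrow> complex" where
  "dfun a z = (if cmod z < 1 then (\<Sum>n. a n * z ^ n) else 0)"

lemma dfun:
  assumes "summable (\<lambda>n. (real n + 1) * (cmod (a n))\<^sup>2)"
  shows "dfun a \<in> dirichlet_space" "taylor_coeff (dfun a) n = a n"
proof -
  have "(\<lambda>n. (real n + 1) * (cmod (a n))\<^sup>2) \<longlonglongrightarrow> 0" using assms by (rule summable_LIMSEQ_zero)
  then have "Bseq (\<lambda>n. (real n + 1) * (cmod (a n))\<^sup>2)" by (intro convergent_imp_Bseq convergentI)
  then obtain K where K: "\<And>n. (real n + 1) * (cmod (a n))\<^sup>2 \<le> K" by (auto simp: Bseq_def) 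
  have Kb: "cmod (a n) \<le> 1 + K" for n
  proof -
    have "1 * (cmod (a n))\<^sup>2 \<le> (real n + 1) * (cmod (a n))\<^sup>2" by (intro mult_right_mono) auto
    then have "(cmod (a n))\<^sup>2 \<le> K" using K[of n] by simp
    moreover have "2 * cmod (a n) \<le> 1 + (cmod (a n))\<^sup>2"
      using zero_le_power2[of "cmod (a n) - 1"] by (simp add: power2_eq_square algebra_simps)
    ultimately show ?thesis using norm_ge_zero[of "a n"] by linarith
  qed
  have ser: "(\<lambda>n. a n * z ^ n) sums dfun a z" if "cmod z < 1" for z
  proof -
    have "summable (\<lambda>n. a n * z ^ n)"
    proof (rule summable_comparison_test_ev)
      show "summable (\<lambda>n. (1 + K) * cmod z ^ n)" using that by (intro summable_mult summable_geometric) auto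
      show "\<forall>\<^sub>F n in sequentially. norm (a n * z ^ n) \<le> (1 + K) * cmod z ^ n"
        using Kb by (intro always_eventually allI) (auto simp: norm_mult norm_power intro!: mult_right_mono)
    qed
    then show ?thesis using that by (simp add: dfun_def summable_sums)
  qed
  show tc: "taylor_coeff (dfun a) n = a n" for n
    by (rule power_series_taylor_coeff(2)[of 1]) (use ser in auto)
  show "dfun a \<in> dirichlet_space"
  proof (rule dirichlet_spaceI)
    show "dfun a holomorphic_on ball 0 1"
      by (rule power_series_taylor_coeff(1)[of 1]) (use ser in auto)
  qed (use assms in \<open>auto simp: tc dfun_def\<close>)
qed

text \<open>Completeness of a weighted sequence space: the coefficients converge one by one, and a partial sum of the norm
  of the difference is bounded by the Cauchy estimate before the limit is taken.\<close>

lemma dirichlet_complete: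
  assumes F: "\<And>k. F k \<in> dirichlet_space"
    and C: "\<And>e. e > 0 \<Longrightarrow> \<exists>N. \<forall>m\<ge>N. \<forall>n\<ge>N. dirichlet_norm (\<lambda>z. F m z - F n z) < e"
  shows "\<exists>f\<in>dirichlet_space. (\<lambda>k. dirichlet_norm (\<lambda>z. F k z - f z)) \<longlonglongrightarrow> 0"
proof -
  have tcd: "taylor_coeff (\<lambda>z. F m z - F n z) j = taylor_coeff (F m) j - taylor_coeff (F n) j" for m n j
    using F by (intro taylor_coeff_diff[of _ 1]) (auto dest: dirichlet_spaceD)
  have Dd: "(\<lambda>z. F m z - F n z) \<in> dirichlet_space" for m n by (intro dirichlet_space_diff F)
  have "Cauchy (\<lambda>k. taylor_coeff (F k) j)" for j
  proof (rule metric_CauchyI)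
    fix e :: real assume "e > 0"
    from C[OF this] obtain N where N: "\<forall>m\<ge>N. \<forall>n\<ge>N. dirichlet_norm (\<lambda>z. F m z - F n z) < e" by blast
    show "\<exists>M. \<forall>m\<ge>M. \<forall>n\<ge>M. dist (taylor_coeff (F m) j) (taylor_coeff (F n) j) < e"
      using N taylor_coeff_norm_le(2)[OF Dd, of _ _ j] unfolding tcd dist_norm by (meson le_less_trans)
  qed
  then have "\<exists>a. (\<lambda>k. taylor_coeff (F k) j) \<longlonglongrightarrow> a" for j
    by (simp add: Cauchy_convergent_iff convergent_def)
  then obtain a where a: "\<And>j. (\<lambda>k. taylor_coeff (F k) j) \<longlonglongrightarrow> a j" by metis
  have fin: "(\<Sum>j<J. (real j + 1) * (cmod (taylor_coeff (F m) j - a j))\<^sup>2) \<le> e\<^sup>2"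
    if N: "\<forall>m\<ge>N. \<forall>n\<ge>N. dirichlet_norm (\<lambda>z. F m z - F n z) < e" and m: "m \<ge> N" for m N e J
  proof (rule LIMSEQ_le_const2)
    show "(\<lambda>n. \<Sum>j<J. (real j + 1) * (cmod (taylor_coeff (F m) j - taylor_coeff (F n) j))\<^sup>2)
       \<longlonglongrightarrow> (\<Sum>j<J. (real j + 1) * (cmod (taylor_coeff (F m) j - a j))\<^sup>2)"
      by (intro tendsto_intros a)
    show "\<exists>N. \<forall>n\<ge>N. (\<Sum>j<J. (real j + 1) * (cmod (taylor_coeff (F m) j - taylor_coeff (F n) j))\<^sup>2) \<le> e\<^sup>2"
    proof (intro exI[of _ N] allI impI)
      fix n assume n: "n \<ge> N"
      have "(\<Sum>j<J. (real j + 1) * (cmod (taylor_coeff (\<lambda>z. F m z - F n z) j))\<^sup>2) \<le> (\<Sum>j. (real j + 1) * (cmod (taylor_coeff (\<lambda>z. F m z - F n z) j))\<^sup>2)"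
        by (intro sum_le_suminf dirichlet_spaceD(5)[OF Dd]) auto
      also have "\<dots> = (dirichlet_norm (\<lambda>z. F m z - F n z))\<^sup>2"
        using dirichlet_norm_sums(1)[OF Dd] by (simp add: sums_iff)
      also have "\<dots> \<le> e\<^sup>2" using N m n Dd by (intro power_mono) (auto intro: less_imp_le)
      finally show "(\<Sum>j<J. (real j + 1) * (cmod (taylor_coeff (F m) j - taylor_coeff (F n) j))\<^sup>2) \<le> e\<^sup>2" by (simp add: tcd)
    qed
  qed
  have summ: "summable (\<lambda>j. (real j + 1) * (cmod (taylor_coeff (F m) j - a j))\<^sup>2)"
    and le: "(\<Sum>j. (real j + 1) * (cmod (taylor_coeff (F m) j - a j))\<^sup>2) \<le> e\<^sup>2"
    if N: "\<forall>m\<ge>N. \<forall>n\<ge>N. dirichlet_norm (\<lambda>z. F m z - F n z) < e" and m: "m \<ge> N" for m N e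
  proof -
    show S: "summable (\<lambda>j. (real j + 1) * (cmod (taylor_coeff (F m) j - a j))\<^sup>2)"
      by (rule summableI_nonneg_bounded[OF _ fin[OF N m]]) auto
    show "(\<Sum>j. (real j + 1) * (cmod (taylor_coeff (F m) j - a j))\<^sup>2) \<le> e\<^sup>2"
      by (rule suminf_le_const[OF S fin[OF N m]])
  qed
  obtain N1 where N1: "\<forall>m\<ge>N1. \<forall>n\<ge>N1. dirichlet_norm (\<lambda>z. F m z - F n z) < 1" using C[of 1] by auto
  define g where "g = dfun (\<lambda>j. taylor_coeff (F N1) j - a j)"
  have g: "g \<in> dirichlet_space" "taylor_coeff g j = taylor_coeff (F N1) j - a j" for j
    unfolding g_def by (intro dfun summ[OF N1]; simp)+
  define f where "f = (\<lambda>z. F N1 z - g z)"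
  have f: "f \<in> dirichlet_space" unfolding f_def by (intro dirichlet_space_diff F g)
  have tf: "taylor_coeff f j = a j" for j
    unfolding f_def using F[of N1] g by (subst taylor_coeff_diff[of _ 1]) (auto dest: dirichlet_spaceD)
  have "(\<lambda>k. dirichlet_norm (\<lambda>z. F k z - f z)) \<longlonglongrightarrow> 0"
  proof (rule LIMSEQ_I)
    fix e :: real assume e: "e > 0"
    from C[of "e / 2"] e obtain N where N: "\<forall>m\<ge>N. \<forall>n\<ge>N. dirichlet_norm (\<lambda>z. F m z - F n z) < e / 2" by auto
    show "\<exists>no. \<forall>n\<ge>no. norm (dirichlet_norm (\<lambda>z. F n z - f z) - 0) < e"
    proof (intro exI[of _ N] allI impI)
      fix m assume m: "m \<ge> N"
      have Dm: "(\<lambda>z. F m z - f z) \<in> dirichlet_space" by (intro dirichlet_space_diff F f)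
      have "taylor_coeff (\<lambda>z. F m z - f z) j = taylor_coeff (F m) j - a j" for j
        using taylor_coeff_diff[OF dirichlet_spaceD(1)[OF F] dirichlet_spaceD(1)[OF f]] by (simp add: tf)
      then have "(dirichlet_norm (\<lambda>z. F m z - f z))\<^sup>2 \<le> (e / 2)\<^sup>2"
        using sums_unique[OF dirichlet_norm_sums(1)[OF Dm]] le[OF N m] by simp
      then have "dirichlet_norm (\<lambda>z. F m z - f z) \<le> e / 2"
        by (rule power2_le_imp_le) (use e in simp)
      then show "norm (dirichlet_norm (\<lambda>z. F m z - f z) - 0) < e" using e dirichlet_norm_nonneg[OF Dm] by simp
    qed
  qed
  with f show ?thesis by blast
qed

section \<open>Orthogonal decomposition\<close>

definition orth :: "(complex \<Rightarrow> complex) set \<Rightarrow> (complex \<Rightarrow> complex) set" where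
  "orth M = {g \<in> dirichlet_space. \<forall>f\<in>M. ip f g = 0}"

lemma closed_subspaceD:
  assumes "closed_subspace M"
  shows "M \<subseteq> dirichlet_space" "(\<lambda>z. 0) \<in> M"
    "f \<in> M \<Longrightarrow> g \<in> M \<Longrightarrow> (\<lambda>z. f z + g z) \<in> M"
    "f \<in> M \<Longrightarrow> (\<lambda>z. c * f z) \<in> M"
    "f \<in> M \<Longrightarrow> g \<in> M \<Longrightarrow> (\<lambda>z. f z - g z) \<in> M"
    "(\<And>k. F k \<in> M) \<Longrightarrow> f \<in> dirichlet_space \<Longrightarrow> (\<lambda>k. dirichlet_norm (\<lambda>z. F k z - f z)) \<longlonglongrightarrow> 0 \<Longrightarrow> f \<in> M"
proof -
  show 1: "M \<subseteq> dirichlet_space" "(\<lambda>z. 0) \<in> M"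
    "f \<in> M \<Longrightarrow> g \<in> M \<Longrightarrow> (\<lambda>z. f z + g z) \<in> M"
    "f \<in> M \<Longrightarrow> (\<lambda>z. c * f z) \<in> M"
    "(\<And>k. F k \<in> M) \<Longrightarrow> f \<in> dirichlet_space \<Longrightarrow> (\<lambda>k. dirichlet_norm (\<lambda>z. F k z - f z)) \<longlonglongrightarrow> 0 \<Longrightarrow> f \<in> M" for f g c F
    using assms unfolding closed_subspace_def by blast+
  assume "f \<in> M" "g \<in> M"
  with 1(3)[OF _ 1(4), of f g "-1"] show "(\<lambda>z. f z - g z) \<in> M" by simp
qed

lemma dirichlet_inner_limit:
  assumes F: "\<And>k. F k \<in> dirichlet_space" and f: "f \<in> dirichlet_space" and g: "g \<in> dirichlet_space"
    and lim: "(\<lambda>k. dirichlet_norm (\<lambda>z. F k z - f z)) \<longlonglongrightarrow> 0"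
  shows "(\<lambda>k. ip (F k) g) \<longlonglongrightarrow> ip f g"
proof -
  have "(\<lambda>k. ip (F k) g - ip f g) \<longlonglongrightarrow> 0"
  proof (rule Lim_null_comparison)
    show "(\<lambda>k. dirichlet_norm (\<lambda>z. F k z - f z) * dirichlet_norm g) \<longlonglongrightarrow> 0"
      using tendsto_mult_right[OF lim, of "dirichlet_norm g"] by simp
    show "\<forall>\<^sub>F k in sequentially. norm (ip (F k) g - ip f g) \<le> dirichlet_norm (\<lambda>z. F k z - f z) * dirichlet_norm g"
      using F f g by (intro always_eventually allI)
        (simp add: dirichlet_Cauchy_Schwarz dirichlet_space_diff flip: dirichlet_inner_diff_left)
  qed
  then show ?thesis by (simp add: Lim_null[symmetric])
qed

lemma closed_subspace_orth:
  assumes "M \<subseteq> dirichlet_space"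
  shows "closed_subspace (orth M)"
proof -
  have z: "ip f (\<lambda>z. 0) = 0" if "f \<in> M" for f
    using dirichlet_inner_cmult_right[of f f 0] that assms by auto
  have c: "f \<in> orth M" if f: "f \<in> dirichlet_space" and F: "\<And>k. F k \<in> orth M"
     and lim: "(\<lambda>k. dirichlet_norm (\<lambda>z. F k z - f z)) \<longlonglongrightarrow> 0" for f F
  proof -
    have "ip g f = 0" if "g \<in> M" for g
    proof -
      have g: "g \<in> dirichlet_space" using that assms by blast
      have FD: "F k \<in> dirichlet_space" for k using F[of k] by (simp add: orth_def)
      have "ip (F k) g = 0" for k
        using F[of k] that dirichlet_inner_cnj[OF g FD, of k] by (simp add: orth_def)
      with dirichlet_inner_limit[OF FD f g lim] have "ip f g = 0" by (simp add: LIMSEQ_const_iff)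
      then show ?thesis using dirichlet_inner_cnj[OF f g] by simp
    qed
    then show ?thesis using f by (simp add: orth_def)
  qed
  show ?thesis
    unfolding closed_subspace_def
  proof (intro conjI ballI allI impI)
    show "orth M \<subseteq> dirichlet_space" by (auto simp: orth_def)
    show "(\<lambda>z. 0) \<in> orth M" by (auto simp: orth_def z)
    show "(\<lambda>z. f z + g z) \<in> orth M" if "f \<in> orth M" "g \<in> orth M" for f g
      using that assms by (auto simp: orth_def dirichlet_space_add dirichlet_inner_add_right subset_iff)
    show "(\<lambda>z. c * f z) \<in> orth M" if "f \<in> orth M" for f c
      using that assms by (auto simp: orth_def dirichlet_space_cmult dirichlet_inner_cmult_right subset_iff)
  qed (use c in blast)
qed

lemma orth_Int:
  assumes "f \<in> M" "f \<in> orth M" shows "f = (\<lambda>z. 0)"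
  using assms by (intro dirichlet_inner_eq_0D) (auto simp: orth_def)

text \<open>The nearest point of \<open>M\<close> to \<open>f\<close>: a minimizing sequence is Cauchy by the parallelogram
  law, and at the minimum the difference is orthogonal to \<open>M\<close>.\<close>

lemma orthogonal_decomposition:
  assumes M: "closed_subspace M" and f: "f \<in> dirichlet_space"
  obtains m g where "m \<in> M" "g \<in> orth M" "f = (\<lambda>z. m z + g z)"
proof -
  note MD = closed_subspaceD[OF M]
  have MDs: "m \<in> dirichlet_space" if "m \<in> M" for m using MD(1) that by blast
  define S where "S = (\<lambda>m. (dirichlet_norm (\<lambda>z. f z - m z))\<^sup>2) ` M"
  define d where "d = Inf S"
  have bdd: "bdd_below S" by (rule bdd_belowI[of _ 0]) (auto simp: S_def)
  have ne: "S \<noteq> {}" using MD(2) by (auto simp: S_def)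
  have dle: "d \<le> (dirichlet_norm (\<lambda>z. f z - m z))\<^sup>2" if "m \<in> M" for m
    unfolding d_def using bdd that by (intro cInf_lower) (auto simp: S_def)
  have "\<exists>m\<in>M. (dirichlet_norm (\<lambda>z. f z - m z))\<^sup>2 < d + 1 / (real k + 1)" for k
    using cInf_lessD[OF ne, of "d + 1 / (real k + 1)"] by (auto simp: d_def S_def add_pos_pos)
  then obtain m where m: "\<And>k. m k \<in> M" and mk: "\<And>k. (dirichlet_norm (\<lambda>z. f z - m k z))\<^sup>2 < d + 1 / (real k + 1)" by metis
  have diff: "(dirichlet_norm (\<lambda>z. m j z - m k z))\<^sup>2 \<le> 2 / (real j + 1) + 2 / (real k + 1)" for j k
  proof -
    let ?a = "\<lambda>z. f z - m k z" and ?b = "\<lambda>z. f z - m j z"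
    have D: "?a \<in> dirichlet_space" "?b \<in> dirichlet_space" using f m MDs by (auto intro: dirichlet_space_diff)
    have mid: "(\<lambda>z. (1/2) * (m j z + m k z)) \<in> M" using MD(4)[OF MD(3)[OF m m]] .
    have h: "(\<lambda>z. f z - (1/2) * (m j z + m k z)) \<in> dirichlet_space" using f MDs[OF mid] by (intro dirichlet_space_diff)
    have e1: "(\<lambda>z. ?a z + ?b z) = (\<lambda>z. 2 * (f z - (1/2) * (m j z + m k z)))" by (auto simp: algebra_simps)
    have e2: "(\<lambda>z. ?a z - ?b z) = (\<lambda>z. m j z - m k z)" by auto
    have "(2 * dirichlet_norm (\<lambda>z. f z - (1/2) * (m j z + m k z)))\<^sup>2 + (dirichlet_norm (\<lambda>z. m j z - m k z))\<^sup>2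
       = 2 * (dirichlet_norm ?a)\<^sup>2 + 2 * (dirichlet_norm ?b)\<^sup>2"
      using dirichlet_norm_parallelogram[OF D] dirichlet_norm_cmult[OF h, of 2] unfolding e1 e2 by simp
    moreover have "2 / (real j + 1) = 2 * (1 / (real j + 1))" "2 / (real k + 1) = 2 * (1 / (real k + 1))" by simp_all
    ultimately show ?thesis
      using dle[OF mid] mk[of j] mk[of k] unfolding power_mult_distrib power2_eq_square[of 2] by linarith
  qed
  obtain m0 where m0: "m0 \<in> dirichlet_space" and lim: "(\<lambda>k. dirichlet_norm (\<lambda>z. m k z - m0 z)) \<longlonglongrightarrow> 0"
  proof -
    have "\<exists>f\<in>dirichlet_space. (\<lambda>k. dirichlet_norm (\<lambda>z. m k z - f z)) \<longlonglongrightarrow> 0"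
    proof (rule dirichlet_complete)
      show "m k \<in> dirichlet_space" for k by (intro MDs m)
      fix e :: real assume e: "e > 0"
      obtain N :: nat where N: "N > 4 / e\<^sup>2" using reals_Archimedean2 by blast
      show "\<exists>N. \<forall>j\<ge>N. \<forall>k\<ge>N. dirichlet_norm (\<lambda>z. m j z - m k z) < e"
      proof (intro exI[of _ N] allI impI)
        fix j k assume jk: "j \<ge> N" "k \<ge> N"
        have N1: "4 / (real N + 1) < e\<^sup>2" 
        proof -
          have "4 < real N * e\<^sup>2" using N e by (simp add: pos_divide_less_eq)
          moreover have "e\<^sup>2 > 0" using e by simp
          moreover have "e\<^sup>2 * (real N + 1) = real N * e\<^sup>2 + e\<^sup>2" by (simp add: algebra_simps)
          ultimately have "4 < e\<^sup>2 * (real N + 1)" by linarith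
          then show ?thesis by (subst pos_divide_less_eq) auto
        qed
        have "2 / (real j + 1) \<le> 2 / (real N + 1)" "2 / (real k + 1) \<le> 2 / (real N + 1)" 
          using jk by (auto intro!: divide_left_mono)
        moreover have "4 / (real N + 1) = 2 / (real N + 1) + 2 / (real N + 1)" by simp
        ultimately have "(dirichlet_norm (\<lambda>z. m j z - m k z))\<^sup>2 < e\<^sup>2" using diff[of j k] N1 by linarith
        then show "dirichlet_norm (\<lambda>z. m j z - m k z) < e" by (rule power2_less_imp_less) (use e in simp)
      qed
    qed
    with that show thesis by blast
  qed
  have m0M: "m0 \<in> M" by (rule MD(6)[OF m m0 lim])
  define g where "g = (\<lambda>z. f z - m0 z)"
  have g: "g \<in> dirichlet_space" unfolding g_def by (intro dirichlet_space_diff f m0)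
  have gd: "(dirichlet_norm g)\<^sup>2 \<le> d"
  proof -
    have le: "dirichlet_norm g \<le> sqrt (d + 1 / (real k + 1)) + dirichlet_norm (\<lambda>z. m k z - m0 z)" for k
    proof -
      have D: "(\<lambda>z. f z - m k z) \<in> dirichlet_space" "(\<lambda>z. m k z - m0 z) \<in> dirichlet_space"
        using f m MDs m0 by (auto intro: dirichlet_space_diff)
      have "g = (\<lambda>z. (f z - m k z) + (m k z - m0 z))" by (auto simp: g_def)
      then have "dirichlet_norm g \<le> dirichlet_norm (\<lambda>z. f z - m k z) + dirichlet_norm (\<lambda>z. m k z - m0 z)"
        using dirichlet_norm_triangle[OF D] by simp
      moreover have "dirichlet_norm (\<lambda>z. f z - m k z) \<le> sqrt (d + 1 / (real k + 1))"
        using mk[of k] by (intro real_le_rsqrt less_imp_le)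
      ultimately show ?thesis by simp
    qed
    have "(\<lambda>k. sqrt (d + 1 / (real k + 1)) + dirichlet_norm (\<lambda>z. m k z - m0 z)) \<longlonglongrightarrow> sqrt (d + 0) + 0"
    proof (intro tendsto_intros lim)
      show "(\<lambda>k. 1 / (real k + 1)) \<longlonglongrightarrow> 0" by real_asymp
    qed
    then have "dirichlet_norm g \<le> sqrt d"
      using le by (intro LIMSEQ_le_const[where a = "dirichlet_norm g"]) auto
    moreover have "0 \<le> d" using bdd ne unfolding d_def by (intro cInf_greatest) (auto simp: S_def)
    ultimately show ?thesis
      using g by (metis dirichlet_norm_nonneg power_mono real_sqrt_pow2)
  qed
  have "ip h g = 0" if h: "h \<in> M" for h
  proof (cases "h = (\<lambda>z. 0)")
    case True
    then show ?thesis using dirichlet_inner_cmult_left[OF g g, of 0] by simp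
  next
    case False
    have hD: "h \<in> dirichlet_space" by (rule MDs[OF h])
    have nh: "(dirichlet_norm h)\<^sup>2 > 0" using False dirichlet_norm_eq_0[OF hD] by auto
    \<comment> \<open>Moving from \<open>m0\<close> in the direction \<open>h\<close> by this amount would bring it closer to \<open>f\<close> unless \<open>ip g h = 0\<close>.\<close>
    define t where "t = ip g h / complex_of_real ((dirichlet_norm h)\<^sup>2)"
    have th: "(\<lambda>z. t * h z) \<in> dirichlet_space" by (rule dirichlet_space_cmult[OF hD])
    define k where "k = (\<lambda>z. g z - t * h z)"
    have kD: "k \<in> dirichlet_space" unfolding k_def by (rule dirichlet_space_diff[OF g th])
    have "(\<lambda>z. m0 z + t * h z) \<in> M" by (intro MD(3) MD(4) m0M h)
    from dle[OF this] have dk: "d \<le> (dirichlet_norm k)\<^sup>2" by (simp add: k_def g_def algebra_simps)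
    have kh: "ip k h = 0"
    proof -
      have "ip k h = ip g h - t * ip h h"
        unfolding k_def using g hD th by (simp add: dirichlet_inner_diff_left dirichlet_inner_cmult_left)
      then show ?thesis using nh by (simp add: t_def dirichlet_inner_self[OF hD])
    qed
    have "ip k k = ip k g"
      using dirichlet_inner_diff_right[OF g th kD] dirichlet_inner_cmult_right[OF hD kD, of t] kh by (simp add: k_def)
    also have "\<dots> = ip g g - t * cnj (ip g h)"
      unfolding k_def using g hD th by (simp add: dirichlet_inner_diff_left dirichlet_inner_cmult_left dirichlet_inner_cnj[of g h])
    also have "t * cnj (ip g h) = complex_of_real ((cmod (ip g h))\<^sup>2 / (dirichlet_norm h)\<^sup>2)"
      unfolding t_def by (simp add: complex_norm_square del: of_real_power)
    finally have "complex_of_real ((dirichlet_norm k)\<^sup>2) = complex_of_real ((dirichlet_norm g)\<^sup>2 - (cmod (ip g h))\<^sup>2 / (dirichlet_norm h)\<^sup>2)"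
      using g kD by (simp add: dirichlet_inner_self)
    then have "(dirichlet_norm k)\<^sup>2 = (dirichlet_norm g)\<^sup>2 - (cmod (ip g h))\<^sup>2 / (dirichlet_norm h)\<^sup>2"
      unfolding of_real_eq_iff .
    then have "(cmod (ip g h))\<^sup>2 / (dirichlet_norm h)\<^sup>2 \<le> 0" using dk gd by linarith
    then have "ip g h = 0" using nh by (simp add: divide_le_0_iff)
    then show ?thesis using dirichlet_inner_cnj[OF g hD] by simp
  qed
  then have "g \<in> orth M" using g by (simp add: orth_def)
  moreover have "f = (\<lambda>z. m0 z + g z)" by (auto simp: g_def)
  ultimately show thesis using that m0M by blast
qed

lemma orth_orth:
  assumes M: "closed_subspace M" shows "orth (orth M) = M"
proof
  show "M \<subseteq> orth (orth M)"
  proof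
    fix f assume f: "f \<in> M"
    then have fD: "f \<in> dirichlet_space" using closed_subspaceD(1)[OF M] by blast
    have "ip g f = 0" if "g \<in> orth M" for g
      using that f dirichlet_inner_cnj[OF fD, of g] by (auto simp: orth_def)
    then show "f \<in> orth (orth M)" using fD by (simp add: orth_def)
  qed
  show "orth (orth M) \<subseteq> M"
  proof
    fix f assume f: "f \<in> orth (orth M)"
    then have "f \<in> dirichlet_space" by (simp add: orth_def)
    from orthogonal_decomposition[OF M this] obtain m g where mg: "m \<in> M" "g \<in> orth M" "f = (\<lambda>z. m z + g z)" .
    have D: "m \<in> dirichlet_space" "g \<in> dirichlet_space" using mg closed_subspaceD(1)[OF M] by (auto simp: orth_def)
    have "ip g f = 0" using f mg(2) by (simp add: orth_def)
    moreover have "ip g m = 0" using mg(1,2) D dirichlet_inner_cnj[OF D] by (auto simp: orth_def)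
    ultimately have "ip g g = 0" using dirichlet_inner_add_right[OF D D(2)] mg(3) by simp
    then have "g = (\<lambda>z. 0)" by (rule dirichlet_inner_eq_0D[OF D(2)])
    then show "f \<in> M" using mg by simp
  qed
qed

section \<open>Riesz representation\<close>

text \<open>The monomials, cut off outside the disc.\<close>

abbreviation dmono :: "nat \<Rightarrow> complex \<Rightarrow> complex" where
  "dmono k \<equiv> dfun (\<lambda>j. if j = k then 1 else 0)"

lemma dmono: "dmono k \<in> dirichlet_space" "taylor_coeff (dmono k) j = (if j = k then 1 else 0)"
proof -
  have "summable (\<lambda>n. (real n + 1) * (cmod (if n = k then 1 else 0))\<^sup>2)"
    by (rule summable_finite[of "{k}"]) auto
  from dfun[OF this] show "dmono k \<in> dirichlet_space" "taylor_coeff (dmono k) j = (if j = k then 1 else 0)" by auto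
qed

lemma dmono_eq: "dmono k z = (if cmod z < 1 then z ^ k else 0)"
proof -
  have "(\<lambda>n. (if n = k then 1 else 0) * z ^ n) sums (z ^ k)"
    using sums_If_finite_set[of "{k}" "\<lambda>n. z ^ n"] by (simp add: if_distrib[of "\<lambda>x. x * _"] cong: if_cong)
  then show ?thesis by (simp add: dfun_def sums_iff)
qed

definition dtrunc :: "nat \<Rightarrow> (complex \<Rightarrow> complex) \<Rightarrow> complex \<Rightarrow> complex" where
  "dtrunc N f = dfun (\<lambda>j. if j < N then taylor_coeff f j else 0)"

lemma dtrunc: "dtrunc N f \<in> dirichlet_space" "taylor_coeff (dtrunc N f) j = (if j < N then taylor_coeff f j else 0)"
proof -
  have "summable (\<lambda>n. (real n + 1) * (cmod (if n < N then taylor_coeff f n else 0))\<^sup>2)"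
    by (rule summable_finite[of "{..<N}"]) auto
  from dfun[OF this] show "dtrunc N f \<in> dirichlet_space" "taylor_coeff (dtrunc N f) j = (if j < N then taylor_coeff f j else 0)" 
    by (auto simp: dtrunc_def)
qed

lemma dtrunc_tendsto:
  assumes f: "f \<in> dirichlet_space"
  shows "(\<lambda>N. dirichlet_norm (\<lambda>z. dtrunc N f z - f z)) \<longlonglongrightarrow> 0"
proof -
  let ?c = "\<lambda>n. (real n + 1) * (cmod (taylor_coeff f n))\<^sup>2"
  note S = dirichlet_spaceD(5)[OF f]
  have D: "(\<lambda>z. dtrunc N f z - f z) \<in> dirichlet_space" for N by (intro dirichlet_space_diff dtrunc f)
  have tc: "taylor_coeff (\<lambda>z. dtrunc N f z - f z) j = (if j < N then 0 else - taylor_coeff f j)" for N j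
    using taylor_coeff_diff[OF dirichlet_spaceD(1)[OF dtrunc(1)] dirichlet_spaceD(1)[OF f]] by (simp add: dtrunc(2))
  have eq: "(dirichlet_norm (\<lambda>z. dtrunc N f z - f z))\<^sup>2 = (\<Sum>n. ?c (n + N))" for N
  proof -
    have "(\<lambda>n. (real n + 1) * (cmod (taylor_coeff (\<lambda>z. dtrunc N f z - f z) n))\<^sup>2) sums (dirichlet_norm (\<lambda>z. dtrunc N f z - f z))\<^sup>2"
      by (rule dirichlet_norm_sums(1)[OF D])
    then have "(\<lambda>n. if n < N then 0 else ?c n) sums (dirichlet_norm (\<lambda>z. dtrunc N f z - f z))\<^sup>2"
      by (rule back_subst[of "\<lambda>h. h sums _"]) (auto simp: tc)
    then have "(\<lambda>n. if n + N < N then 0 else ?c (n + N)) sums ((dirichlet_norm (\<lambda>z. dtrunc N f z - f z))\<^sup>2 - (\<Sum>n<N. if n < N then 0 else ?c n))"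
      by (rule sums_iff_shift'[THEN iffD2, of "\<lambda>n. if n < N then 0 else ?c n"])
    then show ?thesis by (simp add: sums_iff)
  qed
  have "(\<lambda>N. \<Sum>n. ?c (n + N)) \<longlonglongrightarrow> 0" by (rule suminf_exist_split2[OF S])
  then have "(\<lambda>N. (dirichlet_norm (\<lambda>z. dtrunc N f z - f z))\<^sup>2) \<longlonglongrightarrow> 0" by (simp only: eq)
  then have "(\<lambda>N. sqrt ((dirichlet_norm (\<lambda>z. dtrunc N f z - f z))\<^sup>2)) \<longlonglongrightarrow> sqrt 0" by (intro tendsto_real_sqrt)
  then show ?thesis using D by simp
qed

lemma dtrunc_functional:
  assumes add: "\<And>f g. f \<in> dirichlet_space \<Longrightarrow> g \<in> dirichlet_space \<Longrightarrow> L (\<lambda>z. f z + g z) = L f + L g"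
    and cm: "\<And>c f. f \<in> dirichlet_space \<Longrightarrow> L (\<lambda>z. c * f z) = (c :: complex) * L f"
  shows "L (dtrunc N f) = (\<Sum>j<N. taylor_coeff f j * L (dmono j))"
proof (induction N)
  case 0
  have "dtrunc 0 f = (\<lambda>z. 0)" by (rule dirichlet_space_eqI) (auto simp: dtrunc)
  then show ?case using cm[of "\<lambda>z. 0" 0] by simp
next
  case (Suc N)
  have D: "(\<lambda>z. taylor_coeff f N * dmono N z) \<in> dirichlet_space" by (intro dirichlet_space_cmult dmono)
  have "dtrunc (Suc N) f = (\<lambda>z. dtrunc N f z + taylor_coeff f N * dmono N z)"
  proof (rule dirichlet_space_eqI)
    show "taylor_coeff (dtrunc (Suc N) f) n = taylor_coeff (\<lambda>z. dtrunc N f z + taylor_coeff f N * dmono N z) n" for n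
      using taylor_coeff_add[OF dirichlet_spaceD(1)[OF dtrunc(1)] dirichlet_spaceD(1)[OF D]]
        taylor_coeff_cmult[OF dirichlet_spaceD(1)[OF dmono(1)]] by (auto simp: dtrunc(2) dmono(2) less_Suc_eq)
  qed (intro dirichlet_space_add dtrunc D)+
  then show ?case using Suc add[OF dtrunc(1) D] cm[OF dmono(1)] by simp
qed

text \<open>The representing function has coefficients \<open>cnj (L (z ^ j)) / (j + 1)\<close>. Evaluating \<open>L\<close>
  at its own truncations bounds their norms by the constant of \<open>L\<close>, which puts it into the space.\<close>

lemma dirichlet_Riesz:
  assumes add: "\<And>f g. f \<in> dirichlet_space \<Longrightarrow> g \<in> dirichlet_space \<Longrightarrow> L (\<lambda>z. f z + g z) = L f + L g"
    and cm: "\<And>c f. f \<in> dirichlet_space \<Longrightarrow> L (\<lambda>z. c * f z) = (c :: complex) * L f"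
    and bd: "\<And>f. f \<in> dirichlet_space \<Longrightarrow> cmod (L f) \<le> K * dirichlet_norm f"
  shows "\<exists>h\<in>dirichlet_space. \<forall>f\<in>dirichlet_space. L f = ip f h"
proof -
  define a where "a j = cnj (L (dmono j)) / (of_nat j + 1)" for j
  have n0: "(of_nat j + 1 :: complex) \<noteq> 0" for j by (metis of_nat_Suc of_nat_neq_0 add.commute)
  have La: "L (dmono j) = (of_nat j + 1) * cnj (a j)" for j
    using n0[of j] by (simp add: a_def)
  have part: "(\<Sum>j<N. (real j + 1) * (cmod (a j))\<^sup>2) \<le> K\<^sup>2" for N
  proof -
    define p where "p = dtrunc N (dfun (\<lambda>j. if j < N then a j else 0))"
    have fs: "summable (\<lambda>n. (real n + 1) * (cmod (if n < N then a n else 0))\<^sup>2)"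
      by (rule summable_finite[of "{..<N}"]) auto
    have p: "p \<in> dirichlet_space" "taylor_coeff p j = (if j < N then a j else 0)" for j
      unfolding p_def by (simp_all add: dtrunc dfun(2)[OF fs])
    have "(\<lambda>j. if j \<in> {..<N} then (real j + 1) * (cmod (a j))\<^sup>2 else 0) sums (\<Sum>j<N. (real j + 1) * (cmod (a j))\<^sup>2)"
      by (rule sums_If_finite_set) simp
    moreover have eqf: "(\<lambda>j. if j \<in> {..<N} then (real j + 1) * (cmod (a j))\<^sup>2 else 0) = (\<lambda>j. (real j + 1) * (cmod (taylor_coeff p j))\<^sup>2)"
      by (auto simp: p(2))
    ultimately have n: "(dirichlet_norm p)\<^sup>2 = (\<Sum>j<N. (real j + 1) * (cmod (a j))\<^sup>2)"
      using sums_unique2[OF dirichlet_norm_sums(1)[OF p(1)]] by (simp only:)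
    have "L p = (\<Sum>j<N. a j * L (dmono j))"
      unfolding p_def by (subst dtrunc_functional[OF add cm]) (auto simp: dfun(2)[OF fs])
    also have "\<dots> = (\<Sum>j<N. complex_of_real ((real j + 1) * (cmod (a j))\<^sup>2))"
      by (intro sum.cong refl) (simp add: La of_real_mult complex_norm_square del: of_real_power)
    also have "\<dots> = complex_of_real ((dirichlet_norm p)\<^sup>2)" by (simp only: n of_real_sum)
    finally have "(dirichlet_norm p)\<^sup>2 \<le> K * dirichlet_norm p" using bd[OF p(1)] by (simp only: norm_of_real abs_power2)
    then have "dirichlet_norm p \<le> \<bar>K\<bar>"
    proof (cases "dirichlet_norm p = 0")
      case False
      then have "dirichlet_norm p > 0" using dirichlet_norm_nonneg[OF p(1)] by linarith
      with \<open>(dirichlet_norm p)\<^sup>2 \<le> K * dirichlet_norm p\<close> have "dirichlet_norm p \<le> K"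
        by (simp add: power2_eq_square)
      then show ?thesis by linarith
    qed simp
    then have "(dirichlet_norm p)\<^sup>2 \<le> K\<^sup>2" using dirichlet_norm_nonneg[OF p(1)] power_mono[of "dirichlet_norm p" "\<bar>K\<bar>" 2] by simp
    then show ?thesis by (simp add: n)
  qed
  have S: "summable (\<lambda>j. (real j + 1) * (cmod (a j))\<^sup>2)" by (rule summableI_nonneg_bounded[OF _ part]) auto
  define h where "h = dfun a"
  have h: "h \<in> dirichlet_space" "taylor_coeff h j = a j" for j unfolding h_def by (intro dfun S)+
  have "L f = ip f h" if f: "f \<in> dirichlet_space" for f
  proof -
    have LN: "L (dtrunc N f) = (\<Sum>j<N. taylor_coeff f j * L (dmono j))" for N
      by (rule dtrunc_functional) (auto intro: add cm)
    have "(\<lambda>N. L (dtrunc N f)) \<longlonglongrightarrow> ip f h"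
      using dirichlet_inner_sums[OF f h(1)] unfolding sums_def LN by (simp add: La h(2) mult_ac)
    moreover have "(\<lambda>N. L (dtrunc N f)) \<longlonglongrightarrow> L f"
    proof -
      have "(\<lambda>N. L (dtrunc N f) - L f) \<longlonglongrightarrow> 0"
      proof (rule Lim_null_comparison)
        show "(\<lambda>N. K * dirichlet_norm (\<lambda>z. dtrunc N f z - f z)) \<longlonglongrightarrow> 0"
          using tendsto_mult_left[OF dtrunc_tendsto[OF f], of K] by simp
        have LD: "L (\<lambda>z. dtrunc N f z - f z) = L (dtrunc N f) - L f" for N
          using add[OF dtrunc(1) dirichlet_space_cmult[OF f, of "-1"]] cm[OF f, of "-1"] by simp
        show "\<forall>\<^sub>F N in sequentially. norm (L (dtrunc N f) - L f) \<le> K * dirichlet_norm (\<lambda>z. dtrunc N f z - f z)"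
          unfolding LD[symmetric] by (intro always_eventually allI bd dirichlet_space_diff dtrunc(1) f)
      qed
      then show ?thesis by (simp add: Lim_null[symmetric])
    qed
    ultimately show ?thesis by (rule LIMSEQ_unique[rotated])
  qed
  with h(1) show ?thesis by blast
qed

section \<open>Multipliers and reducing subspaces\<close>

text \<open>A sufficient condition for multiplication to be bounded on the Dirichlet space. It does not describe all
  multipliers, but every function holomorphic across the closed disc satisfies it.\<close>

definition dmultiplier :: "(complex \<Rightarrow> complex) \<Rightarrow> bool" where
  "dmultiplier m \<longleftrightarrow> m holomorphic_on ball 0 1 \<and> (\<exists>C. \<forall>z\<in>ball 0 1. cmod (m z) \<le> C \<and> cmod (deriv m z) \<le> C)"

text \<open>The product rule bounds \<open>(m f)'\<close> by \<open>f\<close> and \<open>f'\<close>, whose normalized square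
  integrals over the disc are at most the squared norm of \<open>f\<close>.\<close>

lemma dmultiplier_bounded:
  assumes "dmultiplier m"
  obtains K where "\<And>f. f \<in> dirichlet_space \<Longrightarrow> mult_op m f \<in> dirichlet_space"
    "\<And>f. f \<in> dirichlet_space \<Longrightarrow> dirichlet_norm (mult_op m f) \<le> K * dirichlet_norm f"
proof -
  obtain C where m: "m holomorphic_on ball 0 1" and "\<forall>z\<in>ball 0 1. cmod (m z) \<le> C \<and> cmod (deriv m z) \<le> C"
    using assms unfolding dmultiplier_def by blast
  then have C: "cmod (m z) \<le> C" "cmod (deriv m z) \<le> C" if "cmod z < 1" for z
    using that by auto
  have C0: "C \<ge> 0" using order_trans[OF norm_ge_zero C(1)[of 0]] by simp
  have *: "mult_op m f \<in> dirichlet_space \<and> (dirichlet_norm (mult_op m f))\<^sup>2 \<le> (sqrt 6 * C * dirichlet_norm f)\<^sup>2"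
    if f: "f \<in> dirichlet_space" for f
  proof -
    note F = dirichlet_spaceD[OF f]
    define g where "g = mult_op m f"
    have g: "g holomorphic_on ball 0 1" unfolding g_def mult_op_def by (intro holomorphic_intros m F)
    have g0: "g z = 0" if "\<not> cmod z < 1" for z using F(2)[OF that] by (simp add: g_def mult_op_def)
    have dg: "deriv g z = deriv m z * f z + m z * deriv f z" if "cmod z < 1" for z
    proof -
      have "(f has_field_derivative deriv f z) (at z)" "(m has_field_derivative deriv m z) (at z)"
        using that F(1) m by (auto intro: holomorphic_derivI)
      then have "(g has_field_derivative (deriv m z * f z + m z * deriv f z)) (at z)"
        unfolding g_def mult_op_def by (auto intro!: derivative_eq_intros)
      then show ?thesis by (rule DERIV_imp_deriv)
    qed
    let ?a = "\<lambda>n. (cmod (taylor_coeff f n))\<^sup>2"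
    have S2: "summable (\<lambda>n. ?a n / (real n + 1))"
    proof (rule summable_comparison_test_ev[OF _ F(6)], intro always_eventually allI)
      show "norm (?a n / (real n + 1)) \<le> ?a n" for n
        using mult_left_mono[of 1 "real n + 1" "?a n"] by (simp add: divide_le_eq)
    qed
    note I2 = disc_square_integrable_iff[OF F(1), folded taylor_coeff_def]
    have bound: "(cmod (deriv g z))\<^sup>2 \<le> 2 * C\<^sup>2 * (cmod (f z))\<^sup>2 + 2 * C\<^sup>2 * (cmod (deriv f z))\<^sup>2" if z: "cmod z < 1" for z
    proof -
      have "(cmod (deriv g z))\<^sup>2 \<le> 2 * (cmod (deriv m z * f z))\<^sup>2 + 2 * (cmod (m z * deriv f z))\<^sup>2"
        unfolding dg[OF z] by (rule norm_add_square_le)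
      also have "\<dots> \<le> 2 * (C\<^sup>2 * (cmod (f z))\<^sup>2) + 2 * (C\<^sup>2 * (cmod (deriv f z))\<^sup>2)"
        unfolding norm_mult power_mult_distrib
        by (intro add_mono mult_left_mono mult_right_mono power_mono C z) auto
      finally show ?thesis by simp
    qed
    have J: "set_integrable lborel (ball 0 1) (\<lambda>z. 2 * C\<^sup>2 * (cmod (f z))\<^sup>2 + 2 * C\<^sup>2 * (cmod (deriv f z))\<^sup>2)"
      using I2(1) S2 F(3) by (intro set_integral_add set_integrable_mult_right) auto
    have dgh: "deriv g holomorphic_on ball 0 1" using g by (intro holomorphic_intros) auto
    have Jg: "set_integrable lborel (ball 0 1) (\<lambda>z. (cmod (deriv g z))\<^sup>2)"
    proof (rule set_integrable_bound[OF J])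
      have "continuous_on (ball 0 1) (\<lambda>z. (cmod (deriv g z))\<^sup>2)"
        by (intro continuous_intros holomorphic_on_imp_continuous_on dgh)
      from borel_measurable_continuous_on_indicator[OF _ this]
      show "set_borel_measurable lborel (ball 0 1) (\<lambda>z. (cmod (deriv g z))\<^sup>2)"
        by (simp add: set_borel_measurable_def)
      show "AE z in lborel. z \<in> ball 0 1 \<longrightarrow> norm ((cmod (deriv g z))\<^sup>2) \<le> norm (2 * C\<^sup>2 * (cmod (f z))\<^sup>2 + 2 * C\<^sup>2 * (cmod (deriv f z))\<^sup>2)"
        using bound by (intro AE_I2) (auto intro: order_trans[OF _ abs_ge_self])
    qed
    have gD: "g \<in> dirichlet_space" using g g0 Jg by (auto simp: dirichlet_space_def)
    have A: "(\<lambda>n. real n * (cmod (taylor_coeff g n))\<^sup>2) sums ((LINT z:ball 0 1|lborel. (cmod (deriv g z))\<^sup>2) / pi)"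
      using dirichlet_integral_summable_iff[OF g] Jg by blast
    define A' where "A' = (LINT z:ball 0 1|lborel. (cmod (deriv g z))\<^sup>2) / pi"
    have "A' \<le> (LINT z:ball 0 1|lborel. 2 * C\<^sup>2 * (cmod (f z))\<^sup>2 + 2 * C\<^sup>2 * (cmod (deriv f z))\<^sup>2) / pi"
      unfolding A'_def by (intro divide_right_mono set_integral_mono Jg J bound) auto
    also have "\<dots> = 2 * C\<^sup>2 * ((LINT z:ball 0 1|lborel. (cmod (f z))\<^sup>2) / pi) + 2 * C\<^sup>2 * ((LINT z:ball 0 1|lborel. (cmod (deriv f z))\<^sup>2) / pi)"
    proof -
      have "(LINT z:ball 0 1|lborel. 2 * C\<^sup>2 * (cmod (f z))\<^sup>2 + 2 * C\<^sup>2 * (cmod (deriv f z))\<^sup>2) =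
         2 * C\<^sup>2 * (LINT z:ball 0 1|lborel. (cmod (f z))\<^sup>2) + 2 * C\<^sup>2 * (LINT z:ball 0 1|lborel. (cmod (deriv f z))\<^sup>2)"
        using I2(1) S2 F(3) by (subst set_integral_add(2)) (auto intro!: set_integrable_mult_right)
      then show ?thesis by (simp add: add_divide_distrib)
    qed
    also have "\<dots> = 2 * C\<^sup>2 * ((\<Sum>n. ?a n / (real n + 1)) + (\<Sum>n. real n * ?a n))"
      using I2(2)[OF S2] sums_unique[OF dirichlet_integral_summable_iff(2)[OF F(1) F(4)]] by (simp add: distrib_left)
    also have "\<dots> \<le> 2 * C\<^sup>2 * (dirichlet_norm f)\<^sup>2"
    proof (rule mult_left_mono)
      have "(\<Sum>n. ?a n / (real n + 1)) + (\<Sum>n. real n * ?a n) = (\<Sum>n. ?a n / (real n + 1) + real n * ?a n)"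
        by (rule suminf_add[OF S2 F(4)])
      also have "\<dots> \<le> (\<Sum>n. (real n + 1) * ?a n)"
      proof (intro suminf_le summable_add S2 F(4,5))
        fix n
        have "?a n / (real n + 1) \<le> ?a n" using mult_left_mono[of 1 "real n + 1" "?a n"] by (simp add: divide_le_eq)
        then show "?a n / (real n + 1) + real n * ?a n \<le> (real n + 1) * ?a n" by (simp add: algebra_simps)
      qed
      also have "\<dots> = (dirichlet_norm f)\<^sup>2" using dirichlet_norm_sums(1)[OF f] by (simp add: sums_iff)
      finally show "(\<Sum>n. ?a n / (real n + 1)) + (\<Sum>n. real n * ?a n) \<le> (dirichlet_norm f)\<^sup>2" .
    qed auto
    finally have A'le: "A' \<le> 2 * C\<^sup>2 * (dirichlet_norm f)\<^sup>2" .
    have tg0: "(cmod (taylor_coeff g 0))\<^sup>2 \<le> C\<^sup>2 * (dirichlet_norm f)\<^sup>2"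
    proof -
      have "cmod (taylor_coeff g 0) \<le> C * dirichlet_norm f"
        unfolding taylor_coeff_0 g_def mult_op_def norm_mult
        using taylor_coeff_norm_le(2)[OF f, of 0] C(1)[of 0] C0 by (intro mult_mono) (auto simp: taylor_coeff_0)
      from power_mono[OF this, of 2] show ?thesis by (simp add: power_mult_distrib)
    qed
    have "(dirichlet_norm g)\<^sup>2 = (\<Sum>n. (real n + 1) * (cmod (taylor_coeff g n))\<^sup>2)"
      using dirichlet_norm_sums(1)[OF gD] by (simp add: sums_iff)
    also have "\<dots> \<le> (\<Sum>n. 2 * (real n * (cmod (taylor_coeff g n))\<^sup>2) + (if n = 0 then (cmod (taylor_coeff g 0))\<^sup>2 else 0))"
    proof (intro suminf_le dirichlet_spaceD(5)[OF gD] summable_add summable_mult dirichlet_spaceD(4)[OF gD])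
      fix n :: nat
      show "(real n + 1) * (cmod (taylor_coeff g n))\<^sup>2 \<le> 2 * (real n * (cmod (taylor_coeff g n))\<^sup>2) + (if n = 0 then (cmod (taylor_coeff g 0))\<^sup>2 else 0)"
      proof (cases "n = 0")
        case False
        have "(real n + 1) * (cmod (taylor_coeff g n))\<^sup>2 \<le> (2 * real n) * (cmod (taylor_coeff g n))\<^sup>2"
          using False by (intro mult_right_mono) auto
        then show ?thesis using False by simp
      qed simp
    qed (rule summable_finite[of "{0}"], auto)
    also have "\<dots> = 2 * A' + (cmod (taylor_coeff g 0))\<^sup>2"
    proof -
      have "(\<lambda>n. if n = 0 then (cmod (taylor_coeff g 0))\<^sup>2 else 0) sums (cmod (taylor_coeff g 0))\<^sup>2"
        using sums_single[of 0 "\<lambda>_. (cmod (taylor_coeff g 0))\<^sup>2"] by simp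
      from sums_add[OF sums_mult[OF A, of 2] this] show ?thesis by (simp add: sums_iff A'_def)
    qed
    also have "\<dots> \<le> 6 * (C\<^sup>2 * (dirichlet_norm f)\<^sup>2)"
      using A'le tg0 zero_le_power2[of "C * dirichlet_norm f"] unfolding power_mult_distrib by linarith
    finally show ?thesis using gD by (simp add: g_def power_mult_distrib)
  qed
  show ?thesis
  proof (rule that)
    fix f assume f: "f \<in> dirichlet_space"
    show "mult_op m f \<in> dirichlet_space" using * f by blast
    show "dirichlet_norm (mult_op m f) \<le> (sqrt 6 * C) * dirichlet_norm f"
    proof (rule power2_le_imp_le)
      show "(dirichlet_norm (mult_op m f))\<^sup>2 \<le> ((sqrt 6 * C) * dirichlet_norm f)\<^sup>2" using * f by blast
      show "0 \<le> (sqrt 6 * C) * dirichlet_norm f" using C0 f by simp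
    qed
  qed
qed

lemma mult_op_add: "mult_op m (\<lambda>z. f z + g z) = (\<lambda>z. mult_op m f z + mult_op m g z)"
  and mult_op_cmult: "mult_op m (\<lambda>z. c * f z) = (\<lambda>z. c * mult_op m f z)"
  by (auto simp: mult_op_def algebra_simps)

text \<open>The definite description has a solution by Riesz representation, and only one because the inner product is
  definite.\<close>

lemma dirichlet_adjoint:
  assumes m: "dmultiplier m" and g: "g \<in> dirichlet_space"
  shows "dirichlet_adjoint (mult_op m) g \<in> dirichlet_space"
    "f \<in> dirichlet_space \<Longrightarrow> ip (mult_op m f) g = ip f (dirichlet_adjoint (mult_op m) g)"
proof -
  from dmultiplier_bounded[OF m] obtain K where K: "\<And>f. f \<in> dirichlet_space \<Longrightarrow> mult_op m f \<in> dirichlet_space"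
    "\<And>f. f \<in> dirichlet_space \<Longrightarrow> dirichlet_norm (mult_op m f) \<le> K * dirichlet_norm f" by blast
  have "\<exists>h\<in>dirichlet_space. \<forall>f\<in>dirichlet_space. ip (mult_op m f) g = ip f h"
  proof (rule dirichlet_Riesz)
    fix f assume f: "f \<in> dirichlet_space"
    show "ip (mult_op m (\<lambda>z. f z + f' z)) g = ip (mult_op m f) g + ip (mult_op m f') g" if "f' \<in> dirichlet_space" for f'
      using K f g that by (simp add: mult_op_add dirichlet_inner_add_left)
    show "ip (mult_op m (\<lambda>z. c * f z)) g = c * ip (mult_op m f) g" for c
      using K f g by (simp add: mult_op_cmult dirichlet_inner_cmult_left)
    have "cmod (ip (mult_op m f) g) \<le> dirichlet_norm (mult_op m f) * dirichlet_norm g"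
      using K f g by (intro dirichlet_Cauchy_Schwarz)
    also have "\<dots> \<le> (K * dirichlet_norm f) * dirichlet_norm g"
      using K(2)[OF f] g by (intro mult_right_mono) auto
    finally show "cmod (ip (mult_op m f) g) \<le> (K * dirichlet_norm g) * dirichlet_norm f" by (simp add: mult_ac)
  qed
  then obtain h where h: "h \<in> dirichlet_space" "\<forall>f\<in>dirichlet_space. ip (mult_op m f) g = ip f h" by blast
  have "h' = h" if h': "h' \<in> dirichlet_space" "\<forall>f\<in>dirichlet_space. ip (mult_op m f) g = ip f h'" for h'
  proof -
    let ?d = "\<lambda>z. h' z - h z"
    have d: "?d \<in> dirichlet_space" using h h' by (intro dirichlet_space_diff)
    have "ip ?d h' = ip ?d h" using h(2) h'(2) d by metis
    then have "ip ?d ?d = 0" using dirichlet_inner_diff_right[OF h'(1) h(1) d] by simp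
    from fun_cong[OF dirichlet_inner_eq_0D[OF d this]] show ?thesis by auto
  qed
  then have "dirichlet_adjoint (mult_op m) g = h"
    unfolding dirichlet_adjoint_def using h by (intro the_equality) blast+
  with h show "dirichlet_adjoint (mult_op m) g \<in> dirichlet_space"
    "f \<in> dirichlet_space \<Longrightarrow> ip (mult_op m f) g = ip f (dirichlet_adjoint (mult_op m) g)" by auto
qed

text \<open>\<open>M\<close> is invariant under the adjoint exactly if \<open>orth M\<close> is invariant under
  multiplication. In this form the adjoint no longer has to be computed.\<close>

lemma reducing_subspace_iff:
  assumes m: "dmultiplier m"
  shows "reducing_subspace (mult_op m) M \<longleftrightarrow>
    closed_subspace M \<and> (\<forall>f\<in>M. mult_op m f \<in> M) \<and> (\<forall>f\<in>orth M. mult_op m f \<in> orth M)"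
proof (intro iffI conjI ballI)
  assume R: "reducing_subspace (mult_op m) M"
  then have M: "closed_subspace M" and inv: "\<And>f. f \<in> M \<Longrightarrow> mult_op m f \<in> M"
    and ad: "\<And>f. f \<in> M \<Longrightarrow> dirichlet_adjoint (mult_op m) f \<in> M"
    unfolding reducing_subspace_def by auto
  show "closed_subspace M" by fact
  show "mult_op m f \<in> M" if "f \<in> M" for f by (rule inv[OF that])
  fix f assume f: "f \<in> orth M"
  then have fD: "f \<in> dirichlet_space" by (simp add: orth_def)
  have mfD: "mult_op m f \<in> dirichlet_space" using dmultiplier_bounded[OF m] fD by metis
  show "mult_op m f \<in> orth M"
    unfolding orth_def
  proof (intro CollectI conjI ballI mfD)
    fix g assume g: "g \<in> M"
    then have gD: "g \<in> dirichlet_space" using closed_subspaceD(1)[OF M] by blast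
    have "ip (dirichlet_adjoint (mult_op m) g) f = 0" using f ad[OF g] by (simp add: orth_def)
    then have "ip (mult_op m f) g = 0"
      using dirichlet_adjoint[OF m gD] fD dirichlet_inner_cnj[of "dirichlet_adjoint (mult_op m) g" f] by simp
    then show "ip g (mult_op m f) = 0" using dirichlet_inner_cnj[OF mfD gD] by simp
  qed
next
  assume A: "closed_subspace M \<and> (\<forall>f\<in>M. mult_op m f \<in> M) \<and> (\<forall>f\<in>orth M. mult_op m f \<in> orth M)"
  then have M: "closed_subspace M" by simp
  have "dirichlet_adjoint (mult_op m) g \<in> M" if g: "g \<in> M" for g
  proof -
    have gD: "g \<in> dirichlet_space" using g closed_subspaceD(1)[OF M] by blast
    define h where "h = dirichlet_adjoint (mult_op m) g"
    have h: "h \<in> dirichlet_space" "\<And>f. f \<in> dirichlet_space \<Longrightarrow> ip (mult_op m f) g = ip f h"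
      unfolding h_def using dirichlet_adjoint[OF m gD] by auto
    have "h \<in> orth (orth M)"
      unfolding orth_def[of "orth M"]
    proof (intro CollectI conjI ballI h(1))
      fix f assume f: "f \<in> orth M"
      then have fD: "f \<in> dirichlet_space" and mf: "mult_op m f \<in> orth M" using A by (auto simp: orth_def)
      then have "ip g (mult_op m f) = 0" using g by (simp add: orth_def)
      then show "ip f h = 0" using h(2)[OF fD] dirichlet_inner_cnj[OF gD] mf by (simp add: orth_def)
    qed
    then show ?thesis using orth_orth[OF M] by (simp add: h_def)
  qed
  with A show "reducing_subspace (mult_op m) M" by (simp add: reducing_subspace_def)
qed

section \<open>Integrals over circles about the origin\<close>

lemma holomorphic_quotient:
  assumes A: "open A" and f: "f holomorphic_on A" and h: "h holomorphic_on A"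
    and fin: "finite {z\<in>A. h z = 0}"
    and zero: "\<And>z. z \<in> A \<Longrightarrow> h z = 0 \<Longrightarrow> f z = 0 \<and> deriv h z \<noteq> 0"
  obtains q where "q holomorphic_on A" "\<And>z. z \<in> A \<Longrightarrow> f z = h z * q z"
proof -
  define q where "q z = (if h z = 0 then deriv f z / deriv h z else f z / h z)" for z
  have "q holomorphic_on A"
  proof (rule no_isolated_singularity'[OF _ _ A fin])
    fix z assume "z \<in> {z\<in>A. h z = 0}"
    then have z: "z \<in> A" "h z = 0" by auto
    have df: "((\<lambda>w. (f w - f z) / (w - z)) \<longlongrightarrow> deriv f z) (at z)"
      and dh: "((\<lambda>w. (h w - h z) / (w - z)) \<longlongrightarrow> deriv h z) (at z)"
      using holomorphic_derivI[OF f A z(1)] holomorphic_derivI[OF h A z(1)]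
      by (simp_all add: has_field_derivative_iff)
    have "((\<lambda>w. ((f w - f z) / (w - z)) / ((h w - h z) / (w - z))) \<longlongrightarrow> deriv f z / deriv h z) (at z)"
      using zero[OF z] by (intro tendsto_divide df dh) auto
    moreover have "\<forall>\<^sub>F w in at z. ((f w - f z) / (w - z)) / ((h w - h z) / (w - z)) = q w"
    proof -
      have "\<forall>\<^sub>F w in at z. (h w - h z) / (w - z) \<noteq> 0"
        using zero[OF z] by (intro tendsto_imp_eventually_ne[OF dh]) auto
      moreover have "\<forall>\<^sub>F w in at z. w \<noteq> z" by (simp add: eventually_at_filter)
      ultimately show ?thesis
        by eventually_elim (use zero[OF z] z in \<open>auto simp: q_def\<close>)
    qed
    ultimately have "(q \<longlongrightarrow> deriv f z / deriv h z) (at z)"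
      by (rule Lim_transform_eventually)
    then show "(q \<longlongrightarrow> q z) (at z within A)"
      using z by (auto simp: q_def intro: tendsto_within_subset)
  next
    have "(\<lambda>z. f z / h z) holomorphic_on (A - {z\<in>A. h z = 0})"
      by (intro holomorphic_intros holomorphic_on_subset[OF f] holomorphic_on_subset[OF h]) auto
    then show "q holomorphic_on (A - {z\<in>A. h z = 0})"
      by (rule holomorphic_transform) (auto simp: q_def)
  qed
  moreover have "f z = h z * q z" if "z \<in> A" for z
    using zero[OF that] by (auto simp: q_def)
  ultimately show thesis by (rule that)
qed

text \<open>The factor is chosen so that the integral of \<open>f z / z ^ Suc k\<close> is a Taylor coefficient and the
  residue theorem has no constants.\<close>

definition circ_int :: "real \<Rightarrow> (complex \<Rightarrow> complex) \<Rightarrow> complex" where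
  "circ_int r f = contour_integral (circlepath 0 r) f / (2 * of_real pi * \<i>)"

lemma circ_integrable:
  assumes "r > 0" "continuous_on (sphere 0 r) f"
  shows "f contour_integrable_on circlepath 0 r"
  by (rule contour_integrable_continuous_circlepath) (use assms in \<open>simp add: path_image_circlepath\<close>)

lemma circ_int_add:
  assumes "r > 0" "continuous_on (sphere 0 r) f" "continuous_on (sphere 0 r) g"
  shows "circ_int r (\<lambda>z. f z + g z) = circ_int r f + circ_int r g"
  using circ_integrable[OF assms(1,2)] circ_integrable[OF assms(1,3)]
  by (simp add: circ_int_def contour_integral_add add_divide_distrib)

lemma circ_int_diff:
  assumes "r > 0" "continuous_on (sphere 0 r) f" "continuous_on (sphere 0 r) g"
  shows "circ_int r (\<lambda>z. f z - g z) = circ_int r f - circ_int r g"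
  using circ_integrable[OF assms(1,2)] circ_integrable[OF assms(1,3)]
  by (simp add: circ_int_def contour_integral_diff diff_divide_distrib)

lemma circ_int_cmult:
  assumes "r > 0" "continuous_on (sphere 0 r) f"
  shows "circ_int r (\<lambda>z. c * f z) = c * circ_int r f"
  using circ_integrable[OF assms] by (simp add: circ_int_def contour_integral_lmul)

lemma circ_int_sum:
  assumes "r > 0" "finite I" "\<And>i. i \<in> I \<Longrightarrow> continuous_on (sphere 0 r) (f i)"
  shows "circ_int r (\<lambda>z. \<Sum>i\<in>I. f i z) = (\<Sum>i\<in>I. circ_int r (f i))"
  using assms circ_integrable[OF assms(1)] by (simp add: circ_int_def contour_integral_sum sum_divide_distrib)

lemma circ_int_cong:
  assumes "r > 0" "\<And>z. cmod z = r \<Longrightarrow> f z = g z"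
  shows "circ_int r f = circ_int r g"
  unfolding circ_int_def using assms by (subst contour_integral_eq[of "circlepath 0 r" f g]) (auto simp: path_image_circlepath)

lemma circ_int_bound:
  assumes "r > 0" "continuous_on (sphere 0 r) f" "B \<ge> 0" "\<And>z. cmod z = r \<Longrightarrow> cmod (f z) \<le> B"
  shows "cmod (circ_int r f) \<le> r * B"
proof -
  have "cmod (contour_integral (circlepath 0 r) f) \<le> B * (2 * pi * r)"
    using has_contour_integral_bound_circlepath[OF has_contour_integral_integral[OF circ_integrable[OF assms(1,2)]]] assms by auto
  then show ?thesis by (simp add: circ_int_def norm_divide norm_mult field_simps)
qed

lemma circ_int_holomorphic:
  assumes "r > 0" "f holomorphic_on ball 0 R" "r < R"
  shows "circ_int r f = 0"
proof -
  have "(f has_contour_integral 0) (circlepath 0 r)"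
    by (rule Cauchy_theorem_disc_simple[OF assms(2)]) (use assms in \<open>auto simp: path_image_circlepath\<close>)
  then show ?thesis by (simp add: circ_int_def contour_integral_unique)
qed

lemma circ_int_Cauchy:
  assumes "r > 0" "f holomorphic_on ball 0 R" "r < R" "cmod w < r"
  shows "circ_int r (\<lambda>z. f z / (z - w)) = f w"
proof -
  have "f holomorphic_on cball 0 r" using assms by (intro holomorphic_on_subset[OF assms(2)]) auto
  then have "((\<lambda>z. f z / (z - w)) has_contour_integral (2 * of_real pi * \<i> * f w)) (circlepath 0 r)"
    using assms by (intro Cauchy_integral_circlepath_simple) auto
  then show ?thesis by (simp add: circ_int_def contour_integral_unique)
qed

lemma circ_int_annulus:
  assumes f: "f holomorphic_on {z. r < cmod z \<and> cmod z < R}" and s: "0 < s" "r < s" "s \<le> t" "t < R"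
  shows "circ_int s f = circ_int t f"
proof -
  let ?A = "{z. r < cmod z \<and> cmod z < R}"
  have "open ?A" by (intro open_Collect_conj open_Collect_less continuous_intros)
  have "contour_integral (circlepath 0 s) f = contour_integral (circlepath 0 t) f"
  proof (rule Cauchy_theorem_homotopic_loops[OF _ \<open>open ?A\<close> f])
    show "homotopic_loops ?A (circlepath 0 s) (circlepath 0 t)"
    proof (rule homotopic_loops_linear)
      fix x :: real
      show "closed_segment (circlepath 0 s x) (circlepath 0 t x) \<subseteq> ?A"
      proof
        fix y assume "y \<in> closed_segment (circlepath 0 s x) (circlepath 0 t x)"
        then obtain u where u: "0 \<le> u" "u \<le> 1" and y: "y = (1 - u) *\<^sub>R circlepath 0 s x + u *\<^sub>R circlepath 0 t x"
          by (auto simp: closed_segment_def)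
        define v where "v = (1 - u) * s + u * t"
        have "y = of_real v * exp (2 * of_real pi * \<i> * of_real x)"
          unfolding y circlepath v_def by (simp add: scaleR_conv_of_real algebra_simps)
        moreover have "cmod (exp (2 * of_real pi * \<i> * of_real x)) = 1" by simp
        moreover have le: "s \<le> v" "v \<le> t"
          using u s mult_left_mono[of s t u] mult_left_mono[of s t "1 - u"] by (auto simp: algebra_simps v_def)
        ultimately have "cmod y = v" using s by (simp add: norm_mult del: norm_exp_eq_Re)
        then show "y \<in> ?A" using le s by simp
      qed
    qed auto
  qed auto
  then show ?thesis by (simp add: circ_int_def)
qed

lemma circ_int_inverse:
  assumes "r > 0" "cmod w \<noteq> r"
  shows "circ_int r (\<lambda>z. 1 / (z - w)) = (if cmod w < r then 1 else 0)"
proof (cases "cmod w < r")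
  case True
  then show ?thesis using circ_int_Cauchy[of r "\<lambda>_. 1" "r + 1" w] assms by simp
next
  case False
  then have "(\<lambda>z. 1 / (z - w)) holomorphic_on ball 0 (cmod w)" by (intro holomorphic_intros) auto
  then show ?thesis using circ_int_holomorphic[of r _ "cmod w"] False assms by simp
qed

text \<open>Subtracting the principal parts of \<open>f / h\<close> leaves a function holomorphic on the whole annulus,
  whose integral is the same over both circles.\<close>

lemma circ_int_simple_zeros:
  assumes f: "f holomorphic_on {z. r < cmod z \<and> cmod z < R}" and h: "h holomorphic_on {z. r < cmod z \<and> cmod z < R}"
    and s: "0 < s" "r < s" "s < t" "t < R"
    and fin: "finite Z" and Z: "Z = {z. r < cmod z \<and> cmod z < R \<and> h z = 0}"
    and inner: "\<And>\<zeta>. \<zeta> \<in> Z \<Longrightarrow> s < cmod \<zeta> \<and> cmod \<zeta> < t" and simple: "\<And>\<zeta>. \<zeta> \<in> Z \<Longrightarrow> deriv h \<zeta> \<noteq> 0"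
  shows "circ_int t (\<lambda>z. f z / h z) = circ_int s (\<lambda>z. f z / h z) + (\<Sum>\<zeta>\<in>Z. f \<zeta> / deriv h \<zeta>)"
proof -
  let ?A = "{z. r < cmod z \<and> cmod z < R}"
  have A: "open ?A" by (intro open_Collect_conj open_Collect_less continuous_intros)
  have ZA: "Z \<subseteq> ?A" and hZ: "\<And>\<zeta>. \<zeta> \<in> Z \<Longrightarrow> h \<zeta> = 0" using Z by auto
  have "\<forall>\<zeta>\<in>Z. \<exists>k. k holomorphic_on ?A \<and> (\<forall>z\<in>?A. h z = (z - \<zeta>) * k z)"
  proof
    fix \<zeta> assume \<zeta>: "\<zeta> \<in> Z"
    have fz: "finite {z\<in>?A. z - \<zeta> = 0}" by (rule finite_subset[of _ "{\<zeta>}"]) auto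
    show "\<exists>k. k holomorphic_on ?A \<and> (\<forall>z\<in>?A. h z = (z - \<zeta>) * k z)"
    proof (rule holomorphic_quotient[OF A h _ fz])
      fix z assume "z \<in> ?A" "z - \<zeta> = 0"
      moreover have "deriv (\<lambda>z. z - \<zeta>) z = 1" by (rule DERIV_imp_deriv) (auto intro!: derivative_eq_intros)
      ultimately show "h z = 0 \<and> deriv (\<lambda>z. z - \<zeta>) z \<noteq> 0" using hZ[OF \<zeta>] by simp
    qed (auto intro: holomorphic_intros)
  qed
  then obtain k where k: "\<And>\<zeta>. \<zeta> \<in> Z \<Longrightarrow> k \<zeta> holomorphic_on ?A" "\<And>\<zeta> z. \<zeta> \<in> Z \<Longrightarrow> z \<in> ?A \<Longrightarrow> h z = (z - \<zeta>) * k \<zeta> z"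
    by metis
  have k_self: "k \<zeta> \<zeta> = deriv h \<zeta>" if \<zeta>: "\<zeta> \<in> Z" for \<zeta>
  proof -
    have "\<zeta> \<in> ?A" using \<zeta> ZA by blast
    have "((\<lambda>z. (z - \<zeta>) * k \<zeta> z) has_field_derivative (k \<zeta> \<zeta>)) (at \<zeta>)"
      using holomorphic_derivI[OF k(1)[OF \<zeta>] A \<open>\<zeta> \<in> ?A\<close>] by (auto intro!: derivative_eq_intros)
    then have "(h has_field_derivative (k \<zeta> \<zeta>)) (at \<zeta>)"
      by (rule DERIV_cong_ev[THEN iffD1, OF refl _ refl, rotated])
         (use k(2)[OF \<zeta>] eventually_nhds_in_open[OF A \<open>\<zeta> \<in> ?A\<close>] in \<open>auto elim!: eventually_mono\<close>)
    then show ?thesis by (simp add: DERIV_imp_deriv)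
  qed
  have k_other: "k \<zeta> \<xi> = 0" if "\<zeta> \<in> Z" "\<xi> \<in> Z" "\<xi> \<noteq> \<zeta>" for \<zeta> \<xi>
    using k(2)[of \<zeta> \<xi>] hZ[of \<xi>] that ZA by auto
  \<comment> \<open>The residue of \<open>f / h\<close>; with \<open>h z = (z - \<zeta>) * k \<zeta> z\<close> the principal part is \<open>c \<zeta> * k \<zeta> / h\<close>.\<close>
  define c where "c \<zeta> = f \<zeta> / deriv h \<zeta>" for \<zeta>
  define D where "D z = f z - (\<Sum>\<zeta>\<in>Z. c \<zeta> * k \<zeta> z)" for z
  have D: "D holomorphic_on ?A" unfolding D_def by (intro holomorphic_intros f k)
  have DZ: "D \<xi> = 0" if "\<xi> \<in> Z" for \<xi>
  proof -
    have "(\<Sum>\<zeta>\<in>Z. c \<zeta> * k \<zeta> \<xi>) = (\<Sum>\<zeta>\<in>Z. if \<zeta> = \<xi> then f \<xi> else 0)"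
      using that simple[OF that] k_self[OF that] k_other[OF _ that] by (intro sum.cong) (auto simp: c_def)
    then show ?thesis using that fin by (simp add: D_def)
  qed
  have Zeq: "{z\<in>?A. h z = 0} = Z" by (auto simp: Z)
  obtain q where q: "q holomorphic_on ?A" "\<And>z. z \<in> ?A \<Longrightarrow> D z = h z * q z"
    using holomorphic_quotient[OF A D h] fin DZ simple unfolding Zeq using Z by blast
  have qc: "continuous_on (sphere 0 x) q" if "r < x" "x < R" for x
    using that by (intro holomorphic_on_imp_continuous_on holomorphic_on_subset[OF q(1)]) auto
  have eq: "f z / h z = q z + (\<Sum>\<zeta>\<in>Z. c \<zeta> * (1 / (z - \<zeta>)))" if "z \<in> ?A" "z \<notin> Z" for z
  proof -
    have hz: "h z \<noteq> 0" using that Z by auto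
    have "f z = h z * q z + (\<Sum>\<zeta>\<in>Z. c \<zeta> * k \<zeta> z)" using q(2)[OF that(1)] by (simp add: D_def algebra_simps)
    also have "(\<Sum>\<zeta>\<in>Z. c \<zeta> * k \<zeta> z) = h z * (\<Sum>\<zeta>\<in>Z. c \<zeta> * (1 / (z - \<zeta>)))"
      unfolding sum_distrib_left
    proof (rule sum.cong[OF refl])
      fix \<zeta> assume "\<zeta> \<in> Z"
      moreover from this have "z \<noteq> \<zeta>" using that by auto
      ultimately show "c \<zeta> * k \<zeta> z = h z * (c \<zeta> * (1 / (z - \<zeta>)))" using k(2)[of \<zeta> z] that by simp
    qed
    finally show ?thesis using hz by (simp add: field_simps)
  qed
  have I: "circ_int x (\<lambda>z. f z / h z) = circ_int x q + (\<Sum>\<zeta>\<in>Z. c \<zeta> * circ_int x (\<lambda>z. 1 / (z - \<zeta>)))"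
    if x: "0 < x" "r < x" "x < R" "\<And>\<zeta>. \<zeta> \<in> Z \<Longrightarrow> cmod \<zeta> \<noteq> x" for x
  proof -
    have cont: "continuous_on (sphere 0 x) (\<lambda>z. 1 / (z - \<zeta>))" if "\<zeta> \<in> Z" for \<zeta>
      using x(4)[OF that] by (intro continuous_intros) auto
    have "circ_int x (\<lambda>z. f z / h z) = circ_int x (\<lambda>z. q z + (\<Sum>\<zeta>\<in>Z. c \<zeta> * (1 / (z - \<zeta>))))"
    proof (rule circ_int_cong[OF x(1)])
      fix z assume z: "cmod z = x"
      then have "z \<notin> Z" using x(4)[of z] by auto
      with z x show "f z / h z = q z + (\<Sum>\<zeta>\<in>Z. c \<zeta> * (1 / (z - \<zeta>)))" by (intro eq) auto
    qed
    also have "\<dots> = circ_int x q + circ_int x (\<lambda>z. \<Sum>\<zeta>\<in>Z. c \<zeta> * (1 / (z - \<zeta>)))"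
      using x cont by (intro circ_int_add qc continuous_on_sum continuous_on_mult continuous_on_const) auto
    also have "circ_int x (\<lambda>z. \<Sum>\<zeta>\<in>Z. c \<zeta> * (1 / (z - \<zeta>))) = (\<Sum>\<zeta>\<in>Z. circ_int x (\<lambda>z. c \<zeta> * (1 / (z - \<zeta>))))"
      using x cont fin by (intro circ_int_sum continuous_on_mult continuous_on_const) auto
    also have "\<dots> = (\<Sum>\<zeta>\<in>Z. c \<zeta> * circ_int x (\<lambda>z. 1 / (z - \<zeta>)))"
      using x cont by (intro sum.cong circ_int_cmult) auto
    finally show ?thesis .
  qed
  have "circ_int s q = circ_int t q" using circ_int_annulus[OF q(1)] s by simp
  moreover have "(\<Sum>\<zeta>\<in>Z. c \<zeta> * circ_int t (\<lambda>z. 1 / (z - \<zeta>))) = (\<Sum>\<zeta>\<in>Z. f \<zeta> / deriv h \<zeta>)"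
    using inner s by (intro sum.cong) (auto simp: circ_int_inverse c_def less_imp_neq)
  moreover have "(\<Sum>\<zeta>\<in>Z. c \<zeta> * circ_int s (\<lambda>z. 1 / (z - \<zeta>))) = 0"
    using inner s by (intro sum.neutral ballI) (force simp: circ_int_inverse)
  ultimately show ?thesis
    using I[of s] I[of t] inner s by force
qed

text \<open>Expand \<open>1 / (1 - u)\<close> geometrically: the partial sums integrate to zero and the remainder is of
  order \<open>\<theta> ^ K\<close>.\<close>

lemma circ_int_geometric:
  assumes r: "r > 0" and g: "continuous_on (sphere 0 r) g" and u: "continuous_on (sphere 0 r) u"
    and \<theta>: "\<theta> < 1" and le: "\<And>z. cmod z = r \<Longrightarrow> cmod (u z) \<le> \<theta>"
    and zero: "\<And>k::nat. circ_int r (\<lambda>z. g z * u z ^ k) = 0"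
  shows "circ_int r (\<lambda>z. g z / (1 - u z)) = 0"
proof -
  have \<theta>0: "\<theta> \<ge> 0" using order_trans[OF norm_ge_zero le[of "of_real r"]] r by simp
  have ne: "1 - u z \<noteq> 0" if "cmod z = r" for z using le[OF that] \<theta> by auto
  have cont: "continuous_on (sphere 0 r) (\<lambda>z. g z / (1 - u z))"
    by (intro continuous_intros g u) (use ne in auto)
  have "bounded ((\<lambda>z. g z / (1 - u z)) ` sphere 0 r)" by (intro compact_imp_bounded compact_continuous_image cont) simp
  then obtain B where "\<forall>y\<in>(\<lambda>z. g z / (1 - u z)) ` sphere 0 r. cmod y \<le> B"
    unfolding bounded_iff by blast
  then have B: "cmod (g z / (1 - u z)) \<le> B" if "cmod z = r" for z using that by auto
  have B0: "B \<ge> 0" using order_trans[OF norm_ge_zero B[of "of_real r"]] r by simp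
  have "cmod (circ_int r (\<lambda>z. g z / (1 - u z))) \<le> r * B * \<theta> ^ K" for K
  proof -
    have "circ_int r (\<lambda>z. g z / (1 - u z)) = circ_int r (\<lambda>z. (\<Sum>k<K. g z * u z ^ k) + g z / (1 - u z) * u z ^ K)"
    proof (rule circ_int_cong[OF r])
      fix z assume z: "cmod z = r"
      have "(\<Sum>k<K. u z ^ k) * (1 - u z) = 1 - u z ^ K"
        by (metis mult.commute one_diff_power_eq)
      then have "1 / (1 - u z) = (\<Sum>k<K. u z ^ k) + u z ^ K / (1 - u z)" using ne[OF z] by (simp add: field_simps)
      then have e: "g z * (1 / (1 - u z)) = g z * (\<Sum>k<K. u z ^ k) + g z * (u z ^ K / (1 - u z))" by (simp only: distrib_left)
      have "g z * (1 / (1 - u z)) = g z / (1 - u z)" "g z * (u z ^ K / (1 - u z)) = g z / (1 - u z) * u z ^ K" by simp_all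
      from e[unfolded this sum_distrib_left] show "g z / (1 - u z) = (\<Sum>k<K. g z * u z ^ k) + g z / (1 - u z) * u z ^ K" .
    qed
    also have "\<dots> = (\<Sum>k<K. circ_int r (\<lambda>z. g z * u z ^ k)) + circ_int r (\<lambda>z. g z / (1 - u z) * u z ^ K)"
      by (subst circ_int_add[OF r], intro continuous_intros g u, intro continuous_on_mult cont continuous_on_power u)
         (subst circ_int_sum[OF r]; auto intro!: continuous_intros g u)
    also have "\<dots> = circ_int r (\<lambda>z. g z / (1 - u z) * u z ^ K)" using zero by simp
    finally have "circ_int r (\<lambda>z. g z / (1 - u z)) = circ_int r (\<lambda>z. g z / (1 - u z) * u z ^ K)" .
    moreover have "cmod (circ_int r (\<lambda>z. g z / (1 - u z) * u z ^ K)) \<le> r * (B * \<theta> ^ K)"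
    proof (rule circ_int_bound[OF r])
      show "continuous_on (sphere 0 r) (\<lambda>z. g z / (1 - u z) * u z ^ K)" by (intro continuous_on_mult cont continuous_on_power u)
      show "0 \<le> B * \<theta> ^ K" using B0 \<theta>0 by simp
      show "cmod (g z / (1 - u z) * u z ^ K) \<le> B * \<theta> ^ K" if "cmod z = r" for z
        unfolding norm_mult norm_power by (intro mult_mono B power_mono le that) (use B0 in auto)
    qed
    ultimately show ?thesis by (simp add: mult_ac)
  qed
  moreover have "(\<lambda>K. r * B * \<theta> ^ K) \<longlonglongrightarrow> r * B * 0"
    using \<theta> \<theta>0 by (intro tendsto_intros LIMSEQ_power_zero) auto
  ultimately have "cmod (circ_int r (\<lambda>z. g z / (1 - u z))) \<le> r * B * 0"
    by (intro LIMSEQ_le_const) auto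
  then show ?thesis by simp
qed

section \<open>Finite Blaschke products on the circle\<close>

text \<open>The modulus of \<open>disc_aut w\<close> compares with \<open>1\<close> as the modulus of its argument does.\<close>

lemma disc_aut_norm_identity:
  "(cmod (1 - cnj w * z))\<^sup>2 - (cmod (w - z))\<^sup>2 = (1 - (cmod w)\<^sup>2) * (1 - (cmod z)\<^sup>2)"
proof -
  have "complex_of_real ((cmod (1 - cnj w * z))\<^sup>2 - (cmod (w - z))\<^sup>2) = complex_of_real ((1 - (cmod w)\<^sup>2) * (1 - (cmod z)\<^sup>2))"
    by (simp only: of_real_diff of_real_mult complex_norm_square of_real_1) (simp add: algebra_simps)
  then show ?thesis by (simp only: of_real_eq_iff)
qed

lemma disc_aut_norm:
  assumes w: "cmod w < 1" and ne: "1 - cnj w * z \<noteq> 0"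
  shows "cmod z < 1 \<Longrightarrow> cmod (disc_aut w z) < 1" "cmod z = 1 \<Longrightarrow> cmod (disc_aut w z) = 1"
    "cmod z > 1 \<Longrightarrow> cmod (disc_aut w z) > 1"
proof -
  have pos: "cmod (1 - cnj w * z) > 0" using ne by simp
  have w2: "1 - (cmod w)\<^sup>2 > 0" using w by (simp add: power_less_one_iff abs_square_less_1)
  note id = disc_aut_norm_identity[of w z]
  show "cmod (disc_aut w z) < 1" if "cmod z < 1"
  proof -
    have "1 - (cmod z)\<^sup>2 > 0" using that by (simp add: abs_square_less_1)
    then have "(cmod (w - z))\<^sup>2 < (cmod (1 - cnj w * z))\<^sup>2" using w2 id mult_pos_pos[of "1 - (cmod w)\<^sup>2" "1 - (cmod z)\<^sup>2"] by linarith
    then have "cmod (w - z) < cmod (1 - cnj w * z)" by (rule power2_less_imp_less) simp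
    then show ?thesis using pos by (simp add: disc_aut_def norm_divide)
  qed
  show "cmod (disc_aut w z) = 1" if "cmod z = 1"
  proof -
    have "(cmod (1 - cnj w * z))\<^sup>2 = (cmod (w - z))\<^sup>2" using id that by simp
    then have "cmod (1 - cnj w * z) = cmod (w - z)" by (rule power2_eq_imp_eq) auto
    then show ?thesis using pos by (simp add: disc_aut_def norm_divide)
  qed
  show "cmod (disc_aut w z) > 1" if "cmod z > 1"
  proof -
    have "(cmod z)\<^sup>2 - 1 > 0" using that by (simp add: one_less_power)
    then have "(1 - (cmod w)\<^sup>2) * ((cmod z)\<^sup>2 - 1) > 0" using w2 by (rule mult_pos_pos[rotated])
    then have "(cmod (1 - cnj w * z))\<^sup>2 < (cmod (w - z))\<^sup>2" using id by (simp add: algebra_simps)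
    then have "cmod (1 - cnj w * z) < cmod (w - z)" by (rule power2_less_imp_less) simp
    then show ?thesis using pos by (simp add: disc_aut_def norm_divide)
  qed
qed

lemma disc_aut_has_derivative:
  assumes "1 - cnj w * z \<noteq> 0"
  shows "(disc_aut w has_field_derivative (- (1 - of_real ((cmod w)\<^sup>2)) / (1 - cnj w * z)\<^sup>2)) (at z)"
proof -
  have "((\<lambda>z. (w - z) / (1 - cnj w * z)) has_field_derivative ((-1) * (1 - cnj w * z) - (w - z) * (- cnj w)) / ((1 - cnj w * z) * (1 - cnj w * z))) (at z)"
    using assms by (auto intro!: derivative_eq_intros)
  moreover have "(-1) * (1 - cnj w * z) - (w - z) * (- cnj w) = - (1 - of_real ((cmod w)\<^sup>2))"
    by (simp only: complex_norm_square) (simp add: algebra_simps)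
  ultimately show ?thesis by (simp only: disc_aut_def[abs_def] power2_eq_square)
qed

text \<open>The radius \<open>R\<close> leaves room on both sides of the unit circle: all zeros have modulus less than
  \<open>1 / R\<close>, all poles modulus greater than \<open>R\<close>, so the product is holomorphic on the
  disc of radius \<open>R\<close> and without zeros on the annulus from \<open>1 / R\<close> to
  \<open>R\<close>. Lowering \<open>R\<close> is always possible (\<open>blaschke_shrink\<close> below), and the
  proofs use this to make further functions holomorphic.\<close>

locale blaschke =
  fixes lam :: "nat \<Rightarrow> complex" and n :: nat and c :: complex and R :: real
  assumes n: "n \<ge> 1" and c: "cmod c = 1" and R: "R > 1" and lamR: "i < n \<Longrightarrow> cmod (lam i) * R < 1"
begin

definition phi :: "complex \<Rightarrow> complex" where
  "phi z = c * (\<Prod>i<n. disc_aut (lam i) z)"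

text \<open>A fibre over a point of the unit circle lies on the unit circle, and only such fibres are used.\<close>

definition fib :: "complex \<Rightarrow> complex set" where
  "fib w = {z. cmod z = 1 \<and> phi z = w}"

lemma lam_lt: "i < n \<Longrightarrow> cmod (lam i) < 1"
  using lamR[of i] R by (smt (verit) mult_le_cancel_left1 norm_ge_zero)

lemma lam_lt': "i < n \<Longrightarrow> cmod (lam i) < 1 / R"
  using lamR[of i] R by (simp add: field_simps)

lemma denom:
  assumes "i < n" "cmod z < R" shows "1 - cnj (lam i) * z \<noteq> 0"
proof
  assume "1 - cnj (lam i) * z = 0"
  then have "cmod (cnj (lam i) * z) = 1" by simp
  then have "cmod (lam i) * cmod z = 1" by (simp add: norm_mult)
  moreover have "cmod (lam i) * cmod z \<le> cmod (lam i) * R" using assms by (intro mult_left_mono) auto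
  ultimately show False using lamR[OF assms(1)] by simp
qed

lemma disc_aut_lam_has_derivative:
  "i < n \<Longrightarrow> cmod z < R \<Longrightarrow> (disc_aut (lam i) has_field_derivative (- (1 - of_real ((cmod (lam i))\<^sup>2)) / (1 - cnj (lam i) * z)\<^sup>2)) (at z)"
  by (rule disc_aut_has_derivative[OF denom])

lemma phi_holo: "phi holomorphic_on ball 0 R"
  unfolding phi_def[abs_def] disc_aut_def by (intro holomorphic_intros) (use denom in auto)

lemma phi_holo_subset: "A \<subseteq> ball 0 R \<Longrightarrow> phi holomorphic_on A"
  by (rule holomorphic_on_subset[OF phi_holo])

lemma phi_norm_remove: "cmod (phi z) = cmod (disc_aut (lam 0) z) * (\<Prod>i\<in>{..<n}-{0}. cmod (disc_aut (lam i) z))"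
proof -
  have "0 \<in> {..<n}" using n by simp
  then show ?thesis by (simp add: phi_def norm_mult c prod_norm[symmetric] prod.remove)
qed

lemma phi_lt: "cmod z < 1 \<Longrightarrow> cmod (phi z) < 1"
proof -
  assume z: "cmod z < 1"
  have d: "cmod (disc_aut (lam i) z) < 1" if "i < n" for i
    using disc_aut_norm(1)[OF lam_lt denom z] that z R by simp
  have "(\<Prod>i\<in>{..<n}-{0}. cmod (disc_aut (lam i) z)) \<le> 1" using d by (intro prod_le_1) (auto intro: less_imp_le)
  then have "cmod (disc_aut (lam 0) z) * (\<Prod>i\<in>{..<n}-{0}. cmod (disc_aut (lam i) z)) \<le> cmod (disc_aut (lam 0) z) * 1"
    by (intro mult_left_mono) auto
  then show ?thesis using phi_norm_remove[of z] d[of 0] n by simp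
qed

lemma phi_eq1: "cmod z = 1 \<Longrightarrow> cmod (phi z) = 1"
  using disc_aut_norm(2)[OF lam_lt denom] R by (simp add: phi_def norm_mult c prod_norm[symmetric])

lemma phi_gt: "cmod z > 1 \<Longrightarrow> cmod z < R \<Longrightarrow> cmod (phi z) > 1"
proof -
  assume z: "cmod z > 1" "cmod z < R"
  have d: "cmod (disc_aut (lam i) z) > 1" if "i < n" for i
    using disc_aut_norm(3)[OF lam_lt denom z(1)] that z by simp
  have "(\<Prod>i\<in>{..<n}-{0}. cmod (disc_aut (lam i) z)) \<ge> 1" using d by (intro prod_ge_1) (auto intro: less_imp_le)
  then have "cmod (disc_aut (lam 0) z) * (\<Prod>i\<in>{..<n}-{0}. cmod (disc_aut (lam i) z)) \<ge> cmod (disc_aut (lam 0) z) * 1"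
    by (intro mult_left_mono) auto
  then show ?thesis using phi_norm_remove[of z] d[of 0] n by simp
qed

lemma phi_zero_iff: "cmod z < R \<Longrightarrow> phi z = 0 \<longleftrightarrow> (\<exists>i<n. z = lam i)"
  using c denom by (auto simp: phi_def disc_aut_def)

lemma phi_nonzero: "1 / R \<le> cmod z \<Longrightarrow> cmod z < R \<Longrightarrow> phi z \<noteq> 0"
  using phi_zero_iff[of z] lam_lt' by force

lemma phi_logderiv:
  assumes z: "cmod z < R" and nz: "phi z \<noteq> 0"
  shows "deriv phi z = phi z * (\<Sum>i<n. 1 / (z - lam i) + cnj (lam i) / (1 - cnj (lam i) * z))"
proof -
  have ne: "z \<noteq> lam i" if "i < n" for i using nz phi_zero_iff[OF z] that by auto
  have "((\<lambda>z. \<Prod>i<n. disc_aut (lam i) z) has_field_derivative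
     (\<Prod>i<n. disc_aut (lam i) z) * (\<Sum>i<n. (- (1 - of_real ((cmod (lam i))\<^sup>2)) / (1 - cnj (lam i) * z)\<^sup>2) / disc_aut (lam i) z)) (at z)"
  proof (rule has_field_derivative_prod'[where f = "\<lambda>i. disc_aut (lam i)"])
    fix i assume i: "i \<in> {..<n}"
    then show "disc_aut (lam i) z \<noteq> 0" using ne[of i] denom[OF _ z, of i] by (simp add: disc_aut_def)
    show "(disc_aut (lam i) has_field_derivative (- (1 - of_real ((cmod (lam i))\<^sup>2)) / (1 - cnj (lam i) * z)\<^sup>2)) (at z)"
      using i by (intro disc_aut_lam_has_derivative[OF _ z]) simp
  qed
  then have "(phi has_field_derivative c * ((\<Prod>i<n. disc_aut (lam i) z) * (\<Sum>i<n. (- (1 - of_real ((cmod (lam i))\<^sup>2)) / (1 - cnj (lam i) * z)\<^sup>2) / disc_aut (lam i) z))) (at z)"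
    unfolding phi_def[abs_def] by (rule DERIV_cmult)
  moreover have "(- (1 - of_real ((cmod (lam i))\<^sup>2)) / (1 - cnj (lam i) * z)\<^sup>2) / disc_aut (lam i) z = 1 / (z - lam i) + cnj (lam i) / (1 - cnj (lam i) * z)" if "i < n" for i
  proof -
    have d: "1 - cnj (lam i) * z \<noteq> 0" "z - lam i \<noteq> 0" "lam i - z \<noteq> 0" using denom[OF that z] ne[OF that] by auto
    have "(- (1 - of_real ((cmod (lam i))\<^sup>2)) / (1 - cnj (lam i) * z)\<^sup>2) / disc_aut (lam i) z = - (1 - lam i * cnj (lam i)) / ((1 - cnj (lam i) * z) * (lam i - z))"
      using d by (simp only: complex_norm_square) (simp add: disc_aut_def power2_eq_square)
    also have "\<dots> = (1 - lam i * cnj (lam i)) / ((1 - cnj (lam i) * z) * (z - lam i))"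
      by (metis minus_diff_eq minus_divide_divide mult_minus_right)
    also have "\<dots> = 1 / (z - lam i) + cnj (lam i) / (1 - cnj (lam i) * z)"
      using d by (simp add: add_frac_eq algebra_simps)
    finally show ?thesis .
  qed
  ultimately have "(phi has_field_derivative phi z * (\<Sum>i<n. 1 / (z - lam i) + cnj (lam i) / (1 - cnj (lam i) * z))) (at z)"
    by (simp add: phi_def mult.assoc)
  then show ?thesis by (rule DERIV_imp_deriv)
qed

text \<open>On the unit circle this is \<open>z * phi' z / phi z\<close>, the derivative of the argument of
  \<open>phi\<close> along the circle: a sum of Poisson kernels at the zeros, hence positive.\<close>

definition speed :: "complex \<Rightarrow> real" where
  "speed z = (\<Sum>i<n. (1 - (cmod (lam i))\<^sup>2) / (cmod (z - lam i))\<^sup>2)"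

lemma speed_pos: "cmod z = 1 \<Longrightarrow> speed z > 0"
  unfolding speed_def
proof (rule sum_pos)
  fix i assume z: "cmod z = 1" and i: "i \<in> {..<n}"
  then have "z - lam i \<noteq> 0" using lam_lt[of i] by auto
  then show "(1 - (cmod (lam i))\<^sup>2) / (cmod (z - lam i))\<^sup>2 > 0"
    using lam_lt[of i] i by (simp add: abs_square_less_1)
qed (use n in \<open>auto simp: lessThan_empty_iff\<close>)

text \<open>Logarithmic differentiation; on the circle the two fractions of each factor add up to a Poisson kernel.\<close>

lemma phi_deriv_circle:
  assumes z: "cmod z = 1"
  shows "z * deriv phi z = phi z * of_real (speed z)"
proof -
  have zz: "z * cnj z = 1" using z by (simp add: complex_norm_square[symmetric])
  have "z * (1 / (z - lam i) + cnj (lam i) / (1 - cnj (lam i) * z)) = of_real ((1 - (cmod (lam i))\<^sup>2) / (cmod (z - lam i))\<^sup>2)" if i: "i < n" for i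
  proof -
    have d: "z - lam i \<noteq> 0" using z lam_lt[OF i] by auto
    then have d': "cnj z - cnj (lam i) \<noteq> 0" by (metis complex_cnj_diff complex_cnj_zero_iff)
    have z0: "z \<noteq> 0" using z by auto
    have e: "1 - cnj (lam i) * z = z * (cnj z - cnj (lam i))" using zz by (simp add: algebra_simps)
    have "z * (1 / (z - lam i) + cnj (lam i) / (1 - cnj (lam i) * z)) = z / (z - lam i) + cnj (lam i) / (cnj z - cnj (lam i))"
      unfolding e using z0 by (simp add: distrib_left)
    also have "\<dots> = (z * (cnj z - cnj (lam i)) + cnj (lam i) * (z - lam i)) / ((z - lam i) * (cnj z - cnj (lam i)))"
      using d d' by (simp add: add_frac_eq mult_ac)
    also have "z * (cnj z - cnj (lam i)) + cnj (lam i) * (z - lam i) = 1 - lam i * cnj (lam i)"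
      using zz by (simp add: algebra_simps)
    also have "(1 - lam i * cnj (lam i)) / ((z - lam i) * (cnj z - cnj (lam i))) = of_real ((1 - (cmod (lam i))\<^sup>2) / (cmod (z - lam i))\<^sup>2)"
      by (simp only: of_real_divide of_real_diff complex_norm_square of_real_1 complex_cnj_diff)
    finally show ?thesis .
  qed
  then have A: "z * (\<Sum>i<n. 1 / (z - lam i) + cnj (lam i) / (1 - cnj (lam i) * z)) = of_real (speed z)"
    unfolding sum_distrib_left speed_def of_real_sum by (intro sum.cong) auto
  have "phi z \<noteq> 0" using phi_eq1[OF z] by auto
  then have "deriv phi z = phi z * (\<Sum>i<n. 1 / (z - lam i) + cnj (lam i) / (1 - cnj (lam i) * z))"
    using z R by (intro phi_logderiv) auto
  then have "z * deriv phi z = phi z * (z * (\<Sum>i<n. 1 / (z - lam i) + cnj (lam i) / (1 - cnj (lam i) * z)))"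
    by (simp only: mult.left_commute)
  then show ?thesis unfolding A .
qed

lemma phi_deriv_nonzero: "cmod z = 1 \<Longrightarrow> deriv phi z \<noteq> 0"
  using phi_deriv_circle[of z] speed_pos[of z] phi_eq1[of z] by force

lemma fib_circle: "z \<in> fib w \<Longrightarrow> cmod z = 1"
  by (simp add: fib_def)

lemma phi_circle_iff: "cmod z < R \<Longrightarrow> cmod (phi z) = 1 \<longleftrightarrow> cmod z = 1"
  using phi_lt[of z] phi_gt[of z] phi_eq1[of z] by linarith

lemma fib_self: "cmod z = 1 \<Longrightarrow> z \<in> fib (phi z)"
  using R by (auto simp: fib_def)

text \<open>A point of the fibre is a root of the polynomial of degree at most \<open>n\<close> obtained by clearing
  denominators in \<open>phi z = w\<close>.\<close>

lemma fib_finite_card: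
  assumes w: "cmod w = 1"
  shows "finite (fib w)" "card (fib w) \<le> n"
proof -
  define P where "P = smult c (\<Prod>i<n. [:lam i, -1:])"
  define Q where "Q = (\<Prod>i<n. [:1, - cnj (lam i):])"
  have PQ: "poly P z = poly Q z * phi z" if "cmod z < R" for z
  proof -
    have "(\<Prod>i<n. lam i - z) = (\<Prod>i<n. 1 - cnj (lam i) * z) * (\<Prod>i<n. disc_aut (lam i) z)"
      unfolding prod.distrib[symmetric] using denom[OF _ that] by (intro prod.cong) (auto simp: disc_aut_def)
    then show ?thesis by (simp add: P_def Q_def poly_prod phi_def mult_ac)
  qed
  have Qnz: "poly Q z \<noteq> 0" if "cmod z < R" for z
    using denom[OF _ that] by (auto simp: Q_def poly_prod mult.commute)
  define p where "p = P - smult w Q"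
  have pz: "poly p z = poly Q z * (phi z - w)" if "cmod z < R" for z
    using PQ[OF that] by (simp add: p_def algebra_simps)
  have "phi 0 \<noteq> w" using phi_lt[of 0] w by auto
  then have "poly p 0 \<noteq> 0" using pz[of 0] Qnz[of 0] R by simp
  then have p0: "p \<noteq> 0" by auto
  have sub: "fib w \<subseteq> {z. poly p z = 0}" using pz R by (auto simp: fib_def)
  have deg: "degree (\<Prod>i<n. f i) \<le> n" if "\<And>i. degree (f i) \<le> 1" for f :: "nat \<Rightarrow> complex poly"
  proof -
    have "degree (\<Prod>i<n. f i) \<le> (\<Sum>i<n. degree (f i))" using degree_prod_sum_le[of "{..<n}" f] by (simp add: o_def)
    also have "\<dots> \<le> (\<Sum>i<n. 1)" by (intro sum_mono that)
    finally show ?thesis by simp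
  qed
  have "degree P \<le> n" unfolding P_def by (intro order_trans[OF degree_smult_le] deg) simp
  moreover have "degree (smult w Q) \<le> n" unfolding Q_def by (intro order_trans[OF degree_smult_le] deg) simp
  ultimately have "degree p \<le> n" unfolding p_def by (intro degree_diff_le)
  moreover have "card {z. poly p z = 0} \<le> degree p" by (rule card_poly_roots_bound[OF p0])
  moreover have fin: "finite {z. poly p z = 0}" by (rule poly_roots_finite[OF p0])
  ultimately show "finite (fib w)" "card (fib w) \<le> n"
    using sub finite_subset[OF sub fin] card_mono[OF fin sub] by auto
qed

lemma deriv_phi_diff:
  assumes "\<zeta> \<in> fib w" "cmod w = 1"
  shows "deriv (\<lambda>z. phi z - w) \<zeta> = deriv phi \<zeta>"
proof (rule DERIV_imp_deriv)
  have "\<zeta> \<in> ball 0 R" using assms(1) R by (simp add: fib_def)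
  then have "(phi has_field_derivative deriv phi \<zeta>) (at \<zeta>)" by (rule holomorphic_derivI[OF phi_holo open_ball])
  from DERIV_diff[OF this DERIV_const[of w]] show "((\<lambda>z. phi z - w) has_field_derivative deriv phi \<zeta>) (at \<zeta>)" by simp
qed

lemma fib_annulus:
  assumes w: "cmod w = 1"
  shows "fib w = {z. 1 / R < cmod z \<and> cmod z < R \<and> phi z - w = 0}"
proof (rule set_eqI)
  fix z
  show "z \<in> fib w \<longleftrightarrow> z \<in> {z. 1 / R < cmod z \<and> cmod z < R \<and> phi z - w = 0}"
    using phi_circle_iff[of z] R w by (auto simp: fib_def)
qed

lemma open_annulus: "open {z::complex. a < cmod z \<and> cmod z < b}"
  by (intro open_Collect_conj open_Collect_less continuous_intros)

text \<open>The fibre sum is the sum of the residues of \<open>Y / (phi - w)\<close> between two circles on either side of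
  the unit circle. There \<open>1 / (phi - w)\<close> expands in nonnegative and in negative powers of
  \<open>phi\<close> respectively, so both integrals vanish term by term.\<close>

lemma fibre_sum_zero:
  assumes Y: "Y holomorphic_on {z. 1 / R < cmod z \<and> cmod z < R}" and w: "cmod w = 1"
    and mom: "\<And>j::int. circ_int 1 (\<lambda>z. Y z * phi z powi j) = 0"
  shows "(\<Sum>\<zeta>\<in>fib w. Y \<zeta> / deriv phi \<zeta>) = 0"
proof -
  let ?A = "{z. 1 / R < cmod z \<and> cmod z < R}"
  obtain s where s: "1 / R < s" "s < 1" using R dense[of "1 / R" 1] by auto
  obtain t where t: "1 < t" "t < R" using R dense by blast
  have s0: "s > 0" using s R by (smt (verit) divide_pos_pos)
  have AR: "?A \<subseteq> ball 0 R" by auto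
  have w0: "w \<noteq> 0" using w by auto
  have nz: "phi z \<noteq> 0" if "z \<in> ?A" for z using that phi_nonzero by auto
  have mom': "circ_int x (\<lambda>z. Y z * phi z powi j) = 0" if "0 < x" "1 / R < x" "x < R" for x and j :: int
  proof -
    have hol: "(\<lambda>z. Y z * phi z powi j) holomorphic_on ?A"
      using nz by (intro holomorphic_intros Y phi_holo_subset AR) auto
    show ?thesis
    proof (cases "x \<le> 1")
      case True
      then show ?thesis using circ_int_annulus[OF hol, of x 1] that R mom[of j] by simp
    next
      case False
      then show ?thesis using circ_int_annulus[OF hol, of 1 x] that R mom[of j] by (simp add: divide_less_eq)
    qed
  qed
  have contY: "continuous_on (sphere 0 x) Y" and contphi: "continuous_on (sphere 0 x) phi" if "1 / R < x" "x < R" for x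
    using that by (auto intro!: holomorphic_on_imp_continuous_on holomorphic_on_subset[OF Y] phi_holo_subset)
  have bd: "\<exists>B<1. \<forall>z. cmod z = x \<longrightarrow> cmod (u z) \<le> B" if "continuous_on (sphere 0 x) u" "x > 0" "\<And>z. cmod z = x \<Longrightarrow> cmod (u z) < 1"
    for x and u :: "complex \<Rightarrow> complex"
  proof -
    have ne: "of_real x \<in> sphere (0::complex) x" using that by auto
    have "\<exists>z0\<in>sphere 0 x. \<forall>y\<in>sphere 0 x. cmod (u y) \<le> cmod (u z0)"
      by (rule continuous_attains_sup) (use ne that in \<open>auto intro!: continuous_intros\<close>)
    then obtain z0 where "cmod z0 = x" "\<And>y. cmod y = x \<Longrightarrow> cmod (u y) \<le> cmod (u z0)" by auto
    then show ?thesis using that(3)[of z0] by blast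
  qed
  have inner: "circ_int s (\<lambda>z. Y z / (phi z - w)) = 0"
  proof -
    have c: "continuous_on (sphere 0 s) (\<lambda>z. phi z / w)" using contphi[of s] s R w0 by (intro continuous_intros) auto
    have lt: "cmod (phi z / w) < 1" if "cmod z = s" for z using phi_lt[of z] that s w by (simp add: norm_divide)
    from bd[OF c s0 lt] obtain B where B: "B < 1" "\<And>z. cmod z = s \<Longrightarrow> cmod (phi z / w) \<le> B" by blast
    have "circ_int s (\<lambda>z. (- Y z / w) / (1 - phi z / w)) = 0"
    proof (rule circ_int_geometric[OF s0 _ c B])
      show "continuous_on (sphere 0 s) (\<lambda>z. - Y z / w)" using contY[of s] s R w0 by (intro continuous_intros) auto
      show "circ_int s (\<lambda>z. - Y z / w * (phi z / w) ^ k) = 0" for k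
      proof -
        have "circ_int s (\<lambda>z. - Y z / w * (phi z / w) ^ k) = circ_int s (\<lambda>z. (- 1 / w ^ Suc k) * (Y z * phi z powi int k))"
          by (rule circ_int_cong[OF s0]) (simp add: power_divide)
        also have "\<dots> = (- 1 / w ^ Suc k) * circ_int s (\<lambda>z. Y z * phi z powi int k)"
          using contY[of s] contphi[of s] s R by (intro circ_int_cmult s0) (auto intro!: continuous_intros)
        finally show ?thesis using mom'[of s "int k"] s s0 R by simp
      qed
    qed
    also have "circ_int s (\<lambda>z. (- Y z / w) / (1 - phi z / w)) = circ_int s (\<lambda>z. Y z / (phi z - w))"
    proof (rule circ_int_cong[OF s0])
      fix z assume "cmod z = s"
      then have "phi z \<noteq> w" using phi_lt[of z] s w by auto
      then show "(- Y z / w) / (1 - phi z / w) = Y z / (phi z - w)" using w0 by (simp add: divide_simps) (simp add: algebra_simps)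
    qed
    finally show ?thesis .
  qed
  have outer: "circ_int t (\<lambda>z. Y z / (phi z - w)) = 0"
  proof -
    have t0: "t > 0" using t by simp
    have tR: "1 / R < t" using t R by (smt (verit) divide_less_eq_1_pos)
    have pn: "phi z \<noteq> 0" if "cmod z = t" for z using nz[of z] that tR t by auto
    have c: "continuous_on (sphere 0 t) (\<lambda>z. w / phi z)" using contphi[of t] tR t pn by (intro continuous_intros) auto
    have lt: "cmod (w / phi z) < 1" if "cmod z = t" for z using phi_gt[of z] that t w by (simp add: norm_divide divide_less_eq)
    from bd[OF c t0 lt] obtain B where B: "B < 1" "\<And>z. cmod z = t \<Longrightarrow> cmod (w / phi z) \<le> B" by blast
    have "circ_int t (\<lambda>z. (Y z / phi z) / (1 - w / phi z)) = 0"
    proof (rule circ_int_geometric[OF t0 _ c B])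
      show "continuous_on (sphere 0 t) (\<lambda>z. Y z / phi z)" using contY[of t] contphi[of t] tR t pn by (intro continuous_intros) auto
      show "circ_int t (\<lambda>z. Y z / phi z * (w / phi z) ^ k) = 0" for k
      proof -
        have "circ_int t (\<lambda>z. Y z / phi z * (w / phi z) ^ k) = circ_int t (\<lambda>z. w ^ k * (Y z * phi z powi (- int (Suc k))))"
          by (rule circ_int_cong[OF t0]) (simp add: power_divide power_int_minus power_int_of_nat field_simps del: of_nat_Suc)
        also have "\<dots> = w ^ k * circ_int t (\<lambda>z. Y z * phi z powi (- int (Suc k)))"
          using contY[of t] contphi[of t] tR t pn by (intro circ_int_cmult t0) (auto intro!: continuous_intros)
        finally show ?thesis using mom'[of t "- int (Suc k)"] t tR t0 by simp
      qed
    qed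
    also have "circ_int t (\<lambda>z. (Y z / phi z) / (1 - w / phi z)) = circ_int t (\<lambda>z. Y z / (phi z - w))"
    proof (rule circ_int_cong[OF t0])
      fix z assume z: "cmod z = t"
      then have "phi z \<noteq> w" using phi_gt[of z] t w by auto
      then show "(Y z / phi z) / (1 - w / phi z) = Y z / (phi z - w)" using pn[OF z] by (simp add: field_simps)
    qed
    finally show ?thesis .
  qed
  have "circ_int t (\<lambda>z. Y z / (phi z - w)) = circ_int s (\<lambda>z. Y z / (phi z - w)) + (\<Sum>\<zeta>\<in>fib w. Y \<zeta> / deriv (\<lambda>z. phi z - w) \<zeta>)"
  proof (rule circ_int_simple_zeros[OF Y])
    show "(\<lambda>z. phi z - w) holomorphic_on ?A" by (intro holomorphic_intros phi_holo_subset AR)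
    show "0 < s" "1 / R < s" "s < t" "t < R" using s t s0 by auto
    show "finite (fib w)" by (rule fib_finite_card[OF w])
    show "fib w = {z. 1 / R < cmod z \<and> cmod z < R \<and> phi z - w = 0}"
      by (rule fib_annulus[OF w])
    show "s < cmod \<zeta> \<and> cmod \<zeta> < t" if "\<zeta> \<in> fib w" for \<zeta> using fib_circle[OF that] s t by simp
    show "deriv (\<lambda>z. phi z - w) \<zeta> \<noteq> 0" if "\<zeta> \<in> fib w" for \<zeta>
      using phi_deriv_nonzero[OF fib_circle[OF that]] deriv_phi_diff[OF that w] by simp
  qed
  also have "(\<Sum>\<zeta>\<in>fib w. Y \<zeta> / deriv (\<lambda>z. phi z - w) \<zeta>) = (\<Sum>\<zeta>\<in>fib w. Y \<zeta> / deriv phi \<zeta>)"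
    using deriv_phi_diff[OF _ w] by (intro sum.cong) auto
  finally show ?thesis using inner outer by simp
qed

text \<open>The sum over a fibre is a residue sum, hence the Cauchy-type integral \<open>H w\<close> of \<open>v phi' / (phi
  - w)\<close> over a circle outside the unit circle. In this form it is holomorphic in \<open>w\<close> up to
  the minimum modulus of \<open>phi\<close> on that circle, a number greater than \<open>1\<close>.
  Differentiating under the integral and integrating by parts gives the derivative; at \<open>w = 0\<close> the
  poles are the zeros of \<open>phi\<close>, counted with multiplicity, so a multiple zero contributes several
  equal terms.\<close>

lemma trace_exists:
  assumes v: "v holomorphic_on ball 0 R"
  obtains H \<rho> where "\<rho> > 1" "H holomorphic_on ball 0 \<rho>"
    "\<And>w. cmod w = 1 \<Longrightarrow> H w = (\<Sum>\<zeta>\<in>fib w. v \<zeta>)"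
    "\<And>w. cmod w = 1 \<Longrightarrow> deriv H w = (\<Sum>\<zeta>\<in>fib w. deriv v \<zeta> / deriv phi \<zeta>)"
    "H 0 = (\<Sum>i<n. v (lam i))"
proof -
  obtain t where t: "1 < t" "t < R" using R dense by blast
  have t0: "t > 0" using t by simp
  have tR: "1 / R < t" using t R by (smt (verit) divide_less_eq_1_pos)
  have vt: "continuous_on (sphere 0 t) v" "continuous_on (sphere 0 t) phi"
     "continuous_on (sphere 0 t) (deriv phi)" "continuous_on (sphere 0 t) (deriv v)"
    using t by (auto intro!: holomorphic_on_imp_continuous_on phi_holo_subset holomorphic_on_subset[OF v]
        holomorphic_on_subset[OF holomorphic_deriv[OF phi_holo]] holomorphic_on_subset[OF holomorphic_deriv[OF v]])
  obtain z0 where z0: "cmod z0 = t" "\<And>y. cmod y = t \<Longrightarrow> cmod (phi z0) \<le> cmod (phi y)"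
  proof -
    have "of_real t \<in> sphere (0::complex) t" using t0 by auto
    then have "\<exists>z0\<in>sphere 0 t. \<forall>y\<in>sphere 0 t. cmod (phi z0) \<le> cmod (phi y)"
      by (intro continuous_attains_inf) (auto intro!: continuous_intros vt)
    then show thesis using that by auto
  qed
  define \<rho> where "\<rho> = cmod (phi z0)"
  have \<rho>: "\<rho> > 1" using phi_gt[of z0] z0 t by (simp add: \<rho>_def)
  have ne: "phi z - w \<noteq> 0" if "cmod z = t" "cmod w < \<rho>" for z w
    using z0(2)[OF that(1)] that by (auto simp: \<rho>_def)
  define H where "H w = circ_int t (\<lambda>z. v z * deriv phi z / (phi z - w))" for w
  have cp: "cmod (circlepath 0 t x) = t" for x using t0 by (simp add: circlepath norm_mult)
  have ccp: "continuous_on A (circlepath 0 t)" for A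
    unfolding circlepath by (intro continuous_intros)
  have comp: "continuous_on A (\<lambda>p. F (circlepath 0 t (snd p)))" if "continuous_on (sphere 0 t) F" for F :: "complex \<Rightarrow> complex" and A :: "(complex \<times> real) set"
    by (rule continuous_on_compose2[OF that]) (auto intro!: continuous_on_compose2[OF ccp[of UNIV]] continuous_intros simp: cp)
  have comp1: "continuous_on A (\<lambda>p. F (circlepath 0 t p))" if "continuous_on (sphere 0 t) F" for F :: "complex \<Rightarrow> complex" and A :: "real set"
    by (rule continuous_on_compose2[OF that ccp]) (auto simp: cp)
  have Hd: "(H has_field_derivative circ_int t (\<lambda>z. v z * deriv phi z / (phi z - w)\<^sup>2)) (at w)" if w: "cmod w < \<rho>" for w
  proof -
    have "((\<lambda>w. integral (cbox 0 1) (\<lambda>x. v (circlepath 0 t x) * deriv phi (circlepath 0 t x) / (phi (circlepath 0 t x) - w) * vector_derivative (circlepath 0 t) (at x)))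
      has_field_derivative integral (cbox 0 1) (\<lambda>x. v (circlepath 0 t x) * deriv phi (circlepath 0 t x) / (phi (circlepath 0 t x) - w)\<^sup>2 * vector_derivative (circlepath 0 t) (at x))) (at w within ball 0 \<rho>)"
    proof (rule leibniz_rule_field_derivative)
      fix y x assume "y \<in> ball (0::complex) \<rho>"
      then have "phi (circlepath 0 t x) - y \<noteq> 0" using ne[OF cp] by auto
      then show "((\<lambda>w. v (circlepath 0 t x) * deriv phi (circlepath 0 t x) / (phi (circlepath 0 t x) - w) * vector_derivative (circlepath 0 t) (at x))
        has_field_derivative v (circlepath 0 t x) * deriv phi (circlepath 0 t x) / (phi (circlepath 0 t x) - y)\<^sup>2 * vector_derivative (circlepath 0 t) (at x)) (at y within ball 0 \<rho>)"
        by (auto intro!: derivative_eq_intros simp: power2_eq_square)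
    next
      fix y assume "y \<in> ball (0::complex) \<rho>"
      then show "(\<lambda>x. v (circlepath 0 t x) * deriv phi (circlepath 0 t x) / (phi (circlepath 0 t x) - y) * vector_derivative (circlepath 0 t) (at x)) integrable_on cbox 0 1"
        unfolding vector_derivative_circlepath using ne[OF cp]
        by (intro integrable_continuous continuous_intros comp1 vt) auto
    next
      show "continuous_on (ball 0 \<rho> \<times> cbox 0 1) (\<lambda>(w, x). v (circlepath 0 t x) * deriv phi (circlepath 0 t x) / (phi (circlepath 0 t x) - w)\<^sup>2 * vector_derivative (circlepath 0 t) (at x))"
        unfolding vector_derivative_circlepath split_beta using ne[OF cp]
        by (intro continuous_intros comp vt) auto
    qed (use w in auto)
    then have "((\<lambda>w. integral (cbox 0 1) (\<lambda>x. v (circlepath 0 t x) * deriv phi (circlepath 0 t x) / (phi (circlepath 0 t x) - w) * vector_derivative (circlepath 0 t) (at x)) / (2 * of_real pi * \<i>))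
      has_field_derivative integral (cbox 0 1) (\<lambda>x. v (circlepath 0 t x) * deriv phi (circlepath 0 t x) / (phi (circlepath 0 t x) - w)\<^sup>2 * vector_derivative (circlepath 0 t) (at x)) / (2 * of_real pi * \<i>)) (at w)"
      using w by (subst (asm) at_within_open) (auto intro!: DERIV_cdivide)
    then show ?thesis by (simp add: H_def[abs_def] circ_int_def contour_integral_integral)
  qed
  have Hhol: "H holomorphic_on ball 0 \<rho>"
    unfolding holomorphic_on_open[OF open_ball]
  proof
    fix w assume "w \<in> ball (0::complex) \<rho>"
    then have "cmod w < \<rho>" by simp
    from Hd[OF this] show "\<exists>f'. (H has_field_derivative f') (at w)" by blast
  qed
  have res: "circ_int t (\<lambda>z. f z / (phi z - w)) = (\<Sum>\<zeta>\<in>fib w. f \<zeta> / deriv phi \<zeta>)"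
    if f: "f holomorphic_on ball 0 R" and w: "cmod w = 1" for f w
  proof -
    obtain s where s: "1 / R < s" "s < 1" using R dense[of "1 / R" 1] by auto
    have s0: "s > 0" using s R by (smt (verit) divide_pos_pos)
    let ?A = "{z. 1 / R < cmod z \<and> cmod z < R}"
    have AR: "?A \<subseteq> ball 0 R" by auto
    have "circ_int t (\<lambda>z. f z / (phi z - w)) = circ_int s (\<lambda>z. f z / (phi z - w)) + (\<Sum>\<zeta>\<in>fib w. f \<zeta> / deriv (\<lambda>z. phi z - w) \<zeta>)"
    proof (rule circ_int_simple_zeros)
      show "f holomorphic_on ?A" by (rule holomorphic_on_subset[OF f AR])
      show "(\<lambda>z. phi z - w) holomorphic_on ?A" by (intro holomorphic_intros phi_holo_subset AR)
      show "0 < s" "1 / R < s" "s < t" "t < R" using s t s0 by auto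
      show "finite (fib w)" by (rule fib_finite_card[OF w])
      show "fib w = {z. 1 / R < cmod z \<and> cmod z < R \<and> phi z - w = 0}"
        by (rule fib_annulus[OF w])
      show "s < cmod \<zeta> \<and> cmod \<zeta> < t" if "\<zeta> \<in> fib w" for \<zeta> using fib_circle[OF that] s t by simp
      show "deriv (\<lambda>z. phi z - w) \<zeta> \<noteq> 0" if "\<zeta> \<in> fib w" for \<zeta>
        using phi_deriv_nonzero[OF fib_circle[OF that]] deriv_phi_diff[OF that w] by simp
    qed
    also have "(\<Sum>\<zeta>\<in>fib w. f \<zeta> / deriv (\<lambda>z. phi z - w) \<zeta>) = (\<Sum>\<zeta>\<in>fib w. f \<zeta> / deriv phi \<zeta>)"
      using deriv_phi_diff[OF _ w] by (intro sum.cong) auto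
    also have "circ_int s (\<lambda>z. f z / (phi z - w)) = 0"
    proof (rule circ_int_holomorphic[OF s0 _ s(2)])
      have "phi z - w \<noteq> 0" if "cmod z < 1" for z using phi_lt[OF that] w by auto
      then show "(\<lambda>z. f z / (phi z - w)) holomorphic_on ball 0 1"
        using R by (intro holomorphic_intros holomorphic_on_subset[OF f] phi_holo_subset) auto
    qed
    finally show ?thesis by simp
  qed
  have dphi: "deriv phi holomorphic_on ball 0 R" and dv: "deriv v holomorphic_on ball 0 R"
    using phi_holo v by (auto intro: holomorphic_deriv)
  have H1: "H w = (\<Sum>\<zeta>\<in>fib w. v \<zeta>)" if w: "cmod w = 1" for w
  proof -
    have "H w = (\<Sum>\<zeta>\<in>fib w. v \<zeta> * deriv phi \<zeta> / deriv phi \<zeta>)"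
      unfolding H_def by (intro res holomorphic_intros v dphi w)
    then show ?thesis using phi_deriv_nonzero[OF fib_circle] by (simp cong: sum.cong)
  qed
  have H2: "deriv H w = (\<Sum>\<zeta>\<in>fib w. deriv v \<zeta> / deriv phi \<zeta>)" if w: "cmod w = 1" for w
  proof -
    have w\<rho>: "cmod w < \<rho>" using w \<rho> by simp
    have "deriv H w = circ_int t (\<lambda>z. v z * deriv phi z / (phi z - w)\<^sup>2)"
      using Hd[OF w\<rho>] by (rule DERIV_imp_deriv)
    also have "\<dots> = circ_int t (\<lambda>z. deriv v z / (phi z - w))"
    proof -
      have "((\<lambda>z. deriv v z / (phi z - w) - v z * deriv phi z / (phi z - w)\<^sup>2) has_contour_integral
         (v (pathfinish (circlepath 0 t)) / (phi (pathfinish (circlepath 0 t)) - w) - v (pathstart (circlepath 0 t)) / (phi (pathstart (circlepath 0 t)) - w))) (circlepath 0 t)"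
      proof (rule contour_integral_primitive[where S = "sphere 0 t"])
        fix z assume "z \<in> sphere (0::complex) t"
        then have z: "cmod z = t" by simp
        then have zR: "z \<in> ball 0 R" using t by simp
        have d: "(v has_field_derivative deriv v z) (at z)" "(phi has_field_derivative deriv phi z) (at z)"
          using holomorphic_derivI[OF v open_ball zR] holomorphic_derivI[OF phi_holo open_ball zR] by auto
        have "((\<lambda>z. v z / (phi z - w)) has_field_derivative (deriv v z * (phi z - w) - v z * (deriv phi z - 0)) / ((phi z - w) * (phi z - w))) (at z)"
          by (intro DERIV_divide d DERIV_diff DERIV_const ne z w\<rho>)
        moreover have "(deriv v z * (phi z - w) - v z * (deriv phi z - 0)) / ((phi z - w) * (phi z - w)) = deriv v z / (phi z - w) - v z * deriv phi z / (phi z - w)\<^sup>2"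
          using ne[OF z w\<rho>] by (simp add: diff_divide_distrib power2_eq_square)
        ultimately show "((\<lambda>z. v z / (phi z - w)) has_field_derivative deriv v z / (phi z - w) - v z * deriv phi z / (phi z - w)\<^sup>2) (at z within sphere 0 t)"
          by (metis has_field_derivative_at_within)
      qed (use t0 in \<open>auto simp: path_image_circlepath\<close>)
      then have "circ_int t (\<lambda>z. deriv v z / (phi z - w) - v z * deriv phi z / (phi z - w)\<^sup>2) = 0"
        by (simp add: circ_int_def contour_integral_unique)
      then show ?thesis
        using ne[OF _ w\<rho>] by (subst (asm) circ_int_diff[OF t0]) (auto intro!: continuous_intros vt)
    qed
    also have "\<dots> = (\<Sum>\<zeta>\<in>fib w. deriv v \<zeta> / deriv phi \<zeta>)" by (rule res[OF dv w])
    finally show ?thesis .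
  qed
  have H3: "H 0 = (\<Sum>i<n. v (lam i))"
  proof -
    have "H 0 = circ_int t (\<lambda>z. \<Sum>i<n. v z / (z - lam i) + v z * cnj (lam i) / (1 - cnj (lam i) * z))"
      unfolding H_def
    proof (rule circ_int_cong[OF t0])
      fix z assume z: "cmod z = t"
      have nz: "phi z \<noteq> 0" using phi_nonzero[of z] z tR t by simp
      have "v z * deriv phi z / (phi z - 0) = v z * (\<Sum>i<n. 1 / (z - lam i) + cnj (lam i) / (1 - cnj (lam i) * z))"
        using phi_logderiv[of z] nz z t by simp
      then show "v z * deriv phi z / (phi z - 0) = (\<Sum>i<n. v z / (z - lam i) + v z * cnj (lam i) / (1 - cnj (lam i) * z))"
        by (simp add: sum_distrib_left distrib_left)
    qed
    also have "\<dots> = (\<Sum>i<n. circ_int t (\<lambda>z. v z / (z - lam i) + v z * cnj (lam i) / (1 - cnj (lam i) * z)))"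
    proof (rule circ_int_sum[OF t0])
      fix i assume "i \<in> {..<n}"
      then show "continuous_on (sphere 0 t) (\<lambda>z. v z / (z - lam i) + v z * cnj (lam i) / (1 - cnj (lam i) * z))"
        using lam_lt[of i] t denom[of i] by (intro continuous_intros vt) auto
    qed simp
    also have "\<dots> = (\<Sum>i<n. v (lam i))"
    proof (rule sum.cong[OF refl])
      fix i assume "i \<in> {..<n}"
      then have i: "i < n" by simp
      have "circ_int t (\<lambda>z. v z / (z - lam i) + v z * cnj (lam i) / (1 - cnj (lam i) * z)) =
         circ_int t (\<lambda>z. v z / (z - lam i)) + circ_int t (\<lambda>z. v z * cnj (lam i) / (1 - cnj (lam i) * z))"
        using lam_lt[OF i] t denom[OF i] by (intro circ_int_add t0 continuous_intros vt) auto
      also have "circ_int t (\<lambda>z. v z * cnj (lam i) / (1 - cnj (lam i) * z)) = 0"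
        using denom[OF i] t by (intro circ_int_holomorphic[OF t0 _ t(2)] holomorphic_intros v) auto
      also have "circ_int t (\<lambda>z. v z / (z - lam i)) = v (lam i)"
        using lam_lt[OF i] t by (intro circ_int_Cauchy[OF t0 v]) auto
      finally show "circ_int t (\<lambda>z. v z / (z - lam i) + v z * cnj (lam i) / (1 - cnj (lam i) * z)) = v (lam i)" by simp
    qed
    finally show ?thesis .
  qed
  show thesis by (rule that[OF \<rho> Hhol H1 H2 H3])
qed

end

section \<open>The inner product as a circle integral\<close>

text \<open>Functions holomorphic beyond the closed disc are kept uncut, so that their values on the circle are at hand;
  \<open>cut\<close> turns them into elements of the Dirichlet space.\<close>

definition cut :: "(complex \<Rightarrow> complex) \<Rightarrow> complex \<Rightarrow> complex" where
  "cut f z = (if cmod z < 1 then f z else 0)"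

lemma cut_taylor_coeff:
  assumes "f holomorphic_on ball 0 R" "R \<ge> 1"
  shows "taylor_coeff (cut f) k = taylor_coeff f k" "cut f holomorphic_on ball 0 1"
proof -
  have f: "f holomorphic_on ball 0 1" by (rule holomorphic_on_subset[OF assms(1)]) (use assms in auto)
  show "cut f holomorphic_on ball 0 1" by (rule holomorphic_transform[OF f]) (auto simp: cut_def)
  show "taylor_coeff (cut f) k = taylor_coeff f k"
    by (rule taylor_coeff_cong[OF _ f, symmetric]) (auto simp: cut_def)
qed

lemma taylor_coeff_geometric_bound:
  assumes f: "f holomorphic_on ball 0 R" and r: "0 < r" "r < R"
  obtains K where "K \<ge> 0" "\<And>k. cmod (taylor_coeff f k) \<le> K * (1 / r) ^ k"
proof -
  have "(\<lambda>k. taylor_coeff f k * of_real r ^ k) sums f (of_real r)"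
    using r by (intro taylor_series[OF f]) auto
  then have "(\<lambda>k. taylor_coeff f k * of_real r ^ k) \<longlonglongrightarrow> 0"
    by (intro summable_LIMSEQ_zero) (simp add: sums_iff)
  then have "Bseq (\<lambda>k. taylor_coeff f k * of_real r ^ k)" by (intro convergent_imp_Bseq convergentI)
  then obtain K where K: "K > 0" "\<And>k. norm (taylor_coeff f k * of_real r ^ k) \<le> K" by (auto simp: Bseq_def)
  show thesis
  proof (rule that[of K])
    show "cmod (taylor_coeff f k) \<le> K * (1 / r) ^ k" for k
      using K(2)[of k] r by (simp add: norm_mult norm_power field_simps)
  qed (use K in simp)
qed

lemma summable_weighted_geometric:
  assumes q: "0 \<le> q" "q < 1" and a: "\<And>k. cmod (a k) \<le> K * q ^ k"
  shows "summable (\<lambda>k. (real k + 1) * (cmod (a k))\<^sup>2)"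
proof (rule summable_comparison_test_ev)
  have "q\<^sup>2 < 1" using q by (simp add: abs_square_less_1)
  then have "summable (\<lambda>k. of_nat (Suc k) * (q\<^sup>2) ^ k)"
    using geometric_deriv_sums[of "q\<^sup>2"] by (simp add: sums_iff)
  then show "summable (\<lambda>k. K\<^sup>2 * (of_nat (Suc k) * (q\<^sup>2) ^ k))" by (rule summable_mult)
  show "\<forall>\<^sub>F k in sequentially. norm ((real k + 1) * (cmod (a k))\<^sup>2) \<le> K\<^sup>2 * (of_nat (Suc k) * (q\<^sup>2) ^ k)"
  proof (intro always_eventually allI)
    fix k
    have "(real k + 1) * (cmod (a k))\<^sup>2 \<le> (real k + 1) * (K * q ^ k)\<^sup>2"
      by (intro mult_left_mono power_mono a) auto
    also have "(K * q ^ k)\<^sup>2 = K\<^sup>2 * (q\<^sup>2) ^ k" by (simp add: power_mult_distrib power_mult[symmetric] mult.commute)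
    finally show "norm ((real k + 1) * (cmod (a k))\<^sup>2) \<le> K\<^sup>2 * (of_nat (Suc k) * (q\<^sup>2) ^ k)" by (simp add: mult_ac add.commute)
  qed
qed

lemma cut_dirichlet:
  assumes "f holomorphic_on ball 0 R" "R > 1"
  shows "cut f \<in> dirichlet_space"
proof (rule dirichlet_spaceI)
  show "cut f holomorphic_on ball 0 1" using assms by (intro cut_taylor_coeff) auto
  show "cut f z = 0" if "\<not> cmod z < 1" for z using that by (simp add: cut_def)
  obtain r where r: "1 < r" "r < R" using assms dense by blast
  obtain K where "\<And>k. cmod (taylor_coeff f k) \<le> K * (1 / r) ^ k"
    using taylor_coeff_geometric_bound[OF assms(1), of r] r by auto
  then have "summable (\<lambda>k. (real k + 1) * (cmod (taylor_coeff f k))\<^sup>2)"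
    using r by (intro summable_weighted_geometric[of "1 / r" _ K]) auto
  then show "summable (\<lambda>k. (real k + 1) * (cmod (taylor_coeff (cut f) k))\<^sup>2)"
    using cut_taylor_coeff(1)[OF assms(1)] assms by simp
qed

lemma circ_int_taylor_coeff:
  assumes f: "f holomorphic_on ball 0 R" and R: "R > 1"
  shows "circ_int 1 (\<lambda>z. f z / z ^ Suc k) = taylor_coeff f k"
proof -
  have "((\<lambda>u. f u / (u - 0) ^ Suc k) has_contour_integral ((2 * pi * \<i>) / fact k * (deriv ^^ k) f 0)) (circlepath 0 1)"
    using R by (intro Cauchy_has_contour_integral_higher_derivative_circlepath holomorphic_on_imp_continuous_on
         holomorphic_on_subset[OF f]) auto
  then show ?thesis by (simp add: circ_int_def contour_integral_unique taylor_coeff_def)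
qed

lemma taylor_coeff_shift:
  assumes f: "f holomorphic_on ball 0 R" and R: "R > 0"
  shows "taylor_coeff (\<lambda>z. z * f z) (Suc k) = taylor_coeff f k"
proof -
  have "(\<lambda>j. (case j of 0 \<Rightarrow> 0 | Suc k \<Rightarrow> taylor_coeff f k) * z ^ j) sums (z * f z)" if "cmod z < R" for z
  proof -
    have "(\<lambda>k. z * (taylor_coeff f k * z ^ k)) sums (z * f z)" by (intro sums_mult taylor_series[OF f that])
    then have "(\<lambda>k. (\<lambda>j. (case j of 0 \<Rightarrow> 0 | Suc k \<Rightarrow> taylor_coeff f k) * z ^ j) (Suc k)) sums (z * f z)" by (simp add: mult_ac)
    then show ?thesis by (subst (asm) sums_Suc_iff) simp
  qed
  from power_series_taylor_coeff(2)[OF R this, of "Suc k"] show ?thesis by simp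
qed

text \<open>The weight \<open>n + 1\<close> turns the coefficients of \<open>f\<close> into those of \<open>(z f)'\<close>,
  and on the circle \<open>cnj (z * g z)\<close> is the series of \<open>cnj (b k) / z ^ Suc k\<close>. Being an
  integral over the circle, where \<open>phi\<close> has modulus one, the formula behaves well under
  multiplication by \<open>phi\<close>.\<close>

lemma dirichlet_inner_circle:
  assumes f: "f holomorphic_on ball 0 R" and g: "g holomorphic_on ball 0 R" and R: "R > 1"
  shows "ip (cut f) (cut g) = circ_int 1 (\<lambda>z. deriv (\<lambda>z. z * f z) z * cnj (z * g z))"
proof -
  define F where "F = deriv (\<lambda>z. z * f z)"
  have F: "F holomorphic_on ball 0 R" unfolding F_def by (intro holomorphic_intros f) auto
  have Fc: "continuous_on (sphere 0 1) F"
    using R by (intro holomorphic_on_imp_continuous_on holomorphic_on_subset[OF F]) auto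
  have gc: "continuous_on (sphere 0 1) g"
    using R by (intro holomorphic_on_imp_continuous_on holomorphic_on_subset[OF g]) auto
  let ?a = "taylor_coeff f" and ?b = "taylor_coeff g"
  have tF: "taylor_coeff F k = (of_nat k + 1) * ?a k" for k
    unfolding F_def taylor_coeff_def[of "deriv (\<lambda>z. z * f z)" k] taylor_coeff_deriv
    using taylor_coeff_shift[OF f] R by simp
  obtain B where B: "B \<ge> 0" "\<And>z. cmod z = 1 \<Longrightarrow> cmod (F z) \<le> B"
  proof -
    have "bounded (F ` sphere 0 1)" by (intro compact_imp_bounded compact_continuous_image Fc) simp
    then obtain B where "\<forall>y\<in>F ` sphere 0 1. cmod y \<le> B" unfolding bounded_iff by blast
    then have "cmod (F z) \<le> B" if "cmod z = 1" for z using that by auto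
    then show thesis using that[of B] order_trans[OF norm_ge_zero, of "F 1" B] by simp
  qed
  have bsum: "summable (\<lambda>k. cmod (?b k))"
  proof -
    obtain r where r: "1 < r" "r < R" using R dense by blast
    have "summable (\<lambda>k. ?b k * of_real r ^ k)"
      using taylor_series[OF g, of "of_real r"] r by (simp add: sums_iff)
    from powser_insidea[OF this, of 1] r show ?thesis by simp
  qed
  define S where "S N z = (\<Sum>k<N. cnj (?b k) * (1 / z ^ Suc k))" for N and z :: complex
  have IS: "circ_int 1 (\<lambda>z. F z * S N z) = (\<Sum>k<N. (of_nat k + 1) * ?a k * cnj (?b k))" for N
  proof -
    have "circ_int 1 (\<lambda>z. F z * S N z) = circ_int 1 (\<lambda>z. \<Sum>k<N. cnj (?b k) * (F z / z ^ Suc k))"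
      by (rule circ_int_cong) (auto simp: S_def sum_distrib_left mult_ac)
    also have "\<dots> = (\<Sum>k<N. circ_int 1 (\<lambda>z. cnj (?b k) * (F z / z ^ Suc k)))"
      by (intro circ_int_sum continuous_on_mult continuous_on_const continuous_on_divide Fc continuous_on_power continuous_on_id) auto
    also have "\<dots> = (\<Sum>k<N. cnj (?b k) * circ_int 1 (\<lambda>z. F z / z ^ Suc k))"
      by (intro sum.cong refl circ_int_cmult continuous_on_divide Fc continuous_on_power continuous_on_id) auto
    also have "\<dots> = (\<Sum>k<N. (of_nat k + 1) * ?a k * cnj (?b k))"
      unfolding circ_int_taylor_coeff[OF F R] tF by (simp add: mult_ac)
    finally show ?thesis .
  qed
  let ?T = "\<lambda>N. \<Sum>k. cmod (?b (k + N))"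
  have tail: "cmod (cnj (z * g z) - S N z) \<le> ?T N" if z: "cmod z = 1" for z N
  proof -
    have zz: "cnj z = 1 / z" using z by (metis complex_div_cnj div_by_1 mult_1 norm_one one_power2 of_real_1)
    have "(\<lambda>k. ?b k * z ^ k) sums g z" using z R by (intro taylor_series[OF g]) auto
    then have "(\<lambda>k. z * (?b k * z ^ k)) sums (z * g z)" by (rule sums_mult)
    then have "(\<lambda>k. cnj (z * (?b k * z ^ k))) sums cnj (z * g z)" by (rule sums_cnj[THEN iffD2])
    moreover have "cnj (z * (?b k * z ^ k)) = cnj (?b k) * (1 / z ^ Suc k)" for k
      by (simp add: zz power_divide)
    ultimately have s: "(\<lambda>k. cnj (?b k) * (1 / z ^ Suc k)) sums cnj (z * g z)" by simp
    then have "(\<lambda>k. cnj (?b (k + N)) * (1 / z ^ Suc (k + N))) sums (cnj (z * g z) - S N z)"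
      unfolding S_def by (rule sums_split_initial_segment)
    moreover have n: "norm (cnj (?b (k + N)) * (1 / z ^ Suc (k + N))) = cmod (?b (k + N))" for k
      using z by (simp add: norm_mult norm_divide norm_power del: power_Suc)
    ultimately show ?thesis
      using summable_norm[of "\<lambda>k. cnj (?b (k + N)) * (1 / z ^ Suc (k + N))"] summable_ignore_initial_segment[OF bsum, of N]
      unfolding n by (simp add: sums_iff)
  qed
  have T0: "0 \<le> ?T N" for N by (intro suminf_nonneg summable_ignore_initial_segment bsum) auto
  have "(\<lambda>N. circ_int 1 (\<lambda>z. F z * S N z)) \<longlonglongrightarrow> circ_int 1 (\<lambda>z. F z * cnj (z * g z))"
  proof -
    have "(\<lambda>N. circ_int 1 (\<lambda>z. F z * S N z) - circ_int 1 (\<lambda>z. F z * cnj (z * g z))) \<longlonglongrightarrow> 0"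
    proof (rule Lim_null_comparison)
      show "(\<lambda>N. B * ?T N) \<longlonglongrightarrow> 0"
        using tendsto_mult_left[OF suminf_exist_split2[OF bsum], of B] by simp
      show "\<forall>\<^sub>F N in sequentially. norm (circ_int 1 (\<lambda>z. F z * S N z) - circ_int 1 (\<lambda>z. F z * cnj (z * g z))) \<le> B * ?T N"
      proof (intro always_eventually allI)
        fix N
        have Sc: "continuous_on (sphere 0 1) (S N)"
          unfolding S_def by (intro continuous_on_sum continuous_on_mult continuous_on_const continuous_on_divide continuous_on_power continuous_on_id) auto
        have hc: "continuous_on (sphere 0 1) (\<lambda>z. cnj (z * g z))" by (intro continuous_intros gc)
        have "circ_int 1 (\<lambda>z. F z * S N z) - circ_int 1 (\<lambda>z. F z * cnj (z * g z)) = circ_int 1 (\<lambda>z. F z * S N z - F z * cnj (z * g z))"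
          by (intro circ_int_diff[symmetric] continuous_on_mult Fc Sc hc) simp
        moreover have "cmod (circ_int 1 (\<lambda>z. F z * S N z - F z * cnj (z * g z))) \<le> 1 * (B * ?T N)"
        proof (rule circ_int_bound)
          show "continuous_on (sphere 0 1) (\<lambda>z. F z * S N z - F z * cnj (z * g z))"
            by (intro continuous_on_diff continuous_on_mult Fc Sc hc)
          show "0 \<le> B * ?T N" using B T0 by simp
          fix z :: complex assume z: "cmod z = 1"
          have "cmod (F z * S N z - F z * cnj (z * g z)) = cmod (F z) * cmod (cnj (z * g z) - S N z)"
            unfolding right_diff_distrib[symmetric] norm_mult by (simp only: norm_minus_commute)
          also have "\<dots> \<le> B * ?T N" using B z tail[OF z] T0 by (intro mult_mono) auto
          finally show "cmod (F z * S N z - F z * cnj (z * g z)) \<le> B * ?T N" .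
        qed simp
        ultimately show "norm (circ_int 1 (\<lambda>z. F z * S N z) - circ_int 1 (\<lambda>z. F z * cnj (z * g z))) \<le> B * ?T N" by simp
      qed
    qed
    then show ?thesis by (simp add: Lim_null[symmetric])
  qed
  then have "(\<lambda>k. (of_nat k + 1) * ?a k * cnj (?b k)) sums circ_int 1 (\<lambda>z. F z * cnj (z * g z))"
    unfolding sums_def IS .
  moreover have "(\<lambda>k. (of_nat k + 1) * ?a k * cnj (?b k)) sums ip (cut f) (cut g)"
    using dirichlet_inner_sums[OF cut_dirichlet[OF f R] cut_dirichlet[OF g R]]
      cut_taylor_coeff(1)[OF f] cut_taylor_coeff(1)[OF g] R by simp
  ultimately show ?thesis unfolding F_def by (rule sums_unique2[rotated])
qed

section \<open>Roots and orders of vanishing\<close>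

text \<open>Some polynomial vanishes at \<open>0\<close> and is \<open>1\<close> at all nonzero values; if all power sums
  were zero, the sum of its values would vanish, yet it counts the nonzero values.\<close>

lemma power_sum_nonzero:
  fixes x :: "'b \<Rightarrow> complex"
  assumes fin: "finite S" and \<xi>: "\<xi> \<in> S" "x \<xi> \<noteq> 0"
  obtains (that_k) k where "k \<ge> 1" "(\<Sum>\<zeta>\<in>S. x \<zeta> ^ k) \<noteq> 0"
proof -
  define p where "p = 1 - (\<Prod>y\<in>x ` S - {0}. [:1, - 1 / y:])"
  have p0: "poly p 0 = 0" by (simp add: p_def poly_prod)
  have p1: "poly p (x \<zeta>) = 1" if "\<zeta> \<in> S" "x \<zeta> \<noteq> 0" for \<zeta>
  proof -
    have "(\<Prod>y\<in>x ` S - {0}. poly [:1, - 1 / y:] (x \<zeta>)) = 0"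
      using that fin by (intro prod_zero) (auto intro!: bexI[of _ "x \<zeta>"])
    then show ?thesis by (simp add: p_def poly_prod)
  qed
  have "(\<Sum>\<zeta>\<in>S. poly p (x \<zeta>)) = (\<Sum>\<zeta>\<in>S. if x \<zeta> \<noteq> 0 then 1 else 0)"
    using p0 p1 by (intro sum.cong) auto
  also have "\<dots> = of_nat (card {\<zeta>\<in>S. x \<zeta> \<noteq> 0})"
    using fin by (simp add: sum.If_cases Int_def)
  also have "\<dots> \<noteq> 0" using fin \<xi> by auto
  finally have ne: "(\<Sum>\<zeta>\<in>S. poly p (x \<zeta>)) \<noteq> 0" .
  show thesis
  proof (rule ccontr)
    assume "\<not> thesis"
    then have z: "(\<Sum>\<zeta>\<in>S. x \<zeta> ^ k) = 0" if "k \<ge> 1" for k using that that_k[of k] by blast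
    have "(\<Sum>\<zeta>\<in>S. poly p (x \<zeta>)) = (\<Sum>\<zeta>\<in>S. \<Sum>k\<le>degree p. coeff p k * x \<zeta> ^ k)"
      by (simp add: poly_altdef)
    also have "\<dots> = (\<Sum>k\<le>degree p. coeff p k * (\<Sum>\<zeta>\<in>S. x \<zeta> ^ k))"
      by (subst sum.swap) (simp add: sum_distrib_left)
    also have "\<dots> = 0"
    proof (rule sum.neutral, rule ballI)
      fix k show "coeff p k * (\<Sum>\<zeta>\<in>S. x \<zeta> ^ k) = 0"
        using z[of k] p0 by (cases k) (auto simp: poly_0_coeff_0)
    qed
    finally show False using ne by simp
  qed
qed

text \<open>The unit circle has limit points inside the larger disc.\<close>

lemma holomorphic_zero_on_circle:
  assumes W: "W holomorphic_on ball 0 r" and r: "r > 1" and zero: "\<And>z. cmod z = 1 \<Longrightarrow> W z = 0" and z: "cmod z < r"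
  shows "W z = 0"
proof (rule analytic_continuation[OF W, where U = "sphere 0 1" and \<xi> = 1])
  have "connected (sphere (0::complex) 1)" by (rule connected_sphere) simp
  moreover have "\<not> (\<exists>a. sphere (0::complex) 1 = {a})"
  proof
    assume "\<exists>a. sphere (0::complex) 1 = {a}"
    then obtain a where a: "sphere (0::complex) 1 = {a}" by blast
    have "(1::complex) \<in> sphere 0 1" "(-1::complex) \<in> sphere 0 1" by simp_all
    then have "(1::complex) = a" "(-1::complex) = a" unfolding a by blast+
    then have "(1::complex) = -1" by (rule trans[OF _ sym])
    then show False by simp
  qed
  ultimately show "(1::complex) islimpt sphere 0 1" by (intro connected_imp_perfect) auto
qed (use r z zero in auto)

lemma holomorphic_zero_puncture:
  assumes f: "f holomorphic_on A" and A: "open A" and zero: "\<And>z. z \<in> A \<Longrightarrow> z \<noteq> a \<Longrightarrow> f z = 0" and z: "z \<in> A"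
  shows "f z = 0"
proof (cases "z = a")
  case True
  have "(f \<longlongrightarrow> f a) (at a)"
    using holomorphic_on_imp_continuous_on[OF f] A z True by (simp add: continuous_on_eq_continuous_at isCont_def)
  moreover have "eventually (\<lambda>z. z \<in> A \<and> z \<noteq> a) (at a)"
    using A z True by (auto simp: eventually_at_topological)
  then have "eventually (\<lambda>z. f z = 0) (at a)" by eventually_elim (use zero in auto)
  then have "(f \<longlongrightarrow> 0) (at a)" by (rule tendsto_eventually)
  ultimately show ?thesis using True by (metis LIM_unique)
qed (use zero z in auto)

lemma holomorphic_divide_linear:
  assumes f: "f holomorphic_on A" and A: "open A" and a: "f a = 0"
  obtains q where "q holomorphic_on A" "\<And>z. z \<in> A \<Longrightarrow> f z = (z - a) * q z"
proof -
  have d: "deriv (\<lambda>z. z - a) z = 1" for z by (rule DERIV_imp_deriv) (auto intro!: derivative_eq_intros)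
  show thesis
  proof (rule holomorphic_quotient[OF A f])
    show "(\<lambda>z. z - a) holomorphic_on A" by (intro holomorphic_intros)
    show "finite {z \<in> A. z - a = 0}" by (rule finite_subset[of _ "{a}"]) auto
    show "f z = 0 \<and> deriv (\<lambda>z. z - a) z \<noteq> 0" if "z \<in> A" "z - a = 0" for z using that a d by simp
  qed (rule that)
qed

text \<open>By induction on the number of factors: a \<open>k\<close>-th power that vanishes at \<open>a i\<close> has a
  base that vanishes there, so one linear factor can be taken out of both sides. No order of vanishing has to be
  mentioned.\<close>

lemma holomorphic_root_divide:
  fixes a :: "nat \<Rightarrow> complex"
  assumes A: "open A" and B: "B holomorphic_on A" and k: "k \<ge> 1" and v: "v holomorphic_on A"
    and eq: "\<And>z. z \<in> A \<Longrightarrow> v z ^ k = (\<Prod>i<N. z - a i) ^ k * B z" and a: "\<And>i. i < N \<Longrightarrow> a i \<in> A"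
  obtains u where "u holomorphic_on A" "\<And>z. z \<in> A \<Longrightarrow> v z = (\<Prod>i<N. z - a i) * u z" "\<And>z. z \<in> A \<Longrightarrow> u z ^ k = B z"
proof -
  have "\<exists>u. u holomorphic_on A \<and> (\<forall>z\<in>A. v z = (\<Prod>i<N. z - a i) * u z) \<and> (\<forall>z\<in>A. u z ^ k = B z)"
    using v eq a
  proof (induction N arbitrary: v)
    case 0
    then show ?case by (intro exI[of _ v]) auto
  next
    case (Suc N)
    have "v (a N) ^ k = 0" using Suc.prems(2)[of "a N"] Suc.prems(3)[of N] k by simp
    then have "v (a N) = 0" by simp
    then obtain v1 where v1: "v1 holomorphic_on A" "\<And>z. z \<in> A \<Longrightarrow> v z = (z - a N) * v1 z"
      using holomorphic_divide_linear[OF Suc.prems(1) A] by metis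
    have "v1 z ^ k = (\<Prod>i<N. z - a i) ^ k * B z" if "z \<in> A" for z
    proof -
      have "v1 z ^ k - (\<Prod>i<N. z - a i) ^ k * B z = 0"
      proof (rule holomorphic_zero_puncture[OF _ A _ that, where a = "a N"])
        show "(\<lambda>z. v1 z ^ k - (\<Prod>i<N. z - a i) ^ k * B z) holomorphic_on A" by (intro holomorphic_intros v1 B)
        fix z assume z: "z \<in> A" "z \<noteq> a N"
        have "(z - a N) ^ k * v1 z ^ k = (z - a N) ^ k * ((\<Prod>i<N. z - a i) ^ k * B z)"
          using Suc.prems(2)[OF z(1)] v1(2)[OF z(1)] by (simp add: power_mult_distrib mult_ac)
        then show "v1 z ^ k - (\<Prod>i<N. z - a i) ^ k * B z = 0" using z by simp
      qed
      then show ?thesis by simp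
    qed
    from Suc.IH[OF v1(1) this] Suc.prems(3) obtain u where u: "u holomorphic_on A" "\<forall>z\<in>A. v1 z = (\<Prod>i<N. z - a i) * u z" "\<forall>z\<in>A. u z ^ k = B z"
      by auto
    then show ?case using v1 by (intro exI[of _ u]) (auto simp: mult_ac)
  qed
  with that show thesis by blast
qed

lemma order_unique_at_point:
  fixes q :: complex
  assumes r: "r > 0" and X: "isCont X q" "X q \<noteq> 0" and Y: "isCont Y q" "Y q \<noteq> 0"
    and eq: "\<And>z. dist z q < r \<Longrightarrow> (z - q) ^ a * X z = (z - q) ^ b * Y z"
  shows "a = (b :: nat)"
proof -
  have *: "\<not> a < b" if X: "isCont X q" "X q \<noteq> 0" and Y: "isCont Y q"
    and eq: "\<And>z. dist z q < r \<Longrightarrow> (z - q) ^ a * X z = (z - q) ^ b * Y z" for a b :: nat and X Y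
  proof
    assume ab: "a < b"
    have "eventually (\<lambda>z. dist z q < r \<and> z \<noteq> q) (at q)" using r by (auto simp: eventually_at)
    then have ev: "eventually (\<lambda>z. (z - q) ^ (b - a) * Y z = X z) (at q)"
    proof eventually_elim
      case (elim z)
      have "(z - q) ^ b = (z - q) ^ a * (z - q) ^ (b - a)" using ab by (simp flip: power_add)
      then show ?case using eq[of z] elim by simp
    qed
    have "((\<lambda>z. (z - q) ^ (b - a) * Y z) \<longlongrightarrow> (q - q) ^ (b - a) * Y q) (at q)"
      using Y by (intro tendsto_intros) (simp add: isCont_def)
    then have "(X \<longlongrightarrow> (q - q) ^ (b - a) * Y q) (at q)" by (rule Lim_transform_eventually[OF _ ev])
    then have "(X \<longlongrightarrow> 0) (at q)" using ab by (simp add: power_0_left)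
    then show False using X by (metis LIM_unique isCont_def)
  qed
  show ?thesis using *[OF X Y(1) eq] *[OF Y X(1) eq[symmetric]] by auto
qed

context blaschke
begin

section \<open>Orthogonality on the fibres\<close>

text \<open>Shrinking the radius gives the lemmas about \<open>phi\<close> for functions that are holomorphic on a smaller
  disc only.\<close>

lemma blaschke_shrink: "1 < r \<Longrightarrow> r \<le> R \<Longrightarrow> blaschke lam n c r"
proof
  assume r: "1 < r" "r \<le> R"
  show "cmod (lam i) * r < 1" if "i < n" for i
    using lamR[OF that] mult_left_mono[of r R "cmod (lam i)"] r by simp
qed (use n c in auto)

lemma cnj_phi_circle: "cmod z = 1 \<Longrightarrow> cnj (phi z) = inverse (phi z)"
  using phi_eq1[of z] complex_norm_square[of "phi z"] by (metis inverse_unique mult.commute norm_one of_real_1 one_power2)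

text \<open>On the unit circle this is \<open>cnj (G z)\<close>; the reflection extends it holomorphically to an annulus,
  where residues can be taken.\<close>

lemma reflection_holomorphic:
  assumes G: "G holomorphic_on ball 0 R"
  shows "(\<lambda>z. cnj (G (cnj (1 / z)))) holomorphic_on {z. 1 / R < cmod z \<and> cmod z < R}" (is "_ holomorphic_on ?A")
proof -
  have img: "cnj ` ball 0 R = ball 0 R"
  proof (intro equalityI subsetI)
    fix x assume "x \<in> ball (0::complex) R"
    then show "x \<in> cnj ` ball 0 R" by (intro image_eqI[of _ _ "cnj x"]) auto
  qed auto
  have 1: "(cnj \<circ> G \<circ> cnj) holomorphic_on ball 0 R"
    by (rule holomorphic_on_compose_cnj_cnj) (use G img in auto)
  have 2: "(\<lambda>z. 1 / z) holomorphic_on ?A" using R by (intro holomorphic_intros) auto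
  have 3: "(\<lambda>z. 1 / z) ` ?A \<subseteq> ball 0 R" using R by (auto simp: norm_divide divide_less_eq mult.commute)
  have "((cnj \<circ> G \<circ> cnj) \<circ> (\<lambda>z. 1 / z)) holomorphic_on ?A" by (rule holomorphic_on_compose_gen[OF 2 1 3])
  then show ?thesis by (simp add: o_def)
qed

lemma reflection_circle: "cmod z = 1 \<Longrightarrow> cnj (G (cnj (1 / z))) = cnj (G z)"
  using complex_norm_square[of z] by (simp add: field_simps) (metis complex_cnj_cnj complex_cnj_divide complex_cnj_one mult.commute nonzero_mult_div_cancel_left norm_zero zero_neq_one)

text \<open>By the circle formula the orthogonality relation for \<open>k\<close> and \<open>l\<close> reads \<open>k * IA
  (k - l) + IB (k - l) = 0\<close>, where the two integrals depend on \<open>k - l\<close> alone. Raising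
  \<open>k\<close> and \<open>l\<close> together separates them, so both vanish for every integer argument. They
  are the moments to which the lemma on fibre sums applies.\<close>

lemma fibre_orthogonality:
  assumes f: "f holomorphic_on ball 0 R" and g: "g holomorphic_on ball 0 R"
    and orth: "\<And>k l. ip (cut (\<lambda>z. phi z ^ k * f z)) (cut (\<lambda>z. phi z ^ l * g z)) = 0" and w: "cmod w = 1"
  shows "(\<Sum>\<zeta>\<in>fib w. (\<zeta> * f \<zeta>) * cnj (\<zeta> * g \<zeta>)) = 0"
    and "(\<Sum>\<zeta>\<in>fib w. deriv (\<lambda>z. z * f z) \<zeta> / deriv phi \<zeta> * cnj (\<zeta> * g \<zeta>)) = 0"
proof -
  define F where "F = (\<lambda>z. z * f z)"
  define G where "G = (\<lambda>z. z * g z)"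
  have F: "F holomorphic_on ball 0 R" and G: "G holomorphic_on ball 0 R" unfolding F_def G_def by (intro holomorphic_intros f g)+
  have dF: "deriv F holomorphic_on ball 0 R" and dphi: "deriv phi holomorphic_on ball 0 R" using F phi_holo by (auto intro: holomorphic_deriv)
  have sub: "sphere 0 1 \<subseteq> ball (0::complex) R" using R by auto
  have cont: "continuous_on (sphere 0 1) h" if "h holomorphic_on ball 0 R" for h :: "complex \<Rightarrow> complex"
    by (rule holomorphic_on_imp_continuous_on[OF holomorphic_on_subset[OF that sub]])
  have pn: "phi z \<noteq> 0" if "cmod z = 1" for z using phi_eq1[OF that] by auto
  define IA where "IA j = circ_int 1 (\<lambda>z. phi z powi (j - 1) * deriv phi z * F z * cnj (G z))" for j :: int
  define IB where "IB j = circ_int 1 (\<lambda>z. phi z powi j * deriv F z * cnj (G z))" for j :: int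
  have rel: "of_nat k * IA (int k - int l) + IB (int k - int l) = 0" for k l
  proof -
    let ?j = "int k - int l"
    have "(\<lambda>z. phi z ^ k * f z) holomorphic_on ball 0 R" "(\<lambda>z. phi z ^ l * g z) holomorphic_on ball 0 R"
      by (intro holomorphic_intros phi_holo f g)+
    from dirichlet_inner_circle[OF this R] orth[of k l]
    have "0 = circ_int 1 (\<lambda>z. deriv (\<lambda>z. z * (phi z ^ k * f z)) z * cnj (z * (phi z ^ l * g z)))" by simp
    also have "\<dots> = circ_int 1 (\<lambda>z. of_nat k * (phi z powi (?j - 1) * deriv phi z * F z * cnj (G z)) + phi z powi ?j * deriv F z * cnj (G z))"
    proof (rule circ_int_cong)
      fix z :: complex assume z: "cmod z = 1"
      then have zR: "z \<in> ball 0 R" using R by simp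
      have "(phi has_field_derivative deriv phi z) (at z)" "(F has_field_derivative deriv F z) (at z)"
        using holomorphic_derivI[OF phi_holo open_ball zR] holomorphic_derivI[OF F open_ball zR] by auto
      then have "((\<lambda>z. phi z ^ k * F z) has_field_derivative (of_nat k * phi z ^ (k - 1) * deriv phi z * F z + phi z ^ k * deriv F z)) (at z)"
        by (auto intro!: derivative_eq_intros)
      moreover have "(\<lambda>z. z * (phi z ^ k * f z)) = (\<lambda>z. phi z ^ k * F z)" by (auto simp: F_def)
      ultimately have d: "deriv (\<lambda>z. z * (phi z ^ k * f z)) z = of_nat k * phi z ^ (k - 1) * deriv phi z * F z + phi z ^ k * deriv F z"
        by (simp add: DERIV_imp_deriv)
      have e: "cnj (z * (phi z ^ l * g z)) = inverse (phi z) ^ l * cnj (G z)"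
        using cnj_phi_circle[OF z] by (simp add: G_def)
      have p: "phi z ^ k * inverse (phi z) ^ l = phi z powi ?j"
        using pn[OF z] by (simp add: power_int_diff power_inverse divide_inverse)
      have p1: "of_nat k * phi z ^ (k - 1) * inverse (phi z) ^ l = of_nat k * phi z powi (?j - 1)"
      proof (cases k)
        case (Suc k')
        have "?j - 1 = int k' - int l" using Suc by simp
        then show ?thesis using pn[OF z] Suc by (simp add: power_int_diff power_inverse divide_inverse)
      qed simp
      have "deriv (\<lambda>z. z * (phi z ^ k * f z)) z * cnj (z * (phi z ^ l * g z)) =
        (of_nat k * phi z ^ (k - 1) * inverse (phi z) ^ l) * deriv phi z * F z * cnj (G z) + (phi z ^ k * inverse (phi z) ^ l) * deriv F z * cnj (G z)"
        unfolding d e by (simp add: algebra_simps)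
      then show "deriv (\<lambda>z. z * (phi z ^ k * f z)) z * cnj (z * (phi z ^ l * g z)) =
        of_nat k * (phi z powi (?j - 1) * deriv phi z * F z * cnj (G z)) + phi z powi ?j * deriv F z * cnj (G z)"
        unfolding p p1 by (simp add: mult_ac)
    qed simp
    also have "\<dots> = of_nat k * IA ?j + IB ?j"
      unfolding IA_def IB_def using pn
      by (subst circ_int_add, simp, (intro continuous_intros cont F G dF dphi phi_holo; auto)+)
         (subst circ_int_cmult, simp, (intro continuous_intros cont F G dF dphi phi_holo; auto)+, simp)
    finally show ?thesis by simp
  qed
  have I: "IA j = 0 \<and> IB j = 0" for j
  proof -
    define k l where "k = nat j" and "l = nat (- j)"
    have kl: "int k - int l = j" "int (Suc k) - int (Suc l) = j" by (auto simp: k_def l_def)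
    have "of_nat k * IA j + IB j = 0" "of_nat (Suc k) * IA j + IB j = 0"
      using rel[of k l] rel[of "Suc k" "Suc l"] unfolding kl by auto
    then show ?thesis by (simp add: algebra_simps add_eq_0_iff)
  qed
  let ?A = "{z. 1 / R < cmod z \<and> cmod z < R}"
  have AR: "?A \<subseteq> ball 0 R" by auto
  note hA = holomorphic_on_subset[OF _ AR]
  have "(\<Sum>\<zeta>\<in>fib w. (deriv phi \<zeta> * F \<zeta> * cnj (G (cnj (1 / \<zeta>)))) / deriv phi \<zeta>) = 0"
  proof (rule fibre_sum_zero[OF _ w])
    show "(\<lambda>z. deriv phi z * F z * cnj (G (cnj (1 / z)))) holomorphic_on ?A"
      by (intro holomorphic_on_mult reflection_holomorphic G hA dphi F)
    show "circ_int 1 (\<lambda>z. deriv phi z * F z * cnj (G (cnj (1 / z))) * phi z powi j) = 0" for j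
    proof -
      have "circ_int 1 (\<lambda>z. deriv phi z * F z * cnj (G (cnj (1 / z))) * phi z powi j) = IA (j + 1)"
        unfolding IA_def by (rule circ_int_cong) (simp_all only: reflection_circle, simp_all)
      then show ?thesis using I by simp
    qed
  qed
  moreover have "(\<Sum>\<zeta>\<in>fib w. (deriv phi \<zeta> * F \<zeta> * cnj (G (cnj (1 / \<zeta>)))) / deriv phi \<zeta>) = (\<Sum>\<zeta>\<in>fib w. F \<zeta> * cnj (G \<zeta>))"
    by (intro sum.cong refl) (simp only: reflection_circle[OF fib_circle], simp add: phi_deriv_nonzero[OF fib_circle])
  ultimately show "(\<Sum>\<zeta>\<in>fib w. (\<zeta> * f \<zeta>) * cnj (\<zeta> * g \<zeta>)) = 0" by (simp add: F_def G_def)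
  have "(\<Sum>\<zeta>\<in>fib w. (deriv F \<zeta> * cnj (G (cnj (1 / \<zeta>)))) / deriv phi \<zeta>) = 0"
  proof (rule fibre_sum_zero[OF _ w])
    show "(\<lambda>z. deriv F z * cnj (G (cnj (1 / z)))) holomorphic_on ?A"
      by (intro holomorphic_on_mult reflection_holomorphic G hA dF)
    show "circ_int 1 (\<lambda>z. deriv F z * cnj (G (cnj (1 / z))) * phi z powi j) = 0" for j
    proof -
      have "circ_int 1 (\<lambda>z. deriv F z * cnj (G (cnj (1 / z))) * phi z powi j) = IB j"
        unfolding IB_def by (rule circ_int_cong) (simp_all only: reflection_circle, simp_all)
      then show ?thesis using I by simp
    qed
  qed
  moreover have "(\<Sum>\<zeta>\<in>fib w. (deriv F \<zeta> * cnj (G (cnj (1 / \<zeta>)))) / deriv phi \<zeta>) = (\<Sum>\<zeta>\<in>fib w. deriv F \<zeta> / deriv phi \<zeta> * cnj (G \<zeta>))"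
    by (intro sum.cong refl) (simp only: reflection_circle[OF fib_circle], simp)
  ultimately show "(\<Sum>\<zeta>\<in>fib w. deriv (\<lambda>z. z * f z) \<zeta> / deriv phi \<zeta> * cnj (\<zeta> * g \<zeta>)) = 0" by (simp add: F_def G_def)
qed

section \<open>A function of the Blaschke product\<close>

lemma phi_factorization:
  obtains E where "E holomorphic_on ball 0 R" "\<And>z. cmod z < R \<Longrightarrow> E z \<noteq> 0" "\<And>z. phi z = E z * (\<Prod>i<n. z - lam i)"
proof
  define E where "E = (\<lambda>z. c * (\<Prod>i<n. - 1 / (1 - cnj (lam i) * z)))"
  show "E holomorphic_on ball 0 R" unfolding E_def by (intro holomorphic_intros) (use denom in auto)
  show "E z \<noteq> 0" if "cmod z < R" for z using c denom[OF _ that] by (auto simp: E_def)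
  show "phi z = E z * (\<Prod>i<n. z - lam i)" for z
  proof -
    have "disc_aut (lam i) z = - 1 / (1 - cnj (lam i) * z) * (z - lam i)" for i
      by (simp add: disc_aut_def diff_divide_distrib)
    then show ?thesis by (simp only: E_def phi_def prod.distrib mult.assoc)
  qed
qed

text \<open>\<open>phi\<close> is a product of linear factors times a nonvanishing function, so powers of \<open>phi\<close>
  can be cancelled from \<open>k\<close>-th powers one linear factor at a time.\<close>

lemma root_divide_phi:
  assumes B: "B holomorphic_on ball 0 R" and k: "k \<ge> 1" and v: "v holomorphic_on ball 0 R"
    and eq: "\<And>z. cmod z < R \<Longrightarrow> v z ^ k = phi z ^ (k * m) * B z"
  obtains u where "u holomorphic_on ball 0 R" "\<And>z. cmod z < R \<Longrightarrow> v z = phi z ^ m * u z" "\<And>z. cmod z < R \<Longrightarrow> u z ^ k = B z"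
proof -
  obtain E where E: "E holomorphic_on ball 0 R" "\<And>z. cmod z < R \<Longrightarrow> E z \<noteq> 0" "\<And>z. phi z = E z * (\<Prod>i<n. z - lam i)"
    using phi_factorization by blast
  have lamball: "lam i \<in> ball 0 R" if "i < n" for i using lam_lt[OF that] R by simp
  have "\<exists>u. u holomorphic_on ball 0 R \<and> (\<forall>z\<in>ball 0 R. v z = phi z ^ m * u z) \<and> (\<forall>z\<in>ball 0 R. u z ^ k = B z)"
    using v eq
  proof (induction m arbitrary: v)
    case 0
    then show ?case by (intro exI[of _ v]) auto
  next
    case (Suc m)
    obtain u1 where u1: "u1 holomorphic_on ball 0 R" "\<And>z. z \<in> ball 0 R \<Longrightarrow> v z = (\<Prod>i<n. z - lam i) * u1 z"
      "\<And>z. z \<in> ball 0 R \<Longrightarrow> u1 z ^ k = E z ^ k * (phi z ^ (k * m) * B z)"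
    proof (rule holomorphic_root_divide[OF open_ball _ k Suc.prems(1) _ lamball])
      show "(\<lambda>z. E z ^ k * (phi z ^ (k * m) * B z)) holomorphic_on ball 0 R" by (intro holomorphic_intros E phi_holo B)
      show "v z ^ k = (\<Prod>i<n. z - lam i) ^ k * (E z ^ k * (phi z ^ (k * m) * B z))" if "z \<in> ball 0 R" for z
      proof -
        have "v z ^ k = phi z ^ k * (phi z ^ (k * m) * B z)" using Suc.prems(2)[of z] that by (simp add: power_add)
        also have "phi z ^ k = (\<Prod>i<n. z - lam i) ^ k * E z ^ k" by (simp only: E(3)[of z] power_mult_distrib mult.commute)
        finally show ?thesis by (simp add: mult.assoc)
      qed
    qed auto
    define u2 where "u2 = (\<lambda>z. u1 z / E z)"
    have "u2 holomorphic_on ball 0 R" unfolding u2_def by (intro holomorphic_intros u1 E) (use E in auto)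
    moreover have "u2 z ^ k = phi z ^ (k * m) * B z" if "cmod z < R" for z
      using u1(3)[of z] E(2)[OF that] that by (simp add: u2_def power_divide)
    ultimately obtain u where u: "u holomorphic_on ball 0 R" "\<forall>z\<in>ball 0 R. u2 z = phi z ^ m * u z" "\<forall>z\<in>ball 0 R. u z ^ k = B z"
      using Suc.IH by blast
    have "v z = phi z ^ Suc m * u z" if "z \<in> ball 0 R" for z
    proof -
      have "v z = phi z * u2 z" using u1(2)[OF that] E(2)[of z] E(3)[of z] that by (simp add: u2_def)
      then show ?thesis using u(2) that by simp
    qed
    then show ?case using u by (intro exI[of _ u]) auto
  qed
  with that show thesis by auto
qed

text \<open>Let \<open>H\<close> be the trace of \<open>X = F ^ k\<close>. On a fibre \<open>dX / dphi\<close> is a multiple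
  of \<open>X\<close>, so its sum over the fibre is the same multiple of the sum of \<open>X\<close>. Hence
  \<open>X\<close> and \<open>H \<circ> phi\<close> have the same logarithmic derivative on the circle, and
  their quotient is constant. The power \<open>k\<close> only serves to keep the trace from vanishing
  identically.\<close>

lemma power_is_function_of_phi:
  assumes F: "F holomorphic_on ball 0 R"
    and par: "\<And>w. cmod w = 1 \<Longrightarrow> \<exists>\<kappa>. \<forall>\<zeta>\<in>fib w. deriv F \<zeta> / deriv phi \<zeta> = \<kappa> * F \<zeta>"
    and nz: "cmod z1 = 1" "F z1 \<noteq> 0"
  obtains k C H \<rho> r where "k \<ge> (1::nat)" "C \<noteq> 0" "\<rho> > (1::real)" "H holomorphic_on ball 0 \<rho>" "1 < r" "r \<le> R"
    "\<And>z. cmod z < r \<Longrightarrow> cmod (phi z) < \<rho>" "\<And>z. cmod z < r \<Longrightarrow> F z ^ k = C * H (phi z)" "H (phi z1) \<noteq> 0"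
proof -
  define w1 where "w1 = phi z1"
  have w1: "cmod w1 = 1" using phi_eq1[OF nz(1)] by (simp add: w1_def)
  \<comment> \<open>The trace of \<open>F\<close> itself may vanish, as that of \<open>z\<close> does for \<open>phi z = z\<^sup>2\<close>.\<close>
  obtain k where k: "k \<ge> 1" "(\<Sum>\<zeta>\<in>fib w1. F \<zeta> ^ k) \<noteq> 0"
    using power_sum_nonzero[OF fib_finite_card(1)[OF w1], of z1 F] fib_self[OF nz(1)] nz(2) by (auto simp: w1_def)
  define X where "X = (\<lambda>z. F z ^ k)"
  have X: "X holomorphic_on ball 0 R" unfolding X_def by (intro holomorphic_intros F)
  have dX: "deriv X z = of_nat k * F z ^ (k - 1) * deriv F z" if "cmod z < R" for z
  proof (rule DERIV_imp_deriv)
    have "(F has_field_derivative deriv F z) (at z)" using that by (intro holomorphic_derivI[OF F]) auto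
    then show "(X has_field_derivative of_nat k * F z ^ (k - 1) * deriv F z) (at z)"
      unfolding X_def by (auto intro!: derivative_eq_intros)
  qed
  obtain H \<rho> where H: "\<rho> > 1" "H holomorphic_on ball 0 \<rho>" "\<And>w. cmod w = 1 \<Longrightarrow> H w = (\<Sum>\<zeta>\<in>fib w. X \<zeta>)"
    "\<And>w. cmod w = 1 \<Longrightarrow> deriv H w = (\<Sum>\<zeta>\<in>fib w. deriv X \<zeta> / deriv phi \<zeta>)"
    using trace_exists[OF X] by metis
  have Hw1: "H w1 \<noteq> 0" using H(3)[OF w1] k(2) by (simp add: X_def)
  define U where "U = ball 0 R \<inter> phi -` ball 0 \<rho>"
  have U: "open U" unfolding U_def using phi_holo
    by (intro continuous_open_preimage holomorphic_on_imp_continuous_on) auto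
  have "cball 0 1 \<subseteq> U"
  proof
    fix z :: complex assume "z \<in> cball 0 1"
    then have "cmod z < 1 \<or> cmod z = 1" by auto
    then have "cmod (phi z) \<le> 1" using phi_lt[of z] phi_eq1[of z] by auto
    then show "z \<in> U" using \<open>z \<in> cball 0 1\<close> R H(1) by (simp add: U_def)
  qed
  then obtain e where e: "e > 0" "(\<Union>x\<in>cball 0 1. ball x e) \<subseteq> U"
    using compact_subset_open_imp_ball_epsilon_subset[OF compact_cball U] by blast
  define r where "r = 1 + e / 2"
  have rU: "z \<in> U" if z: "cmod z < r" for z
  proof (cases "cmod z \<le> 1")
    case True
    then show ?thesis using \<open>cball 0 1 \<subseteq> U\<close> by auto
  next
    case False
    define y where "y = z / of_real (cmod z)"
    have "cmod z > 0" using False by linarith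
    then have y: "z = y * of_real (cmod z)" "cmod y = 1" by (simp_all add: y_def norm_divide)
    have "y - z = y * of_real (1 - cmod z)" by (subst y(1)) (simp only: of_real_diff of_real_1 right_diff_distrib mult_1_right)
    then have "dist y z = \<bar>1 - cmod z\<bar>" using y(2) by (simp only: dist_norm norm_mult norm_of_real mult_1)
    then have "z \<in> ball y e" using z e False by (simp add: r_def)
    moreover have "y \<in> cball 0 1" using y(2) by simp
    ultimately show ?thesis using e(2) by blast
  qed
  have r1: "1 < r" using e by (simp add: r_def)
  have zr: "cmod z < R" "cmod (phi z) < \<rho>" if "cmod z < r" for z using rU[OF that] by (auto simp: U_def)
  have rR: "r \<le> R"
  proof (rule ccontr)
    assume "\<not> r \<le> R"
    then have "cmod (of_real R) < r" using R by simp
    from zr(1)[OF this] show False using R by simp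
  qed
  have sub: "ball 0 r \<subseteq> ball (0::complex) R" using rR by auto
  define Y where "Y = H \<circ> phi"
  have Y: "Y holomorphic_on ball 0 r"
    unfolding Y_def by (rule holomorphic_on_compose_gen[OF phi_holo_subset[OF sub] H(2)]) (use zr in auto)
  have Xr: "X holomorphic_on ball 0 r" by (rule holomorphic_on_subset[OF X sub])
  \<comment> \<open>The Wronskian vanishes on the circle, hence everywhere.\<close>
  have wronsk: "deriv X z * Y z - X z * deriv Y z = 0" if "cmod z < r" for z
  proof (rule holomorphic_zero_on_circle[OF _ r1 _ that])
    show "(\<lambda>z. deriv X z * Y z - X z * deriv Y z) holomorphic_on ball 0 r" by (intro holomorphic_intros Xr Y) auto
    fix z :: complex assume z: "cmod z = 1"
    have pz: "cmod (phi z) = 1" by (rule phi_eq1[OF z])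
    obtain \<kappa> where \<kappa>: "\<And>\<zeta>. \<zeta> \<in> fib (phi z) \<Longrightarrow> deriv F \<zeta> / deriv phi \<zeta> = \<kappa> * F \<zeta>" using par[OF pz] by blast
    have dXf: "deriv X \<zeta> / deriv phi \<zeta> = of_nat k * \<kappa> * X \<zeta>" if "\<zeta> \<in> fib (phi z)" for \<zeta>
    proof -
      have "deriv X \<zeta> / deriv phi \<zeta> = of_nat k * F \<zeta> ^ (k - 1) * (deriv F \<zeta> / deriv phi \<zeta>)"
        using dX[of \<zeta>] fib_circle[OF that] R by simp
      also have "\<dots> = of_nat k * \<kappa> * (F \<zeta> ^ (k - 1) * F \<zeta>)" unfolding \<kappa>[OF that] by simp
      also have "F \<zeta> ^ (k - 1) * F \<zeta> = X \<zeta>" using k(1) by (simp add: X_def flip: power_Suc2)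
      finally show ?thesis .
    qed
    have dH: "deriv H (phi z) = of_nat k * \<kappa> * H (phi z)"
      unfolding H(3)[OF pz] H(4)[OF pz] sum_distrib_left by (intro sum.cong refl dXf)
    have dYz: "deriv Y z = deriv H (phi z) * deriv phi z"
    proof (unfold Y_def, rule deriv_chain)
      show "phi field_differentiable at z"
        using phi_holo z R by (intro holomorphic_on_imp_differentiable_at[of _ "ball 0 R"]) auto
      show "H field_differentiable at (phi z)"
        using H(1,2) pz by (intro holomorphic_on_imp_differentiable_at[of _ "ball 0 \<rho>"]) auto
    qed
    have "deriv X z = of_nat k * \<kappa> * X z * deriv phi z"
      using dXf[OF fib_self[OF z]] phi_deriv_nonzero[OF z] by (simp add: field_simps)
    then show "deriv X z * Y z - X z * deriv Y z = 0"
      unfolding dYz dH by (simp add: Y_def)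
  qed
  have Yz1: "Y z1 \<noteq> 0" using Hw1 by (simp add: Y_def w1_def)
  have z1r: "z1 \<in> ball 0 r" using nz r1 by simp
  obtain \<delta> where \<delta>: "\<delta> > 0" "ball z1 \<delta> \<subseteq> ball 0 r" "\<And>z. z \<in> ball z1 \<delta> \<Longrightarrow> Y z \<noteq> 0"
  proof -
    have Yc: "continuous_on (ball 0 r) Y" by (rule holomorphic_on_imp_continuous_on[OF Y])
    have "open (ball 0 r \<inter> Y -` (- {0}))" by (rule continuous_open_preimage[OF Yc]) auto
    moreover have "z1 \<in> ball 0 r \<inter> Y -` (- {0})" using Yz1 z1r by simp
    ultimately obtain \<delta> where "\<delta> > 0" "ball z1 \<delta> \<subseteq> ball 0 r \<inter> Y -` (- {0})" using open_contains_ball by meson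
    then show thesis using that[of \<delta>] by blast
  qed
  have "\<exists>C. \<forall>z\<in>ball z1 \<delta>. X z / Y z = C"
  proof (rule has_field_derivative_zero_constant)
    fix z assume z: "z \<in> ball z1 \<delta>"
    then have zr': "z \<in> ball 0 r" using \<delta>(2) by blast
    have d: "(X has_field_derivative deriv X z) (at z)" "(Y has_field_derivative deriv Y z) (at z)"
      using holomorphic_derivI[OF Xr open_ball zr'] holomorphic_derivI[OF Y open_ball zr'] by auto
    have "((\<lambda>z. X z / Y z) has_field_derivative (deriv X z * Y z - X z * deriv Y z) / (Y z * Y z)) (at z)"
      by (rule DERIV_divide[OF d \<delta>(3)[OF z]])
    moreover have "cmod z < r" using zr' by simp
    ultimately have "((\<lambda>z. X z / Y z) has_field_derivative 0) (at z)" by (simp only: wronsk div_0)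
    then show "((\<lambda>z. X z / Y z) has_field_derivative 0) (at z within ball z1 \<delta>)"
      by (rule has_field_derivative_at_within)
  qed simp
  then obtain C where C: "\<And>z. z \<in> ball z1 \<delta> \<Longrightarrow> X z / Y z = C" by blast
  have XC: "X z = C * Y z" if "cmod z < r" for z
  proof -
    have "X z - C * Y z = 0"
    proof (rule analytic_continuation[where f = "\<lambda>z. X z - C * Y z" and w = z and U = "ball z1 \<delta>" and \<xi> = z1 and S = "ball 0 r"])
      show "(\<lambda>z. X z - C * Y z) holomorphic_on ball 0 r" by (intro holomorphic_intros Xr Y)
      show "z1 islimpt ball z1 \<delta>" using \<delta>(1) by (simp add: islimpt_ball)
      show "X z - C * Y z = 0" if "z \<in> ball z1 \<delta>" for z using C[OF that] \<delta>(3)[OF that] by (simp add: field_simps)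
    qed (use that \<delta>(2) z1r in auto)
    then show ?thesis by simp
  qed
  have "X z1 \<noteq> 0" using nz(2) by (simp add: X_def)
  then have C0: "C \<noteq> 0" using XC[of z1] z1r by auto
  show thesis
  proof (rule that[OF k(1) C0 H(1,2) r1 rR])
    show "cmod (phi z) < \<rho>" if "cmod z < r" for z by (rule zr(2)[OF that])
    show "F z ^ k = C * H (phi z)" if "cmod z < r" for z using XC[OF that] by (simp add: X_def Y_def)
    show "H (phi z1) \<noteq> 0" using Hw1 by (simp add: w1_def)
  qed
qed

text \<open>At a simple zero of \<open>phi\<close> the left side vanishes to an order divisible by \<open>k\<close> and the
  right side to the order \<open>s\<close>.\<close>

lemma order_at_simple_zero:
  assumes q: "q < n" "\<And>j. j < n \<Longrightarrow> j \<noteq> q \<Longrightarrow> lam j \<noteq> lam q"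
    and F: "F holomorphic_on ball 0 R" and F0: "F (lam q) = 0" and nz: "cmod z1 < R" "F z1 \<noteq> 0"
    and B: "B holomorphic_on ball 0 R" "B (lam q) \<noteq> 0"
    and eq: "\<And>z. cmod z < R \<Longrightarrow> F z ^ k = phi z ^ s * B z"
  shows "k dvd s"
proof -
  have lq: "lam q \<in> ball 0 R" using lam_lt[OF q(1)] R by simp
  have "\<not> F constant_on ball 0 R" using F0 nz lq unfolding constant_on_def by force
  from holomorphic_factor_zero_nonconstant[OF F open_ball connected_ball lq F0 this]
  obtain g r o' where g: "0 < o'" "0 < r" "ball (lam q) r \<subseteq> ball 0 R" "g holomorphic_on ball (lam q) r"
    "\<And>w. w \<in> ball (lam q) r \<Longrightarrow> F w = (w - lam q) ^ o' * g w" "\<And>w. w \<in> ball (lam q) r \<Longrightarrow> g w \<noteq> 0" by metis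
  obtain E where E: "E holomorphic_on ball 0 R" "\<And>z. cmod z < R \<Longrightarrow> E z \<noteq> 0" "\<And>z. phi z = E z * (\<Prod>i<n. z - lam i)"
    using phi_factorization by blast
  define \<psi> where "\<psi> = (\<lambda>z. E z * (\<Prod>i\<in>{..<n}-{q}. z - lam i))"
  have \<psi>: "\<psi> holomorphic_on ball 0 R" unfolding \<psi>_def by (intro holomorphic_intros E)
  have "lam q - lam i \<noteq> 0" if "i \<in> {..<n} - {q}" for i using q(2)[of i] that by auto
  then have \<psi>q: "\<psi> (lam q) \<noteq> 0" using E(2)[of "lam q"] lq by (simp add: \<psi>_def)
  have phi\<psi>: "phi z = (z - lam q) * \<psi> z" for z
    using q(1) by (simp add: E(3) \<psi>_def prod.remove[of "{..<n}" q])
  have ct: "isCont h (lam q)" if "h holomorphic_on ball 0 R" for h :: "complex \<Rightarrow> complex"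
    using holomorphic_on_imp_continuous_on[OF that] lq by (simp add: continuous_on_eq_continuous_at)
  have gct: "isCont g (lam q)"
    using holomorphic_on_imp_continuous_on[OF g(4)] g(2) by (simp add: continuous_on_eq_continuous_at)
  have "o' * k = s"
  proof (rule order_unique_at_point[OF g(2)])
    show "isCont (\<lambda>z. g z ^ k) (lam q)" by (intro continuous_intros gct)
    show "g (lam q) ^ k \<noteq> 0" using g(2,6) by simp
    show "isCont (\<lambda>z. \<psi> z ^ s * B z) (lam q)" by (intro continuous_intros ct \<psi> B)
    show "\<psi> (lam q) ^ s * B (lam q) \<noteq> 0" using \<psi>q B by simp
    fix z assume "dist z (lam q) < r"
    then have z: "z \<in> ball (lam q) r" by (simp add: dist_commute)
    have "cmod z < R" using z g(3) by auto
    from eq[OF this] show "(z - lam q) ^ (o' * k) * g z ^ k = (z - lam q) ^ s * (\<psi> z ^ s * B z)"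
      unfolding g(5)[OF z] phi\<psi>[of z] by (simp add: power_mult_distrib power_mult mult.assoc)
  qed
  then show ?thesis by auto
qed

text \<open>The central step. Here \<open>f0\<close> spans one part of the wandering space and \<open>V\<close> is the other
  part.

  Put \<open>F z = z * f0 z\<close>. On a fibre over the circle \<open>V\<close> and \<open>f0\<close> together
  take arbitrary values, and both \<open>F\<close> and \<open>dF / dphi\<close> are orthogonal to all \<open>z *
  g z\<close>; therefore \<open>dF / dphi\<close> is a multiple of \<open>F\<close>, and \<open>F ^ k = C * H
  (phi)\<close> for some \<open>k\<close>. The simple zero \<open>lam q\<close> of \<open>phi\<close> shows that
  \<open>k\<close> divides the order \<open>s\<close> of \<open>H\<close> at the origin, so that \<open>F = phi
  ^ m * u\<close> with \<open>u\<close> nonzero at all zeros of \<open>phi\<close>.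

  The modulus of \<open>F\<close> is constant on a fibre, hence \<open>cnj F\<close> is proportional to \<open>F
  ^ (k - 1)\<close> and so to \<open>u ^ (k - 1)\<close>. Orthogonality of \<open>F\<close> and \<open>z * g
  z\<close> thus says that the trace of the holomorphic function \<open>u z ^ (k - 1) * z * g z\<close> vanishes
  on the circle. Then it vanishes at \<open>0\<close> too, where it is the sum over the zeros of
  \<open>phi\<close>. Since \<open>F\<close> vanishes at these zeros, the values of \<open>z * g z\<close> there
  can be prescribed as those of \<open>z * y z\<close> for any \<open>y\<close>, and a function \<open>y\<close>
  that singles out a nonzero zero is contradictory.\<close>

lemma phi_root_zero:
  assumes phi0: "phi 0 = 0"
    and f0: "f0 holomorphic_on ball 0 R" and V: "\<And>g. g \<in> V \<Longrightarrow> g holomorphic_on ball 0 R"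
    and orth: "\<And>g k l. g \<in> V \<Longrightarrow> ip (cut (\<lambda>z. phi z ^ k * f0 z)) (cut (\<lambda>z. phi z ^ l * g z)) = 0"
    and surj: "\<And>w x. cmod w = 1 \<Longrightarrow> \<exists>\<alpha>. \<exists>g\<in>V. \<forall>\<zeta>\<in>fib w. x \<zeta> = \<alpha> * f0 \<zeta> + g \<zeta>"
    and nz: "cmod z1 = 1" "f0 z1 \<noteq> 0"
    and interp: "\<And>y. \<exists>\<alpha>. \<exists>g\<in>V. \<forall>i<n. y (lam i) = \<alpha> * f0 (lam i) + g (lam i)"
    and q: "q < n" "\<And>j. j < n \<Longrightarrow> j \<noteq> q \<Longrightarrow> lam j \<noteq> lam q"
    and i1: "i1 < n"
  shows "lam i1 = 0"
proof -
  define F where "F = (\<lambda>z. z * f0 z)"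
  have F: "F holomorphic_on ball 0 R" unfolding F_def by (intro holomorphic_intros f0)
  have Fz1: "F z1 \<noteq> 0" using nz by (auto simp: F_def)
  have par: "\<exists>\<kappa>. \<forall>\<zeta>\<in>fib w. deriv F \<zeta> / deriv phi \<zeta> = \<kappa> * F \<zeta>" if w: "cmod w = 1" for w
  proof -
    obtain \<alpha> g where g: "g \<in> V" and eq: "\<And>\<zeta>. \<zeta> \<in> fib w \<Longrightarrow> deriv F \<zeta> / deriv phi \<zeta> / \<zeta> = \<alpha> * f0 \<zeta> + g \<zeta>"
      using surj[OF w, of "\<lambda>\<zeta>. deriv F \<zeta> / deriv phi \<zeta> / \<zeta>"] by blast
    have eq': "deriv F \<zeta> / deriv phi \<zeta> = \<alpha> * F \<zeta> + \<zeta> * g \<zeta>" if "\<zeta> \<in> fib w" for \<zeta>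
    proof -
      have "\<zeta> \<noteq> 0" using fib_circle[OF that] by auto
      then have "deriv F \<zeta> / deriv phi \<zeta> = \<zeta> * (deriv F \<zeta> / deriv phi \<zeta> / \<zeta>)" by simp
      also have "\<dots> = \<zeta> * (\<alpha> * f0 \<zeta> + g \<zeta>)" by (simp only: eq[OF that])
      also have "\<dots> = \<alpha> * F \<zeta> + \<zeta> * g \<zeta>" by (simp add: F_def algebra_simps)
      finally show ?thesis .
    qed
    note o = fibre_orthogonality[OF f0 V[OF g] orth[OF g] w, folded F_def]
    have "(\<Sum>\<zeta>\<in>fib w. deriv F \<zeta> / deriv phi \<zeta> * cnj (\<zeta> * g \<zeta>)) = (\<Sum>\<zeta>\<in>fib w. \<alpha> * (F \<zeta> * cnj (\<zeta> * g \<zeta>)) + (\<zeta> * g \<zeta>) * cnj (\<zeta> * g \<zeta>))"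
      by (intro sum.cong refl) (simp only: eq' distrib_right mult.assoc)
    also have "\<dots> = \<alpha> * (\<Sum>\<zeta>\<in>fib w. F \<zeta> * cnj (\<zeta> * g \<zeta>)) + (\<Sum>\<zeta>\<in>fib w. (\<zeta> * g \<zeta>) * cnj (\<zeta> * g \<zeta>))"
      by (simp only: sum.distrib sum_distrib_left)
    also have "(\<Sum>\<zeta>\<in>fib w. F \<zeta> * cnj (\<zeta> * g \<zeta>)) = 0" using o(1) by (simp only: F_def)
    finally have "(\<Sum>\<zeta>\<in>fib w. (\<zeta> * g \<zeta>) * cnj (\<zeta> * g \<zeta>)) = 0" using o(2) by (simp only:) simp
    then have "complex_of_real (\<Sum>\<zeta>\<in>fib w. (cmod (\<zeta> * g \<zeta>))\<^sup>2) = 0" by (simp only: of_real_sum complex_norm_square)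
    then have "(\<Sum>\<zeta>\<in>fib w. (cmod (\<zeta> * g \<zeta>))\<^sup>2) = 0" by (simp only: of_real_eq_0_iff)
    then have "\<forall>\<zeta>\<in>fib w. (cmod (\<zeta> * g \<zeta>))\<^sup>2 = 0"
      using fib_finite_card(1)[OF w] by (subst (asm) sum_nonneg_eq_0_iff) auto
    then have "\<forall>\<zeta>\<in>fib w. deriv F \<zeta> / deriv phi \<zeta> = \<alpha> * F \<zeta>" by (simp add: eq')
    then show ?thesis by (rule exI)
  qed
  obtain k C H \<rho> r where k: "k \<ge> (1::nat)" and C: "C \<noteq> 0" and \<rho>: "\<rho> > (1::real)" and H: "H holomorphic_on ball 0 \<rho>"
    and r: "1 < r" "r \<le> R" and phir: "\<And>z. cmod z < r \<Longrightarrow> cmod (phi z) < \<rho>"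
    and FH: "\<And>z. cmod z < r \<Longrightarrow> F z ^ k = C * H (phi z)" and Hw1: "H (phi z1) \<noteq> 0"
    by (rule power_is_function_of_phi[OF F par nz(1) Fz1], assumption, rule that)
  interpret r: blaschke lam n c r by (rule blaschke_shrink[OF r])
  have sub: "ball 0 r \<subseteq> ball (0::complex) R" using r by auto
  have H0: "H 0 = 0" using FH[of 0] r k C phi0 by (simp add: F_def power_0_left)
  have pz1: "phi z1 \<in> ball 0 \<rho>" using phi_eq1[OF nz(1)] \<rho> by simp
  have \<rho>0: "(0::complex) \<in> ball 0 \<rho>" using \<rho> by simp
  have nc: "\<not> H constant_on ball 0 \<rho>" using H0 Hw1 pz1 \<rho>0 unfolding constant_on_def by force
  obtain h d s where h: "0 < s" "0 < d" "ball (0::complex) d \<subseteq> ball 0 \<rho>" "h holomorphic_on ball 0 d"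
    "\<And>w. w \<in> ball 0 d \<Longrightarrow> H w = (w - 0) ^ s * h w" "\<And>w. w \<in> ball 0 d \<Longrightarrow> h w \<noteq> 0"
    by (rule holomorphic_factor_zero_nonconstant[OF H open_ball connected_ball \<rho>0 H0 nc], rule that)
  \<comment> \<open>The quotient \<open>H w / w ^ s\<close> with its singularity at the origin removed.\<close>
  define H1 where "H1 w = (if w = 0 then h 0 else H w / w ^ s)" for w
  have H1: "H1 holomorphic_on ball 0 \<rho>"
  proof -
    have "H1 holomorphic_on ball 0 d" by (rule holomorphic_transform[OF h(4)]) (use h(5) in \<open>auto simp: H1_def\<close>)
    moreover have "H1 holomorphic_on (ball 0 \<rho> - {0})"
    proof (rule holomorphic_transform)
      show "(\<lambda>w. H w / w ^ s) holomorphic_on (ball 0 \<rho> - {0})" by (intro holomorphic_intros holomorphic_on_subset[OF H]) auto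
    qed (auto simp: H1_def)
    ultimately have "H1 holomorphic_on (ball 0 d \<union> (ball 0 \<rho> - {0}))" by (rule holomorphic_on_Un) auto
    moreover have "ball 0 d \<union> (ball 0 \<rho> - {0}) = ball (0::complex) \<rho>" using h(2,3) by auto
    ultimately show ?thesis by simp
  qed
  have H10: "H1 0 \<noteq> 0" using h(2,6) by (simp add: H1_def)
  have HH1: "H w = w ^ s * H1 w" for w using H0 h(1) by (simp add: H1_def)
  define B where "B = (\<lambda>z. C * H1 (phi z))"
  have B: "B holomorphic_on ball 0 r"
  proof -
    have "(H1 \<circ> phi) holomorphic_on ball 0 r"
      by (rule holomorphic_on_compose_gen[OF phi_holo_subset[OF sub] H1]) (use phir in auto)
    then show ?thesis unfolding B_def by (intro holomorphic_intros) (simp add: o_def)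
  qed
  have FB: "F z ^ k = phi z ^ s * B z" if "cmod z < r" for z
    using FH[OF that] HH1[of "phi z"] by (simp add: B_def)
  have Fr: "F holomorphic_on ball 0 r" by (rule holomorphic_on_subset[OF F sub])
  have lamz: "phi (lam i) = 0" if "i < n" for i
    using phi_zero_iff[of "lam i"] lam_lt[OF that] R that by auto
  have Blam: "B (lam i) \<noteq> 0" if "i < n" for i using lamz[OF that] C H10 by (simp add: B_def)
  have Flam: "F (lam i) = 0" if "i < n" for i
    using FB[of "lam i"] lamz[OF that] lam_lt[OF that] r h(1) k by (simp add: power_0_left)
  have "k dvd s"
    by (rule r.order_at_simple_zero[OF q Fr Flam[OF q(1)] _ Fz1 B Blam[OF q(1)] FB]) (use nz r in auto)
  then obtain m where m: "s = k * m" by auto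
  have m0: "m > 0" using m h(1) by auto
  obtain u where u: "u holomorphic_on ball 0 r" "\<And>z. cmod z < r \<Longrightarrow> F z = phi z ^ m * u z" "\<And>z. cmod z < r \<Longrightarrow> u z ^ k = B z"
    by (rule r.root_divide_phi[OF B k Fr FB[unfolded m]], assumption, rule that)
  have ulam: "u (lam i) \<noteq> 0" if "i < n" for i
    using u(3)[of "lam i"] Blam[OF that] lam_lt[OF that] r k by (auto simp: power_0_left)
  have key: "(\<Sum>i<n. u (lam i) ^ (k - 1) * (lam i * g (lam i))) = 0" if g: "g \<in> V" for g
  proof -
    define T where "T = (\<lambda>z. u z ^ (k - 1) * (z * g z))"
    have T: "T holomorphic_on ball 0 r" unfolding T_def by (intro holomorphic_intros u holomorphic_on_subset[OF V[OF g] sub])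
    obtain H2 \<rho>2 where H2: "\<rho>2 > 1" "H2 holomorphic_on ball 0 \<rho>2" "\<And>w. cmod w = 1 \<Longrightarrow> H2 w = (\<Sum>\<zeta>\<in>fib w. T \<zeta>)"
      "H2 0 = (\<Sum>i<n. T (lam i))" by (rule r.trace_exists[OF T], rule that)
    have zero: "H2 w * H1 w = 0" if w: "cmod w = 1" for w
    proof (cases "H w = 0")
      case True
      have "w \<noteq> 0" using w by auto
      then show ?thesis using True HH1[of w] by simp
    next
      case False
      have w0: "w \<noteq> 0" using w by auto
      have Fk: "F \<zeta> ^ k = C * H w" if "\<zeta> \<in> fib w" for \<zeta>
        using FH[of \<zeta>] that r by (auto simp: fib_def)
      define M where "M = root k (cmod (C * H w))"
      have Fn: "cmod (F \<zeta>) = M" if "\<zeta> \<in> fib w" for \<zeta>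
      proof -
        have "cmod (C * H w) = cmod (F \<zeta>) ^ k" by (simp only: Fk[OF that, symmetric] norm_power)
        then have "M = root k (cmod (F \<zeta>) ^ k)" by (simp only: M_def)
        also have "\<dots> = cmod (F \<zeta>)" using k by (intro real_root_power_cancel) auto
        finally show ?thesis by (rule sym)
      qed
      have Fnz: "F \<zeta> \<noteq> 0" if "\<zeta> \<in> fib w" for \<zeta> using Fk[OF that] False C k by (auto simp: power_0_left)
      \<comment> \<open>The only nonholomorphic factor, \<open>M\<close>, is constant on the fibre and leaves the sum.\<close>
      have t: "cnj (F \<zeta>) = of_real (M\<^sup>2) / (C * H w) * w ^ (m * (k - 1)) * u \<zeta> ^ (k - 1)" if \<zeta>: "\<zeta> \<in> fib w" for \<zeta>
      proof -
        have 1: "cnj (F \<zeta>) * F \<zeta> = of_real (M\<^sup>2)"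
          unfolding Fn[OF \<zeta>, symmetric] complex_norm_square by (rule mult.commute)
        have 2: "F \<zeta> * F \<zeta> ^ (k - 1) = C * H w"
          unfolding Fk[OF \<zeta>, symmetric] using k by (cases k) auto
        have CH: "C * H w \<noteq> 0" using False C by simp
        have "cnj (F \<zeta>) * (C * H w) = of_real (M\<^sup>2) * F \<zeta> ^ (k - 1)"
          unfolding 2[symmetric] 1[symmetric] by (simp only: mult.assoc)
        then have 3: "cnj (F \<zeta>) = of_real (M\<^sup>2) * F \<zeta> ^ (k - 1) / (C * H w)"
          by (simp only: nonzero_eq_divide_eq[OF CH])
        have "cmod \<zeta> < r" "phi \<zeta> = w" using \<zeta> r by (auto simp: fib_def)
        then have "F \<zeta> ^ (k - 1) = w ^ (m * (k - 1)) * u \<zeta> ^ (k - 1)"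
          using u(2)[of \<zeta>] by (simp only: power_mult_distrib power_mult)
        then show ?thesis unfolding 3 by simp
      qed
      have "(\<Sum>\<zeta>\<in>fib w. F \<zeta> * cnj (\<zeta> * g \<zeta>)) = 0"
        using fibre_orthogonality(1)[OF f0 V[OF g] orth[OF g] w] by (simp only: F_def)
      then have "cnj (\<Sum>\<zeta>\<in>fib w. F \<zeta> * cnj (\<zeta> * g \<zeta>)) = 0" by simp
      then have "(\<Sum>\<zeta>\<in>fib w. cnj (F \<zeta>) * (\<zeta> * g \<zeta>)) = 0" by simp
      also have "(\<Sum>\<zeta>\<in>fib w. cnj (F \<zeta>) * (\<zeta> * g \<zeta>)) = of_real (M\<^sup>2) / (C * H w) * w ^ (m * (k - 1)) * (\<Sum>\<zeta>\<in>fib w. T \<zeta>)"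
        unfolding sum_distrib_left T_def by (intro sum.cong refl) (simp only: t mult.assoc)
      finally have "M = 0 \<or> (\<Sum>\<zeta>\<in>fib w. T \<zeta>) = 0" using False C w0 by simp
      moreover have "fib w = {}" if "M = 0"
      proof (rule ccontr)
        assume "fib w \<noteq> {}"
        then obtain \<zeta> where "\<zeta> \<in> fib w" by blast
        then show False using Fn[of \<zeta>] Fnz[of \<zeta>] that by simp
      qed
      ultimately have "(\<Sum>\<zeta>\<in>fib w. T \<zeta>) = 0" by auto
      then show ?thesis using H2(3)[OF w] by simp
    qed
    have "H2 0 * H1 0 = 0"
    proof (rule holomorphic_zero_on_circle[where r = "min \<rho> \<rho>2" and W = "\<lambda>w. H2 w * H1 w"])
      show "(\<lambda>w. H2 w * H1 w) holomorphic_on ball 0 (min \<rho> \<rho>2)"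
        by (intro holomorphic_intros holomorphic_on_subset[OF H1] holomorphic_on_subset[OF H2(2)]) auto
    qed (use zero \<rho> H2(1) in auto)
    then show ?thesis using H10 H2(4) by (simp add: T_def)
  qed
  show ?thesis
  proof (rule ccontr)
    assume ne: "lam i1 \<noteq> 0"
    obtain \<alpha> g where g: "g \<in> V" and y: "\<And>i. i < n \<Longrightarrow> (if lam i = lam i1 then 1 else 0) = \<alpha> * f0 (lam i) + g (lam i)"
      using interp[of "\<lambda>z. if z = lam i1 then 1 else 0"] by blast
    have "lam i * g (lam i) = (if lam i = lam i1 then lam i1 else 0)" if "i < n" for i
    proof -
      have "lam i * (if lam i = lam i1 then 1 else 0) = \<alpha> * F (lam i) + lam i * g (lam i)"
        unfolding y[OF that] by (simp add: F_def algebra_simps)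
      then show ?thesis using Flam[OF that] by (auto split: if_splits)
    qed
    then have "(\<Sum>i<n. u (lam i) ^ (k - 1) * (lam i * g (lam i))) = (\<Sum>i<n. if lam i = lam i1 then u (lam i1) ^ (k - 1) * lam i1 else 0)"
      by (intro sum.cong) auto
    also have "\<dots> = of_nat (card {i\<in>{..<n}. lam i = lam i1}) * (u (lam i1) ^ (k - 1) * lam i1)"
      by (simp add: sum.If_cases Int_def)
    also have "\<dots> \<noteq> 0" using ulam[OF i1] ne i1 by auto
    finally show False using key[OF g] by simp
  qed
qed

end

section \<open>Divided differences and division by the Blaschke product\<close>

lemma holomorphic_dmultiplier:
  assumes f: "f holomorphic_on ball 0 R" and R: "R > 1"
  shows "dmultiplier f"
proof -
  have sub: "cball 0 1 \<subseteq> ball (0::complex) R" using R by auto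
  have df: "deriv f holomorphic_on ball 0 R" using f by (auto intro: holomorphic_deriv)
  have "bounded (f ` cball 0 1)" "bounded (deriv f ` cball 0 1)"
    by (intro compact_imp_bounded compact_continuous_image compact_cball holomorphic_on_imp_continuous_on
        holomorphic_on_subset[OF f sub] holomorphic_on_subset[OF df sub])+
  then obtain C1 C2 where C: "\<forall>y\<in>f ` cball 0 1. cmod y \<le> C1" "\<forall>y\<in>deriv f ` cball 0 1. cmod y \<le> C2"
    unfolding bounded_iff by blast
  have "\<forall>z\<in>ball 0 1. cmod (f z) \<le> max C1 C2 \<and> cmod (deriv f z) \<le> max C1 C2"
    using C by (auto simp: le_max_iff_disj)
  moreover have "f holomorphic_on ball 0 1" by (rule holomorphic_on_subset[OF f]) (use R in auto)
  ultimately show ?thesis unfolding dmultiplier_def by blast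
qed

lemma mult_op_cut: "mult_op m (cut f) = cut (\<lambda>z. m z * f z)"
  by (auto simp: mult_op_def cut_def)

text \<open>The Taylor series converges uniformly on the circle and may be integrated term by term.\<close>

lemma circ_int_taylor_sums:
  assumes f: "f holomorphic_on ball 0 1" and r: "0 < r" "r < 1" and h: "continuous_on (sphere 0 r) h"
  shows "(\<lambda>k. taylor_coeff f k * circ_int r (\<lambda>z. z ^ k * h z)) sums circ_int r (\<lambda>z. f z * h z)"
proof -
  have fc: "continuous_on (sphere 0 r) f"
    using r by (intro holomorphic_on_imp_continuous_on holomorphic_on_subset[OF f]) auto
  obtain B where B: "B \<ge> 0" "\<And>z. cmod z = r \<Longrightarrow> cmod (h z) \<le> B"
  proof -
    have "bounded (h ` sphere 0 r)" by (intro compact_imp_bounded compact_continuous_image h) simp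
    then obtain B where "\<forall>y\<in>h ` sphere 0 r. cmod y \<le> B" unfolding bounded_iff by blast
    then have "cmod (h z) \<le> B" if "cmod z = r" for z using that by auto
    then show thesis using that[of B] order_trans[OF norm_ge_zero, of "h (of_real r)" B] r by simp
  qed
  obtain r' where r': "r < r'" "r' < 1" using r dense by blast
  obtain K where K: "K \<ge> 0" "\<And>k. cmod (taylor_coeff f k) \<le> K * (1 / r') ^ k"
    using taylor_coeff_geometric_bound[OF f, of r'] r r' by auto
  let ?q = "r / r'"
  have q: "0 \<le> ?q" "?q < 1" using r r' by auto
  have asum: "summable (\<lambda>k. cmod (taylor_coeff f k) * r ^ k)"
  proof (rule summable_comparison_test_ev)
    show "summable (\<lambda>k. K * ?q ^ k)" using q by (intro summable_mult summable_geometric) auto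
    show "\<forall>\<^sub>F k in sequentially. norm (cmod (taylor_coeff f k) * r ^ k) \<le> K * ?q ^ k"
    proof (intro always_eventually allI)
      fix k
      have "cmod (taylor_coeff f k) * r ^ k \<le> K * (1 / r') ^ k * r ^ k" using K(2)[of k] r by (intro mult_right_mono) auto
      then show "norm (cmod (taylor_coeff f k) * r ^ k) \<le> K * ?q ^ k" using r by (simp add: power_divide)
    qed
  qed
  define S where "S N z = (\<Sum>k<N. taylor_coeff f k * z ^ k)" for N and z :: complex
  have Sc: "continuous_on (sphere 0 r) (S N)" for N unfolding S_def by (intro continuous_intros)
  have IS: "circ_int r (\<lambda>z. S N z * h z) = (\<Sum>k<N. taylor_coeff f k * circ_int r (\<lambda>z. z ^ k * h z))" for N
  proof -
    have "circ_int r (\<lambda>z. S N z * h z) = circ_int r (\<lambda>z. \<Sum>k<N. taylor_coeff f k * (z ^ k * h z))"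
      by (rule circ_int_cong) (use r in \<open>simp_all only: S_def sum_distrib_right mult.assoc\<close>)
    also have "\<dots> = (\<Sum>k<N. circ_int r (\<lambda>z. taylor_coeff f k * (z ^ k * h z)))"
      using r by (intro circ_int_sum continuous_on_mult continuous_on_const continuous_on_power continuous_on_id h) auto
    also have "\<dots> = (\<Sum>k<N. taylor_coeff f k * circ_int r (\<lambda>z. z ^ k * h z))"
      using r by (intro sum.cong refl circ_int_cmult continuous_on_mult continuous_on_power continuous_on_id h) auto
    finally show ?thesis .
  qed
  let ?T = "\<lambda>N. \<Sum>k. cmod (taylor_coeff f (k + N)) * r ^ (k + N)"
  have T0: "0 \<le> ?T N" for N using r by (intro suminf_nonneg summable_ignore_initial_segment[OF asum]) auto
  have tail: "cmod (f z - S N z) \<le> ?T N" if z: "cmod z = r" for z N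
  proof -
    have "(\<lambda>k. taylor_coeff f k * z ^ k) sums f z" using z r by (intro taylor_series[OF f]) auto
    then have "(\<lambda>k. taylor_coeff f (k + N) * z ^ (k + N)) sums (f z - S N z)"
      unfolding S_def by (rule sums_split_initial_segment)
    moreover have n: "norm (taylor_coeff f (k + N) * z ^ (k + N)) = cmod (taylor_coeff f (k + N)) * r ^ (k + N)" for k
      using z by (simp add: norm_mult norm_power)
    ultimately show ?thesis
      using summable_norm[of "\<lambda>k. taylor_coeff f (k + N) * z ^ (k + N)"] summable_ignore_initial_segment[OF asum, of N]
      unfolding n by (simp add: sums_iff)
  qed
  have "(\<lambda>N. circ_int r (\<lambda>z. S N z * h z) - circ_int r (\<lambda>z. f z * h z)) \<longlonglongrightarrow> 0"
  proof (rule Lim_null_comparison)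
    show "(\<lambda>N. r * B * ?T N) \<longlonglongrightarrow> 0"
      using tendsto_mult_left[OF suminf_exist_split2[OF asum], of "r * B"] by simp
    show "\<forall>\<^sub>F N in sequentially. norm (circ_int r (\<lambda>z. S N z * h z) - circ_int r (\<lambda>z. f z * h z)) \<le> r * B * ?T N"
    proof (intro always_eventually allI)
      fix N
      have "circ_int r (\<lambda>z. S N z * h z) - circ_int r (\<lambda>z. f z * h z) = circ_int r (\<lambda>z. S N z * h z - f z * h z)"
        using r by (intro circ_int_diff[symmetric] continuous_on_mult fc Sc h) simp
      moreover have "cmod (circ_int r (\<lambda>z. S N z * h z - f z * h z)) \<le> r * (B * ?T N)"
      proof (rule circ_int_bound)
        show "continuous_on (sphere 0 r) (\<lambda>z. S N z * h z - f z * h z)"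
          by (intro continuous_on_diff continuous_on_mult fc Sc h)
        show "0 \<le> B * ?T N" using B T0 by simp
        fix z :: complex assume z: "cmod z = r"
        have "cmod (S N z * h z - f z * h z) = cmod (h z) * cmod (f z - S N z)"
          unfolding left_diff_distrib[symmetric] norm_mult by (simp only: norm_minus_commute mult.commute)
        also have "\<dots> \<le> B * ?T N" using B z tail[OF z] T0 by (intro mult_mono) auto
        finally show "cmod (S N z * h z - f z * h z) \<le> B * ?T N" .
      qed (use r in simp)
      ultimately show "norm (circ_int r (\<lambda>z. S N z * h z) - circ_int r (\<lambda>z. f z * h z)) \<le> r * B * ?T N" by (simp add: mult_ac)
    qed
  qed
  then have "(\<lambda>N. circ_int r (\<lambda>z. S N z * h z)) \<longlonglongrightarrow> circ_int r (\<lambda>z. f z * h z)" by (simp add: Lim_null[symmetric])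
  then show ?thesis unfolding sums_def IS .
qed

context blaschke
begin

lemma phi_dmultiplier: "dmultiplier phi"
  by (rule holomorphic_dmultiplier[OF phi_holo R])

lemma phi_mult_dirichlet: "f \<in> dirichlet_space \<Longrightarrow> mult_op phi f \<in> dirichlet_space"
  using dmultiplier_bounded[OF phi_dmultiplier] by metis

text \<open>The integral of \<open>f * rep_kernel j\<close> over a circle around the zeros is the divided difference of
  \<open>f\<close> at \<open>lam 0, \<dots>, lam j\<close>. Divided differences treat multiple zeros without
  derivatives.\<close>

definition rep_kernel :: "nat \<Rightarrow> complex \<Rightarrow> complex" where
  "rep_kernel j z = 1 / (\<Prod>i\<le>j. z - lam i)"

text \<open>The coefficients dictated by testing \<open>ip f (rep j)\<close> on monomials.\<close>

definition rep_coeff :: "nat \<Rightarrow> nat \<Rightarrow> complex" where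
  "rep_coeff j k = cnj (circ_int (1 / R) (\<lambda>z. z ^ k * rep_kernel j z)) / (of_nat k + 1)"

definition rep :: "nat \<Rightarrow> complex \<Rightarrow> complex" where
  "rep j z = (\<Sum>k. rep_coeff j k * z ^ k)"

lemma R_inv: "0 < 1 / R" "1 / R < 1" using R by auto

lemma rep_kernel_nonzero: "j < n \<Longrightarrow> cmod z \<ge> 1 / R \<Longrightarrow> (\<Prod>i\<le>j. z - lam i) \<noteq> 0"
proof -
  assume j: "j < n" and z: "1 / R \<le> cmod z"
  have "z - lam i \<noteq> 0" if "i \<le> j" for i using lam_lt'[of i] that j z by auto
  then show ?thesis by simp
qed

lemma rep_kernel_continuous: "j < n \<Longrightarrow> continuous_on (sphere 0 (1 / R)) (rep_kernel j)"
  unfolding rep_kernel_def[abs_def] by (intro continuous_intros) (use rep_kernel_nonzero in auto)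

lemma rep_coeff_bound:
  assumes j: "j < n"
  obtains K where "K \<ge> 0" "\<And>k. cmod (rep_coeff j k) \<le> K * (1 / R) ^ k"
proof -
  have "bounded (rep_kernel j ` sphere 0 (1 / R))" by (intro compact_imp_bounded compact_continuous_image rep_kernel_continuous j) simp
  then obtain B where "\<forall>y\<in>rep_kernel j ` sphere 0 (1 / R). cmod y \<le> B" unfolding bounded_iff by blast
  then have B: "cmod (rep_kernel j z) \<le> B" if "cmod z = 1 / R" for z using that by auto
  have B0: "B \<ge> 0"
  proof -
    have "cmod (complex_of_real (1 / R)) = 1 / R" using R by (simp del: of_real_divide)
    from order_trans[OF norm_ge_zero B[OF this]] show ?thesis .
  qed
  show thesis
  proof (rule that[of "1 / R * B"])
    show "0 \<le> 1 / R * B" using B0 R_inv by simp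
    fix k
    have "cmod (circ_int (1 / R) (\<lambda>z. z ^ k * rep_kernel j z)) \<le> 1 / R * ((1 / R) ^ k * B)"
    proof (rule circ_int_bound)
      show "continuous_on (sphere 0 (1 / R)) (\<lambda>z. z ^ k * rep_kernel j z)"
        by (intro continuous_on_mult continuous_on_power continuous_on_id rep_kernel_continuous j)
      show "0 \<le> (1 / R) ^ k * B" using B0 R_inv by simp
      show "cmod (z ^ k * rep_kernel j z) \<le> (1 / R) ^ k * B" if z: "cmod z = 1 / R" for z
        unfolding norm_mult norm_power z using B[OF z] R_inv by (intro mult_left_mono) auto
    qed (rule R_inv)
    moreover have "cmod (of_nat k + 1 :: complex) = real k + 1" by (metis norm_of_nat of_nat_Suc add.commute of_nat_1 of_nat_add)
    moreover have "x / (real k + 1) \<le> x" if "x \<ge> 0" for x :: real using that mult_left_mono[of 1 "real k + 1" x] by (simp add: divide_le_eq)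
    ultimately show "cmod (rep_coeff j k) \<le> 1 / R * B * (1 / R) ^ k"
      unfolding rep_coeff_def norm_divide complex_mod_cnj by (smt (verit) mult.assoc mult.commute norm_ge_zero)
  qed
qed

text \<open>The kernel is integrated over the circle of radius \<open>1 / R\<close>, so the coefficients decay like
  \<open>(1 / R) ^ k\<close>.\<close>

lemma rep_holo:
  assumes j: "j < n"
  shows "rep j holomorphic_on ball 0 R" "taylor_coeff (rep j) k = rep_coeff j k"
proof -
  obtain K where K: "K \<ge> 0" "\<And>k. cmod (rep_coeff j k) \<le> K * (1 / R) ^ k" using rep_coeff_bound[OF j] by blast
  have ser: "(\<lambda>k. rep_coeff j k * z ^ k) sums rep j z" if z: "cmod z < R" for z
  proof -
    have "summable (\<lambda>k. rep_coeff j k * z ^ k)"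
    proof (rule summable_comparison_test_ev)
      show "summable (\<lambda>k. K * (cmod z / R) ^ k)" using z R by (intro summable_mult summable_geometric) auto
      show "\<forall>\<^sub>F k in sequentially. norm (rep_coeff j k * z ^ k) \<le> K * (cmod z / R) ^ k"
      proof (intro always_eventually allI)
        fix k
        have "norm (rep_coeff j k * z ^ k) \<le> K * (1 / R) ^ k * cmod z ^ k"
          unfolding norm_mult norm_power by (intro mult_right_mono K(2)) auto
        then show "norm (rep_coeff j k * z ^ k) \<le> K * (cmod z / R) ^ k" by (simp add: power_divide)
      qed
    qed
    then show ?thesis unfolding rep_def by (rule summable_sums)
  qed
  have "R > 0" using R by simp
  from power_series_taylor_coeff[OF this ser]
  show "rep j holomorphic_on ball 0 R" "taylor_coeff (rep j) k = rep_coeff j k" by auto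
qed

lemma rep_dirichlet: "j < n \<Longrightarrow> cut (rep j) \<in> dirichlet_space"
  by (rule cut_dirichlet[OF rep_holo(1) R])

lemma inner_rep:
  assumes j: "j < n" and f: "f \<in> dirichlet_space"
  shows "ip f (cut (rep j)) = circ_int (1 / R) (\<lambda>z. f z * rep_kernel j z)"
proof -
  have n0: "(of_nat k + 1 :: complex) \<noteq> 0" for k by (metis of_nat_Suc of_nat_neq_0 add.commute)
  have "(\<lambda>k. (of_nat k + 1) * taylor_coeff f k * cnj (taylor_coeff (cut (rep j)) k)) sums ip f (cut (rep j))"
    by (rule dirichlet_inner_sums[OF f rep_dirichlet[OF j]])
  moreover have "(of_nat k + 1) * taylor_coeff f k * cnj (taylor_coeff (cut (rep j)) k) = taylor_coeff f k * circ_int (1 / R) (\<lambda>z. z ^ k * rep_kernel j z)" for k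
    using n0[of k] cut_taylor_coeff(1)[OF rep_holo(1)[OF j]] rep_holo(2)[OF j] R by (simp add: rep_coeff_def)
  ultimately have "(\<lambda>k. taylor_coeff f k * circ_int (1 / R) (\<lambda>z. z ^ k * rep_kernel j z)) sums ip f (cut (rep j))" by simp
  with circ_int_taylor_sums[OF dirichlet_spaceD(1)[OF f] R_inv rep_kernel_continuous[OF j]] show ?thesis
    by (rule sums_unique2[rotated])
qed

text \<open>Once the first \<open>m\<close> linear factors are divided out, the divided difference at \<open>lam 0, \<dots>,
  lam m\<close> is the value of the quotient at \<open>lam m\<close>; as it vanishes, the next factor divides.
  The remaining factor of \<open>phi\<close> has no zeros.\<close>

lemma orth_rep_divisible:
  assumes f: "f \<in> dirichlet_space" and z: "\<And>j. j < n \<Longrightarrow> ip f (cut (rep j)) = 0"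
  obtains h where "h holomorphic_on ball 0 1" "\<And>z. cmod z < 1 \<Longrightarrow> f z = phi z * h z"
proof -
  note fh = dirichlet_spaceD(1)[OF f]
  have "\<exists>h. h holomorphic_on ball 0 1 \<and> (\<forall>z\<in>ball 0 1. f z = (\<Prod>i<m. z - lam i) * h z)" if "m \<le> n" for m
    using that
  proof (induction m)
    case 0
    then show ?case using fh by auto
  next
    case (Suc m)
    then obtain h where h: "h holomorphic_on ball 0 1" "\<And>z. z \<in> ball 0 1 \<Longrightarrow> f z = (\<Prod>i<m. z - lam i) * h z" by auto
    have m: "m < n" using Suc.prems by simp
    have "0 = circ_int (1 / R) (\<lambda>z. f z * rep_kernel m z)" using inner_rep[OF m f] z[OF m] by simp
    also have "\<dots> = circ_int (1 / R) (\<lambda>z. h z / (z - lam m))"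
    proof (rule circ_int_cong[OF R_inv(1)])
      fix z assume zr: "cmod z = 1 / R"
      have "(\<Prod>i\<le>m. z - lam i) = (\<Prod>i<m. z - lam i) * (z - lam m)" by (simp flip: lessThan_Suc_atMost)
      then show "f z * rep_kernel m z = h z / (z - lam m)"
        using rep_kernel_nonzero[OF m, of z] zr h(2)[of z] R_inv by (simp add: rep_kernel_def)
    qed
    also have "\<dots> = h (lam m)" by (rule circ_int_Cauchy[OF R_inv(1) h(1) R_inv(2) lam_lt'[OF m]])
    finally have "h (lam m) = 0" by simp
    then obtain q where q: "q holomorphic_on ball 0 1" "\<And>z. z \<in> ball 0 1 \<Longrightarrow> h z = (z - lam m) * q z"
      using holomorphic_divide_linear[OF h(1) open_ball] by metis
    then show ?case using h(2) by (intro exI[of _ q]) (auto simp: mult_ac)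
  qed
  from this[of n] obtain h where h: "h holomorphic_on ball 0 1" "\<And>z. z \<in> ball 0 1 \<Longrightarrow> f z = (\<Prod>i<n. z - lam i) * h z" by auto
  obtain E where E': "E holomorphic_on ball 0 R" "\<And>z. cmod z < R \<Longrightarrow> E z \<noteq> 0" and Ez: "\<And>z. phi z = E z * (\<Prod>i<n. z - lam i)"
    using phi_factorization by blast
  have E: "E holomorphic_on ball 0 1" "\<And>z. cmod z < 1 \<Longrightarrow> E z \<noteq> 0"
    using E' R by (auto intro: holomorphic_on_subset)
  show thesis
  proof (rule that[of "\<lambda>z. h z / E z"])
    show "(\<lambda>z. h z / E z) holomorphic_on ball 0 1" using E by (intro holomorphic_intros h) auto
    show "f z = phi z * (h z / E z)" if "cmod z < 1" for z
      using h(2)[of z] E(2)[OF that] that by (simp add: Ez)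
  qed
qed

text \<open>Only the behaviour near the circle matters, and there \<open>phi\<close> is bounded away from zero.\<close>

lemma divide_phi_dirichlet:
  assumes f: "f \<in> dirichlet_space" and h: "h holomorphic_on ball 0 1" and eq: "\<And>z. cmod z < 1 \<Longrightarrow> f z = phi z * h z"
  shows "cut h \<in> dirichlet_space" "f = mult_op phi (cut h)"
proof -
  note F = dirichlet_spaceD[OF f]
  show "f = mult_op phi (cut h)" using eq F(2) by (auto simp: fun_eq_iff mult_op_def cut_def)
  have ch: "cut h holomorphic_on ball 0 1" by (rule holomorphic_transform[OF h]) (auto simp: cut_def)
  have dh: "deriv h holomorphic_on ball 0 1" using h by (auto intro: holomorphic_deriv)
  have dch: "deriv (cut h) z = deriv h z" if "cmod z < 1" for z
  proof (rule deriv_cong_ev)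
    show "eventually (\<lambda>z. cut h z = h z) (nhds z)"
      using eventually_nhds_in_open[of "ball 0 1" z] that by (auto elim!: eventually_mono simp: cut_def)
  qed simp
  obtain s where s: "1 / R < s" "s < 1" using dense[OF R_inv(2)] by blast
  have s0: "s > 0" using s R_inv by linarith
  let ?K = "{z. s \<le> cmod z} \<inter> cball (0::complex) 1"
  have Kc: "compact ?K"
    by (intro closed_Int_compact compact_cball closed_Collect_le continuous_intros)
  have KR: "?K \<subseteq> ball 0 R" using R by auto
  have nz: "phi z \<noteq> 0" if "z \<in> ?K" for z using phi_nonzero[of z] that s R by auto
  have bp: "bounded ((\<lambda>z. 1 / phi z) ` ?K)" "bounded (deriv phi ` ?K)"
    using nz phi_holo holomorphic_deriv[OF phi_holo open_ball]
    by (intro compact_imp_bounded compact_continuous_image Kc continuous_intros holomorphic_on_imp_continuous_on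
        holomorphic_on_subset[OF _ KR]; auto)+
  then obtain C1 C2 where "\<forall>y\<in>(\<lambda>z. 1 / phi z) ` ?K. cmod y \<le> C1" "\<forall>y\<in>deriv phi ` ?K. cmod y \<le> C2"
    unfolding bounded_iff by blast
  then have C: "cmod (1 / phi z) \<le> C1" "cmod (deriv phi z) \<le> C2" if "z \<in> ?K" for z using that by blast+
  have "bounded (deriv h ` cball 0 s)"
    by (intro compact_imp_bounded compact_continuous_image holomorphic_on_imp_continuous_on holomorphic_on_subset[OF dh])
       (use s in auto)
  then obtain C3 where "\<forall>y\<in>deriv h ` cball 0 s. cmod y \<le> C3" unfolding bounded_iff by blast
  then have C3: "cmod (deriv h z) \<le> C3" if "cmod z \<le> s" for z using that by auto
  \<comment> \<open>Near the circle the quotient rule bounds the derivative of \<open>f / phi\<close> by \<open>A\<close> times the moduli of \<open>f\<close> and its derivative.\<close>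
  define A where "A = C1 * max 1 (C2 * C1)"
  have "of_real s \<in> ?K" using s s0 by auto
  from order_trans[OF norm_ge_zero C(1)[OF this]] order_trans[OF norm_ge_zero C(2)[OF this]] have C0: "C1 \<ge> 0" "C2 \<ge> 0" by auto
  have bound: "(cmod (deriv h z))\<^sup>2 \<le> C3\<^sup>2 + (2 * A\<^sup>2 * (cmod (f z))\<^sup>2 + 2 * A\<^sup>2 * (cmod (deriv f z))\<^sup>2)" if z: "cmod z < 1" for z
  proof (cases "cmod z \<le> s")
    case True
    then have "(cmod (deriv h z))\<^sup>2 \<le> C3\<^sup>2" using C3[OF True] by (intro power_mono) auto
    moreover have "0 \<le> 2 * A\<^sup>2 * (cmod (f z))\<^sup>2 + 2 * A\<^sup>2 * (cmod (deriv f z))\<^sup>2" by simp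
    ultimately show ?thesis by linarith
  next
    case False
    then have zK: "z \<in> ?K" using z by auto
    have zb: "z \<in> ball 0 1" "z \<in> ball 0 R" using z R by auto
    have d: "(phi has_field_derivative deriv phi z) (at z)" "(h has_field_derivative deriv h z) (at z)"
      using holomorphic_derivI[OF phi_holo open_ball zb(2)] holomorphic_derivI[OF h open_ball zb(1)] by auto
    have "((\<lambda>z. phi z * h z) has_field_derivative (deriv phi z * h z + phi z * deriv h z)) (at z)"
      using d by (auto intro!: derivative_eq_intros)
    then have "deriv (\<lambda>z. phi z * h z) z = deriv phi z * h z + phi z * deriv h z" by (rule DERIV_imp_deriv)
    moreover have "deriv f z = deriv (\<lambda>z. phi z * h z) z"
      by (rule deriv_cong_ev) (use eventually_nhds_in_open[OF open_ball zb(1)] eq in \<open>auto elim!: eventually_mono\<close>)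
    ultimately have "phi z * deriv h z = deriv f z - deriv phi z * h z" by simp
    then have "deriv h z = 1 / phi z * (deriv f z - deriv phi z * (1 / phi z * f z))"
      using nz[OF zK] eq[OF z] by (simp add: field_simps)
    then have "cmod (deriv h z) = cmod (1 / phi z) * cmod (deriv f z - deriv phi z * (1 / phi z * f z))" by (simp only: norm_mult)
    also have "\<dots> \<le> C1 * (cmod (deriv f z) + cmod (deriv phi z) * (cmod (1 / phi z) * cmod (f z)))"
      using C(1)[OF zK] C0 norm_triangle_ineq4[of "deriv f z" "deriv phi z * (1 / phi z * f z)"]
      by (intro mult_mono) (simp_all only: norm_mult norm_ge_zero)
    also have "\<dots> \<le> C1 * (cmod (deriv f z) + C2 * (C1 * cmod (f z)))"
      using C[OF zK] C0 by (intro mult_left_mono add_left_mono mult_mono mult_nonneg_nonneg) auto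
    also have "\<dots> \<le> C1 * (max 1 (C2 * C1) * cmod (deriv f z) + max 1 (C2 * C1) * cmod (f z))"
    proof (intro mult_left_mono add_mono)
      show "cmod (deriv f z) \<le> max 1 (C2 * C1) * cmod (deriv f z)" using mult_right_mono[of 1 "max 1 (C2 * C1)" "cmod (deriv f z)"] by simp
      show "C2 * (C1 * cmod (f z)) \<le> max 1 (C2 * C1) * cmod (f z)" using mult_right_mono[of "C2 * C1" "max 1 (C2 * C1)" "cmod (f z)"] by (simp add: mult.assoc)
    qed (rule C0)
    also have "\<dots> = A * cmod (f z) + A * cmod (deriv f z)" by (simp add: A_def algebra_simps)
    finally have "(cmod (deriv h z))\<^sup>2 \<le> (A * cmod (f z) + A * cmod (deriv f z))\<^sup>2" by (intro power_mono) auto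
    also have "\<dots> \<le> 2 * A\<^sup>2 * (cmod (f z))\<^sup>2 + 2 * A\<^sup>2 * (cmod (deriv f z))\<^sup>2"
      using zero_le_power2[of "A * cmod (f z) - A * cmod (deriv f z)"] by (simp add: power2_eq_square algebra_simps)
    finally show ?thesis using zero_le_power2[of C3] by linarith
  qed
  have S2: "summable (\<lambda>n. (cmod (taylor_coeff f n))\<^sup>2 / (real n + 1))"
  proof (rule summable_comparison_test_ev[OF _ F(6)], intro always_eventually allI)
    fix n show "norm ((cmod (taylor_coeff f n))\<^sup>2 / (real n + 1)) \<le> (cmod (taylor_coeff f n))\<^sup>2"
      using mult_left_mono[of 1 "real n + 1" "(cmod (taylor_coeff f n))\<^sup>2"] by (simp add: divide_le_eq)
  qed
  have J: "set_integrable lborel (ball 0 1) (\<lambda>z. C3\<^sup>2 + (2 * A\<^sup>2 * (cmod (f z))\<^sup>2 + 2 * A\<^sup>2 * (cmod (deriv f z))\<^sup>2))"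
  proof (intro set_integral_add(1))
    show "set_integrable lborel (ball 0 1) (\<lambda>z::complex. C3\<^sup>2)"
      by (intro set_integrable_disc_continuous continuous_intros)
    show "set_integrable lborel (ball 0 1) (\<lambda>z. 2 * A\<^sup>2 * (cmod (f z))\<^sup>2)"
      using disc_square_integrable_iff(1)[OF F(1), folded taylor_coeff_def] S2 by (intro set_integrable_mult_right) auto
    show "set_integrable lborel (ball 0 1) (\<lambda>z. 2 * A\<^sup>2 * (cmod (deriv f z))\<^sup>2)"
      using F(3) by (intro set_integrable_mult_right) auto
  qed
  have "set_integrable lborel (ball 0 1) (\<lambda>z. (cmod (deriv (cut h) z))\<^sup>2)"
  proof (rule set_integrable_bound[OF J])
    have "continuous_on (ball 0 1) (\<lambda>z. (cmod (deriv (cut h) z))\<^sup>2)"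
      by (intro continuous_intros holomorphic_on_imp_continuous_on holomorphic_deriv ch open_ball)
    from borel_measurable_continuous_on_indicator[OF _ this]
    show "set_borel_measurable lborel (ball 0 1) (\<lambda>z. (cmod (deriv (cut h) z))\<^sup>2)"
      by (simp add: set_borel_measurable_def)
    show "AE z in lborel. z \<in> ball 0 1 \<longrightarrow> norm ((cmod (deriv (cut h) z))\<^sup>2) \<le> norm (C3\<^sup>2 + (2 * A\<^sup>2 * (cmod (f z))\<^sup>2 + 2 * A\<^sup>2 * (cmod (deriv f z))\<^sup>2))"
    proof (intro AE_I2 impI)
      fix z :: complex assume "z \<in> ball 0 1"
      then have z: "cmod z < 1" by simp
      from bound[OF z] show "norm ((cmod (deriv (cut h) z))\<^sup>2) \<le> norm (C3\<^sup>2 + (2 * A\<^sup>2 * (cmod (f z))\<^sup>2 + 2 * A\<^sup>2 * (cmod (deriv f z))\<^sup>2))"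
        unfolding dch[OF z] by (simp only: real_norm_def abs_power2)
    qed
  qed
  then show "cut h \<in> dirichlet_space" using ch by (auto simp: dirichlet_space_def cut_def)
qed

end

section \<open>Finite systems of linear equations\<close>

lemma homogeneous_system:
  fixes b :: "'j \<Rightarrow> 's \<Rightarrow> complex"
  assumes "finite S" "finite J" "card S < card J"
  shows "\<exists>c. (\<exists>j\<in>J. c j \<noteq> 0) \<and> (\<forall>s\<in>S. (\<Sum>j\<in>J. c j * b j s) = 0)"
  using assms
proof (induction S arbitrary: J b rule: finite_induct)
  case empty
  then have "J \<noteq> {}" by auto
  then show ?case by (intro exI[of _ "\<lambda>_. 1"]) auto
next
  case (insert s S)
  show ?case
  proof (cases "\<forall>j\<in>J. b j s = 0")
    case True
    have "card S < card J" using insert by simp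
    from insert.IH[OF insert.prems(1) this, of b] True show ?thesis by auto
  next
    case False
    then obtain j0 where j0: "j0 \<in> J" "b j0 s \<noteq> 0" by blast
    have "card S < card (J - {j0})" using insert j0 by simp
    from insert.IH[OF _ this, of "\<lambda>j t. b j t - b j s / b j0 s * b j0 t"] insert.prems(1)
    obtain c where c: "\<exists>j\<in>J-{j0}. c j \<noteq> 0" "\<forall>t\<in>S. (\<Sum>j\<in>J-{j0}. c j * (b j t - b j s / b j0 s * b j0 t)) = 0" by auto
    define d where "d j = (if j = j0 then - (\<Sum>j\<in>J-{j0}. c j * b j s) / b j0 s else c j)" for j
    have sum: "(\<Sum>j\<in>J. d j * b j t) = (\<Sum>j\<in>J-{j0}. c j * (b j t - b j s / b j0 s * b j0 t))" for t
    proof -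
      have "(\<Sum>j\<in>J. d j * b j t) = d j0 * b j0 t + (\<Sum>j\<in>J-{j0}. d j * b j t)"
        using insert.prems(1) j0(1) by (rule sum.remove)
      also have "(\<Sum>j\<in>J-{j0}. d j * b j t) = (\<Sum>j\<in>J-{j0}. c j * b j t)" by (intro sum.cong) (auto simp: d_def)
      also have "d j0 * b j0 t = - (\<Sum>j\<in>J-{j0}. c j * (b j s / b j0 s * b j0 t))"
      proof -
        have "d j0 * b j0 t = - ((\<Sum>j\<in>J-{j0}. c j * b j s) * (b j0 t / b j0 s))" by (simp add: d_def)
        also have "\<dots> = - (\<Sum>j\<in>J-{j0}. c j * (b j s / b j0 s * b j0 t))"
          unfolding sum_distrib_right by (simp add: mult.assoc)
        finally show ?thesis .
      qed
      finally show ?thesis by (simp add: right_diff_distrib sum_subtractf)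
    qed
    have "\<forall>t\<in>insert s S. (\<Sum>j\<in>J. d j * b j t) = 0"
      unfolding sum using c(2) j0(2) by auto
    moreover have "\<exists>j\<in>J. d j \<noteq> 0" using c(1) by (auto simp: d_def)
    ultimately show ?thesis by blast
  qed
qed

text \<open>Among \<open>n + 1\<close> columns with at most \<open>n\<close> entries, namely \<open>x\<close> and the
  \<open>b j\<close>, there is a linear relation, and \<open>x\<close> occurs in it.\<close>

lemma interpolation_of_independent:
  fixes b :: "nat \<Rightarrow> 's \<Rightarrow> complex"
  assumes S: "finite S" "card S \<le> n" and ind: "\<And>c. (\<forall>s\<in>S. (\<Sum>j<n. c j * b j s) = 0) \<Longrightarrow> \<forall>j<n. c j = 0"
  shows "\<exists>c. \<forall>s\<in>S. x s = (\<Sum>j<n. c j * b j s)"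
proof -
  have "card S < card {..<Suc n}" using S by simp
  from homogeneous_system[OF S(1) _ this, of "\<lambda>j s. if j < n then b j s else x s"]
  obtain c where c: "\<exists>j<Suc n. c j \<noteq> 0" "\<And>s. s \<in> S \<Longrightarrow> (\<Sum>j<Suc n. c j * (if j < n then b j s else x s)) = 0" by auto
  have eq: "(\<Sum>j<n. c j * b j s) + c n * x s = 0" if "s \<in> S" for s
    using c(2)[OF that] by simp
  have cn: "c n \<noteq> 0"
  proof
    assume "c n = 0"
    then have "\<forall>j<n. c j = 0" using eq by (intro ind) simp
    with \<open>c n = 0\<close> c(1) show False using less_Suc_eq by auto
  qed
  have "x s = (\<Sum>j<n. (- c j / c n) * b j s)" if "s \<in> S" for s
  proof -
    have "c n * x s = - (\<Sum>j<n. c j * b j s)" using eq[OF that] by (simp add: add_eq_0_iff)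
    then have "x s = - (\<Sum>j<n. c j * b j s) / c n" using cn by (simp add: field_simps)
    then show ?thesis by (simp add: sum_divide_distrib sum_negf)
  qed
  then show ?thesis by (intro exI[of _ "\<lambda>j. - c j / c n"]) blast
qed

lemma dirichlet_space_sum:
  assumes "finite J" "\<And>j. j \<in> J \<Longrightarrow> g j \<in> dirichlet_space"
  shows "(\<lambda>z. \<Sum>j\<in>J. c j * g j z) \<in> dirichlet_space"
  using assms by (induction J rule: finite_induct) (auto intro!: dirichlet_space_add dirichlet_space_cmult)

lemma dirichlet_inner_sum_right:
  assumes "finite J" "\<And>j. j \<in> J \<Longrightarrow> g j \<in> dirichlet_space" "f \<in> dirichlet_space"
  shows "ip f (\<lambda>z. \<Sum>j\<in>J. c j * g j z) = (\<Sum>j\<in>J. cnj (c j) * ip f (g j))"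
  using assms
proof (induction J rule: finite_induct)
  case empty
  then show ?case using dirichlet_inner_cmult_right[OF empty.prems(2) empty.prems(2), of 0] by simp
next
  case (insert j J)
  have D: "(\<lambda>z. c j * g j z) \<in> dirichlet_space" "(\<lambda>z. \<Sum>j\<in>J. c j * g j z) \<in> dirichlet_space"
    using insert.prems insert.hyps by (auto intro: dirichlet_space_cmult dirichlet_space_sum)
  show ?case
    using insert dirichlet_inner_add_right[OF D insert.prems(2)] dirichlet_inner_cmult_right[of "g j" f "c j"] by simp
qed

text \<open>Gram--Schmidt: the new vector is first made orthogonal to the earlier ones. If nothing is left of it, the
  earlier projection already serves.\<close>

lemma finite_projection:
  fixes m :: nat
  assumes "\<And>j. j < m \<Longrightarrow> g j \<in> dirichlet_space" "f \<in> dirichlet_space"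
  shows "\<exists>c. \<forall>i<m. ip (\<lambda>z. f z - (\<Sum>j<m. c j * g j z)) (g i) = 0"
  using assms
proof (induction m arbitrary: f)
  case 0
  then show ?case by simp
next
  case (Suc m)
  have g: "\<And>j. j < m \<Longrightarrow> g j \<in> dirichlet_space" and gm: "g m \<in> dirichlet_space" using Suc.prems by auto
  obtain a where a: "\<And>i. i < m \<Longrightarrow> ip (\<lambda>z. f z - (\<Sum>j<m. a j * g j z)) (g i) = 0" using Suc.IH[OF g Suc.prems(2)] by auto
  obtain b where b: "\<And>i. i < m \<Longrightarrow> ip (\<lambda>z. g m z - (\<Sum>j<m. b j * g j z)) (g i) = 0" using Suc.IH[OF g gm] by auto
  define f' where "f' = (\<lambda>z. f z - (\<Sum>j<m. a j * g j z))"
  define e where "e = (\<lambda>z. g m z - (\<Sum>j<m. b j * g j z))"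
  have sD: "(\<lambda>z. \<Sum>j<m. a j * g j z) \<in> dirichlet_space" "(\<lambda>z. \<Sum>j<m. b j * g j z) \<in> dirichlet_space"
    using g by (auto intro!: dirichlet_space_sum)
  have f'D: "f' \<in> dirichlet_space" and eD: "e \<in> dirichlet_space"
    unfolding f'_def e_def using sD Suc.prems(2) gm by (auto intro: dirichlet_space_diff)
  have f'i: "ip f' (g i) = 0" and ei: "ip e (g i) = 0" if "i < m" for i using a b that by (auto simp: f'_def e_def)
  have orthsum: "ip h (\<lambda>z. \<Sum>j<m. b j * g j z) = 0" if "h \<in> dirichlet_space" "\<And>i. i < m \<Longrightarrow> ip h (g i) = 0" for h
    using that g by (subst dirichlet_inner_sum_right) auto
  define t where "t = ip f' e / ip e e"
  have te: "(\<lambda>z. t * e z) \<in> dirichlet_space" by (rule dirichlet_space_cmult[OF eD])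
  have fte: "(\<lambda>z. f' z - t * e z) \<in> dirichlet_space" by (rule dirichlet_space_diff[OF f'D te])
  have i0: "ip (\<lambda>z. f' z - t * e z) (g i) = 0" if "i < m" for i
    using dirichlet_inner_diff_left[OF f'D te g[OF that]] dirichlet_inner_cmult_left[OF eD g[OF that], of t] f'i[OF that] ei[OF that] by simp
  have "ip (\<lambda>z. f' z - t * e z) e = 0"
  proof (cases "ip e e = 0")
    case True
    then have e0: "e = (\<lambda>z. 0)" by (rule dirichlet_inner_eq_0D[OF eD])
    have "ip (\<lambda>z. f' z - t * e z) (\<lambda>z. 0 * g m z) = cnj 0 * ip (\<lambda>z. f' z - t * e z) (g m)"
      by (rule dirichlet_inner_cmult_right[OF gm fte])
    then show ?thesis by (simp add: e0)
  next
    case False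
    then show ?thesis using dirichlet_inner_diff_left[OF f'D te eD] dirichlet_inner_cmult_left[OF eD eD, of t] by (simp add: t_def)
  qed
  moreover have "g m = (\<lambda>z. e z + (\<Sum>j<m. b j * g j z))" by (simp add: e_def)
  ultimately have "ip (\<lambda>z. f' z - t * e z) (g m) = 0"
    using dirichlet_inner_add_right[OF eD sD(2) fte] orthsum[OF fte i0] by simp
  with i0 have all: "ip (\<lambda>z. f' z - t * e z) (g i) = 0" if "i < Suc m" for i using that less_Suc_eq by auto
  have "(\<lambda>z. f' z - t * e z) = (\<lambda>z. f z - (\<Sum>j<Suc m. (if j < m then a j - t * b j else t) * g j z))"
  proof
    fix z
    have "(\<Sum>j<Suc m. (if j < m then a j - t * b j else t) * g j z) = (\<Sum>j<m. a j * g j z - t * (b j * g j z)) + t * g m z"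
      by (simp add: left_diff_distrib mult.assoc)
    also have "\<dots> = (\<Sum>j<m. a j * g j z) - t * (\<Sum>j<m. b j * g j z) + t * g m z"
      by (simp add: sum_subtractf sum_distrib_left)
    finally show "f' z - t * e z = f z - (\<Sum>j<Suc m. (if j < m then a j - t * b j else t) * g j z)"
      by (simp add: f'_def e_def algebra_simps)
  qed
  with all show ?case by (intro exI[of _ "\<lambda>j. if j < m then a j - t * b j else t"]) auto
qed

context blaschke
begin

section \<open>The wandering space\<close>

text \<open>The orthogonal complement of \<open>phi D\<close>, that is, the kernel of the adjoint of multiplication.\<close>

definition wander :: "(complex \<Rightarrow> complex) set" where
  "wander = {g \<in> dirichlet_space. \<forall>f\<in>dirichlet_space. ip (mult_op phi f) g = 0}"

definition rep_comb :: "(nat \<Rightarrow> complex) \<Rightarrow> complex \<Rightarrow> complex" where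
  "rep_comb a z = (\<Sum>j<n. a j * rep j z)"

lemma rep_comb_holo: "rep_comb a holomorphic_on ball 0 R"
  unfolding rep_comb_def[abs_def]
  by (intro holomorphic_on_sum holomorphic_on_mult holomorphic_on_const rep_holo(1)) simp

lemma cut_rep_comb: "cut (rep_comb a) = (\<lambda>z. \<Sum>j<n. a j * cut (rep j) z)"
  by (rule ext) (simp add: cut_def rep_comb_def)

text \<open>\<open>phi\<close> is divisible by the denominator of the kernel, so the divided difference of a multiple of
  \<open>phi\<close> integrates a holomorphic function.\<close>

lemma rep_wander:
  assumes j: "j < n"
  shows "cut (rep j) \<in> wander"
proof -
  have "ip (mult_op phi f) (cut (rep j)) = 0" if f: "f \<in> dirichlet_space" for f
  proof -
    obtain E where E: "E holomorphic_on ball 0 R" "\<And>z. cmod z < R \<Longrightarrow> E z \<noteq> 0" "\<And>z. phi z = E z * (\<Prod>i<n. z - lam i)"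
      using phi_factorization by blast
    have "ip (mult_op phi f) (cut (rep j)) = circ_int (1 / R) (\<lambda>z. mult_op phi f z * rep_kernel j z)"
      by (rule inner_rep[OF j phi_mult_dirichlet[OF f]])
    also have "\<dots> = circ_int (1 / R) (\<lambda>z. E z * (\<Prod>i\<in>{Suc j..<n}. z - lam i) * f z)"
    proof (rule circ_int_cong[OF R_inv(1)])
      fix z assume z: "cmod z = 1 / R"
      have un: "{..<n} = {..j} \<union> {Suc j..<n}" using j by auto
      have split: "(\<Prod>i<n. z - lam i) = (\<Prod>i\<le>j. z - lam i) * (\<Prod>i\<in>{Suc j..<n}. z - lam i)"
        unfolding un by (rule prod.union_disjoint) auto
      have "(\<Prod>i\<le>j. z - lam i) \<noteq> 0" using rep_kernel_nonzero[OF j, of z] z by simp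
      moreover have "(e * (A * B)) * F * (1 / A) = e * B * F" if "A \<noteq> 0" for e A B F :: complex using that by simp
      ultimately show "mult_op phi f z * rep_kernel j z = E z * (\<Prod>i\<in>{Suc j..<n}. z - lam i) * f z"
        unfolding mult_op_def rep_kernel_def E(3) split by blast
    qed
    also have "\<dots> = 0"
      by (rule circ_int_holomorphic[OF R_inv(1) _ R_inv(2)])
         (intro holomorphic_intros holomorphic_on_subset[OF E(1)] dirichlet_spaceD(1)[OF f], use R in auto)
    finally show ?thesis .
  qed
  then show ?thesis using rep_dirichlet[OF j] by (simp add: wander_def)
qed

lemma rep_comb_dirichlet: "cut (rep_comb a) \<in> dirichlet_space"
  by (rule cut_dirichlet[OF rep_comb_holo R])

lemma rep_comb_wander: "cut (rep_comb a) \<in> wander"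
proof -
  have "ip (mult_op phi f) (cut (rep_comb a)) = 0" if f: "f \<in> dirichlet_space" for f
  proof -
    have "ip (mult_op phi f) (cut (rep_comb a)) = (\<Sum>j<n. cnj (a j) * ip (mult_op phi f) (cut (rep j)))"
      unfolding cut_rep_comb using rep_dirichlet phi_mult_dirichlet[OF f] by (intro dirichlet_inner_sum_right) auto
    also have "\<dots> = 0" using rep_wander f by (intro sum.neutral) (auto simp: wander_def)
    finally show ?thesis .
  qed
  then show ?thesis using rep_comb_dirichlet by (simp add: wander_def)
qed

text \<open>Subtract the projection to the span of the representers. The difference is divisible by \<open>phi\<close>,
  hence orthogonal to the wandering space, and it is orthogonal to the span as well.\<close>

lemma wander_rep_comb:
  assumes g: "g \<in> wander"
  obtains a where "g = cut (rep_comb a)"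
proof -
  have gD: "g \<in> dirichlet_space" using g by (simp add: wander_def)
  obtain a where a: "\<And>i. i < n \<Longrightarrow> ip (\<lambda>z. g z - (\<Sum>j<n. a j * cut (rep j) z)) (cut (rep i)) = 0"
    using finite_projection[where g = "\<lambda>j. cut (rep j)" and m = n, OF rep_dirichlet gD] by auto
  define f where "f = (\<lambda>z. g z - cut (rep_comb a) z)"
  have f: "f \<in> dirichlet_space" unfolding f_def by (rule dirichlet_space_diff[OF gD rep_comb_dirichlet])
  have fi: "ip f (cut (rep i)) = 0" if "i < n" for i using a[OF that] by (simp add: f_def cut_rep_comb)
  obtain h where h: "h holomorphic_on ball 0 1" "\<And>z. cmod z < 1 \<Longrightarrow> f z = phi z * h z"
    using orth_rep_divisible[OF f fi] by blast
  have "ip f g = 0" using g divide_phi_dirichlet[OF f h] by (simp add: wander_def)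
  moreover have "ip f (cut (rep_comb a)) = 0"
    unfolding cut_rep_comb using fi rep_dirichlet f by (subst dirichlet_inner_sum_right) auto
  ultimately have "ip f f = 0"
    using dirichlet_inner_diff_right[OF gD rep_comb_dirichlet f] by (simp add: f_def)
  then have "f = (\<lambda>z. 0)" by (rule dirichlet_inner_eq_0D[OF f])
  then have "g = cut (rep_comb a)" by (auto simp: f_def fun_eq_iff)
  then show thesis by (rule that)
qed

text \<open>Divided differences are triangular on the Newton polynomials: test with the product of the first
  \<open>m\<close> linear factors, \<open>m\<close> being the last index with a nonzero coefficient.\<close>

lemma rep_independent:
  assumes z: "\<And>z. cut (rep_comb a) z = 0" and j: "j < n"
  shows "a j = 0"
proof (rule ccontr)
  assume ne: "a j \<noteq> 0"
  define m where "m = Max {i. i < n \<and> a i \<noteq> 0}"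
  have fin: "finite {i. i < n \<and> a i \<noteq> 0}" by simp
  have "m \<in> {i. i < n \<and> a i \<noteq> 0}" unfolding m_def using ne j by (intro Max_in fin) auto
  then have m: "m < n" "a m \<noteq> 0" by auto
  have above: "a i = 0" if "i < n" "i > m" for i
  proof (rule ccontr)
    assume "a i \<noteq> 0"
    then have "i \<le> m" unfolding m_def using that by (intro Max_ge fin) auto
    then show False using that by simp
  qed
  define p where "p = (\<lambda>z. \<Prod>i<m. z - lam i)"
  have p: "p holomorphic_on ball 0 R" unfolding p_def by (intro holomorphic_intros)
  have pD: "cut p \<in> dirichlet_space" by (rule cut_dirichlet[OF p R])
  have val: "ip (cut p) (cut (rep i)) = (if i = m then 1 else 0)" if i: "i \<le> m" for i
  proof -
    have iln: "i < n" using i m by simp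
    have "ip (cut p) (cut (rep i)) = circ_int (1 / R) (\<lambda>z. cut p z * rep_kernel i z)" by (rule inner_rep[OF iln pD])
    also have "\<dots> = (if i = m then 1 else 0)"
    proof (cases "i = m")
      case True
      have "circ_int (1 / R) (\<lambda>z. cut p z * rep_kernel i z) = circ_int (1 / R) (\<lambda>z. 1 / (z - lam m))"
      proof (rule circ_int_cong[OF R_inv(1)])
        fix z assume z: "cmod z = 1 / R"
        have split: "(\<Prod>i\<le>m. z - lam i) = p z * (z - lam m)" by (simp add: p_def flip: lessThan_Suc_atMost)
        have "p z \<noteq> 0" using rep_kernel_nonzero[OF m(1), of z] z unfolding split by simp
        moreover have "cut p z = p z" using z R_inv by (simp add: cut_def)
        ultimately show "cut p z * rep_kernel i z = 1 / (z - lam m)"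
          unfolding rep_kernel_def True split by simp
      qed
      also have "\<dots> = 1" using circ_int_inverse[OF R_inv(1), of "lam m"] lam_lt'[OF m(1)] by simp
      finally show ?thesis using True by simp
    next
      case False
      then have im: "i < m" using i by simp
      have "circ_int (1 / R) (\<lambda>z. cut p z * rep_kernel i z) = circ_int (1 / R) (\<lambda>z. \<Prod>l\<in>{Suc i..<m}. z - lam l)"
      proof (rule circ_int_cong[OF R_inv(1)])
        fix z assume z: "cmod z = 1 / R"
        have un: "{..<m} = {..i} \<union> {Suc i..<m}" using im by auto
        have split: "p z = (\<Prod>l\<le>i. z - lam l) * (\<Prod>l\<in>{Suc i..<m}. z - lam l)"
          unfolding p_def un by (rule prod.union_disjoint) auto
        have "(\<Prod>l\<le>i. z - lam l) \<noteq> 0" using rep_kernel_nonzero[OF iln, of z] z by simp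
        moreover have "(A * B) * (1 / A) = B" if "A \<noteq> 0" for A B :: complex using that by simp
        moreover have "cut p z = p z" using z R_inv by (simp add: cut_def)
        ultimately show "cut p z * rep_kernel i z = (\<Prod>l\<in>{Suc i..<m}. z - lam l)"
          unfolding rep_kernel_def split by metis
      qed
      also have "\<dots> = 0" by (rule circ_int_holomorphic[OF R_inv(1) _ R_inv(2)]) (intro holomorphic_intros)
      finally show ?thesis using False by simp
    qed
    finally show ?thesis .
  qed
  have "cut (rep_comb a) = (\<lambda>z. 0 * cut p z)" using z by auto
  then have "ip (cut p) (cut (rep_comb a)) = 0"
    using dirichlet_inner_cmult_right[OF pD pD, of 0] by simp
  moreover have "ip (cut p) (cut (rep_comb a)) = (\<Sum>i<n. cnj (a i) * ip (cut p) (cut (rep i)))"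
    unfolding cut_rep_comb using rep_dirichlet pD by (intro dirichlet_inner_sum_right) auto
  moreover have "\<dots> = (\<Sum>i<n. if i = m then cnj (a m) else 0)"
  proof (rule sum.cong[OF refl])
    fix i assume "i \<in> {..<n}"
    then show "cnj (a i) * ip (cut p) (cut (rep i)) = (if i = m then cnj (a m) else 0)"
      using val[of i] above[of i] by (cases "i \<le> m") auto
  qed
  ultimately show False using m by simp
qed

text \<open>With \<open>dz / z\<close> the integral is an average over the circle.\<close>

lemma circ_int_real:
  assumes p: "continuous_on (sphere 0 1) p" and nn: "\<And>z. cmod z = 1 \<Longrightarrow> p z \<ge> (0::real)"
  obtains I where "circ_int 1 (\<lambda>z. of_real (p z) / z) = of_real I" "I \<ge> 0" "\<And>x. I = 0 \<Longrightarrow> cmod x = 1 \<Longrightarrow> p x = 0"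
proof -
  let ?e = "circlepath 0 1"
  have e: "cmod (?e t) = 1" for t by (simp add: circlepath)
  have ec: "continuous_on A ?e" for A unfolding circlepath by (intro continuous_intros)
  have pc: "continuous_on {0..1} (\<lambda>t. p (?e t))"
    by (rule continuous_on_compose2[OF p ec]) (use e in auto)
  define I where "I = integral {0..1} (\<lambda>t. p (?e t))"
  have "((\<lambda>t. p (?e t)) has_integral I) {0..1}"
    unfolding I_def by (intro integrable_integral integrable_continuous_interval pc)
  from has_integral_mult_right[OF has_integral_linear[OF this bounded_linear_of_real], of "2 * of_real pi * \<i>"]
  have "((\<lambda>t. 2 * of_real pi * \<i> * complex_of_real (p (?e t))) has_integral 2 * of_real pi * \<i> * of_real I) {0..1}"
    by (simp add: o_def)
  moreover have "2 * of_real pi * \<i> * complex_of_real (p (?e t)) = of_real (p (?e t)) / ?e t * vector_derivative ?e (at t)" for t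
  proof -
    have "exp (2 * of_real pi * \<i> * of_real t) = ?e t" by (simp add: circlepath)
    moreover have "?e t \<noteq> 0" using e[of t] by (metis norm_zero zero_neq_one)
    ultimately show ?thesis unfolding vector_derivative_circlepath by simp
  qed
  ultimately have "((\<lambda>z. of_real (p z) / z) has_contour_integral 2 * of_real pi * \<i> * of_real I) ?e"
    unfolding has_contour_integral by simp
  then have "circ_int 1 (\<lambda>z. of_real (p z) / z) = of_real I"
    by (simp add: circ_int_def contour_integral_unique)
  moreover have "I \<ge> 0" unfolding I_def using nn e by (intro integral_nonneg integrable_continuous_interval pc) auto
  moreover have "p x = 0" if I0: "I = 0" and x: "cmod x = 1" for x
  proof -
    have "\<forall>t\<in>{0..1}. p (?e t) = 0"
      using integral_eq_0_iff[of 0 1 "\<lambda>t. p (?e t)"] pc nn e I0 by (simp add: I_def)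
    moreover have "x \<in> path_image ?e" using x by (simp add: path_image_circlepath)
    then obtain t where "t \<in> {0..1}" "x = ?e t" unfolding path_image_def by blast
    ultimately show ?thesis by simp
  qed
  ultimately show thesis by (rule that)
qed

text \<open>The circle formula gives \<open>\<parallel>phi h\<parallel>\<^sup>2 - \<parallel>h\<parallel>\<^sup>2\<close> as
  the average of \<open>speed z * \<bar>h z\<bar>\<^sup>2\<close> over the circle. Since \<open>speed\<close> is
  positive, multiplication by \<open>phi\<close> strictly increases the norm of a nonzero function.\<close>

lemma phi_mult_norm_strict:
  assumes h: "h holomorphic_on ball 0 R" and le: "dirichlet_norm (mult_op phi (cut h)) \<le> dirichlet_norm (cut h)"
    and z: "cmod z < R"
  shows "h z = 0"
proof -
  define X where "X = (\<lambda>z. z * h z)"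
  have X: "X holomorphic_on ball 0 R" unfolding X_def by (intro holomorphic_intros h)
  have sub: "sphere 0 1 \<subseteq> ball (0::complex) R" using R by auto
  have cont: "continuous_on (sphere 0 1) f" if "f holomorphic_on ball 0 R" for f :: "complex \<Rightarrow> complex"
    by (rule holomorphic_on_imp_continuous_on[OF holomorphic_on_subset[OF that sub]])
  have dX: "deriv X holomorphic_on ball 0 R" and dphi: "deriv phi holomorphic_on ball 0 R" using X phi_holo by (auto intro: holomorphic_deriv)
  have hc: "continuous_on (sphere 0 1) h" by (rule cont[OF h])
  have sc: "continuous_on (sphere 0 1) speed"
    unfolding speed_def[abs_def] using lam_lt by (intro continuous_intros) (auto, fastforce)
  have ph: "(\<lambda>z. phi z * h z) holomorphic_on ball 0 R" by (intro holomorphic_intros phi_holo h)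
  have "ip (cut (\<lambda>z. phi z * h z)) (cut (\<lambda>z. phi z * h z)) = circ_int 1 (\<lambda>z. deriv (\<lambda>z. z * (phi z * h z)) z * cnj (z * (phi z * h z)))"
    by (rule dirichlet_inner_circle[OF ph ph R])
  also have "\<dots> = circ_int 1 (\<lambda>z. deriv X z * cnj (X z) + of_real (speed z * (cmod (h z))\<^sup>2) / z)"
  proof (rule circ_int_cong)
    fix z :: complex assume z: "cmod z = 1"
    then have zR: "z \<in> ball 0 R" and z0: "z \<noteq> 0" using R by auto
    have "(phi has_field_derivative deriv phi z) (at z)" "(X has_field_derivative deriv X z) (at z)"
      using holomorphic_derivI[OF phi_holo open_ball zR] holomorphic_derivI[OF X open_ball zR] by auto
    then have "((\<lambda>z. phi z * X z) has_field_derivative (deriv phi z * X z + phi z * deriv X z)) (at z)"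
      by (auto intro!: derivative_eq_intros)
    moreover have "(\<lambda>z. z * (phi z * h z)) = (\<lambda>z. phi z * X z)" by (auto simp: X_def)
    ultimately have d: "deriv (\<lambda>z. z * (phi z * h z)) z = deriv phi z * X z + phi z * deriv X z" by (simp add: DERIV_imp_deriv)
    have pp: "phi z * cnj (phi z) = 1" using phi_eq1[OF z] complex_norm_square[of "phi z"] by simp
    have XX: "X z * cnj (X z) = of_real ((cmod (h z))\<^sup>2)"
      using z complex_norm_square[of "X z"] by (simp add: X_def norm_mult)
    have dz: "deriv phi z = phi z * of_real (speed z) / z" using phi_deriv_circle[OF z] z0 by (simp add: field_simps)
    have "deriv (\<lambda>z. z * (phi z * h z)) z * cnj (z * (phi z * h z)) = (deriv phi z * X z + phi z * deriv X z) * (cnj (phi z) * cnj (X z))"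
      unfolding d by (simp add: X_def mult_ac)
    also have "\<dots> = (phi z * cnj (phi z)) * (deriv X z * cnj (X z)) + (phi z * cnj (phi z)) * of_real (speed z) / z * (X z * cnj (X z))"
      unfolding dz using z0 by (simp add: algebra_simps)
    also have "\<dots> = deriv X z * cnj (X z) + of_real (speed z * (cmod (h z))\<^sup>2) / z"
      unfolding pp XX by simp
    finally show "deriv (\<lambda>z. z * (phi z * h z)) z * cnj (z * (phi z * h z)) = deriv X z * cnj (X z) + of_real (speed z * (cmod (h z))\<^sup>2) / z" .
  qed simp
  also have "\<dots> = circ_int 1 (\<lambda>z. deriv X z * cnj (X z)) + circ_int 1 (\<lambda>z. of_real (speed z * (cmod (h z))\<^sup>2) / z)"
    by (intro circ_int_add continuous_intros cont dX X sc h) auto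
  also have "circ_int 1 (\<lambda>z. deriv X z * cnj (X z)) = ip (cut h) (cut h)"
    unfolding X_def by (rule dirichlet_inner_circle[OF h h R, symmetric])
  finally have eq: "circ_int 1 (\<lambda>z. of_real (speed z * (cmod (h z))\<^sup>2) / z) = of_real ((dirichlet_norm (mult_op phi (cut h)))\<^sup>2 - (dirichlet_norm (cut h))\<^sup>2)"
    using dirichlet_inner_self[OF cut_dirichlet[OF ph R]] dirichlet_inner_self[OF cut_dirichlet[OF h R]] by (simp add: mult_op_cut)
  have sp: "continuous_on (sphere 0 1) (\<lambda>z. speed z * (cmod (h z))\<^sup>2)" by (intro continuous_intros sc hc)
  have nn: "speed z * (cmod (h z))\<^sup>2 \<ge> 0" if "cmod z = 1" for z using speed_pos[OF that] by simp
  obtain I where I: "circ_int 1 (\<lambda>z. of_real (speed z * (cmod (h z))\<^sup>2) / z) = of_real I" "I \<ge> 0"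
    "\<And>x. I = 0 \<Longrightarrow> cmod x = 1 \<Longrightarrow> speed x * (cmod (h x))\<^sup>2 = 0" by (rule circ_int_real[OF sp nn], assumption, rule that)
  have "I = (dirichlet_norm (mult_op phi (cut h)))\<^sup>2 - (dirichlet_norm (cut h))\<^sup>2"
    using eq unfolding I(1) of_real_eq_iff .
  also have "\<dots> \<le> 0"
    using power_mono[OF le, of 2] dirichlet_norm_nonneg[OF cut_dirichlet[OF ph R]] by (simp add: mult_op_cut)
  finally have "I = 0" using I(2) by simp
  have "h x = 0" if x: "cmod x = 1" for x using I(3)[OF \<open>I = 0\<close> x] speed_pos[OF x] by simp
  then show ?thesis by (rule holomorphic_zero_on_circle[OF h R _ z])
qed

text \<open>Such a combination is \<open>(phi - w) * h\<close>, because \<open>phi - w\<close> has simple zeros. Being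
  orthogonal to \<open>phi h\<close>, it satisfies \<open>\<parallel>phi h\<parallel>\<^sup>2 = \<bar>ip (phi h)
  h\<bar>\<close>, so \<open>phi h\<close> is no longer than \<open>h\<close> and \<open>h\<close> vanishes.\<close>

lemma rep_comb_zero_on_fibre:
  assumes w: "cmod w = 1" and zero: "\<And>\<zeta>. \<zeta> \<in> fib w \<Longrightarrow> rep_comb a \<zeta> = 0" and j: "j < n"
  shows "a j = 0"
proof -
  have fz: "{z \<in> ball 0 R. phi z - w = 0} = fib w"
    using phi_circle_iff w R by (auto simp: fib_def)
  obtain h where h: "h holomorphic_on ball 0 R" "\<And>z. z \<in> ball 0 R \<Longrightarrow> rep_comb a z = (phi z - w) * h z"
  proof (rule holomorphic_quotient[OF open_ball rep_comb_holo])
    show "(\<lambda>z. phi z - w) holomorphic_on ball 0 R" by (intro holomorphic_intros phi_holo)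
    show "finite {z \<in> ball 0 R. phi z - w = 0}" unfolding fz by (rule fib_finite_card[OF w])
    show "rep_comb a z = 0 \<and> deriv (\<lambda>z. phi z - w) z \<noteq> 0" if "z \<in> ball 0 R" "phi z - w = 0" for z
    proof -
      have "z \<in> fib w" using that fz by blast
      then show ?thesis using zero deriv_phi_diff[OF _ w] phi_deriv_nonzero[OF fib_circle] by simp
    qed
  qed (rule that)
  define g where "g = cut (rep_comb a)"
  have hD: "cut h \<in> dirichlet_space" by (rule cut_dirichlet[OF h(1) R])
  have pD: "mult_op phi (cut h) \<in> dirichlet_space" by (rule phi_mult_dirichlet[OF hD])
  have geq: "g = (\<lambda>z. mult_op phi (cut h) z - w * cut h z)"
    using h(2) R by (auto simp: g_def cut_def mult_op_def fun_eq_iff left_diff_distrib)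
  have "ip (mult_op phi (cut h)) g = 0" using rep_comb_wander[of a] hD by (simp add: g_def wander_def)
  then have "ip (mult_op phi (cut h)) (mult_op phi (cut h)) = cnj w * ip (mult_op phi (cut h)) (cut h)"
    unfolding geq using dirichlet_inner_diff_right[OF pD dirichlet_space_cmult[OF hD] pD] dirichlet_inner_cmult_right[OF hD pD] by simp
  then have "(dirichlet_norm (mult_op phi (cut h)))\<^sup>2 = cmod (ip (mult_op phi (cut h)) (cut h))"
    using dirichlet_inner_self[OF pD] w by (metis abs_power2 complex_mod_cnj mult_1 norm_mult norm_of_real)
  also have "\<dots> \<le> dirichlet_norm (mult_op phi (cut h)) * dirichlet_norm (cut h)" by (rule dirichlet_Cauchy_Schwarz[OF pD hD])
  finally have sq: "dirichlet_norm (mult_op phi (cut h)) * dirichlet_norm (mult_op phi (cut h)) \<le> dirichlet_norm (mult_op phi (cut h)) * dirichlet_norm (cut h)"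
    by (simp only: power2_eq_square)
  have "dirichlet_norm (mult_op phi (cut h)) \<le> dirichlet_norm (cut h)"
  proof (cases "dirichlet_norm (mult_op phi (cut h)) = 0")
    case True
    then show ?thesis using dirichlet_norm_nonneg[OF hD] by simp
  next
    case False
    then have "dirichlet_norm (mult_op phi (cut h)) > 0" using dirichlet_norm_nonneg[OF pD] by linarith
    with sq show ?thesis by (rule mult_left_le_imp_le)
  qed
  from phi_mult_norm_strict[OF h(1) this] have "h z = 0" if "cmod z < R" for z using that by blast
  then have "cut (rep_comb a) z = 0" for z using h(2)[of z] R by (auto simp: cut_def)
  from rep_independent[OF this j] show ?thesis .
qed

text \<open>A fibre has at most \<open>n\<close> points, and the \<open>n\<close> representers are independent on it.\<close>

lemma rep_comb_interpolates_fibre: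
  assumes w: "cmod w = 1"
  shows "\<exists>a. \<forall>\<zeta>\<in>fib w. x \<zeta> = rep_comb a \<zeta>"
proof -
  have "\<exists>a. \<forall>\<zeta>\<in>fib w. x \<zeta> = (\<Sum>j<n. a j * rep j \<zeta>)"
  proof (rule interpolation_of_independent[OF fib_finite_card[OF w]])
    fix a assume "\<forall>\<zeta>\<in>fib w. (\<Sum>j<n. a j * rep j \<zeta>) = 0"
    then show "\<forall>j<n. a j = 0" using rep_comb_zero_on_fibre[OF w] by (auto simp: rep_comb_def)
  qed
  then show ?thesis by (simp add: rep_comb_def)
qed

text \<open>Project a Lagrange polynomial to the wandering space: the difference is a multiple of \<open>phi\<close> and
  vanishes at the zeros.\<close>

lemma rep_comb_interpolates_zeros: "\<exists>a. \<forall>i<n. y (lam i) = rep_comb a (lam i)"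
proof -
  define Z where "Z = lam ` {..<n}"
  have Z: "finite Z" by (simp add: Z_def)
  define p where "p = (\<lambda>z. \<Sum>\<xi>\<in>Z. y \<xi> * (\<Prod>\<eta>\<in>Z-{\<xi>}. (z - \<eta>) / (\<xi> - \<eta>)))"
  have p: "p holomorphic_on ball 0 R" unfolding p_def by (intro holomorphic_intros) auto
  have pv: "p \<zeta> = y \<zeta>" if "\<zeta> \<in> Z" for \<zeta>
  proof -
    have "p \<zeta> = (\<Sum>\<xi>\<in>Z. if \<xi> = \<zeta> then y \<zeta> else 0)"
      unfolding p_def
    proof (rule sum.cong[OF refl])
      fix \<xi> assume "\<xi> \<in> Z"
      show "y \<xi> * (\<Prod>\<eta>\<in>Z-{\<xi>}. (\<zeta> - \<eta>) / (\<xi> - \<eta>)) = (if \<xi> = \<zeta> then y \<zeta> else 0)"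
      proof (cases "\<xi> = \<zeta>")
        case True
        then have "(\<Prod>\<eta>\<in>Z-{\<xi>}. (\<zeta> - \<eta>) / (\<xi> - \<eta>)) = (\<Prod>\<eta>\<in>Z-{\<xi>}. 1)" by (intro prod.cong) auto
        then show ?thesis using True by simp
      next
        case False
        then have "(\<Prod>\<eta>\<in>Z-{\<xi>}. (\<zeta> - \<eta>) / (\<xi> - \<eta>)) = 0" using that Z by (intro prod_zero) auto
        then show ?thesis using False by simp
      qed
    qed
    then show ?thesis using that Z by simp
  qed
  have pD: "cut p \<in> dirichlet_space" by (rule cut_dirichlet[OF p R])
  obtain a where a: "\<And>i. i < n \<Longrightarrow> ip (\<lambda>z. cut p z - (\<Sum>j<n. a j * cut (rep j) z)) (cut (rep i)) = 0"
    using finite_projection[where g = "\<lambda>j. cut (rep j)" and m = n, OF rep_dirichlet pD] by auto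
  define f where "f = (\<lambda>z. cut p z - cut (rep_comb a) z)"
  have f: "f \<in> dirichlet_space" unfolding f_def by (rule dirichlet_space_diff[OF pD rep_comb_dirichlet])
  have fi: "ip f (cut (rep i)) = 0" if "i < n" for i using a[OF that] by (simp add: f_def cut_rep_comb)
  obtain h where h: "h holomorphic_on ball 0 1" "\<And>z. cmod z < 1 \<Longrightarrow> f z = phi z * h z"
    using orth_rep_divisible[OF f fi] by blast
  have "y (lam i) = rep_comb a (lam i)" if i: "i < n" for i
  proof -
    have l: "cmod (lam i) < 1" by (rule lam_lt[OF i])
    have "phi (lam i) = 0" using phi_zero_iff[of "lam i"] l R i by auto
    then have "f (lam i) = 0" using h(2)[OF l] by simp
    then show ?thesis using pv[of "lam i"] i l by (simp add: f_def cut_def Z_def)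
  qed
  then show ?thesis by blast
qed

end

section \<open>Reducing subspaces of low order Blaschke products\<close>

lemma taylor_coeff_mult:
  assumes f: "f holomorphic_on ball 0 R" and g: "g holomorphic_on ball 0 R" and R: "R > 0"
  shows "taylor_coeff (\<lambda>z. f z * g z) k = (\<Sum>i\<le>k. taylor_coeff f i * taylor_coeff g (k - i))"
proof -
  have "(deriv ^^ k) (\<lambda>w. f w * g w) 0 = (\<Sum>i = 0..k. of_nat (k choose i) * (deriv ^^ i) f 0 * (deriv ^^ (k - i)) g 0)"
    using R by (intro higher_deriv_mult[OF f g open_ball]) simp
  then have "taylor_coeff (\<lambda>z. f z * g z) k = (\<Sum>i\<le>k. of_nat (k choose i) * (deriv ^^ i) f 0 * (deriv ^^ (k - i)) g 0 / fact k)"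
    by (simp add: taylor_coeff_def sum_divide_distrib atLeast0AtMost)
  also have "\<dots> = (\<Sum>i\<le>k. taylor_coeff f i * taylor_coeff g (k - i))"
    by (intro sum.cong refl) (simp add: taylor_coeff_def binomial_fact)
  finally show ?thesis .
qed

context blaschke
begin

lemma phi_mult_injective:
  assumes k: "k \<in> dirichlet_space" and z: "\<And>z. mult_op phi k z = 0"
  shows "k = (\<lambda>z. 0)"
proof
  fix z
  obtain x where x: "1 / R < x" "x < 1" using dense[OF R_inv(2)] by blast
  have x0: "x > 0" using x R_inv by linarith
  show "k z = 0"
  proof (cases "cmod z < 1")
    case True
    have op: "open {z::complex. 1 / R < cmod z \<and> cmod z < 1}" by (rule open_annulus)
    show ?thesis
    proof (rule analytic_continuation[where f = k and w = z and S = "ball 0 1" and U = "{z. 1 / R < cmod z \<and> cmod z < 1}" and \<xi> = "of_real x"])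
      show "k holomorphic_on ball 0 1" by (rule dirichlet_spaceD(1)[OF k])
      show "complex_of_real x islimpt {z. 1 / R < cmod z \<and> cmod z < 1}"
        using op x x0 by (intro interior_limit_point) (simp add: interior_open)
      show "k y = 0" if "y \<in> {z. 1 / R < cmod z \<and> cmod z < 1}" for y
        using z[of y] phi_nonzero[of y] that R by (auto simp: mult_op_def)
    qed (use True x x0 in auto)
  next
    case False
    then show ?thesis by (rule dirichlet_spaceD(2)[OF k])
  qed
qed

text \<open>The form of the reducing property that does not mention the adjoint.\<close>

definition reduces :: "(complex \<Rightarrow> complex) set \<Rightarrow> bool" where
  "reduces M \<longleftrightarrow> closed_subspace M \<and> (\<forall>f\<in>M. mult_op phi f \<in> M) \<and> (\<forall>f\<in>orth M. mult_op phi f \<in> orth M)"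

lemma reducesD:
  assumes "reduces M"
  shows "closed_subspace M" "f \<in> M \<Longrightarrow> mult_op phi f \<in> M" "f \<in> orth M \<Longrightarrow> mult_op phi f \<in> orth M"
    "M \<subseteq> dirichlet_space" "orth M \<subseteq> dirichlet_space" "closed_subspace (orth M)"
  using assms closed_subspaceD(1)[of M] closed_subspace_orth[of M] by (auto simp: reduces_def orth_def)

lemma reduces_orth: "reduces M \<Longrightarrow> reduces (orth M)"
  using closed_subspace_orth[OF reducesD(4)] orth_orth[OF reducesD(1)] by (simp add: reduces_def)

text \<open>The projection to \<open>M\<close> commutes with multiplication by \<open>phi\<close>.\<close>

lemma wander_components:
  assumes M: "reduces M" and g: "g \<in> wander" and mk: "m \<in> M" "k \<in> orth M" "g = (\<lambda>z. m z + k z)"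
  shows "m \<in> wander"
proof -
  have D: "m \<in> dirichlet_space" "k \<in> dirichlet_space" using mk reducesD[OF M] by auto
  have "ip (mult_op phi f) m = 0" if f: "f \<in> dirichlet_space" for f
  proof -
    obtain p q where pq: "p \<in> M" "q \<in> orth M" "f = (\<lambda>z. p z + q z)"
      using orthogonal_decomposition[OF reducesD(1)[OF M] f] by blast
    have pM: "mult_op phi p \<in> M" and qN: "mult_op phi q \<in> orth M" using pq reducesD[OF M] by auto
    have PD: "mult_op phi p \<in> dirichlet_space" "mult_op phi q \<in> dirichlet_space" "p \<in> dirichlet_space" using pM qN pq reducesD[OF M] by auto
    have "ip m (mult_op phi q) = 0" using mk(1) qN by (simp add: orth_def)
    then have q0: "ip (mult_op phi q) m = 0" using dirichlet_inner_cnj[OF D(1) PD(2)] by simp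
    have k0: "ip (mult_op phi p) k = 0" using pM mk(2) by (simp add: orth_def)
    have "ip (mult_op phi p) g = 0" using g PD(3) by (simp add: wander_def)
    then have p0: "ip (mult_op phi p) m = 0" using dirichlet_inner_add_right[OF D PD(1)] k0 by (simp add: mk(3))
    show ?thesis using dirichlet_inner_add_left[OF PD(1,2) D(1)] p0 q0 by (simp add: pq(3) mult_op_add)
  qed
  then show ?thesis using D by (simp add: wander_def)
qed

text \<open>Otherwise the wandering space lies in \<open>orth M\<close>, so each element of \<open>M\<close> is
  \<open>phi\<close> times another element of \<open>M\<close>, and repeating this gives it a zero of infinite
  order at the origin.\<close>

lemma reducing_meets_wander:
  assumes M: "reduces M" and phi0: "phi 0 = 0" and ne: "M \<noteq> {\<lambda>z. 0}"
  obtains f where "f \<in> M" "f \<in> wander" "f \<noteq> (\<lambda>z. 0)"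
proof (rule ccontr)
  assume "\<not> thesis"
  then have trivial: "f = (\<lambda>z. 0)" if "f \<in> M" "f \<in> wander" for f using that(1,2) \<open>\<And>f. f \<in> M \<Longrightarrow> f \<in> wander \<Longrightarrow> f \<noteq> (\<lambda>z. 0) \<Longrightarrow> thesis\<close> by blast
  have repN: "cut (rep j) \<in> orth M" if j: "j < n" for j
  proof -
    obtain m k where mk: "m \<in> M" "k \<in> orth M" "cut (rep j) = (\<lambda>z. m z + k z)"
      using orthogonal_decomposition[OF reducesD(1)[OF M] rep_dirichlet[OF j]] by blast
    have "m = (\<lambda>z. 0)" by (rule trivial[OF mk(1) wander_components[OF M rep_wander[OF j] mk]])
    then show ?thesis using mk by simp
  qed
  have divide: "\<exists>h\<in>M. f = mult_op phi h" if f: "f \<in> M" for f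
  proof -
    have fD: "f \<in> dirichlet_space" using f reducesD(4)[OF M] by blast
    have "ip f (cut (rep j)) = 0" if "j < n" for j using repN[OF that] f by (simp add: orth_def)
    then obtain h where h: "h holomorphic_on ball 0 1" "\<And>z. cmod z < 1 \<Longrightarrow> f z = phi z * h z"
      using orth_rep_divisible[OF fD] by blast
    have hD: "cut h \<in> dirichlet_space" and fe: "f = mult_op phi (cut h)" using divide_phi_dirichlet[OF fD h] by auto
    obtain m k where mk: "m \<in> M" "k \<in> orth M" "cut h = (\<lambda>z. m z + k z)"
      using orthogonal_decomposition[OF reducesD(1)[OF M] hD] by blast
    have kN: "mult_op phi k \<in> orth M" and mM: "mult_op phi m \<in> M" using mk reducesD[OF M] by auto
    have "mult_op phi k = (\<lambda>z. f z - mult_op phi m z)" unfolding fe mk(3) mult_op_add by auto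
    then have "mult_op phi k \<in> M" using closed_subspaceD(5)[OF reducesD(1)[OF M] f mM] by simp
    then have "mult_op phi k = (\<lambda>z. 0)" using orth_Int kN by blast
    then have "k = (\<lambda>z. 0)" using mk(2) reducesD(5)[OF M] by (intro phi_mult_injective) auto
    then show ?thesis using mk fe by (intro bexI[of _ m]) auto
  qed
  have vanish: "taylor_coeff f j = 0" if "f \<in> M" "j < N" for f j N
    using that
  proof (induction N arbitrary: f j)
    case (Suc N)
    obtain h where h: "h \<in> M" "f = mult_op phi h" using divide[OF Suc.prems(1)] by blast
    have hh: "h holomorphic_on ball 0 1" using h reducesD(4)[OF M] dirichlet_spaceD(1) by blast
    have ph: "phi holomorphic_on ball 0 1" using R by (intro phi_holo_subset) auto
    have "taylor_coeff f j = (\<Sum>i\<le>j. taylor_coeff phi i * taylor_coeff h (j - i))"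
      unfolding h(2) mult_op_def using taylor_coeff_mult[OF ph hh] by simp
    also have "\<dots> = 0"
    proof (rule sum.neutral, rule ballI)
      fix i assume "i \<in> {..j}"
      show "taylor_coeff phi i * taylor_coeff h (j - i) = 0"
      proof (cases "i = 0")
        case True
        then show ?thesis using phi0 by (simp add: taylor_coeff_0)
      next
        case False
        show ?thesis
        proof (cases "j = 0")
          case True
          then show ?thesis using \<open>i \<in> {..j}\<close> False by simp
        next
          case j0: False
          then have "j - i < N" using Suc.prems(2) False by linarith
          then show ?thesis using Suc.IH[OF h(1)] by simp
        qed
      qed
    qed
    finally show ?case .
  qed simp
  have "f = (\<lambda>z. 0)" if f: "f \<in> M" for f
  proof (rule dirichlet_space_eqI)
    show "f \<in> dirichlet_space" using f reducesD(4)[OF M] by blast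
    show "taylor_coeff f j = taylor_coeff (\<lambda>z. 0) j" for j using vanish[OF f, of j "Suc j"] by simp
  qed simp
  then have "M \<subseteq> {\<lambda>z. 0}" by blast
  then show False using ne closed_subspaceD(2)[OF reducesD(1)[OF M]] by blast
qed

lemma cut_phi_power_mem:
  assumes inv: "\<And>f. f \<in> M \<Longrightarrow> mult_op phi f \<in> M" and v: "cut v \<in> M"
  shows "cut (\<lambda>z. phi z ^ k * v z) \<in> M"
proof (induction k)
  case (Suc k)
  from inv[OF this] show ?case by (simp add: mult_op_cut mult.assoc)
qed (use v in simp)

text \<open>If the wandering part of \<open>M\<close> is a line, the wandering part of \<open>orth M\<close> can play the
  role of \<open>V\<close> in \<open>phi_root_zero\<close>: together they make up the wandering space, which has
  the two interpolation properties.\<close>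

lemma line_imp_zero:
  assumes M: "reduces M" and phi0: "phi 0 = 0"
    and f0: "f0 \<in> M" "f0 \<in> wander" "f0 \<noteq> (\<lambda>z. 0)"
    and line: "\<And>f. f \<in> M \<Longrightarrow> f \<in> wander \<Longrightarrow> \<exists>\<alpha>. f = (\<lambda>z. \<alpha> * f0 z)"
    and q: "q < n" "\<And>j. j < n \<Longrightarrow> j \<noteq> q \<Longrightarrow> lam j \<noteq> lam q"
    and i1: "i1 < n"
  shows "lam i1 = 0"
proof -
  obtain a0 where a0: "f0 = cut (rep_comb a0)" using wander_rep_comb[OF f0(2)] by blast
  define v0 where "v0 = rep_comb a0"
  define V where "V = {v. v holomorphic_on ball 0 R \<and> cut v \<in> orth M}"
  have split: "\<exists>\<alpha>. \<exists>g\<in>V. \<forall>z. rep_comb a z = \<alpha> * v0 z + g z" for a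
  proof -
    obtain m k where mk: "m \<in> M" "k \<in> orth M" "cut (rep_comb a) = (\<lambda>z. m z + k z)"
      using orthogonal_decomposition[OF reducesD(1)[OF M] rep_comb_dirichlet] by blast
    obtain \<alpha> where \<alpha>: "m = (\<lambda>z. \<alpha> * f0 z)" using line[OF mk(1) wander_components[OF M rep_comb_wander mk]] by blast
    define g where "g = (\<lambda>z. rep_comb a z - \<alpha> * v0 z)"
    have "cut g z = k z" for z
    proof -
      have "cut (rep_comb a) z = \<alpha> * f0 z + k z" using mk(3) \<alpha> by simp
      then show ?thesis by (auto simp: g_def cut_def a0 v0_def)
    qed
    then have "cut g = k" by auto
    moreover have "g holomorphic_on ball 0 R" unfolding g_def v0_def by (intro holomorphic_intros rep_comb_holo)
    ultimately have "g \<in> V" using mk(2) by (simp add: V_def)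
    then show ?thesis by (intro exI[of _ \<alpha>] bexI[of _ g]) (auto simp: g_def)
  qed
  have v0h: "v0 holomorphic_on ball 0 R" unfolding v0_def by (rule rep_comb_holo)
  obtain z1 where z1: "cmod z1 = 1" "v0 z1 \<noteq> 0"
  proof (rule ccontr)
    assume "\<not> thesis"
    then have "v0 z = 0" if "cmod z = 1" for z using that \<open>\<And>z1. cmod z1 = 1 \<Longrightarrow> v0 z1 \<noteq> 0 \<Longrightarrow> thesis\<close> by blast
    then have "v0 z = 0" if "cmod z < R" for z using holomorphic_zero_on_circle[OF v0h R _ that] by blast
    then have "f0 = (\<lambda>z. 0)" using R by (auto simp: a0 cut_def v0_def fun_eq_iff)
    then show False using f0(3) by simp
  qed
  show ?thesis
  proof (rule phi_root_zero[OF phi0 v0h _ _ _ z1 _ q i1, where V = V])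
    show "g holomorphic_on ball 0 R" if "g \<in> V" for g using that by (simp add: V_def)
    show "ip (cut (\<lambda>z. phi z ^ k * v0 z)) (cut (\<lambda>z. phi z ^ l * g z)) = 0" if g: "g \<in> V" for g k l
    proof -
      have "cut (\<lambda>z. phi z ^ k * v0 z) \<in> M"
        using reducesD(2)[OF M] f0(1) by (intro cut_phi_power_mem) (auto simp: a0 v0_def)
      moreover have "cut (\<lambda>z. phi z ^ l * g z) \<in> orth M"
        using reducesD(3)[OF M] g by (intro cut_phi_power_mem) (auto simp: V_def)
      ultimately show ?thesis by (simp add: orth_def)
    qed
    show "\<exists>\<alpha>. \<exists>g\<in>V. \<forall>\<zeta>\<in>fib w. x \<zeta> = \<alpha> * v0 \<zeta> + g \<zeta>" if w: "cmod w = 1" for w x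
    proof -
      obtain a where a: "\<forall>\<zeta>\<in>fib w. x \<zeta> = rep_comb a \<zeta>" using rep_comb_interpolates_fibre[OF w] by blast
      obtain \<alpha> g where "g \<in> V" "\<forall>z. rep_comb a z = \<alpha> * v0 z + g z" using split by blast
      then show ?thesis using a by (intro exI[of _ \<alpha>] bexI[of _ g]) auto
    qed
    show "\<exists>\<alpha>. \<exists>g\<in>V. \<forall>i<n. y (lam i) = \<alpha> * v0 (lam i) + g (lam i)" for y
    proof -
      obtain a where a: "\<forall>i<n. y (lam i) = rep_comb a (lam i)" using rep_comb_interpolates_zeros by blast
      obtain \<alpha> g where "g \<in> V" "\<forall>z. rep_comb a z = \<alpha> * v0 z + g z" using split by blast
      then show ?thesis using a by (intro exI[of _ \<alpha>] bexI[of _ g]) auto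
    qed
  qed
qed

text \<open>Two independent elements on each side would be four independent combinations of at most three representers.\<close>

lemma one_wandering_line:
  assumes M: "reduces M" and n3: "n \<le> 3"
    and f1: "f1 \<in> M" "f1 \<in> wander" "f1 \<noteq> (\<lambda>z. 0)" and g1: "g1 \<in> orth M" "g1 \<in> wander" "g1 \<noteq> (\<lambda>z. 0)"
  shows "(\<forall>f. f \<in> M \<longrightarrow> f \<in> wander \<longrightarrow> (\<exists>\<alpha>. f = (\<lambda>z. \<alpha> * f1 z))) \<or>
    (\<forall>g. g \<in> orth M \<longrightarrow> g \<in> wander \<longrightarrow> (\<exists>\<alpha>. g = (\<lambda>z. \<alpha> * g1 z)))"
proof (rule ccontr)
  assume "\<not> ?thesis"
  then obtain f2 g2 where f2: "f2 \<in> M" "f2 \<in> wander" "\<And>\<alpha>. f2 \<noteq> (\<lambda>z. \<alpha> * f1 z)"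
    and g2: "g2 \<in> orth M" "g2 \<in> wander" "\<And>\<alpha>. g2 \<noteq> (\<lambda>z. \<alpha> * g1 z)" by blast
  obtain a1 where a1: "f1 = cut (rep_comb a1)" using wander_rep_comb[OF f1(2)] by blast
  obtain a2 where a2: "f2 = cut (rep_comb a2)" using wander_rep_comb[OF f2(2)] by blast
  obtain b1 where b1: "g1 = cut (rep_comb b1)" using wander_rep_comb[OF g1(2)] by blast
  obtain b2 where b2: "g2 = cut (rep_comb b2)" using wander_rep_comb[OF g2(2)] by blast
  define A where "A i = (if i = 0 then a1 else if i = 1 then a2 else if i = 2 then b1 else b2)" for i :: nat
  have "card {..<n} < card {..<4::nat}" using n3 by simp
  from homogeneous_system[OF _ _ this, of A] obtain x where x: "\<exists>j<4. x j \<noteq> 0" "\<And>s. s < n \<Longrightarrow> (\<Sum>j<4. x j * A j s) = 0" by auto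
  have S4: "{..<4} = {0, 1, 2, 3::nat}" by auto
  have rel: "x 0 * a1 s + x 1 * a2 s + x 2 * b1 s + x 3 * b2 s = 0" if "s < n" for s
    using x(2)[OF that] unfolding S4 by (simp add: A_def add.assoc)
  have zero: "x 0 * f1 z + x 1 * f2 z + x 2 * g1 z + x 3 * g2 z = 0" for z
  proof -
    have "x 0 * f1 z + x 1 * f2 z + x 2 * g1 z + x 3 * g2 z = (\<Sum>j<n. (x 0 * a1 j + x 1 * a2 j + x 2 * b1 j + x 3 * b2 j) * cut (rep j) z)"
      unfolding a1 a2 b1 b2 cut_rep_comb by (simp add: sum_distrib_left sum.distrib distrib_right mult.assoc)
    also have "\<dots> = 0" using rel by (intro sum.neutral) simp
    finally show ?thesis .
  qed
  define p where "p = (\<lambda>z. x 0 * f1 z + x 1 * f2 z)"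
  define r where "r = (\<lambda>z. x 2 * g1 z + x 3 * g2 z)"
  have pM: "p \<in> M" unfolding p_def
    by (intro closed_subspaceD(3,4)[OF reducesD(1)[OF M]] f1 f2)
  have rN: "r \<in> orth M" unfolding r_def
    by (intro closed_subspaceD(3,4)[OF reducesD(6)[OF M]] g1 g2)
  have "p = (\<lambda>z. (-1) * r z)"
  proof
    fix z
    have "p z + r z = 0" using zero[of z] by (simp only: p_def r_def add.assoc)
    then show "p z = (-1) * r z" by (simp add: eq_neg_iff_add_eq_0)
  qed
  then have "p \<in> orth M" using closed_subspaceD(4)[OF reducesD(6)[OF M] rN, of "-1"] by simp
  then have p0: "p = (\<lambda>z. 0)" by (rule orth_Int[OF pM])
  have r0: "r z = 0" for z
  proof -
    have "p z + r z = 0" using zero[of z] by (simp only: p_def r_def add.assoc)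
    then show ?thesis by (simp add: p0)
  qed
  have lin: "s = 0 \<and> t = 0" if z: "\<And>z. s * u z + t * v z = 0" and u: "u \<noteq> (\<lambda>z. 0)" and v: "\<And>\<alpha>. v \<noteq> (\<lambda>z. \<alpha> * u z)"
    for s t and u v :: "complex \<Rightarrow> complex"
  proof -
    have "t = 0"
    proof (rule ccontr)
      assume t: "t \<noteq> 0"
      have "v z = (- s / t) * u z" for z
      proof -
        have "t * v z = - s * u z" using z[of z] by (simp add: add_eq_0_iff)
        then show ?thesis using t by (simp add: field_simps)
      qed
      then show False using v[of "- s / t"] by blast
    qed
    moreover have "s = 0"
    proof (rule ccontr)
      assume "s \<noteq> 0"
      then have "u z = 0" for z using z[of z] \<open>t = 0\<close> by simp
      then show False using u by auto
    qed
    ultimately show ?thesis by simp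
  qed
  have "x 0 = 0 \<and> x 1 = 0" using fun_cong[OF p0] by (intro lin[of "x 0" f1 "x 1" f2] f1 f2) (simp add: p_def)
  moreover have "x 2 = 0 \<and> x 3 = 0" using r0 by (intro lin[of "x 2" g1 "x 3" g2] g1 g2) (simp add: r_def)
  ultimately have "x j = 0" if "j < 4" for j
  proof -
    have "j = 0 \<or> j = 1 \<or> j = 2 \<or> j = 3" using that by linarith
    then show ?thesis using \<open>x 0 = 0 \<and> x 1 = 0\<close> \<open>x 2 = 0 \<and> x 3 = 0\<close> by (elim disjE) simp_all
  qed
  then show False using x(1) by blast
qed

text \<open>If not all zeros are \<open>0\<close>, then one of them is simple: with at most three zeros, either
  \<open>0\<close> occurs once, or it occurs twice and the remaining zero is simple.\<close>

lemma reduces_imp_zeros_zero: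
  assumes M: "reduces M" and phi0: "phi 0 = 0" and n3: "n = 2 \<or> n = 3"
    and ne: "M \<noteq> {\<lambda>z. 0}" "M \<noteq> dirichlet_space" and i: "i < n"
  shows "lam i = 0"
proof (rule ccontr)
  assume i1: "lam i \<noteq> 0"
  obtain i0 where i0: "i0 < n" "lam i0 = 0" using phi0 phi_zero_iff[of 0] R by auto
  obtain q where q: "q < n" "\<And>j. j < n \<Longrightarrow> j \<noteq> q \<Longrightarrow> lam j \<noteq> lam q"
  proof (cases "\<exists>j<n. j \<noteq> i0 \<and> lam j = 0")
    case False
    then show thesis using that[of i0] i0 by auto
  next
    case True
    then obtain j where j: "j < n" "j \<noteq> i0" "lam j = 0" by blast
    have ij: "i \<noteq> i0" "i \<noteq> j" using i1 i0 j by auto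
    have "lam l \<noteq> lam i" if "l < n" "l \<noteq> i" for l
    proof -
      have "l = i0 \<or> l = j" using that ij i i0 j n3 by linarith
      then show ?thesis using i0 j i1 by auto
    qed
    then show thesis using that[of i] i by auto
  qed
  have Nne: "orth M \<noteq> {\<lambda>z. 0}"
  proof
    assume N0: "orth M = {\<lambda>z. 0}"
    have "dirichlet_space \<subseteq> M"
    proof
      fix f assume "f \<in> dirichlet_space"
      then obtain m k where mk: "m \<in> M" "k \<in> orth M" "f = (\<lambda>z. m z + k z)"
        using orthogonal_decomposition[OF reducesD(1)[OF M]] by blast
      then show "f \<in> M" using N0 by auto
    qed
    then show False using ne(2) reducesD(4)[OF M] by blast
  qed
  have N: "reduces (orth M)" by (rule reduces_orth[OF M])
  obtain f1 where f1: "f1 \<in> M" "f1 \<in> wander" "f1 \<noteq> (\<lambda>z. 0)" using reducing_meets_wander[OF M phi0 ne(1)] by blast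
  obtain g1 where g1: "g1 \<in> orth M" "g1 \<in> wander" "g1 \<noteq> (\<lambda>z. 0)" using reducing_meets_wander[OF N phi0 Nne] by blast
  have "n \<le> 3" using n3 by auto
  from one_wandering_line[OF M this f1 g1] show False
  proof
    assume "\<forall>f. f \<in> M \<longrightarrow> f \<in> wander \<longrightarrow> (\<exists>\<alpha>. f = (\<lambda>z. \<alpha> * f1 z))"
    then show False using line_imp_zero[OF M phi0 f1 _ q i] i1 by blast
  next
    assume "\<forall>g. g \<in> orth M \<longrightarrow> g \<in> wander \<longrightarrow> (\<exists>\<alpha>. g = (\<lambda>z. \<alpha> * g1 z))"
    then show False using line_imp_zero[OF N phi0 g1 _ q i] i1 by blast
  qed
qed

end

section \<open>Functions of a power have reducing subspaces\<close>

lemma taylor_coeff_power_argument: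
  assumes A: "A holomorphic_on ball 0 1" and n: "n \<ge> 1" and k: "\<not> n dvd k"
  shows "taylor_coeff (\<lambda>z. A (z ^ n)) k = 0"
proof -
  define b where "b k = (if n dvd k then taylor_coeff A (k div n) else 0)" for k
  have mono: "strict_mono (\<lambda>i. n * i)" using n by (simp add: strict_mono_def)
  have ser: "(\<lambda>k. b k * z ^ k) sums A (z ^ n)" if z: "cmod z < 1" for z
  proof -
    have "cmod (z ^ n) < 1" using z n by (simp add: norm_power power_less_one_iff)
    from taylor_series[OF A this] have "(\<lambda>i. taylor_coeff A i * (z ^ n) ^ i) sums A (z ^ n)" .
    then have "(\<lambda>i. b (n * i) * z ^ (n * i)) sums A (z ^ n)" using n by (simp add: b_def power_mult)
    moreover have "b j * z ^ j = 0" if "j \<notin> range (\<lambda>i. n * i)" for j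
      using that by (auto simp: b_def dvd_def)
    ultimately show ?thesis using sums_mono_reindex[OF mono, of "\<lambda>k. b k * z ^ k"] by blast
  qed
  from power_series_taylor_coeff(2)[OF zero_less_one ser] k show ?thesis by (simp add: b_def)
qed

lemma ip_dmono:
  assumes "g \<in> dirichlet_space"
  shows "ip (dmono k) g = (of_nat k + 1) * cnj (taylor_coeff g k)"
proof -
  have 1: "(\<lambda>j. if j = k then (of_nat j + 1) * cnj (taylor_coeff g j) else 0) sums ((of_nat k + 1) * cnj (taylor_coeff g k))"
    using sums_If_finite_set[of "{k}" "\<lambda>j. (of_nat j + 1) * cnj (taylor_coeff g j)"] by simp
  have 2: "(\<lambda>j. (of_nat j + 1) * taylor_coeff (dmono k) j * cnj (taylor_coeff g j)) =
      (\<lambda>j. if j = k then (of_nat j + 1) * cnj (taylor_coeff g j) else 0)"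
    by (auto simp: dmono(2))
  show ?thesis by (rule sums_unique2[OF dirichlet_inner_sums[OF dmono(1)[of k] assms, unfolded 2] 1])
qed

lemma orth_dmono: "orth (dmono ` S) = {g \<in> dirichlet_space. \<forall>k\<in>S. taylor_coeff g k = 0}"
proof -
  have "of_nat k + 1 \<noteq> (0::complex)" for k
    by (metis of_nat_Suc of_nat_neq_0 add.commute)
  then show ?thesis by (auto simp: orth_def ip_dmono)
qed

text \<open>Let \<open>M\<close> be the space of functions whose coefficients vanish off the multiples of \<open>n\<close>.
  Its complement consists of those whose coefficients vanish on the multiples of \<open>n\<close>, and
  multiplying by a series in \<open>z ^ n\<close> shifts indices by multiples of \<open>n\<close>. Defining
  \<open>M\<close> as the complement of a set of monomials makes it closed at once.\<close>

lemma reducible_of_lacunary: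
  assumes m: "dmultiplier m" and n: "n \<ge> 2" and lac: "\<And>k. \<not> n dvd k \<Longrightarrow> taylor_coeff m k = 0"
  shows "reducible (mult_op m)"
proof -
  define M where "M = orth (dmono ` {k. \<not> n dvd k})"
  have M: "f \<in> M \<longleftrightarrow> f \<in> dirichlet_space \<and> (\<forall>k. \<not> n dvd k \<longrightarrow> taylor_coeff f k = 0)" for f
    by (simp add: M_def orth_dmono)
  have dm: "dmono k \<in> M \<longleftrightarrow> n dvd k" for k by (auto simp: M dmono)
  have N: "f \<in> orth M \<longleftrightarrow> f \<in> dirichlet_space \<and> (\<forall>k. n dvd k \<longrightarrow> taylor_coeff f k = 0)" for f
  proof
    assume f: "f \<in> orth M"
    then have "f \<in> orth (dmono ` {k. n dvd k})" using dm by (auto simp: orth_def)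
    then show "f \<in> dirichlet_space \<and> (\<forall>k. n dvd k \<longrightarrow> taylor_coeff f k = 0)" by (simp add: orth_dmono)
  next
    assume f: "f \<in> dirichlet_space \<and> (\<forall>k. n dvd k \<longrightarrow> taylor_coeff f k = 0)"
    have "ip g f = 0" if g: "g \<in> M" for g
    proof -
      have z: "(\<lambda>k. (of_nat k + 1) * taylor_coeff g k * cnj (taylor_coeff f k)) = (\<lambda>k. 0)"
      proof
        fix k
        show "(of_nat k + 1) * taylor_coeff g k * cnj (taylor_coeff f k) = 0"
          using g f unfolding M by (cases "n dvd k") auto
      qed
      have "(\<lambda>k. (of_nat k + 1) * taylor_coeff g k * cnj (taylor_coeff f k)) sums ip g f"
        using g f unfolding M by (intro dirichlet_inner_sums) auto
      then show ?thesis unfolding z by (simp add: sums_iff)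
    qed
    then show "f \<in> orth M" using f by (simp add: orth_def)
  qed
  have mh: "m holomorphic_on ball 0 1" using m by (simp add: dmultiplier_def)
  have mD: "mult_op m f \<in> dirichlet_space" if "f \<in> dirichlet_space" for f
    using dmultiplier_bounded[OF m] that by metis
  have prod: "taylor_coeff (mult_op m f) k = (\<Sum>i\<le>k. taylor_coeff m i * taylor_coeff f (k - i))" if "f \<in> dirichlet_space" for f k
    unfolding mult_op_def by (rule taylor_coeff_mult[OF mh dirichlet_spaceD(1)[OF that]]) simp
  have term0: "taylor_coeff m i * taylor_coeff f (k - i) = 0"
    if "i \<le> k" and "n dvd i \<Longrightarrow> taylor_coeff f (k - i) = 0" for f i k
    using that lac by (cases "n dvd i") auto
  have inv: "mult_op m f \<in> M" if f: "f \<in> M" for f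
    unfolding M
  proof (intro conjI allI impI)
    show "mult_op m f \<in> dirichlet_space" using mD f unfolding M by blast
    fix k assume k: "\<not> n dvd k"
    show "taylor_coeff (mult_op m f) k = 0"
      unfolding prod[OF f[unfolded M, THEN conjunct1]]
    proof (rule sum.neutral, rule ballI, rule term0)
      fix i assume i: "i \<in> {..k}" then show "i \<le> k" by simp
      assume "n dvd i"
      then have "\<not> n dvd (k - i)" using k i dvd_diff_nat[of n "k" i] by (metis atMost_iff dvd_diffD)
      then show "taylor_coeff f (k - i) = 0" using f unfolding M by blast
    qed
  qed
  have invN: "mult_op m f \<in> orth M" if f: "f \<in> orth M" for f
    unfolding N
  proof (intro conjI allI impI)
    show "mult_op m f \<in> dirichlet_space" using mD f unfolding N by blast
    fix k assume k: "n dvd k"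
    show "taylor_coeff (mult_op m f) k = 0"
      unfolding prod[OF f[unfolded N, THEN conjunct1]]
    proof (rule sum.neutral, rule ballI, rule term0)
      fix i assume i: "i \<in> {..k}" then show "i \<le> k" by simp
      assume "n dvd i"
      then have "n dvd (k - i)" using k by (rule dvd_diff_nat[rotated])
      then show "taylor_coeff f (k - i) = 0" using f unfolding N by blast
    qed
  qed
  have cl: "closed_subspace M" unfolding M_def by (rule closed_subspace_orth) (auto simp: dmono)
  have "reducing_subspace (mult_op m) M"
    using reducing_subspace_iff[OF m] cl inv invN by blast
  moreover have "M \<noteq> {\<lambda>z. 0}"
  proof
    assume "M = {\<lambda>z. 0}"
    then have "dmono 0 = (\<lambda>z. 0)" using dm[of 0] by auto
    then show False using dmono_eq[of 0 0] by simp
  qed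
  moreover have "M \<noteq> dirichlet_space" using dm[of 1] dmono(1)[of 1] n by auto
  ultimately show ?thesis unfolding reducible_def by blast
qed

lemma dmultiplier_cong:
  assumes m: "dmultiplier m" and e: "\<And>z. cmod z < 1 \<Longrightarrow> m z = m' z"
  shows "dmultiplier m'"
proof -
  have h: "m' holomorphic_on ball 0 1"
    using m e by (auto simp: dmultiplier_def intro: holomorphic_transform)
  have "deriv m z = deriv m' z" if "z \<in> ball 0 1" for z
    by (rule complex_derivative_transform_within_open[of m "ball 0 1" m']) (use m h that e in \<open>auto simp: dmultiplier_def\<close>)
  then show ?thesis using m h e by (simp add: dmultiplier_def)
qed

lemma reducible_power_function:
  assumes m: "dmultiplier m" and n: "n \<ge> 2" and A: "A holomorphic_on ball 0 1"
    and e: "\<And>z. cmod z < 1 \<Longrightarrow> m z = A (z ^ n)"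
  shows "reducible (mult_op m)"
proof (rule reducible_of_lacunary[OF m n])
  fix k assume k: "\<not> n dvd k"
  have "taylor_coeff m k = taylor_coeff (\<lambda>z. A (z ^ n)) k"
    using m e by (intro taylor_coeff_cong[of 1]) (auto simp: dmultiplier_def)
  then show "taylor_coeff m k = 0" using taylor_coeff_power_argument[OF A _ k] n by simp
qed

section \<open>Moving a zero to the origin\<close>

lemma common_radius:
  fixes w :: "nat \<Rightarrow> complex"
  assumes w: "\<And>i. i < n \<Longrightarrow> cmod (w i) < 1"
  shows "\<exists>R>1. \<forall>i<n. cmod (w i) * R < 1"
proof -
  define r where "r = Max (insert 0 ((\<lambda>i. cmod (w i)) ` {..<n}))"
  have fin: "finite (insert 0 ((\<lambda>i. cmod (w i)) ` {..<n}))" by simp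
  have r: "r < 1" "0 \<le> r" "\<And>i. i < n \<Longrightarrow> cmod (w i) \<le> r"
    unfolding r_def using w Max_less_iff[OF fin] by (auto intro!: Max_ge)
  show ?thesis
  proof (intro exI conjI allI impI)
    show "2 / (1 + r) > 1" using r by (simp add: field_simps)
    fix i assume "i < n"
    then have "cmod (w i) * (2 / (1 + r)) \<le> r * (2 / (1 + r))" using r by (intro mult_right_mono) auto
    also have "\<dots> < 1" using r by (simp add: field_simps)
    finally show "cmod (w i) * (2 / (1 + r)) < 1" .
  qed
qed

lemma prod_linear_poly:
  fixes p q :: "nat \<Rightarrow> complex"
  shows "degree (\<Prod>i<n. [:p i, q i:]) \<le> n" "coeff (\<Prod>i<n. [:p i, q i:]) n = (\<Prod>i<n. q i)"
proof (induction n)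
  case (Suc n)
  have d: "degree [:p n, q n:] \<le> 1" by simp
  { case 1
    have "degree ((\<Prod>i<n. [:p i, q i:]) * [:p n, q n:]) \<le> n + 1"
      using degree_mult_le[of "\<Prod>i<n. [:p i, q i:]" "[:p n, q n:]"] Suc(1) d by linarith
    then show ?case by simp
  next
    case 2
    have "coeff (\<Prod>i<n. [:p i, q i:]) (Suc n) = 0" using Suc(1) by (intro coeff_eq_0) simp
    then show ?case using Suc(2) by (simp add: mult.commute[of "prod _ _" "[:_, _:]"])
  }
qed auto

text \<open>Write the product as \<open>P / Q\<close>. The composition is \<open>N / E\<close> with \<open>N = b Q -
  P\<close> and \<open>E = Q - cnj b P\<close>. Outside the open disc \<open>P\<close> dominates
  \<open>Q\<close>, so all roots of \<open>N\<close> lie in the disc, and there are \<open>n\<close> of them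
  since the leading coefficient does not vanish. Up to a constant \<open>E\<close> is the polynomial reciprocal
  to \<open>N\<close>, because \<open>Q\<close> is reciprocal to \<open>P\<close>; so its factors are the
  denominators that belong to the roots of \<open>N\<close>.\<close>

lemma disc_aut_comp_blaschke:
  fixes w :: "nat \<Rightarrow> complex"
  assumes c: "cmod c = 1" and w: "\<And>i. i < n \<Longrightarrow> cmod (w i) < 1" and b: "cmod b < 1"
  obtains c' mu where "cmod c' = 1" "\<forall>i<n. cmod (mu i) < 1"
    "\<forall>z. cmod z < 1 \<longrightarrow> disc_aut b (c * (\<Prod>i<n. disc_aut (w i) z)) = c' * (\<Prod>i<n. disc_aut (mu i) z)"
proof -
  define P where "P = smult c (\<Prod>i<n. [:w i, -1:])"
  define Q where "Q = (\<Prod>i<n. [:1, - cnj (w i):])"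
  define N where "N = smult b Q - P"
  define E where "E = Q - smult (cnj b) P"
  have sgn: "(\<Prod>i<n. f i - g i) = (-1) ^ n * (\<Prod>i<n. g i - f i)" for f g :: "nat \<Rightarrow> complex"
  proof -
    have "(\<Prod>i<n. f i - g i) = (\<Prod>i<n. (-1) * (g i - f i))" by (intro prod.cong) auto
    then show ?thesis unfolding prod.distrib by simp
  qed
  have P: "poly P z = c * (\<Prod>i<n. w i - z)" for z by (simp add: P_def poly_prod)
  have Q: "poly Q z = (\<Prod>i<n. 1 - cnj (w i) * z)" for z by (simp add: Q_def poly_prod mult.commute)
  have cc: "c * cnj c = 1" using c by (simp add: complex_norm_square[symmetric] del: of_real_power)
  have ccn: "c * (cnj c * x) = x" for x using cc by (simp add: mult.assoc[symmetric])
  have "coeff N n = b * (\<Prod>i<n. - cnj (w i)) - c * (\<Prod>i<n. -1)"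
    unfolding N_def P_def Q_def by (simp add: prod_linear_poly(2))
  moreover have "cmod (b * (\<Prod>i<n. - cnj (w i))) < cmod (c * (\<Prod>i<n. -1))"
  proof -
    have "(\<Prod>i<n. cmod (w i)) \<le> 1" using w by (intro prod_le_1) (auto simp: less_imp_le)
    then have "cmod b * (\<Prod>i<n. cmod (w i)) \<le> cmod b * 1" by (intro mult_left_mono) auto
    then show ?thesis using b c by (simp add: norm_mult norm_power prod_norm[symmetric])
  qed
  ultimately have cN: "coeff N n \<noteq> 0" by auto
  have "degree N \<le> n" unfolding N_def P_def Q_def
    by (intro degree_diff_le order.trans[OF degree_smult_le] prod_linear_poly(1))
  moreover have "n \<le> degree N" using cN by (rule le_degree)
  ultimately have dN: "degree N = n" by simp
  obtain mu where "smult (lead_coeff N) (\<Prod>i<degree N. [:- mu i, 1:]) = N" using complex_poly_decompose' by blast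
  then have muN: "N = smult (coeff N n) (\<Prod>i<n. [:- mu i, 1:])" by (simp add: dN)
  define e where "e = (-1) ^ n * coeff N n"
  have e0: "e \<noteq> 0" using cN by (simp add: e_def)
  have Nz: "poly N z = e * (\<Prod>i<n. mu i - z)" for z
  proof -
    have "poly N z = coeff N n * (\<Prod>i<n. z - mu i)" by (subst muN) (simp add: poly_prod)
    also have "(\<Prod>i<n. z - mu i) = (-1) ^ n * (\<Prod>i<n. mu i - z)" by (rule sgn)
    finally show ?thesis by (simp add: e_def)
  qed
  have mu: "cmod (mu i) < 1" if i: "i < n" for i
  proof (rule ccontr)
    assume "\<not> cmod (mu i) < 1"
    then have z1: "cmod (mu i) \<ge> 1" by simp
    have "poly N (mu i) = 0" unfolding Nz using i by (auto intro!: prod_zero)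
    then have PQ: "poly P (mu i) = b * poly Q (mu i)" by (simp add: N_def)
    have le: "cmod (1 - cnj (w j) * mu i) \<le> cmod (w j - mu i)" if "j < n" for j
    proof -
      have "(1 - (cmod (w j))\<^sup>2) * (1 - (cmod (mu i))\<^sup>2) \<le> 0"
        using w[OF that] z1 by (intro mult_nonneg_nonpos) (auto simp: power_le_one_iff abs_square_le_1)
      then have "(cmod (1 - cnj (w j) * mu i))\<^sup>2 \<le> (cmod (w j - mu i))\<^sup>2"
        using disc_aut_norm_identity[of "w j" "mu i"] by linarith
      then show ?thesis by (rule power2_le_imp_le) simp
    qed
    have "cmod (poly Q (mu i)) \<le> cmod (poly P (mu i))"
      using c le by (simp add: P Q norm_mult prod_norm[symmetric]) (intro prod_mono, auto)
    moreover have "cmod (poly P (mu i)) = cmod b * cmod (poly Q (mu i))" by (simp add: PQ norm_mult)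
    moreover have "cmod (poly P (mu i)) > 0"
    proof -
      have "w j - mu i \<noteq> 0" if "j < n" for j using w[OF that] z1 by auto
      then show ?thesis using c by (auto simp: P)
    qed
    ultimately show False using b mult_strict_right_mono[OF b, of "cmod (poly Q (mu i))"]
      by (cases "poly Q (mu i) = 0") auto
  qed
  have E_eq: "poly E z = - c * cnj e * (\<Prod>i<n. 1 - cnj (mu i) * z)" for z
  proof -
    have inversion: "z ^ n * cnj (\<Prod>i<n. f i - 1 / cnj z) = (\<Prod>i<n. cnj (f i) * z - 1)" if "z \<noteq> 0" for z and f :: "nat \<Rightarrow> complex"
    proof -
      have "z ^ n * cnj (\<Prod>i<n. f i - 1 / cnj z) = (\<Prod>i<n. z * (cnj (f i) - 1 / z))"
        by (simp add: prod.distrib)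
      also have "\<dots> = (\<Prod>i<n. cnj (f i) * z - 1)" using that by (intro prod.cong refl) (simp add: field_simps)
      finally show ?thesis .
    qed
    have inversion': "z ^ n * cnj (\<Prod>i<n. 1 - f i * (1 / cnj z)) = (\<Prod>i<n. z - cnj (f i))" if "z \<noteq> 0" for z and f :: "nat \<Rightarrow> complex"
    proof -
      have "z ^ n * cnj (\<Prod>i<n. 1 - f i * (1 / cnj z)) = (\<Prod>i<n. z * (1 - cnj (f i) * (1 / z)))"
        by (simp add: prod.distrib)
      also have "\<dots> = (\<Prod>i<n. z - cnj (f i))" using that by (intro prod.cong refl) (simp add: right_diff_distrib)
      finally show ?thesis .
    qed
    have ne: "poly E z = - c * cnj e * (\<Prod>i<n. 1 - cnj (mu i) * z)" if z: "z \<noteq> 0" for z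
    proof -
      have "poly N (1 / cnj z) = b * (\<Prod>i<n. 1 - cnj (w i) * (1 / cnj z)) - c * (\<Prod>i<n. w i - 1 / cnj z)"
        by (simp add: N_def P Q)
      then have "z ^ n * cnj (poly N (1 / cnj z)) =
          cnj b * (z ^ n * cnj (\<Prod>i<n. 1 - cnj (w i) * (1 / cnj z))) - cnj c * (z ^ n * cnj (\<Prod>i<n. w i - 1 / cnj z))"
        by (simp only: complex_cnj_diff complex_cnj_mult) (simp only: right_diff_distrib mult.left_commute)
      also have "\<dots> = cnj b * ((-1) ^ n * (\<Prod>i<n. w i - z)) - cnj c * ((-1) ^ n * (\<Prod>i<n. 1 - cnj (w i) * z))"
        unfolding inversion[OF z] inversion'[OF z] by (subst (1 2) sgn) simp
      also have "\<dots> = - ((-1) ^ n * cnj c * poly E z)"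
        by (simp add: E_def P Q right_diff_distrib mult.left_commute mult.assoc ccn)
      finally have 1: "z ^ n * cnj (poly N (1 / cnj z)) = - ((-1) ^ n * cnj c * poly E z)" .
      have "z ^ n * cnj (poly N (1 / cnj z)) = cnj e * (z ^ n * cnj (\<Prod>i<n. mu i - 1 / cnj z))"
        unfolding Nz by (simp only: complex_cnj_mult mult.left_commute)
      also have "\<dots> = (-1) ^ n * cnj e * (\<Prod>i<n. 1 - cnj (mu i) * z)"
        unfolding inversion[OF z] by (subst sgn) simp
      finally have 2: "z ^ n * cnj (poly N (1 / cnj z)) = (-1) ^ n * cnj e * (\<Prod>i<n. 1 - cnj (mu i) * z)" .
      have "(-1) ^ n * (cnj c * poly E z) = - (z ^ n * cnj (poly N (1 / cnj z)))"
        by (simp only: 1 minus_minus mult.assoc)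
      also have "\<dots> = (-1) ^ n * (- (cnj e * (\<Prod>i<n. 1 - cnj (mu i) * z)))"
        by (simp only: 2 mult_minus_right mult.assoc)
      finally have "(-1) ^ n * (cnj c * poly E z) = (-1) ^ n * (- (cnj e * (\<Prod>i<n. 1 - cnj (mu i) * z)))" .
      then have "cnj c * poly E z = - (cnj e * (\<Prod>i<n. 1 - cnj (mu i) * z))" by (simp only: mult_cancel_left) auto
      then have "c * (cnj c * poly E z) = c * - (cnj e * (\<Prod>i<n. 1 - cnj (mu i) * z))" by (rule arg_cong)
      then show ?thesis by (simp only: ccn) simp
    qed
    define F where "F = smult (- c * cnj e) (\<Prod>i<n. [:1, - cnj (mu i):])"
    have F: "poly F z = - c * cnj e * (\<Prod>i<n. 1 - cnj (mu i) * z)" for z by (simp add: F_def poly_prod mult.commute)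
    \<comment> \<open>Multiplying by \<open>z\<close> covers the point \<open>0\<close>, at which the reflection \<open>1 / cnj z\<close> makes no sense.\<close>
    have "poly (pCons 0 E) z = poly (pCons 0 F) z" for z
      by (cases "z = 0") (use ne[of z] in \<open>simp_all add: F\<close>)
    then have "poly (pCons 0 E) = poly (pCons 0 F)" by (rule ext)
    then have "pCons 0 E = pCons 0 F" by (simp only: poly_eq_poly_eq_iff)
    then show ?thesis by (simp add: F)
  qed
  define c' where "c' = - e / (c * cnj e)"
  show thesis
  proof (rule that)
    show "cmod c' = 1" using e0 c by (simp add: c'_def norm_divide norm_mult)
    show "\<forall>i<n. cmod (mu i) < 1" using mu by blast
    show "\<forall>z. cmod z < 1 \<longrightarrow> disc_aut b (c * (\<Prod>i<n. disc_aut (w i) z)) = c' * (\<Prod>i<n. disc_aut (mu i) z)"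
    proof (intro allI impI)
    fix z assume z: "cmod z < 1"
    have den: "1 - cnj v * z \<noteq> 0" if "cmod v < 1" for v
    proof
      assume "1 - cnj v * z = 0"
      then have "cmod (cnj v * z) = 1" by (simp add: norm_one)
      moreover have "cmod v * cmod z < 1 * 1" using that z by (intro mult_strict_mono') auto
      ultimately show False by (simp add: norm_mult)
    qed
    have Q0: "poly Q z \<noteq> 0" using den w by (auto simp: Q)
    have "c * (\<Prod>i<n. disc_aut (w i) z) = poly P z / poly Q z"
      by (simp add: P Q disc_aut_def prod_dividef)
    then have "disc_aut b (c * (\<Prod>i<n. disc_aut (w i) z)) = (b - poly P z / poly Q z) / (1 - cnj b * (poly P z / poly Q z))"
      by (simp add: disc_aut_def)
    also have "\<dots> = poly N z / poly E z"
    proof -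
      have "b - poly P z / poly Q z = poly N z / poly Q z" using Q0 by (simp add: N_def field_simps)
      moreover have "1 - cnj b * (poly P z / poly Q z) = poly E z / poly Q z" using Q0 by (simp add: E_def field_simps)
      ultimately show ?thesis using Q0 by simp
    qed
    also have "\<dots> = (e * (\<Prod>i<n. mu i - z)) / (- c * cnj e * (\<Prod>i<n. 1 - cnj (mu i) * z))"
      by (simp only: Nz E_eq)
    also have "\<dots> = c' * (\<Prod>i<n. disc_aut (mu i) z)"
      by (simp add: c'_def disc_aut_def prod_dividef)
    finally show "disc_aut b (c * (\<Prod>i<n. disc_aut (w i) z)) = c' * (\<Prod>i<n. disc_aut (mu i) z)" .
    qed
  qed
qed

lemma disc_aut_involution:
  assumes w: "cmod w < 1" and z: "1 - cnj w * z \<noteq> 0"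
  shows "disc_aut w (disc_aut w z) = z"
proof -
  have "1 - cnj w * w \<noteq> 0"
  proof
    assume "1 - cnj w * w = 0"
    then have "cmod (cnj w * w) = 1" by (simp add: norm_one)
    moreover have "cmod w * cmod w < 1 * 1" using w by (intro mult_strict_mono') auto
    ultimately show False by (simp add: norm_mult)
  qed
  moreover have "w - disc_aut w z = (1 - cnj w * w) * z / (1 - cnj w * z)"
    using z by (simp add: disc_aut_def field_simps)
  moreover have "1 - cnj w * disc_aut w z = (1 - cnj w * w) / (1 - cnj w * z)"
    using z by (simp add: disc_aut_def field_simps)
  ultimately show ?thesis using z by (simp add: disc_aut_def[of w "disc_aut w z"])
qed

lemma one_minus_cnj_mult_ge:
  assumes "cmod u \<le> 1" shows "1 - cmod b \<le> cmod (1 - cnj b * u)"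
proof -
  have "cmod (cnj b * u) \<le> cmod b * 1" unfolding norm_mult using assms by (intro mult_mono) auto
  then show ?thesis using norm_triangle_ineq2[of 1 "cnj b * u"] by simp
qed

lemma dmultiplier_inverse_one_minus:
  assumes m: "dmultiplier m" and m1: "\<And>z. cmod z < 1 \<Longrightarrow> cmod (m z) \<le> 1" and b: "cmod b < 1"
  shows "dmultiplier (\<lambda>z. 1 / (1 - cnj b * m z))"
proof -
  obtain C where mh: "m holomorphic_on ball 0 1" and "\<forall>z\<in>ball 0 1. cmod (m z) \<le> C \<and> cmod (deriv m z) \<le> C"
    using m unfolding dmultiplier_def by blast
  then have C: "cmod (deriv m z) \<le> C" if "cmod z < 1" for z using that by auto
  define d where "d = 1 - cmod b"
  have d: "d > 0" using b by (simp add: d_def)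
  have ge: "d \<le> cmod (1 - cnj b * m z)" if "cmod z < 1" for z
    unfolding d_def by (rule one_minus_cnj_mult_ge[OF m1[OF that]])
  have ne: "1 - cnj b * m z \<noteq> 0" if "cmod z < 1" for z
    using ge[OF that] d by auto
  have holo: "(\<lambda>z. 1 / (1 - cnj b * m z)) holomorphic_on ball 0 1"
    by (intro holomorphic_intros mh) (use ne in auto)
  have C0: "0 \<le> C" using order.trans[OF norm_ge_zero C[of 0]] by simp
  have "cmod (1 / (1 - cnj b * m z)) \<le> 1 / d + C / d\<^sup>2 \<and> cmod (deriv (\<lambda>z. 1 / (1 - cnj b * m z)) z) \<le> 1 / d + C / d\<^sup>2"
    if z: "cmod z < 1" for z
  proof -
    have dm: "(m has_field_derivative deriv m z) (at z)"
      using z by (intro holomorphic_derivI[OF mh open_ball]) simp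
    have "((\<lambda>z. 1 / (1 - cnj b * m z)) has_field_derivative (0 * (1 - cnj b * m z) - 1 * (0 - cnj b * deriv m z)) / ((1 - cnj b * m z) * (1 - cnj b * m z))) (at z)"
      by (intro DERIV_divide DERIV_diff DERIV_const DERIV_cmult dm ne z)
    then have "deriv (\<lambda>z. 1 / (1 - cnj b * m z)) z = cnj b * deriv m z / (1 - cnj b * m z)\<^sup>2"
      by (auto dest!: DERIV_imp_deriv simp: power2_eq_square)
    then have "cmod (deriv (\<lambda>z. 1 / (1 - cnj b * m z)) z) = cmod b * cmod (deriv m z) / (cmod (1 - cnj b * m z))\<^sup>2"
      by (simp add: norm_divide norm_mult norm_power)
    also have "\<dots> \<le> (1 * C) / d\<^sup>2"
      using b C[OF z] C0 ge[OF z] d by (intro frac_le mult_mono power_mono) auto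
    finally have 1: "cmod (deriv (\<lambda>z. 1 / (1 - cnj b * m z)) z) \<le> C / d\<^sup>2" by simp
    have 2: "cmod (1 / (1 - cnj b * m z)) \<le> 1 / d"
      using ge[OF z] d by (simp add: norm_divide frac_le)
    have "0 \<le> C / d\<^sup>2" "0 \<le> 1 / d" using C0 d by auto
    then show ?thesis using 1 2 by linarith
  qed
  then show ?thesis unfolding dmultiplier_def using holo by (intro conjI exI[of _ "1 / d + C / d\<^sup>2"]) auto
qed

text \<open>It suffices that \<open>h = f / (1 - cnj b * m)\<close> lies in \<open>M\<close>, as the product in question is
  \<open>b * h - m * h\<close>. Its component \<open>k\<close> in \<open>orth M\<close> satisfies \<open>(1 -
  cnj b * m) * k \<in> M \<inter> orth M\<close>, so it is zero.\<close>

lemma invariant_disc_aut: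
  assumes m: "dmultiplier m" and m1: "\<And>z. cmod z < 1 \<Longrightarrow> cmod (m z) \<le> 1" and b: "cmod b < 1"
    and M: "closed_subspace M" and inv: "\<And>f. f \<in> M \<Longrightarrow> mult_op m f \<in> M"
    and invN: "\<And>f. f \<in> orth M \<Longrightarrow> mult_op m f \<in> orth M" and f: "f \<in> M"
  shows "mult_op (\<lambda>z. disc_aut b (m z)) f \<in> M"
proof -
  note MD = closed_subspaceD[OF M]
  have fD: "f \<in> dirichlet_space" using f MD(1) by blast
  have N: "closed_subspace (orth M)" by (rule closed_subspace_orth[OF MD(1)])
  have ne: "1 - cnj b * m z \<noteq> 0" if "cmod z < 1" for z
    using one_minus_cnj_mult_ge[OF m1[OF that], of b] b by auto
  define h where "h = mult_op (\<lambda>z. 1 / (1 - cnj b * m z)) f"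
  have hD: "h \<in> dirichlet_space"
    unfolding h_def using dmultiplier_bounded[OF dmultiplier_inverse_one_minus[OF m m1 b]] fD by metis
  have fh: "f z = h z - cnj b * mult_op m h z" for z
  proof (cases "cmod z < 1")
    case True
    have "h z - cnj b * mult_op m h z = (1 - cnj b * m z) * h z" by (simp add: mult_op_def algebra_simps)
    also have "\<dots> = f z" using ne[OF True] by (simp add: h_def mult_op_def)
    finally show ?thesis by simp
  next
    case False
    then show ?thesis using dirichlet_spaceD(2)[OF fD False] by (simp add: h_def mult_op_def)
  qed
  obtain p k where pk: "p \<in> M" "k \<in> orth M" "h = (\<lambda>z. p z + k z)"
    using orthogonal_decomposition[OF M hD] by blast
  define P where "P = (\<lambda>z. p z - cnj b * mult_op m p z)"
  define K where "K = (\<lambda>z. k z - cnj b * mult_op m k z)"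
  have PM: "P \<in> M" unfolding P_def by (intro MD(5) MD(4) inv pk)
  have KN: "K \<in> orth M" unfolding K_def
    by (intro closed_subspaceD(5)[OF N] closed_subspaceD(4)[OF N] invN pk)
  have "K = (\<lambda>z. f z - P z)"
    by (rule ext, subst fh) (simp add: K_def P_def pk(3) mult_op_def algebra_simps)
  then have "K \<in> M" using MD(5)[OF f PM] by simp
  then have K0: "K = (\<lambda>z. 0)" using KN by (rule orth_Int)
  have k0: "k z = 0" for z
  proof (cases "cmod z < 1")
    case True
    have "(1 - cnj b * m z) * k z = 0" using fun_cong[OF K0, of z] by (simp add: K_def mult_op_def algebra_simps)
    then show ?thesis using ne[OF True] by simp
  next
    case False
    have "k \<in> dirichlet_space" using pk(2) by (simp add: orth_def)
    then show ?thesis using False by (rule dirichlet_spaceD(2))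
  qed
  have "h \<in> M" using pk(1,3) by (simp add: k0)
  have "mult_op (\<lambda>z. disc_aut b (m z)) f = (\<lambda>z. b * h z - mult_op m h z)"
    by (rule ext) (simp add: h_def mult_op_def disc_aut_def algebra_simps diff_divide_distrib)
  then show ?thesis using MD(5)[OF MD(4)[OF \<open>h \<in> M\<close>] inv[OF \<open>h \<in> M\<close>]] by simp
qed

text \<open>Finitely many zeros in the open disc leave room for the radius that the locale asks for.\<close>

lemma finite_blaschke_locale:
  assumes "finite_blaschke n \<phi>"
  obtains c w R where "blaschke w n c R" "\<forall>z. cmod z < 1 \<longrightarrow> \<phi> z = blaschke.phi w n c z"
proof -
  obtain c w where n: "n \<ge> 1" and c: "cmod c = 1" and w: "\<forall>i<n. w i \<in> ball 0 1"
    and e: "\<forall>z\<in>ball 0 1. \<phi> z = c * (\<Prod>i<n. disc_aut (w i) z)"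
    using assms unfolding finite_blaschke_def by blast
  have w': "cmod (w i) < 1" if "i < n" for i using w that by simp
  obtain R where R: "R > 1" "\<forall>i<n. cmod (w i) * R < 1" using common_radius[of n w] w' by blast
  have B: "blaschke w n c R" using n c R by unfold_locales auto
  show thesis by (rule that[OF B]) (use e in \<open>simp add: blaschke.phi_def[OF B]\<close>)
qed

section \<open>Reducibility on the Dirichlet space\<close>

text \<open>Compose with the automorphism that takes \<open>b = \<phi> 0\<close> to \<open>0\<close>. The new product has
  the same reducing subspace and all its zeros are \<open>0\<close>, so it is \<open>d * z ^ n\<close>. The
  automorphism is an involution, and applying it again recovers \<open>\<phi>\<close>.\<close>

lemma reducible_blaschke_imp:
  assumes n: "n = 2 \<or> n = 3" and fb: "finite_blaschke n \<phi>" and red: "reducible (mult_op \<phi>)"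
  shows "\<exists>w\<in>ball 0 1. \<exists>a. cmod a = 1 \<and> (\<forall>z\<in>ball 0 1. \<phi> z = a * disc_aut w (z ^ n))"
proof -
  obtain c w R where B: "blaschke w n c R" and "\<forall>z. cmod z < 1 \<longrightarrow> \<phi> z = blaschke.phi w n c z"
    by (rule finite_blaschke_locale[OF fb])
  then have e: "\<And>z. cmod z < 1 \<Longrightarrow> \<phi> z = blaschke.phi w n c z" by blast
  interpret B: blaschke w n c R by (rule B)
  have m: "dmultiplier \<phi>" by (rule dmultiplier_cong[OF B.phi_dmultiplier]) (simp add: e)
  have lt: "cmod (\<phi> z) < 1" if "cmod z < 1" for z using B.phi_lt[OF that] e[OF that] by simp
  obtain M where M: "reducing_subspace (mult_op \<phi>) M" and ne: "M \<noteq> {\<lambda>z. 0}" "M \<noteq> dirichlet_space"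
    using red unfolding reducible_def by blast
  have cl: "closed_subspace M" and inv: "\<And>f. f \<in> M \<Longrightarrow> mult_op \<phi> f \<in> M"
    and invN: "\<And>f. f \<in> orth M \<Longrightarrow> mult_op \<phi> f \<in> orth M"
    using M unfolding reducing_subspace_iff[OF m] by blast+
  define b where "b = \<phi> 0"
  have b: "cmod b < 1" using lt[of 0] by (simp add: b_def)
  have ne0: "1 - cnj b * \<phi> z \<noteq> 0" if "cmod z < 1" for z
    using one_minus_cnj_mult_ge[OF less_imp_le[OF lt[OF that]], of b] b by auto
  obtain c' mu where c': "cmod c' = 1" and mu: "\<forall>i<n. cmod (mu i) < 1"
    and comp: "\<forall>z. cmod z < 1 \<longrightarrow> disc_aut b (c * (\<Prod>i<n. disc_aut (w i) z)) = c' * (\<Prod>i<n. disc_aut (mu i) z)"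
    by (rule disc_aut_comp_blaschke[OF B.c B.lam_lt b])
  obtain R' where R': "R' > 1" "\<forall>i<n. cmod (mu i) * R' < 1" using common_radius[of n mu] mu by blast
  have B'': "blaschke mu n c' R'" using n c' R' by unfold_locales auto
  interpret B': blaschke mu n c' R' by (rule B'')
  have psi: "B'.phi z = disc_aut b (\<phi> z)" if "cmod z < 1" for z
    using comp that e[OF that] by (simp add: B.phi_def B'.phi_def)
  have op: "mult_op B'.phi f = mult_op (\<lambda>z. disc_aut b (\<phi> z)) f" if f: "f \<in> dirichlet_space" for f
  proof
    fix z show "mult_op B'.phi f z = mult_op (\<lambda>z. disc_aut b (\<phi> z)) f z"
      using psi[of z] dirichlet_spaceD(2)[OF f, of z] by (cases "cmod z < 1") (auto simp: mult_op_def)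
  qed
  note lt' = less_imp_le[OF lt]
  have N: "closed_subspace (orth M)" by (rule closed_subspace_orth[OF closed_subspaceD(1)[OF cl]])
  have "mult_op B'.phi f \<in> M" if f: "f \<in> M" for f
  proof -
    have "f \<in> dirichlet_space" using f closed_subspaceD(1)[OF cl] by blast
    then show ?thesis using invariant_disc_aut[OF m lt' b cl inv invN f] op by simp
  qed
  moreover have "mult_op B'.phi f \<in> orth M" if f: "f \<in> orth M" for f
  proof -
    have "f \<in> dirichlet_space" using f by (simp add: orth_def)
    moreover have "mult_op (\<lambda>z. disc_aut b (\<phi> z)) f \<in> orth M"
      by (rule invariant_disc_aut[OF m lt' b N invN _ f]) (simp_all add: orth_orth[OF cl] inv)
    ultimately show ?thesis using op by simp
  qed
  ultimately have red': "B'.reduces M" using cl by (simp add: B'.reduces_def)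
  have "disc_aut b b = 0" by (simp add: disc_aut_def)
  then have "B'.phi 0 = 0" using psi[of 0] by (simp add: b_def)
  then have mu0: "mu i = 0" if "i < n" for i using B'.reduces_imp_zeros_zero[OF red' _ n ne that] by blast
  define d where "d = c' * (-1) ^ n"
  have d: "cmod d = 1" by (simp add: d_def norm_mult norm_power c')
  have dd: "d * cnj d = 1" using d by (simp add: complex_norm_square[symmetric] del: of_real_power)
  have psi_eq: "B'.phi z = d * z ^ n" for z
  proof -
    have "B'.phi z = c' * (\<Prod>i<n. - z)" unfolding B'.phi_def using mu0 by (simp add: disc_aut_def)
    also have "\<dots> = d * z ^ n" by (simp add: d_def power_minus[of z])
    finally show ?thesis .
  qed
  show ?thesis
  proof (intro bexI[of _ "b * cnj d"] exI[of _ d] conjI ballI)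
    show "b * cnj d \<in> ball 0 1" using b d by (simp add: norm_mult)
    show "cmod d = 1" by (rule d)
    fix z :: complex assume "z \<in> ball 0 1"
    then have z: "cmod z < 1" by simp
    have "\<phi> z = disc_aut b (disc_aut b (\<phi> z))" by (rule disc_aut_involution[OF b ne0[OF z], symmetric])
    also have "\<dots> = disc_aut b (d * z ^ n)" using psi[OF z] psi_eq[of z] by simp
    also have "\<dots> = d * disc_aut (b * cnj d) (z ^ n)"
    proof -
      have "b - d * z ^ n = d * (b * cnj d - z ^ n)"
        using dd by (simp add: right_diff_distrib mult.left_commute[of d b])
      then show ?thesis by (simp add: disc_aut_def mult.assoc)
    qed
    finally show "\<phi> z = d * disc_aut (b * cnj d) (z ^ n)" .
  qed
qed

lemma reducible_equivalent_power:
  assumes n: "n \<ge> 2" and fb: "finite_blaschke n \<phi>" and w: "cmod w < 1"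
    and e: "\<And>z. cmod z < 1 \<Longrightarrow> \<phi> z = a * disc_aut w (z ^ n)"
  shows "reducible (mult_op \<phi>)"
proof -
  obtain c v R where B: "blaschke v n c R" and "\<forall>z. cmod z < 1 \<longrightarrow> \<phi> z = blaschke.phi v n c z"
    by (rule finite_blaschke_locale[OF fb])
  then have e': "\<And>z. cmod z < 1 \<Longrightarrow> \<phi> z = blaschke.phi v n c z" by blast
  interpret B: blaschke v n c R by (rule B)
  have m: "dmultiplier \<phi>" by (rule dmultiplier_cong[OF B.phi_dmultiplier]) (simp add: e')
  have ne: "1 - cnj w * u \<noteq> 0" if "cmod u < 1" for u
    using one_minus_cnj_mult_ge[of u w] that w by auto
  have "(\<lambda>u. a * disc_aut w u) holomorphic_on ball 0 1"
    unfolding disc_aut_def by (intro holomorphic_intros) (use ne in auto)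
  from reducible_power_function[OF m n this e] show ?thesis .
qed

theorem theorem1p1:
  fixes n :: nat and \<phi> :: "complex \<Rightarrow> complex"
  assumes "n = 2 \<or> n = 3"
    and "finite_blaschke n \<phi>"
  shows "reducible (mult_op \<phi>) \<longleftrightarrow>
    (\<exists>w\<in>unit_disc. \<exists>a. cmod a = 1 \<and> (\<forall>z\<in>unit_disc. \<phi> z = a * disc_aut w (z ^ n)))"
proof
  assume "reducible (mult_op \<phi>)"
  then show "\<exists>w\<in>unit_disc. \<exists>a. cmod a = 1 \<and> (\<forall>z\<in>unit_disc. \<phi> z = a * disc_aut w (z ^ n))"
    by (rule reducible_blaschke_imp[OF assms])
next
  assume "\<exists>w\<in>unit_disc. \<exists>a. cmod a = 1 \<and> (\<forall>z\<in>unit_disc. \<phi> z = a * disc_aut w (z ^ n))"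
  then obtain w a where w': "w \<in> unit_disc" and e: "\<forall>z\<in>unit_disc. \<phi> z = a * disc_aut w (z ^ n)" by blast
  have w: "cmod w < 1" using w' by simp
  have n: "n \<ge> 2" using assms(1) by auto
  show "reducible (mult_op \<phi>)"
    by (rule reducible_equivalent_power[OF n assms(2) w]) (use e in auto)
qed

end
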